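(* Let $N\ge 1$ be an integer, let $H\in(0,1)$, and let $\mathcal{B}=\{\mathbf{x}\in\mathbb{R}^N\colon\|\mathbf{x}\|\le 1\}$. Let $\xi^l_{mn}$ ($m\ge 0$, $n\ge 1$, $1\le l\le h(m,N)$) be independent standard normal random variables, and put $$\tau_{mn}=\frac{2^{H+1}\sqrt{\pi^{(N-2)/2}\,\Gamma(H+N/2)\,\Gamma(H+1)\sin(\pi H)}}{\Gamma(N/2)\,J_{|m-1|-H+1}(j_{|m-1|-H,n})\,j_{|m-1|-H,n}^{H+1}}.$$ Then the series $$\xi(\mathbf{x})=\sum_{m=0}^{\infty}\sum_{n=1}^{\infty}\sum_{l=1}^{h(m,N)}\tau_{mn}\left[g_m(j_{|m-1|-H,n}\|\mathbf{x}\|)-\delta^0_m\right]S^l_m\left(\frac{\mathbf{x}}{\|\mathbf{x}\|}\right)\xi^l_{mn},\qquad \mathbf{x}\in\mathcal{B},$$ converges with probability $1$ in the space $C(\mathcal{B})$ of continuous functions on $\mathcal{B}$ (with the uniform norm), and its sum is the multiparameter fractional Brownian motion with parameter $H$ on $\mathcal{B}$, i.e. a centred Gaussian random field with $$\mathsf{E}\,\xi(\mathbf{x})\xi(\mathbf{y})=\tfrac12\left(\|\mathbf{x}\|^{2H}+\|\mathbf{y}\|^{2H}-\|\mathbf{x}-\mathbf{y}\|^{2H}\right),\qquad \mathbf{x},\mathbf{y}\in\mathcal{B}.$$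
   Context: $\|\cdot\|$ is the Euclidean norm on $\mathbb{R}^N$. The multiparameter fractional Brownian motion with parameter $H\in(0,1)$ is the centred Gaussian random field on $\mathbb{R}^N$ with covariance $R(\mathbf{x},\mathbf{y})=\frac12(\|\mathbf{x}\|^{2H}+\|\mathbf{y}\|^{2H}-\|\mathbf{x}-\mathbf{y}\|^{2H})$. $J_\nu$ is the Bessel function of the first kind of order $\nu$, and $j_{\nu,1}<j_{\nu,2}<\dots$ are the positive zeros of $J_\nu$ (here $\nu>-1$). For $m\ge 0$, $$g_m(u)=2^{(N-2)/2}\Gamma(N/2)\frac{J_{m+(N-2)/2}(u)}{u^{(N-2)/2}},$$ extended by continuity to $u=0$; $\delta^0_m$ is the Kronecker delta. Each term of the series is interpreted as $0$ at $\mathbf{x}=\mathbf{0}$ (note $g_0(0)=1$ and $g_m(0)=0$ for $m\ge1$). Convergence of the triple series refers to the partial sums over $0\le m\le M$, $1\le n\le M$, $1\le l\le h(m,N)$ as $M\to\infty$. $h(m,N)=\frac{(2m+N-2)(m+N-3)!}{(N-2)!\,m!}$ is the number of linearly independent spherical harmonics of degree $m$ on $S^{N-1}$; when this formula is not literally meaningful the conventions are $h(0,2)=1$, and for $N=1$: $h(0,1)=h(1,1)=1$, $h(m,1)=0$ for $m\ge2$. The functions $S^l_m$, $1\le l\le h(m,N)$, are real-valued spherical harmonics of degree $m$, orthonormal in $L^2(S^{N-1})$ with respect to surface measure, defined as follows. For $N=1$: $S^0=\{-1,1\}$, $S^1_0(x)=1/\sqrt2$, $S^1_1(x)=x/\sqrt2$.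 For $N\ge 2$: let $C^\lambda_m$ be the Gegenbauer polynomials, $(1-2xt+t^2)^{-\lambda}=\sum_{m\ge0}C^\lambda_m(x)t^m$. For integers $m=m_0\ge m_1\ge\dots\ge m_{N-2}\ge0$ and $r_k=\sqrt{x_{k+1}^2+\dots+x_N^2}$ ($0\le k\le N-2$) put $$H(m_k,\pm,\mathbf{x})=\left(\frac{x_{N-1}+ix_N}{r_{N-2}}\right)^{\pm m_{N-2}}r_{N-2}^{m_{N-2}}\prod_{k=0}^{N-3}r_k^{m_k-m_{k+1}}C^{m_{k+1}+(N-k-2)/2}_{m_k-m_{k+1}}\left(\frac{x_{k+1}}{r_k}\right)$$ (extended by continuity), $Y(m_k,\pm,\mathbf{x})=r_0^{-m}H(m_k,\pm,\mathbf{x})$, and $$L(m_k)=2\pi\prod_{k=1}^{N-2}\frac{\pi\,2^{k-2m_k-N+2}\,\Gamma(m_{k-1}+m_k+N-1-k)}{(m_{k-1}+(N-1-k)/2)\,(m_{k-1}-m_k)!\,[\Gamma(m_k+(N-1-k)/2)]^2},$$ which is the squared $L^2(S^{N-1})$-norm of $Y(m_k,\pm,\cdot)$. Let $l=l(m_k,\pm)$ be the number of the symbol $(m_0,\dots,m_{N-2},\pm)$ in the lexicographic ordering of the symbols with $m_0=m$ (when $m_{N-2}=0$ the two signs give the same function and are counted once). Then $S^l_m=Y(m_k,+,\cdot)/\sqrt{L(m_k)}$ if $m_{N-2}=0$; $S^l_m=\sqrt2\,\mathrm{Re}\,Y(m_k,+,\cdot)/\sqrt{L(m_k)}$ if $m_{N-2}>0$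 and $l=l(m_k,+)$; $S^l_m=-\sqrt2\,\mathrm{Im}\,Y(m_k,-,\cdot)/\sqrt{L(m_k)}$ if $m_{N-2}>0$ and $l=l(m_k,-)$. *)

theory Defs
  imports "HOL-Probability.Probability"
begin

section \<open>Bessel functions and their positive zeros\<close>

text \<open>
  The Bessel function of the first kind, meant for arguments \<open>x > 0\<close> only (\<open>powr\<close> is used for the
  real powers). The entire function \<open>rGamma\<close> is \<open>1 / Gamma\<close>, with value 0 at the poles of \<open>Gamma\<close>.
\<close>

definition bessel_J :: "real \<Rightarrow> real \<Rightarrow> real" where
  "bessel_J \<nu> x =
     (\<Sum>k. (- 1) ^ k * rGamma (\<nu> + real k + 1) / fact k * (x / 2) powr (2 * real k + \<nu>))"

text \<open>
  The \<open>n\<close>-th positive zero, \<open>n \<ge> 1\<close>: the zero \<open>z\<close> such that exactly \<open>n\<close> zeros lie in the interval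
  from 0 (exclusive) to \<open>z\<close> (inclusive). As \<open>n \<noteq> 0\<close>, the set of these zeros is then finite.
\<close>

definition bessel_zero :: "real \<Rightarrow> nat \<Rightarrow> real" where
  "bessel_zero \<nu> n =
     (THE z. 0 < z \<and> bessel_J \<nu> z = 0 \<and> card {y. 0 < y \<and> y \<le> z \<and> bessel_J \<nu> y = 0} = n)"

text \<open>The radial functions on \<open>u \<ge> 0\<close>, extended by continuity to \<open>u = 0\<close>.\<close>

definition g_fun :: "nat \<Rightarrow> nat \<Rightarrow> real \<Rightarrow> real" where
  "g_fun N m u =
     (let f = (\<lambda>v. 2 powr ((real N - 2) / 2) * Gamma (real N / 2) *
                   bessel_J (real m + (real N - 2) / 2) v / v powr ((real N - 2) / 2))
      in if u = 0 then Lim (at_right 0) f else f u)"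


section \<open>Real spherical harmonics\<close>

text \<open>
  \<open>gegenbauer a m x\<close> is the coefficient of \<open>t ^ m\<close> in \<open>(1 - 2 x t + t\<^sup>2)\<close> to the power \<open>- a\<close>;
  \<open>fps_binomial b\<close> is the binomial series of \<open>(1 + t)\<close> to the power \<open>b\<close>.
\<close>

definition gegenbauer :: "real \<Rightarrow> nat \<Rightarrow> real \<Rightarrow> real" where
  "gegenbauer a m x =
     fps_nth (fps_compose (fps_binomial (- a)) (fps_X ^ 2 - fps_const (2 * x) * fps_X)) m"

text \<open>
  The number of linearly independent spherical harmonics of degree \<open>m\<close> on the unit sphere of
  dimension \<open>N - 1\<close>; the division is exact.
\<close>

definition sph_dim :: "nat \<Rightarrow> nat \<Rightarrow> nat" where
  "sph_dim m N =
     (if N = 1 then (if m \<le> 1 then 1 else 0)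
      else if N = 2 \<and> m = 0 then 1
      else ((2 * m + N - 2) * fact (m + N - 3)) div (fact (N - 2) * fact m))"

datatype sign = Plus | Minus

fun sign_exp :: "sign \<Rightarrow> nat \<Rightarrow> int" where
  "sign_exp Plus k = int k"
| "sign_exp Minus k = - int k"

text \<open>
  A point of \<open>\<real>\<^sup>N\<close> enters through its coordinates \<open>x 1, \<dots>, x N\<close>, and \<open>m\<^sub>0, \<dots>, m\<^bsub>N-2\<^esub>\<close> are the entries
  of the list \<open>ms\<close>. Where some \<open>sph_r N k x\<close> vanishes, \<open>a / 0 = 0\<close>, \<open>0 ^ 0 = 1\<close> and \<open>0 ^ k = 0\<close> for
  \<open>k > 0\<close> give \<open>sph_H\<close> the value of its extension by continuity.
\<close>

definition sph_r :: "nat \<Rightarrow> nat \<Rightarrow> (nat \<Rightarrow> real) \<Rightarrow> real" where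
  "sph_r N k x = sqrt (\<Sum>i = k + 1..N. (x i)\<^sup>2)"

definition sph_H :: "nat \<Rightarrow> nat list \<Rightarrow> sign \<Rightarrow> (nat \<Rightarrow> real) \<Rightarrow> complex" where
  "sph_H N ms s x =
     (Complex (x (N - 1)) (x N) / of_real (sph_r N (N - 2) x)) powi sign_exp s (ms ! (N - 2)) *
     of_real (sph_r N (N - 2) x ^ (ms ! (N - 2)) *
       (\<Prod>k<N - 2. sph_r N k x ^ (ms ! k - ms ! (k + 1)) *
          gegenbauer (real (ms ! (k + 1)) + (real N - real k - 2) / 2) (ms ! k - ms ! (k + 1))
            (x (k + 1) / sph_r N k x)))"

definition sph_Y :: "nat \<Rightarrow> nat list \<Rightarrow> sign \<Rightarrow> (nat \<Rightarrow> real) \<Rightarrow> complex" where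
  "sph_Y N ms s x = sph_H N ms s x / of_real (sph_r N 0 x ^ (ms ! 0))"

definition sph_L :: "nat \<Rightarrow> nat list \<Rightarrow> real" where
  "sph_L N ms =
     2 * pi * (\<Prod>k = 1..N - 2.
       pi * 2 powi (int k - 2 * int (ms ! k) - int N + 2) *
         Gamma (real (ms ! (k - 1)) + real (ms ! k) + real N - 1 - real k) /
       ((real (ms ! (k - 1)) + (real N - 1 - real k) / 2) * fact (ms ! (k - 1) - ms ! k) *
         (Gamma (real (ms ! k) + (real N - 1 - real k) / 2))\<^sup>2))"

text \<open>
  If the last index is 0, both signs give the same function, and only the symbol with \<open>Plus\<close> is kept.
\<close>

definition sph_symbols :: "nat \<Rightarrow> nat \<Rightarrow> (nat list \<times> sign) set" where
  "sph_symbols N m =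
     {(ms, s). length ms = N - 1 \<and> ms ! 0 = m \<and> sorted_wrt (\<ge>) ms \<and>
               (ms ! (N - 2) = 0 \<longrightarrow> s = Plus)}"

text \<open>The position, from 1, in the increasing lexicographic order, where \<open>Plus\<close> precedes \<open>Minus\<close>.\<close>

definition symbol_number :: "nat \<Rightarrow> nat \<Rightarrow> nat list \<times> sign \<Rightarrow> nat" where
  "symbol_number N m t =
     card {t' \<in> sph_symbols N m. (t', t) \<in> lexord less_than <*lex*> {(Plus, Minus)}} + 1"

text \<open>
  In the case \<open>ms ! (N - 2) = 0\<close> the function \<open>sph_Y\<close> is real-valued, and \<open>Re\<close> is a mere coercion.
\<close>

definition sph_harmonic :: "nat \<Rightarrow> nat \<Rightarrow> nat \<Rightarrow> (nat \<Rightarrow> real) \<Rightarrow> real" where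
  "sph_harmonic N m l x =
     (if N = 1 then (if m = 0 then 1 / sqrt 2 else x 1 / sqrt 2)
      else case (THE t. t \<in> sph_symbols N m \<and> symbol_number N m t = l) of (ms, s) \<Rightarrow>
        if ms ! (N - 2) = 0 then Re (sph_Y N ms Plus x) / sqrt (sph_L N ms)
        else (case s of
                Plus \<Rightarrow> sqrt 2 * Re (sph_Y N ms Plus x) / sqrt (sph_L N ms)
              | Minus \<Rightarrow> - sqrt 2 * Im (sph_Y N ms Minus x) / sqrt (sph_L N ms)))"


section \<open>The series\<close>

definition bessel_order :: "real \<Rightarrow> nat \<Rightarrow> real" where
  "bessel_order H m = \<bar>real m - 1\<bar> - H"

definition tau :: "nat \<Rightarrow> real \<Rightarrow> nat \<Rightarrow> nat \<Rightarrow> real" where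
  "tau N H m n =
     (let j = bessel_zero (bessel_order H m) n in
      2 powr (H + 1) *
        sqrt (pi powr ((real N - 2) / 2) * Gamma (H + real N / 2) * Gamma (H + 1) * sin (pi * H)) /
      (Gamma (real N / 2) * bessel_J (bessel_order H m + 1) j * j powr (H + 1)))"

text \<open>
  The map \<open>e\<close> numbers the coordinates of \<open>real ^ 'n\<close> by \<open>1, \<dots>, CARD('n)\<close>.
\<close>

definition series_term ::
  "(nat \<Rightarrow> 'n::finite) \<Rightarrow> real \<Rightarrow> nat \<Rightarrow> nat \<Rightarrow> nat \<Rightarrow> real ^ 'n \<Rightarrow> real" where
  "series_term e H m n l x =
     (if x = 0 then 0
      else tau CARD('n) H m n *
           (g_fun CARD('n) m (bessel_zero (bessel_order H m) n * norm x) -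
              (if m = 0 then 1 else 0)) *
           sph_harmonic CARD('n) m l (\<lambda>i. (x /\<^sub>R norm x) $ e i))"

definition partial_series ::
  "(nat \<Rightarrow> 'n::finite) \<Rightarrow> real \<Rightarrow> (nat \<Rightarrow> nat \<Rightarrow> nat \<Rightarrow> 'a \<Rightarrow> real) \<Rightarrow>
     nat \<Rightarrow> real ^ 'n \<Rightarrow> 'a \<Rightarrow> real" where
  "partial_series e H \<xi> M x \<omega> =
     (\<Sum>m = 0..M. \<Sum>n = 1..M. \<Sum>l = 1..sph_dim m CARD('n). series_term e H m n l x * \<xi> m n l \<omega>)"

definition series_sum ::
  "(nat \<Rightarrow> 'n::finite) \<Rightarrow> real \<Rightarrow> (nat \<Rightarrow> nat \<Rightarrow> nat \<Rightarrow> 'a \<Rightarrow> real) \<Rightarrow>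
     real ^ 'n \<Rightarrow> 'a \<Rightarrow> real" where
  "series_sum e H \<xi> x \<omega> = lim (\<lambda>M. partial_series e H \<xi> M x \<omega>)"


section \<open>Gaussian random fields\<close>

text \<open>Constants count as (degenerate) Gaussian random variables.\<close>

definition gaussian_rv :: "'a measure \<Rightarrow> ('a \<Rightarrow> real) \<Rightarrow> bool" where
  "gaussian_rv P Y \<longleftrightarrow>
     Y \<in> borel_measurable P \<and>
     ((\<exists>\<mu> \<sigma>. 0 < \<sigma> \<and> distributed P lborel Y (normal_density \<mu> \<sigma>)) \<or>
      (\<exists>\<mu>. AE \<omega> in P. Y \<omega> = \<mu>))"

definition centred_gaussian_field ::
  "'a measure \<Rightarrow> 'b set \<Rightarrow> ('b \<Rightarrow> 'a \<Rightarrow> real) \<Rightarrow> bool" where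
  "centred_gaussian_field P T X \<longleftrightarrow>
     (\<forall>F a. finite F \<and> F \<subseteq> T \<longrightarrow> gaussian_rv P (\<lambda>\<omega>. \<Sum>x\<in>F. a x * X x \<omega>)) \<and>
     (\<forall>x\<in>T. integral\<^sup>L P (X x) = 0)"

definition mfbm_cov :: "real \<Rightarrow> 'b::real_normed_vector \<Rightarrow> 'b \<Rightarrow> real" where
  "mfbm_cov H x y =
     (norm x powr (2 * H) + norm y powr (2 * H) - norm (x - y) powr (2 * H)) / 2"

definition mfbm_on ::
  "'a measure \<Rightarrow> real \<Rightarrow> 'b::real_normed_vector set \<Rightarrow> ('b \<Rightarrow> 'a \<Rightarrow> real) \<Rightarrow> bool" where
  "mfbm_on P H T X \<longleftrightarrow>
     centred_gaussian_field P T X \<and>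
     (\<forall>x\<in>T. \<forall>y\<in>T. integral\<^sup>L P (\<lambda>\<omega>. X x \<omega> * X y \<omega>) = mfbm_cov H x y)"

end

theory Submission
  imports Defs "HOL-Complex_Analysis.Complex_Analysis" "HOL-Real_Asymp.Real_Asymp"
begin

text \<open>
  For fixed \<open>m\<close>, Sonine's integral writes the radial functions as Fourier-Bessel coefficients of dilations of
  one kernel on \<open>(0, 1)\<close>. By Parseval's identity the sum over \<open>n\<close> is an inner product of two dilated kernels, which is
  evaluated as a power series in \<open>r = \<parallel>x\<parallel> / \<parallel>y\<parallel>\<close>; the sum over \<open>l\<close> is the addition theorem. The sum over \<open>m\<close> is
  then the expansion of \<open>(1 - 2 r cos \<theta> + r\<^sup>2)\<close> to the power \<open>H\<close> in zonal polynomials. This gives the covariance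
  for \<open>\<parallel>x\<parallel> < \<parallel>y\<parallel>\<close>. Fatou's lemma and the Cauchy-Schwarz inequality extend it to \<open>x = y\<close>, and the increments
  then give the case \<open>\<parallel>x\<parallel> = \<parallel>y\<parallel>\<close>.

  Hence the coefficients of the increments have square sum \<open>\<parallel>x - y\<parallel>\<close> to the power \<open>2 H\<close>. Levy's maximal
  inequality and chaining bound all partial sums at once, so that pointwise convergence becomes uniform.
\<close>

section \<open>Zonal polynomials and the addition theorem\<close>

text \<open>In the variable \<open>v = radius^2\<close> the Bessel functions become entire functions
  on a finite power weight. Completeness of the resulting orthogonal system is not presupposed: it
  is extracted from Rayleigh's sum of the inverse zeros. The order \<open>|m - 1| - H\<close> is
  forced. For \<open>m >= 1\<close> Sonine's integral raises it by \<open>N / 2 + H\<close> to the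
  order \<open>m + (N - 2) / 2\<close> of the radial function. For \<open>m = 0\<close> the same
  recipe would start from \<open>- 1 - H\<close>, where the weight is not integrable. Subtracting 1
  from \<open>g_0\<close> allows a division by the squared argument and moves the order to
  \<open>1 - H\<close>, at the price of a second kernel with a singularity at 0. That singularity is
  the source of the term \<open>norm x powr (2 * H)\<close> of the smaller point. Dimensions 1 and 2
  have \<open>(N - 2) / 2\<close> equal to -1/2 and 0, where the usual normalisation of Gegenbauer
  polynomials degenerates; everything is therefore phrased with zonal polynomials. For points of
  equal norm the power series in \<open>r\<close> sits on its circle of convergence, which is why
  those points are reached by limits and inequalities instead of termwise computation.\<close>

definition solid_fps :: "real \<Rightarrow> real \<Rightarrow> real \<Rightarrow> real fps" where
  "solid_fps a x q = fps_binomial (- a) oo (fps_const q * fps_X ^ 2 - fps_const (2 * x) * fps_X)"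

text \<open>For \<open>q = r^2\<close> this is \<open>r^m\<close> times the Gegenbauer polynomial at
  \<open>x / r\<close>, a polynomial in one coordinate and a squared radius. No division by a radius
  remains, so points where some \<open>sph_r\<close> vanishes are covered by the same
  algebra.\<close>

definition solid_geg :: "real \<Rightarrow> nat \<Rightarrow> real \<Rightarrow> real \<Rightarrow> real" where
  "solid_geg a m x q = fps_nth (solid_fps a x q) m"

lemma gegenbauer_eq_solid: "gegenbauer a m x = solid_geg a m x 1"
  by (simp add: gegenbauer_def solid_geg_def solid_fps_def)

lemma solid_fps_deriv:
  "fps_deriv (solid_fps a x q) =
     fps_const (2 * a) * (fps_const x - fps_const q * fps_X) * solid_fps (a + 1) x q"
proof -
  define u :: "real fps" where "u = fps_const q * fps_X ^ 2 - fps_const (2 * x) * fps_X"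
  have u0: "fps_nth u 0 = 0" by (simp add: u_def)
  have "fps_deriv (fps_binomial (- a)) = fps_const (- a) * fps_binomial (- a - 1)"
    by (rule fps_ext) (use gbinomial_absorption[of _ "- a"] in \<open>simp add: add.commute\<close>)
  then have "fps_deriv (solid_fps a x q) = (fps_const (- a) * fps_binomial (- a - 1) oo u) * fps_deriv u"
    unfolding solid_fps_def u_def[symmetric] by (simp add: fps_compose_deriv[OF u0])
  also have "(fps_const (- a) * fps_binomial (- a - 1)) oo u = fps_const (- a) * solid_fps (a + 1) x q"
    unfolding solid_fps_def u_def[symmetric]
    by (simp add: fps_compose_mult_distrib[OF u0])
  also have "fps_deriv u = fps_const (- 2) * (fps_const x - fps_const q * fps_X)"
    unfolding u_def
    by (rule fps_ext) (simp add: fps_deriv_power algebra_simps numeral_fps_const)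
  finally show ?thesis
    by (simp add: mult_ac fps_const_mult[symmetric] del: fps_const_mult)
qed

lemma solid_fps_plus1:
  "solid_fps a x q = (1 - fps_const (2 * x) * fps_X + fps_const q * fps_X ^ 2) * solid_fps (a + 1) x q"
proof -
  define u :: "real fps" where "u = fps_const q * fps_X ^ 2 - fps_const (2 * x) * fps_X"
  have u0: "fps_nth u 0 = 0" by (simp add: u_def)
  have "fps_binomial (- a) = (1 + fps_X :: real fps) * fps_binomial (- a - 1)"
    using fps_binomial_add_mult[of 1 "- a - 1 :: real"] by (simp add: fps_binomial_1)
  then have "solid_fps a x q = ((1 + fps_X) oo u) * (fps_binomial (- a - 1) oo u)"
    unfolding solid_fps_def u_def[symmetric] by (simp add: fps_compose_mult_distrib[OF u0])
  also have "(1 + fps_X) oo u = 1 + u"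
    by (simp add: fps_compose_add_distrib u0)
  finally have "solid_fps a x q = (1 + u) * (fps_binomial (- (a + 1)) oo u)" by simp
  moreover have "1 + u = 1 - fps_const (2 * x) * fps_X + fps_const q * fps_X ^ 2"
    by (simp add: u_def)
  ultimately show ?thesis
    unfolding solid_fps_def[of "a + 1"] u_def[symmetric] by simp
qed

lemma fps_nth_deriv_combination:
  "fps_nth (fps_const b * fps_X ^ k * f) n = (if n < k then 0 else b * fps_nth f (n - k))"
  for f :: "real fps"
  by (simp add: mult.assoc fps_X_power_mult_nth)

lemma solid_geg_0 [simp]: "solid_geg a 0 x q = 1"
  by (simp add: solid_geg_def solid_fps_def)

lemma solid_geg_deriv:
  "(real m + 2) * solid_geg a (m + 2) x q = 2 * a * (x * solid_geg (a + 1) (m + 1) x q - q * solid_geg (a + 1) m x q)"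
proof -
  have "fps_nth (fps_deriv (solid_fps a x q)) (m + 1) =
     fps_nth (fps_const (2 * a * x) * fps_X ^ 0 * solid_fps (a + 1) x q
       - fps_const (2 * a * q) * fps_X ^ 1 * solid_fps (a + 1) x q) (m + 1)"
    unfolding solid_fps_deriv by (simp add: algebra_simps fps_const_mult[symmetric] del: fps_const_mult)
  then show ?thesis
    unfolding fps_sub_nth fps_nth_deriv_combination by (simp add: solid_geg_def algebra_simps)
qed

lemma solid_geg_1 [simp]: "solid_geg a (Suc 0) x q = 2 * a * x"
proof -
  have "fps_nth (fps_deriv (solid_fps a x q)) 0 = 2 * a * x * fps_nth (solid_fps (a + 1) x q) 0"
    unfolding solid_fps_deriv by (simp)
  then show ?thesis
    using solid_geg_0[of "a+1" x q] unfolding solid_geg_def by simp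
qed

lemma solid_geg_plus1:
  "solid_geg a (m + 2) x q = solid_geg (a + 1) (m + 2) x q - 2 * x * solid_geg (a + 1) (m + 1) x q
     + q * solid_geg (a + 1) m x q"
proof -
  have "solid_fps a x q = fps_const 1 * fps_X ^ 0 * solid_fps (a + 1) x q
       - fps_const (2 * x) * fps_X ^ 1 * solid_fps (a + 1) x q
       + fps_const q * fps_X ^ 2 * solid_fps (a + 1) x q"
    by (subst solid_fps_plus1) (simp add: algebra_simps)
  then have "fps_nth (solid_fps a x q) (m + 2) = fps_nth (fps_const 1 * fps_X ^ 0 * solid_fps (a + 1) x q
       - fps_const (2 * x) * fps_X ^ 1 * solid_fps (a + 1) x q
       + fps_const q * fps_X ^ 2 * solid_fps (a + 1) x q) (m + 2)" by simp
  then show ?thesis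
    unfolding fps_sub_nth fps_add_nth fps_nth_deriv_combination by (simp add: solid_geg_def)
qed

lemma solid_geg_rec:
  "(real m + 2) * solid_geg a (m + 2) x q =
     2 * (real m + 1 + a) * x * solid_geg a (m + 1) x q - (real m + 2 * a) * q * solid_geg a m x q"
proof -
  \<comment> \<open>Eliminating the series of parameter \<open>a + 1\<close> between the two shift
    rules leaves a first-order differential equation for a single parameter; its coefficients are
    the three-term recurrence.\<close>
  have *: "fps_deriv (solid_fps a x q) * (1 - fps_const (2 * x) * fps_X + fps_const q * fps_X ^ 2) =
     fps_const (2 * a) * (fps_const x - fps_const q * fps_X) * solid_fps a x q"
    unfolding solid_fps_deriv by (subst solid_fps_plus1[of a]) (simp only: mult_ac)
  have "fps_const 1 * fps_X ^ 0 * fps_deriv (solid_fps a x q)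
       - fps_const (2 * x) * fps_X ^ 1 * fps_deriv (solid_fps a x q)
       + fps_const q * fps_X ^ 2 * fps_deriv (solid_fps a x q)
     = fps_const (2 * a * x) * fps_X ^ 0 * solid_fps a x q
       - fps_const (2 * a * q) * fps_X ^ 1 * solid_fps a x q"
    using * by (simp add: algebra_simps fps_const_mult[symmetric] del: fps_const_mult)
  then have "fps_nth (fps_const 1 * fps_X ^ 0 * fps_deriv (solid_fps a x q)
       - fps_const (2 * x) * fps_X ^ 1 * fps_deriv (solid_fps a x q)
       + fps_const q * fps_X ^ 2 * fps_deriv (solid_fps a x q)) (m + 1)
     = fps_nth (fps_const (2 * a * x) * fps_X ^ 0 * solid_fps a x q
       - fps_const (2 * a * q) * fps_X ^ 1 * solid_fps a x q) (m + 1)" by simp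
  then show ?thesis
    unfolding fps_sub_nth fps_add_nth fps_nth_deriv_combination
    by (cases m) (simp_all add: solid_geg_def algebra_simps)
qed

text \<open>The coefficient of \<open>t ^ m\<close> in \<open>(1 - q t\<^sup>2) / (1 - 2 x t + q t\<^sup>2)\<close> to the power \<open>\<lambda> + 1\<close>, that is the
  zonal polynomial \<open>(m + \<lambda>) / \<lambda> C\<^sup>\<lambda>\<^sub>m\<close> in a form that makes sense for \<open>\<lambda> = 0\<close> as well.\<close>

definition zonal :: "real \<Rightarrow> nat \<Rightarrow> real \<Rightarrow> real \<Rightarrow> real" where
  "zonal l m x q = solid_geg (l + 1) m x q - (if m < 2 then 0 else q * solid_geg (l + 1) (m - 2) x q)"

text \<open>The derivative rule and the parameter shift combine to turn a difference of two
  polynomials of parameter \<open>l + 1\<close> into one of parameter \<open>l\<close>. The factor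
  \<open>l\<close> stays on the left so that the relation also holds at \<open>l = 0\<close>, where
  the quotient \<open>(m + l) / l\<close> has no value.\<close>

lemma zonal_solid_geg: "l * zonal l m x q = (real m + l) * solid_geg l m x q"
proof (cases "m < 2")
  case True
  then have "m = 0 \<or> m = Suc 0" by auto
  then show ?thesis by (auto simp: zonal_def algebra_simps)
next
  case False
  then have "\<exists>k. m = k + 2" by presburger
  then obtain k where m: "m = k + 2" by blast
  show ?thesis
    using solid_geg_deriv[of k l x q] arg_cong[OF solid_geg_plus1[of l k x q], of "\<lambda>t. l * t"]
    unfolding m zonal_def by (simp add: algebra_simps)
qed

lemma solid_geg_minus:
  "(real m + 1 + 2 * a) * solid_geg a (m + 1) x q = 2 * a * (solid_geg (a + 1) (m + 1) x q - x * solid_geg (a + 1) m x q)"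
proof (cases m)
  case 0 then show ?thesis by (simp add: algebra_simps)
next
  case (Suc k)
  show ?thesis
    using solid_geg_deriv[of k a x q] arg_cong[OF solid_geg_plus1[of a k x q], of "\<lambda>t. a * t"] unfolding Suc
    by (simp add: algebra_simps)
qed

text \<open>The factor \<open>q - x^2\<close> is the squared radius in the coordinates other than
  \<open>x\<close>. Absorbing it lowers the parameter, which later undoes a shift of the summation
  index in the addition theorem.\<close>

lemma solid_geg_down:
  "4 * a * (real m + a + 1) * (q - x\<^sup>2) * solid_geg (a + 1) m x q =
     (real m + 2 * a) * (real m + 2 * a + 1) * q * solid_geg a m x q
     - (real m + 1) * (real m + 2) * solid_geg a (m + 2) x q"
proof (cases m)
  case 0
  have "2 * solid_geg a (Suc (Suc 0)) x q = 2 * a * (2 * (a + 1) * x * x - q)"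
    using solid_geg_rec[of 0 a x q] by (simp add: algebra_simps numeral_2_eq_2)
  then show ?thesis unfolding 0 by (simp add: algebra_simps power2_eq_square)
next
  case (Suc k)
  define D where "D j = solid_geg (a + 1) j x q" for j
  have 1: "(real m + 2) * solid_geg a (m + 2) x q = 2 * a * (x * D (k + 2) - q * D (k + 1))"
    using solid_geg_deriv[of m a x q] unfolding Suc D_def by simp
  have 2: "(real m + 1) * D (k + 2) = 2 * (real m + a + 1) * x * D (k + 1) - (real m + 2 * a + 1) * q * D k"
    using solid_geg_rec[of k "a + 1" x q] unfolding Suc D_def by (simp add: algebra_simps)
  have 3: "(real m + 2 * a) * solid_geg a m x q = 2 * a * (D (k + 1) - x * D k)"
    using solid_geg_minus[of k a x q] unfolding Suc D_def by (simp add: algebra_simps)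
  have "(real m + 2 * a) * (real m + 2 * a + 1) * q * solid_geg a m x q
     - (real m + 1) * (real m + 2) * solid_geg a (m + 2) x q
     = (real m + 2 * a + 1) * q * ((real m + 2 * a) * solid_geg a m x q)
      - (real m + 1) * ((real m + 2) * solid_geg a (m + 2) x q)" by (simp add: algebra_simps)
  also have "\<dots> = (real m + 2 * a + 1) * q * (2 * a * (D (k + 1) - x * D k))
      - 2 * a * (x * ((real m + 1) * D (k + 2)) - (real m + 1) * q * D (k + 1))"
    unfolding 1 3 by (simp add: algebra_simps)
  also have "\<dots> = 4 * a * (real m + a + 1) * (q - x\<^sup>2) * D (k + 1)"
    unfolding 2 by (simp add: algebra_simps power2_eq_square)
  finally show ?thesis unfolding D_def Suc by simp
qed

lemma solid_geg_scale: "solid_geg a m (r * x) (r\<^sup>2 * q) = r ^ m * solid_geg a m x q"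
proof (induction m rule: less_induct)
  case (less m)
  have "m = 0 \<or> m = Suc 0 \<or> (\<exists>k. m = k + 2)" by presburger
  then consider "m = 0" | "m = Suc 0" | k where "m = k + 2" by blast
  then show ?case
  proof cases
    case 1
    then show ?thesis by simp
  next
    case 2
    then show ?thesis by simp
  next
    case 3
    have 0: "solid_geg a k (r * x) (r\<^sup>2 * q) = r ^ k * solid_geg a k x q"
      and 1: "solid_geg a (k + 1) (r * x) (r\<^sup>2 * q) = r ^ (k + 1) * solid_geg a (k + 1) x q"
      by (rule less.IH; simp add: 3)+
    have "(real k + 2) * solid_geg a (k + 2) (r * x) (r\<^sup>2 * q) =
      r ^ (k + 2) * (2 * (real k + 1 + a) * x * solid_geg a (k + 1) x q - (real k + 2 * a) * q * solid_geg a k x q)"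
      unfolding solid_geg_rec 0 1 by (simp add: right_diff_distrib power2_eq_square)
    also have "\<dots> = (real k + 2) * (r ^ (k + 2) * solid_geg a (k + 2) x q)"
      unfolding solid_geg_rec[symmetric] by (simp only: mult_ac)
    finally have "solid_geg a (k + 2) (r * x) (r\<^sup>2 * q) = r ^ (k + 2) * solid_geg a (k + 2) x q"
      by (subst (asm) mult_left_cancel) simp_all
    then show ?thesis unfolding 3 .
  qed
qed

definition zonal_up :: "real \<Rightarrow> nat \<Rightarrow> real" where
  "zonal_up l k = (real k + 1) / (real k + 1 + l)"

text \<open>At \<open>k = 1\<close> the general quotient reads \<open>2 * l / l\<close>; its value 2
  is fixed separately because \<open>l = 0\<close> occurs. The value 0 at \<open>k = 0\<close>
  cancels the term with the truncated index \<open>k - 1\<close>.\<close>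

definition zonal_down :: "real \<Rightarrow> nat \<Rightarrow> real" where
  "zonal_down l k = (if k = 1 then 2 else if k = 0 then 0 else (real k + 2 * l - 1) / (real k - 1 + l))"

text \<open>A zonal polynomial is a difference of two polynomials of parameter \<open>l + 1\<close>
  two degrees apart, so the rule combines the three-term recurrence at two places. The first values
  of \<open>k\<close> are separate, since there one of the two is absent or the coefficient is
  exceptional.\<close>

lemma zonal_mult:
  assumes l: "l > -1"
  shows "2 * x * zonal l k x q = zonal_up l k * zonal l (k + 1) x q + zonal_down l k * q * zonal l (k - 1) x q"
proof -
  define D where "D j = solid_geg (l + 1) j x q" for j
  have z: "zonal l j x q = D j - (if j < 2 then 0 else q * D (j - 2))" for j
    by (simp add: zonal_def D_def)
  have rec: "(real m + 2) * D (m + 2) = 2 * (real m + 2 + l) * x * D (m + 1) - (real m + 2 * l + 2) * q * D m" for m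
    using solid_geg_rec[of m "l + 1" x q] unfolding D_def by (simp add: algebra_simps)
  have D01: "D 0 = 1" "D (Suc 0) = 2 * (l + 1) * x" unfolding D_def by auto
  have "k = 0 \<or> k = 1 \<or> k = 2 \<or> (\<exists>m. k = m + 3)" by presburger
  then consider "k = 0" | "k = 1" | "k = 2" | m where "k = m + 3" by blast
  then show ?thesis
  proof cases
    case 1
    then show ?thesis using l by (simp add: z D01 zonal_up_def zonal_down_def field_simps)
  next
    case 2
    have "2 * D 2 = 2 * (2 + l) * x * (2 * (l + 1) * x) - (2 * l + 2) * q"
      using rec[of 0] by (simp add: D01 numeral_2_eq_2)
    then have "(2 + l) * (2 * x * D 1) = 2 * (D 2 - q) + (2 + l) * (2 * q)"
      by (simp add: D01 algebra_simps)
    then have "2 * x * D 1 = 2 / (2 + l) * (D 2 - q) + 2 * q" using l by (simp add: field_simps)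
    then show ?thesis unfolding 2
      using D01 by (simp add: z zonal_up_def zonal_down_def numeral_2_eq_2)
  next
    case 3
    have a: "2 * D 2 = 2 * (2 + l) * x * (2 * (l + 1) * x) - (2 * l + 2) * q"
      using rec[of 0] by (simp add: D01 numeral_2_eq_2)
    have b: "3 * D 3 = 2 * (3 + l) * x * D 2 - (2 * l + 3) * q * (2 * (l + 1) * x)"
      using rec[of 1] by (simp add: D01 numeral_3_eq_3 numeral_2_eq_2)
    have "(3 + l) * (1 + l) * (2 * x * (D 2 - q)) = (1 + l) * (3 * (D 3 - q * (2 * (l + 1) * x))) + (3 + l) * (1 + 2 * l) * q * (2 * (l + 1) * x)"
      using arg_cong[OF b, of "\<lambda>t. (1 + l) * t"] by (simp add: algebra_simps)
    then have "2 * x * (D 2 - q) = 3 / (3 + l) * (D 3 - q * (2 * (l + 1) * x)) + (1 + 2 * l) / (1 + l) * q * (2 * (l + 1) * x)"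
      using l by (simp add: divide_simps) (simp add: algebra_simps)
    then show ?thesis unfolding 3
      using D01 by (simp add: z zonal_up_def zonal_down_def numeral_2_eq_2 numeral_3_eq_3 add.commute[of 1 l])
  next
    case 4
    define M where "M = real m"
    have M: "M \<ge> 0" by (simp add: M_def)
    have a: "(M + 2) * D (m + 2) = 2 * (M + 2 + l) * x * D (m + 1) - (M + 2 * l + 2) * q * D m"
      using rec[of m] by (simp add: M_def)
    have c: "(M + 4) * D (m + 4) = 2 * (M + 4 + l) * x * D (m + 3) - (M + 2 * l + 4) * q * D (m + 2)"
      using rec[of "m + 2"] by (simp add: M_def algebra_simps numeral_eq_Suc)
    have a': "(M + 4 + l) * (q * ((M + 2) * D (m + 2))) = (M + 4 + l) * (q * (2 * (M + 2 + l) * x * D (m + 1) - (M + 2 * l + 2) * q * D m))"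
      using a by simp
    have c': "(M + 2 + l) * ((M + 4) * D (m + 4)) = (M + 2 + l) * (2 * (M + 4 + l) * x * D (m + 3) - (M + 2 * l + 4) * q * D (m + 2))"
      using c by simp
    have "(M + 4 + l) * (M + 2 + l) * (2 * x * (D (m + 3) - q * D (m + 1))) =
       (M + 2 + l) * ((M + 4) * (D (m + 4) - q * D (m + 2)))
      + (M + 4 + l) * ((M + 2 + 2 * l) * q * (D (m + 2) - q * D m))"
      using a' c' by (simp add: algebra_simps)
    then have "2 * x * (D (m + 3) - q * D (m + 1)) =
       (M + 4) / (M + 4 + l) * (D (m + 4) - q * D (m + 2))
      + (M + 2 + 2 * l) / (M + 2 + l) * q * (D (m + 2) - q * D m)"
      using l M by (simp add: divide_simps) (simp add: algebra_simps)
    then show ?thesis unfolding 4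
      by (simp add: z zonal_up_def zonal_down_def M_def numeral_eq_Suc add_ac)
  qed
qed

section \<open>Gegenbauer's addition theorem\<close>

definition assoc_geg :: "real \<Rightarrow> nat \<Rightarrow> nat \<Rightarrow> real \<Rightarrow> real \<Rightarrow> real" where
  "assoc_geg l m k x q = (if k \<le> m then solid_geg (l + real k) (m - k) x q else 0)"

text \<open>\<open>assoc_geg\<close> plays the part of the associated Legendre functions without
  their power of the sine. The three rules from here on rewrite a factor of the middle degree by its
  neighbours: with the same \<open>k\<close>, with \<open>k\<close> raised, with \<open>k\<close>
  lowered. The value 0 for \<open>k > m\<close> keeps them valid at the ends of the range.\<close>

lemma assoc_geg_cos:
  assumes "k \<le> M + 1"
  shows "2 * (real M + 1 + l) * x * assoc_geg l (M + 1) k x q =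
    (real M + 2 - real k) * assoc_geg l (M + 2) k x q + (real M + real k + 2 * l) * (q * assoc_geg l M k x q)"
proof (cases "k = M + 1")
  case True
  then show ?thesis by (simp add: assoc_geg_def algebra_simps)
next
  case False
  then obtain j where M: "M = k + j" using assms by (metis le_Suc_ex le_SucE Suc_eq_plus1)
  show ?thesis
    using solid_geg_rec[of j "l + real k" x q] unfolding M assoc_geg_def
    by (simp add: algebra_simps Suc_diff_le)
qed

lemma assoc_geg_up:
  assumes "k \<le> M + 1"
  shows "(real M + 1 + l) * assoc_geg l (M + 1) k x q =
    (l + real k) * (assoc_geg l (M + 2) (k + 1) x q - q * assoc_geg l M (k + 1) x q)"
proof -
  obtain j where M: "M + 1 = k + j" using assms by (metis le_Suc_ex)
  have Mj: "real M = real k + real j - 1" using M by linarith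
  have "M + 1 - k = j" "M + 2 - (k + 1) = j" "M - (k + 1) = j - 2" "k + 1 \<le> M \<longleftrightarrow> \<not> j < 2" "k + 1 \<le> M + 2"
    using M by auto
  then have A: "assoc_geg l (M + 1) k x q = solid_geg (l + real k) j x q"
      "assoc_geg l (M + 2) (k + 1) x q = solid_geg (l + real k + 1) j x q"
      "assoc_geg l M (k + 1) x q = (if j < 2 then 0 else solid_geg (l + real k + 1) (j - 2) x q)"
    unfolding assoc_geg_def using assms by (simp_all only: if_True of_nat_add of_nat_1 add.assoc) simp
  have "(real M + 1 + l) * solid_geg (l + real k) j x q = (l + real k) * zonal (l + real k) j x q"
    unfolding zonal_solid_geg Mj by simp
  then show ?thesis unfolding A zonal_def by (simp only: if_distrib[of "\<lambda>t. q * t"] mult_zero_right)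
qed

lemma assoc_geg_down:
  assumes "k \<le> M"
  shows "4 * (l + real k) * (real M + 1 + l) * ((q - x\<^sup>2) * assoc_geg l (M + 1) (k + 1) x q) =
    (real M + real k + 2 * l) * (real M + real k + 1 + 2 * l) * (q * assoc_geg l M k x q)
    - (real M + 1 - real k) * (real M + 2 - real k) * assoc_geg l (M + 2) k x q"
proof -
  obtain j where M: "M = k + j" using assms by (metis le_Suc_ex)
  show ?thesis
    using solid_geg_down[of "l + real k" j q x] unfolding M assoc_geg_def
    by (simp add: Suc_diff_le add_ac mult.assoc)
qed

text \<open>The coefficients of the classical addition theorem, except that its factor
  \<open>(2 * k + 2 * l - 1) / (2 * l - 1)\<close> is absorbed into
  \<open>zonal (l - 1 / 2) k\<close>; this is what admits \<open>l = 1 / 2\<close>.\<close>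

definition addition_coeff :: "real \<Rightarrow> nat \<Rightarrow> nat \<Rightarrow> real" where
  "addition_coeff l m k =
     (if k \<le> m then 4 ^ k * fact (m - k) * (pochhammer l k)\<^sup>2 / pochhammer (2 * l) (m + k) else 0)"

lemma addition_coeff_step:
  assumes l: "l > 0" and k: "k \<le> M + 1"
  shows "addition_coeff l (M + 2) k * (real M + real k + 2 * l + 1) = addition_coeff l (M + 1) k * (real M + 2 - real k)"
proof -
  obtain j where M: "M + 1 = k + j" using k by (metis le_Suc_ex)
  have Mj: "real M = real k + real j - 1" using M by linarith
  have e: "M + 2 - k = Suc j" "M + 1 - k = j" "k \<le> M + 2" "M + 2 + k = Suc (M + 1 + k)" using M by auto
  have p: "pochhammer (2 * l) (M + 1 + k) > 0" using l by (intro pochhammer_pos) auto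
  show ?thesis
    unfolding addition_coeff_def e pochhammer_Suc using k p l
    by (simp add: Mj divide_simps)
qed

lemma addition_coeff_Suc:
  assumes l: "l > 0" and k: "k \<le> M"
  shows "addition_coeff l (M + 1) (k + 1) * ((real M + 1 - real k) * (real M + real k + 2 * l + 1)) =
    addition_coeff l (M + 1) k * (4 * (l + real k)\<^sup>2)"
proof -
  obtain j where M: "M = k + j" using k by (metis le_Suc_ex)
  have p: "pochhammer (2 * l) (M + 1 + k) > 0" using l by (intro pochhammer_pos) auto
  have e: "M + 1 + (k + 1) = Suc (M + 1 + k)" by simp
  have f: "M + 1 - k = Suc j" "M + 1 - (k + 1) = j" "k \<le> M + 1" "k + 1 \<le> M + 1" using M by auto
  show ?thesis
    unfolding addition_coeff_def e f pochhammer_Suc using p l k f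
    by (simp add: M divide_simps) (auto simp: algebra_simps power2_eq_square pochhammer_Suc)
qed

text \<open>The comparison of coefficients behind the addition theorem. The mixed products
  \<open>X * Y'\<close> and \<open>X' * Y\<close> cancel because the up and down coefficients
  \<open>u\<close> and \<open>d\<close> add to 2; the pure products then carry the common factor
  \<open>S\<close>.\<close>

lemma addition_identity:
  fixes al be u d K S X Y X' Y' :: real
  assumes d: "d = 2 - u" and u: "u * (be - al + 1) = 2 * K" and S: "al + be = 2 * S"
    and pos: "al - 1 \<noteq> 0" "be + 1 \<noteq> 0"
  shows "(al * X + be * X') * (al * Y + be * Y') / 2 + al * be * u / 4 * ((X - X') * (Y - Y'))
     + d / (4 * (al - 1) * (be + 1)) *
        ((be * (be + 1) * X' - (al - 1) * al * X) * (be * (be + 1) * Y' - (al - 1) * al * Y))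
     = S * ((al + K) * (al / (be + 1)) * (X * Y) + (be - K) * (be / (al - 1)) * (X' * Y'))"
proof -
  have K: "K = u * (be - al + 1) / 2" and S': "S = (al + be) / 2" using u S by auto
  define C where "C = al - 1"
  define D where "D = be + 1"
  have CD: "C \<noteq> 0" "D \<noteq> 0" "al = C + 1" "be = D - 1" using pos by (auto simp: C_def D_def)
  have e1: "al\<^sup>2 / 2 + al * be * u / 4 + d * (C * al\<^sup>2 / D) / 4 = S * ((al + K) * (al / D))"
  proof -
    have "D * (al\<^sup>2 / 2 + al * be * u / 4 + d * (C * al\<^sup>2 / D) / 4) = D * (S * ((al + K) * (al / D)))"
      using CD(1,2) unfolding d K S' distrib_left
      by (simp add: CD(3,4)) (simp add: field_simps power2_eq_square)
    then show ?thesis using CD(1,2) mult_left_cancel by blast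
  qed
  have e2: "be\<^sup>2 / 2 + al * be * u / 4 + d * (be\<^sup>2 * D / C) / 4 = S * ((be - K) * (be / C))"
  proof -
    have "C * (be\<^sup>2 / 2 + al * be * u / 4 + d * (be\<^sup>2 * D / C) / 4) = C * (S * ((be - K) * (be / C)))"
      using CD(1,2) unfolding d K S' distrib_left
      by (simp add: CD(3,4)) (simp add: field_simps power2_eq_square)
    then show ?thesis using CD(1,2) mult_left_cancel by blast
  qed
  have e3: "d / (4 * C * D) * ((be * D * X' - C * al * X) * (be * D * Y' - C * al * Y)) =
     d * (be\<^sup>2 * D / C) / 4 * (X' * Y') - d * al * be / 4 * (X * Y' + X' * Y) + d * (C * al\<^sup>2 / D) / 4 * (X * Y)"
    using CD(1,2) by (simp add: field_simps power2_eq_square)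
  have "(al * X + be * X') * (al * Y + be * Y') / 2 + al * be * u / 4 * ((X - X') * (Y - Y'))
     + d / (4 * C * D) * ((be * D * X' - C * al * X) * (be * D * Y' - C * al * Y))
     = (al\<^sup>2 / 2 + al * be * u / 4 + d * (C * al\<^sup>2 / D) / 4) * (X * Y)
      + (be\<^sup>2 / 2 + al * be * u / 4 + d * (be\<^sup>2 * D / C) / 4) * (X' * Y')"
  proof -
    have "(al * X + be * X') * (al * Y + be * Y') / 2 + al * be * u / 4 * ((X - X') * (Y - Y'))
     + (P / 4 * (X' * Y') - (2 - u) * al * be / 4 * (X * Y' + X' * Y) + Q / 4 * (X * Y))
     = (al\<^sup>2 / 2 + al * be * u / 4 + Q / 4) * (X * Y)
      + (be\<^sup>2 / 2 + al * be * u / 4 + P / 4) * (X' * Y')" for P Q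
      by (simp add: field_simps power2_eq_square)
    then show ?thesis unfolding e3 unfolding d .
  qed
  also have "\<dots> = S * ((al + K) * (al / D) * (X * Y) + (be - K) * (be / C) * (X' * Y'))"
    unfolding e1 e2 by (simp only: ring_distribs mult_ac)
  finally show ?thesis unfolding C_def D_def .
qed

text \<open>Both sides obey the same three-term recurrence in \<open>m\<close>. In the sum,
  multiplication by \<open>x * y\<close> keeps \<open>k\<close> and multiplication by
  \<open>z\<close> moves it by one; the raising and lowering rules bring the moved terms back to a
  common index, so that the coefficients of each zonal factor can be compared.\<close>

lemma solid_geg_addition:
  assumes l: "l \<ge> 1 / 2"
  shows "solid_geg l m (x * y + z) ((x\<^sup>2 + q) * (y\<^sup>2 + r)) =
    (\<Sum>k\<le>m. addition_coeff l m k * assoc_geg l m k x (x\<^sup>2 + q) * assoc_geg l m k y (y\<^sup>2 + r)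
        * zonal (l - 1 / 2) k z (q * r))"
    (is "?P m = ?S m")
proof (induction m rule: less_induct)
  case (less m)
  define V where "V k = zonal (l - 1 / 2) k z (q * r)" for k
  define A where "A n k = assoc_geg l n k x (x\<^sup>2 + q)" for n k
  define B where "B n k = assoc_geg l n k y (y\<^sup>2 + r)" for n k
  define b where "b n k = addition_coeff l n k" for n k
  have S: "?S n = (\<Sum>k\<le>n. b n k * A n k * B n k * V k)" for n
    by (simp add: V_def A_def B_def b_def)
  have "m = 0 \<or> m = 1 \<or> (\<exists>M. m = M + 2)" by presburger
  then consider "m = 0" | "m = 1" | M where "m = M + 2" by blast
  then show ?case
  proof cases
    case 1
    then show ?thesis by (simp add: addition_coeff_def assoc_geg_def zonal_def)
  next
    case 2
    have "l * 4 + l * (l * 8) = (l * 4) * (1 + 2 * l)" by algebra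
    then show ?thesis unfolding 2 using l
      by (simp add: addition_coeff_def assoc_geg_def zonal_def pochhammer_Suc divide_simps power2_eq_square)
        (simp add: algebra_simps)
  next
    case 3
    define s where "s = real M + 1 + l"
    define Qx where "Qx = x\<^sup>2 + q"
    define Qy where "Qy = y\<^sup>2 + r"
    define u where "u k = zonal_up (l - 1 / 2) k" for k
    define d where "d k = zonal_down (l - 1 / 2) k" for k
    have s: "s > 0" using l by (simp add: s_def)
    have z2: "2 * z * V k = u k * V (k + 1) + d k * (q * r) * V (k - 1)" for k
      unfolding V_def u_def d_def by (rule zonal_mult) (use l in simp)
    have cx: "2 * s * x * A (M + 1) k = (real M + 2 - real k) * A (M + 2) k + (real M + real k + 2 * l) * (Qx * A M k)"
      if "k \<le> M + 1" for k
      unfolding A_def s_def Qx_def by (rule assoc_geg_cos[OF that])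
    have cy: "2 * s * y * B (M + 1) k = (real M + 2 - real k) * B (M + 2) k + (real M + real k + 2 * l) * (Qy * B M k)"
      if "k \<le> M + 1" for k
      unfolding B_def s_def Qy_def by (rule assoc_geg_cos[OF that])
    have ux: "s * A (M + 1) k = (l + real k) * (A (M + 2) (k + 1) - Qx * A M (k + 1))"
      if "k \<le> M + 1" for k
      unfolding A_def s_def Qx_def by (rule assoc_geg_up[OF that])
    have uy: "s * B (M + 1) k = (l + real k) * (B (M + 2) (k + 1) - Qy * B M (k + 1))"
      if "k \<le> M + 1" for k
      unfolding B_def s_def Qy_def by (rule assoc_geg_up[OF that])
    have dx: "4 * (l + real k) * s * (q * A (M + 1) (k + 1)) =
       (real M + real k + 2 * l) * (real M + real k + 1 + 2 * l) * (Qx * A M k)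
       - (real M + 1 - real k) * (real M + 2 - real k) * A (M + 2) k" if "k \<le> M" for k
      using assoc_geg_down[OF that, of l "x\<^sup>2 + q" x] by (simp add: A_def s_def Qx_def)
    have dy: "4 * (l + real k) * s * (r * B (M + 1) (k + 1)) =
       (real M + real k + 2 * l) * (real M + real k + 1 + 2 * l) * (Qy * B M k)
       - (real M + 1 - real k) * (real M + 2 - real k) * B (M + 2) k" if "k \<le> M" for k
      using assoc_geg_down[OF that, of l "y\<^sup>2 + r" y] by (simp add: B_def s_def Qy_def)
    \<comment> \<open>The three ways to reach the zonal factor of index \<open>k\<close>:
      \<open>T0 k\<close> stays, \<open>TU (k - 1)\<close> comes from below and
      \<open>TD (k + 1)\<close> from above. The whole identity is multiplied by one more
      \<open>s\<close>, because the rules for \<open>A\<close> and for \<open>B\<close> each consume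
      one.\<close>
    define T0 where "T0 k = b (M + 1) k / 2 * ((2 * s * x * A (M + 1) k) * (2 * s * y * B (M + 1) k))" for k
    define TU where "TU k = b (M + 1) k * u k * ((s * A (M + 1) k) * (s * B (M + 1) k))" for k
    define TD where "TD k = b (M + 1) k * d k * ((s * (q * A (M + 1) k)) * (s * (r * B (M + 1) k)))" for k
    have TD0: "TD 0 = 0" by (simp add: TD_def d_def zonal_down_def)
    have clifford_zeros: "b n k = 0" if "n < k" for n k using that by (simp add: b_def addition_coeff_def)
    have key: "T0 k + (if k = 0 then 0 else TU (k - 1)) + (if k \<le> M then TD (k + 1) else 0) =
      s * ((real M + 2) * b (M + 2) k * A (M + 2) k * B (M + 2) k
         + (real M + 2 * l) * b M k * (Qx * A M k) * (Qy * B M k))" if "k \<le> M + 2" for k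
    proof -
      define al where "al = real M + 2 - real k"
      define be where "be = real M + real k + 2 * l"
      define X where "X = A (M + 2) k"
      define X' where "X' = Qx * A M k"
      define Y where "Y = B (M + 2) k"
      define Y' where "Y' = Qy * B M k"
      define U where "U = (if k = 0 then 0 else u (k - 1))"
      have U: "U * (be - al + 1) = 2 * real k"
      proof (cases "k = 0")
        case False
        then show ?thesis using l by (simp add: U_def u_def zonal_up_def al_def be_def field_simps of_nat_diff)
      qed (simp add: U_def)
      have be: "be > 0" using l by (simp add: be_def)
      have abs: "al + be = 2 * s" by (simp add: al_def be_def s_def)
      have TU: "(if k = 0 then 0 else TU (k - 1)) = b (M + 1) k * (al * be * U / 4 * ((X - X') * (Y - Y')))"
        if kM: "k \<le> M + 1"
      proof (cases k)
        case (Suc i)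
        then have i: "i \<le> M" using kM by simp
        have "TU i = b (M + 1) i * u i * (((l + real i) * (X - X')) * ((l + real i) * (Y - Y')))"
          unfolding TU_def using ux[of i] uy[of i] i by (simp add: X_def X'_def Y_def Y'_def Suc)
        also have "\<dots> = (b (M + 1) i * (4 * (l + real i)\<^sup>2)) * (u i / 4 * ((X - X') * (Y - Y')))"
          by (simp add: power2_eq_square)
        also have "b (M + 1) i * (4 * (l + real i)\<^sup>2) = b (M + 1) k * (al * be)"
        proof -
          have "al = real M + 1 - real i" "be = real M + real i + 2 * l + 1" using Suc by (simp_all add: al_def be_def)
          then show ?thesis using addition_coeff_Suc[of l i M] l i by (simp add: b_def Suc)
        qed
        finally show ?thesis using Suc by (simp add: U_def)
      qed (simp add: U_def)
      have T0: "T0 k = b (M + 1) k * ((al * X + be * X') * (al * Y + be * Y') / 2)"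
      proof (cases "k \<le> M + 1")
        case True
        show ?thesis unfolding T0_def cx[OF True] cy[OF True]
          by (simp add: al_def be_def X_def X'_def Y_def Y'_def)
      next
        case False
        then show ?thesis unfolding T0_def by (simp add: clifford_zeros)
      qed
      have b2: "b (M + 2) k * (be + 1) = b (M + 1) k * al" if "k \<le> M + 1"
        using addition_coeff_step[OF _ that, of l] l by (simp add: b_def al_def be_def add_ac)
      have "k = M + 2 \<or> k = M + 1 \<or> k \<le> M" using that by linarith
      then consider "k = M + 2" | "k = M + 1" | "k \<le> M" by blast
      then show ?thesis
      proof cases
        case 1
        \<comment> \<open>At the top index only the step up from \<open>M + 1\<close> contributes:
          the coefficient at \<open>M + 1\<close> and the products of degree \<open>M\<close> vanish
          there. The claim becomes a relation between two addition coefficients.\<close>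
        have TU1: "TU (M + 1) = b (M + 1) (M + 1) * u (M + 1) * (((l + real M + 1) * (X - X')) * ((l + real M + 1) * (Y - Y')))"
          unfolding TU_def using ux[of "M + 1"] uy[of "M + 1"] by (simp add: X_def X'_def Y_def Y'_def 1 numeral_2_eq_2 add_ac)
        have X'0: "X' = 0" "Y' = 0" by (auto simp: X'_def Y'_def A_def B_def assoc_geg_def 1)
        have bu: "b (M + 1) (M + 1) * u (M + 1) * (l + real M + 1)\<^sup>2 = s * (real M + 2) * b (M + 2) k"
        proof -
          define p where "p = pochhammer (2 * l) (M + 1 + (M + 1))"
          have p: "p > 0" unfolding p_def using l by (intro pochhammer_pos) auto
          have "M + 2 + (M + 2) = Suc (Suc (M + 1 + (M + 1)))" by simp
          then have pp: "pochhammer (2 * l) (M + 2 + (M + 2)) = p * (2 * l + 2 * real M + 2) * (2 * l + 2 * real M + 3)"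
            unfolding p_def by (simp only: pochhammer_Suc) (simp add: algebra_simps)
          have po: "pochhammer l (M + 2) = pochhammer l (M + 1) * (l + real M + 1)"
            using pochhammer_Suc[of l "M + 1"] by (simp add: add_ac)
          define t where "t = l + real M + 1"
          define W where "W = 2 * l + 2 * real M + 3"
          have tW: "t > 0" "W > 0" "2 * l + 2 * real M + 2 = 2 * t" using l by (auto simp: t_def W_def)
          have u: "u (M + 1) = 2 * (real M + 2) / W"
            using l by (simp add: u_def zonal_up_def W_def field_simps)
          have b1: "b (M + 1) (M + 1) = 4 ^ (M + 1) * (pochhammer l (M + 1))\<^sup>2 / p"
            by (simp add: b_def addition_coeff_def p_def)
          have b2: "b (M + 2) k = 4 * 4 ^ (M + 1) * (pochhammer l (M + 1) * t)\<^sup>2 / (p * (2 * t) * W)"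
            unfolding b_def addition_coeff_def 1 pp po W_def[symmetric] t_def[symmetric] tW(3) by simp
          have st: "s = t" by (simp add: s_def t_def)
          show ?thesis unfolding u b1 b2 st t_def[symmetric]
            using p tW(1,2) by (simp add: divide_simps power2_eq_square del: power_Suc)
        qed
        have "TU (M + 1) = (b (M + 1) (M + 1) * u (M + 1) * (l + real M + 1)\<^sup>2) * ((X - X') * (Y - Y'))"
          unfolding TU1 by (simp only: power2_eq_square mult_ac)
        then have "TU (M + 1) = s * (real M + 2) * b (M + 2) k * (X * Y)"
          unfolding bu X'0 by simp
        moreover have "T0 k = 0" unfolding T0_def using clifford_zeros[of "M + 1" k] 1 by simp
        ultimately show ?thesis using 1 clifford_zeros[of M k] by (simp add: X_def Y_def)
      next
        case 2
        have X': "X' = 0" "Y' = 0" by (auto simp: X'_def Y'_def A_def B_def assoc_geg_def 2)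
        have al1: "al = 1" by (simp add: al_def 2)
        have "s * (real M + 2) * b (M + 2) k * (be + 1) = b (M + 1) k * (1 / 2 + be * U / 4) * (be + 1)"
        proof -
          have "U * be = 2 * real k" using U al1 by simp
          moreover have "be + 1 = 2 * s" "real k = real M + 1" using abs al1 2 by auto
          ultimately show ?thesis using b2 al1 2 by (simp add: algebra_simps)
        qed
        then have bu: "s * (real M + 2) * b (M + 2) k = b (M + 1) k * (1 / 2 + be * U / 4)"
          using be by simp
        have "T0 k + (if k = 0 then 0 else TU (k - 1)) = b (M + 1) k * (1 / 2 + be * U / 4) * (X * Y)"
          unfolding T0 using TU 2 X' al1 by (simp add: distrib_left distrib_right)
        then have "T0 k + (if k = 0 then 0 else TU (k - 1)) = s * (real M + 2) * b (M + 2) k * (X * Y)"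
          unfolding bu .
        then show ?thesis
          using 2 clifford_zeros[of M k] by (simp add: X_def Y_def)
      next
        case 3
        have al1: "al - 1 > 0" using 3 by (simp add: al_def)
        have TD: "TD (k + 1) = b (M + 1) k * (d (k + 1) / (4 * (al - 1) * (be + 1)) *
          ((be * (be + 1) * X' - (al - 1) * al * X) * (be * (be + 1) * Y' - (al - 1) * al * Y)))"
        proof -
          have lk: "l + real k > 0" using l by simp
          have "16 * (l + real k)\<^sup>2 * TD (k + 1) = b (M + 1) (k + 1) * d (k + 1) *
             ((4 * (l + real k) * s * (q * A (M + 1) (k + 1))) * (4 * (l + real k) * s * (r * B (M + 1) (k + 1))))"
          proof -
            have "16 * (l + real k)\<^sup>2 = (4 * (l + real k)) * (4 * (l + real k))" by (simp add: power2_eq_square algebra_simps)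
            then show ?thesis unfolding TD_def by (simp only: mult_ac)
          qed
          also have "\<dots> = b (M + 1) (k + 1) * d (k + 1) *
             ((be * (be + 1) * X' - (al - 1) * al * X) * (be * (be + 1) * Y' - (al - 1) * al * Y))"
          proof -
            have e: "real M + real k + 2 * l = be" "real M + real k + 1 + 2 * l = be + 1"
              "real M + 1 - real k = al - 1" "real M + 2 - real k = al" by (simp_all add: al_def be_def)
            show ?thesis unfolding dx[OF 3] dy[OF 3] e by (simp only: X_def X'_def Y_def Y'_def)
          qed
          also have "b (M + 1) (k + 1) = b (M + 1) k * (4 * (l + real k)\<^sup>2) / ((al - 1) * (be + 1))"
          proof -
            have e: "real M + real k + 2 * l + 1 = be + 1" "real M + 1 - real k = al - 1" by (simp_all add: al_def be_def)
            have "b (M + 1) (k + 1) * ((al - 1) * (be + 1)) = b (M + 1) k * (4 * (l + real k)\<^sup>2)"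
              using addition_coeff_Suc[OF _ 3, of l] l unfolding b_def e by simp
            moreover have "(al - 1) * (be + 1) \<noteq> 0" using al1 be by simp
            ultimately show ?thesis by (subst nonzero_eq_divide_eq)
          qed
          finally have "16 * (l + real k)\<^sup>2 * TD (k + 1) = 16 * (l + real k)\<^sup>2 * (b (M + 1) k * (d (k + 1) / (4 * (al - 1) * (be + 1)) *
            ((be * (be + 1) * X' - (al - 1) * al * X) * (be * (be + 1) * Y' - (al - 1) * al * Y))))"
          proof -
            have gen: "B * (4 * L) / (C * D) * e * Z = 16 * L * (B * (e / (4 * C * D) * Z))" for B L C D e Z :: real
              by (cases "C = 0"; cases "D = 0"; simp add: field_simps)
            assume "16 * (l + real k)\<^sup>2 * TD (k + 1) = b (M + 1) k * (4 * (l + real k)\<^sup>2) / ((al - 1) * (be + 1)) * d (k + 1) *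
              ((be * (be + 1) * X' - (al - 1) * al * X) * (be * (be + 1) * Y' - (al - 1) * al * Y))"
            then show ?thesis unfolding gen .
          qed
          moreover have "16 * (l + real k)\<^sup>2 \<noteq> 0" using lk by simp
          ultimately show ?thesis using mult_left_cancel by blast
        qed
        have b0: "b M k * (al - 1) = b (M + 1) k * be"
        proof -
          obtain j where M: "M = k + j" using 3 by (metis le_Suc_ex)
          have p: "pochhammer (2 * l) (M + k) > 0" using l by (intro pochhammer_pos) auto
          have e: "M + 1 + k = Suc (M + k)" by simp
          have f: "M + 1 - k = Suc j" "M - k = j" "k \<le> M + 1" "k \<le> M" using M by auto
          show ?thesis
            unfolding b_def addition_coeff_def e f pochhammer_Suc al_def be_def using p l f
            by (simp add: M divide_simps)
        qed
        have dd: "d (k + 1) = 2 - U"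
        proof (cases "k = 0")
          case False
          then show ?thesis using l
            by (simp add: d_def U_def u_def zonal_up_def zonal_down_def of_nat_diff field_simps)
        qed (simp add: d_def U_def zonal_down_def)
        have "T0 k + (if k = 0 then 0 else TU (k - 1)) + (if k \<le> M then TD (k + 1) else 0)
          = b (M + 1) k * ((al * X + be * X') * (al * Y + be * Y') / 2 + al * be * U / 4 * ((X - X') * (Y - Y'))
             + d (k + 1) / (4 * (al - 1) * (be + 1)) *
           ((be * (be + 1) * X' - (al - 1) * al * X) * (be * (be + 1) * Y' - (al - 1) * al * Y)))"
          using 3 by (simp only: T0 TU TD if_True distrib_left le_trans[OF 3, of "M+1"])
        also have "\<dots> = b (M + 1) k * (s * ((al + real k) * (al / (be + 1)) * (X * Y)
             + (be - real k) * (be / (al - 1)) * (X' * Y')))"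
          by (subst addition_identity[OF dd U abs]) (use al1 be in auto)
        also have "\<dots> = s * ((al + real k) * (b (M + 1) k * al / (be + 1)) * (X * Y)
             + (be - real k) * (b (M + 1) k * be / (al - 1)) * (X' * Y'))"
          by (simp add: algebra_simps)
        also have "b (M + 1) k * al / (be + 1) = b (M + 2) k" using b2 3 be by (simp add: field_simps)
        also have "b (M + 1) k * be / (al - 1) = b M k" using b0 al1 by (simp add: field_simps)
        finally show ?thesis by (simp add: al_def be_def X_def X'_def Y_def Y'_def mult_ac)
      qed
    qed
    have "s * (2 * s * (x * y + z) * ?S (M + 1)) = (\<Sum>k\<le>M+1. T0 k * V k + TU k * V (k + 1) + TD k * V (k - 1))"
      unfolding S sum_distrib_left
    proof (rule sum.cong[OF refl])
      fix k
      have "s * (2 * s * (x * y + z) * (b (M + 1) k * A (M + 1) k * B (M + 1) k * V k))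
        = T0 k * V k + s * s * b (M + 1) k * A (M + 1) k * B (M + 1) k * (2 * z * V k)"
        by (simp add: T0_def algebra_simps)
      then show "s * (2 * s * (x * y + z) * (b (M + 1) k * A (M + 1) k * B (M + 1) k * V k))
        = T0 k * V k + TU k * V (k + 1) + TD k * V (k - 1)"
        unfolding z2 by (simp add: TU_def TD_def algebra_simps)
    qed
    also have "\<dots> = (\<Sum>k\<le>M+1. T0 k * V k) + (\<Sum>k\<le>M+1. TU k * V (k + 1)) + (\<Sum>k\<le>M+1. TD k * V (k - 1))"
      by (simp add: sum.distrib)
    also have "(\<Sum>k\<le>M+1. T0 k * V k) = (\<Sum>k\<le>M+2. T0 k * V k)"
      by (simp add: T0_def clifford_zeros)
    also have "(\<Sum>k\<le>M+1. TU k * V (k + 1)) = (\<Sum>k\<le>M+2. (if k = 0 then 0 else TU (k - 1)) * V k)"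
      using sum.atMost_Suc_shift[of "\<lambda>k. (if k = 0 then 0 else TU (k - 1)) * V k" "M + 1"] by simp
    also have "(\<Sum>k\<le>M+1. TD k * V (k - 1)) = (\<Sum>k\<le>M+2. (if k \<le> M then TD (k + 1) else 0) * V k)"
      using sum.atMost_Suc_shift[of "\<lambda>k. TD k * V (k - 1)" M] TD0 by simp
    finally have "s * (2 * s * (x * y + z) * ?S (M + 1)) =
      (\<Sum>k\<le>M+2. (T0 k + (if k = 0 then 0 else TU (k - 1)) + (if k \<le> M then TD (k + 1) else 0)) * V k)"
      by (simp only: sum.distrib[symmetric] distrib_right)
    also have "\<dots> = (\<Sum>k\<le>M+2. s * ((real M + 2) * (b (M + 2) k * A (M + 2) k * B (M + 2) k * V k))
         + s * ((real M + 2 * l) * (Qx * Qy) * (b M k * A M k * B M k * V k)))"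
      by (rule sum.cong[OF refl], subst key) (simp_all add: algebra_simps)
    also have "\<dots> = s * ((real M + 2) * ?S (M + 2)) + s * ((real M + 2 * l) * (Qx * Qy) * (\<Sum>k\<le>M+2. b M k * A M k * B M k * V k))"
      unfolding S sum.distrib sum_distrib_left ..
    also have "(\<Sum>k\<le>M+2. b M k * A M k * B M k * V k) = ?S M"
      unfolding S by (simp add: clifford_zeros)
    finally have "s * (2 * s * (x * y + z) * ?S (M + 1)) =
       s * ((real M + 2) * ?S (M + 2) + (real M + 2 * l) * (Qx * Qy) * ?S M)" by (simp only: distrib_left)
    then have "2 * s * (x * y + z) * ?S (M + 1) = (real M + 2) * ?S (M + 2) + (real M + 2 * l) * (Qx * Qy) * ?S M"
      using s by simp
    moreover have "?P (M + 1) = ?S (M + 1)" "?P M = ?S M" by (rule less.IH; simp add: 3)+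
    ultimately have "(real M + 2) * ?P (M + 2) = (real M + 2) * ?S (M + 2)"
      using solid_geg_rec[of M l "x * y + z" "(x\<^sup>2 + q) * (y\<^sup>2 + r)"]
      unfolding s_def Qx_def Qy_def by (simp add: algebra_simps)
    then have "?P (M + 2) = ?S (M + 2)" by (subst (asm) mult_left_cancel) simp_all
    then show ?thesis unfolding 3 .
  qed
qed

definition addition_weight :: "real \<Rightarrow> nat \<Rightarrow> nat \<Rightarrow> real" where
  "addition_weight l m k = pi * 2 powr (1 - 2 * real k - 2 * l) * Gamma (real m + real k + 2 * l) /
     ((real m + l) * fact (m - k) * (Gamma (real k + l))\<^sup>2)"

text \<open>The reciprocal of the surface area of the unit sphere in dimension
  \<open>2 * l + 2\<close>, that is, the square of the normalised constant harmonic.\<close>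

definition zonal_norm :: "real \<Rightarrow> real" where
  "zonal_norm l = Gamma (l + 1) / (2 * pi powr (l + 1))"

text \<open>Legendre's duplication formula turns the Pochhammer symbols in \<open>2 * l\<close> into
  the Gamma factors of \<open>sph_L\<close>. Thus, up to the areas of the two spheres involved, the
  coefficients of the addition theorem are the inverse squared norms of one level of the
  chain.\<close>

lemma addition_weight_coeff:
  assumes l: "l > 0" and k: "k \<le> m"
  shows "zonal_norm l * ((real m + l) / l) * addition_coeff l m k = zonal_norm (l - 1 / 2) / addition_weight l m k"
proof -
  have np: "x \<notin> \<int>\<^sub>\<le>\<^sub>0" if "x > 0" for x :: real using that by (auto elim!: nonpos_Ints_cases)
  have G: "Gamma x > 0" if "x > 0" for x :: real using that by (rule Gamma_real_pos)
  have 1: "pochhammer l k = Gamma (real k + l) / Gamma l"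
    using pochhammer_Gamma[OF np[OF l], of k] by (simp add: add.commute)
  have 2: "pochhammer (2 * l) (m + k) = Gamma (real m + real k + 2 * l) / Gamma (2 * l)"
    using pochhammer_Gamma[OF np[of "2 * l"], of "m + k"] l by (simp add: add_ac)
  have 3: "Gamma (l + 1) = l * Gamma l" using Gamma_plus1[OF np[OF l]] .
  have 4: "Gamma l * Gamma (l + 1 / 2) = 2 powr (1 - 2 * l) * sqrt pi * Gamma (2 * l)"
  proof -
    have "complex_of_real l \<notin> \<int>\<^sub>\<le>\<^sub>0" "complex_of_real l + 1 / 2 \<notin> \<int>\<^sub>\<le>\<^sub>0"
      using np[OF l] np[of "l + 1 / 2"] l of_real_in_nonpos_Ints_iff[where 'a = complex, of l]
        of_real_in_nonpos_Ints_iff[where 'a = complex, of "l + 1 / 2"] by auto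
    from Gamma_legendre_duplication[OF this]
    have "Gamma (complex_of_real l) * Gamma (complex_of_real (l + 1 / 2)) =
      complex_of_real (exp ((1 - 2 * l) * ln 2)) * complex_of_real (sqrt pi) * Gamma (complex_of_real (2 * l))"
      by (simp flip: exp_of_real)
    then have "complex_of_real (Gamma l * Gamma (l + 1 / 2)) = complex_of_real (exp ((1 - 2 * l) * ln 2) * sqrt pi * Gamma (2 * l))"
      by (simp only: of_real_mult Gamma_complex_of_real[symmetric])
    then show ?thesis unfolding of_real_eq_iff by (simp add: powr_def)
  qed
  have 5: "pi powr (l + 1) = pi powr (l + 1 / 2) * sqrt pi"
    by (simp add: powr_half_sqrt[symmetric] powr_add[symmetric] add.commute)
  have 6: "2 powr (1 - 2 * real k - 2 * l) * 4 ^ k = 2 powr (1 - 2 * l)"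
  proof -
    have "(4::real) ^ k = 2 powr (2 * real k)"
      by (metis mult_2 numeral_Bit0 numeral_powr_numeral_real powr_powr powr_realpow powr_numeral zero_less_numeral power2_eq_square numeral_times_numeral num_double)
    then show ?thesis by (simp add: powr_add[symmetric])
  qed
  define a where "a = Gamma l"
  define b where "b = Gamma (l + 1 / 2)"
  define c where "c = Gamma (2 * l)"
  define g where "g = Gamma (real k + l)"
  define h where "h = Gamma (real m + real k + 2 * l)"
  define p where "p = (2::real) powr (1 - 2 * real k - 2 * l)"
  define w where "w = pi powr (l + 1 / 2)"
  define s where "s = sqrt pi"
  define F where "F = (fact (m - k) :: real)"
  have pos: "a > 0" "b > 0" "c > 0" "g > 0" "h > 0" "p > 0" "w > 0" "s > 0" "F > 0" "real m + l > 0"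
    using l by (auto simp: a_def b_def c_def g_def h_def p_def w_def s_def F_def intro!: G)
  have s2: "pi = s * s" by (simp add: s_def)
  have ab: "a * b = p * 4 ^ k * s * c" using 4 6 by (simp add: a_def b_def c_def p_def s_def mult_ac)
  have "zonal_norm l * ((real m + l) / l) * addition_coeff l m k =
     a * (real m + l) * 4 ^ k * F * g\<^sup>2 * c / (2 * w * s * a\<^sup>2 * h)"
    using l k pos unfolding zonal_norm_def addition_coeff_def 3 5 1 2 a_def[symmetric] c_def[symmetric]
      g_def[symmetric] h_def[symmetric] w_def[symmetric] s_def[symmetric] F_def[symmetric]
    by (simp add: field_simps power2_eq_square)
  also have "\<dots> = b * (real m + l) * F * g\<^sup>2 / (2 * w * (s * s) * p * h)"
    using pos ab by (simp add: divide_simps power2_eq_square) (simp add: algebra_simps)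
  also have "\<dots> = zonal_norm (l - 1 / 2) / addition_weight l m k"
  proof -
    have e: "l - 1 / 2 + 1 = l + 1 / 2" by simp
    have n: "zonal_norm (l - 1 / 2) = b / (2 * w)" unfolding zonal_norm_def e b_def w_def ..
    have w: "addition_weight l m k = s * s * p * h / ((real m + l) * F * g\<^sup>2)"
      unfolding addition_weight_def g_def[symmetric] h_def[symmetric] p_def[symmetric] F_def[symmetric]
      using s2 by simp
    show ?thesis unfolding n w using pos by (simp add: field_simps)
  qed
  finally show ?thesis .
qed

text \<open>The inductive step in the dimension: one coordinate of each point is split off, and the
  kernel of the sphere of one dimension less appears, with \<open>l\<close> lowered by a half. The
  bound on \<open>l\<close> lets the descent end at \<open>l = 0\<close>, the circle.\<close>

lemma zonal_addition:
  assumes l: "l \<ge> 1 / 2"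
  shows "zonal_norm l * zonal l m (x * y + z) ((x\<^sup>2 + q) * (y\<^sup>2 + r)) =
    (\<Sum>k\<le>m. assoc_geg l m k x (x\<^sup>2 + q) * assoc_geg l m k y (y\<^sup>2 + r) / addition_weight l m k
        * (zonal_norm (l - 1 / 2) * zonal (l - 1 / 2) k z (q * r)))"
proof -
  have l0: "l > 0" using l by simp
  have "zonal l m (x * y + z) ((x\<^sup>2 + q) * (y\<^sup>2 + r)) = (real m + l) / l * solid_geg l m (x * y + z) ((x\<^sup>2 + q) * (y\<^sup>2 + r))"
    using zonal_solid_geg[of l m] l0 by (simp add: field_simps)
  then have "zonal_norm l * zonal l m (x * y + z) ((x\<^sup>2 + q) * (y\<^sup>2 + r)) =
     (\<Sum>k\<le>m. (zonal_norm l * ((real m + l) / l) * addition_coeff l m k) *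
        (assoc_geg l m k x (x\<^sup>2 + q) * assoc_geg l m k y (y\<^sup>2 + r) * zonal (l - 1 / 2) k z (q * r)))"
    unfolding solid_geg_addition[OF l] by (simp add: sum_distrib_left mult_ac)
  also have "\<dots> = (\<Sum>k\<le>m. zonal_norm (l - 1 / 2) / addition_weight l m k *
        (assoc_geg l m k x (x\<^sup>2 + q) * assoc_geg l m k y (y\<^sup>2 + r) * zonal (l - 1 / 2) k z (q * r)))"
    by (intro sum.cong refl, subst addition_weight_coeff[OF l0]) simp_all
  finally show ?thesis by (simp add: mult_ac)
qed

text \<open>On the circle these are Chebyshev polynomials: \<open>u\<close> is a root of
  \<open>X^2 - 2 * Re u * X + (cmod u)^2\<close>, and this quadratic relation for the powers of
  \<open>u\<close> is the recurrence of the zonal polynomials.\<close>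

lemma zonal_0_Re:
  "zonal 0 m (Re u) ((cmod u)\<^sup>2) = (if m = 0 then 1 else 2) * Re (u ^ m)"
proof (induction m rule: less_induct)
  case (less m)
  have "m = 0 \<or> m = 1 \<or> (\<exists>M. m = M + 2)" by presburger
  then consider "m = 0" | "m = 1" | M where "m = M + 2" by blast
  then show ?case
  proof cases
    case 3
    have sq: "u * u = of_real (2 * Re u) * u - of_real ((cmod u)\<^sup>2)"
      by (simp add: complex_eq_iff cmod_power2) (simp add: power2_eq_square algebra_simps)
    have "u ^ (M + 2) = u ^ M * (u * u)" by (simp add: mult_ac)
    also have "\<dots> = of_real (2 * Re u) * u ^ (M + 1) - of_real ((cmod u)\<^sup>2) * u ^ M"
      unfolding sq by (simp add: algebra_simps)
    finally have "Re (u ^ (M + 2)) = 2 * Re u * Re (u ^ (M + 1)) - (cmod u)\<^sup>2 * Re (u ^ M)" by simp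
    moreover have "zonal 0 (M + 2) (Re u) ((cmod u)\<^sup>2) =
      2 * Re u * zonal 0 (M + 1) (Re u) ((cmod u)\<^sup>2) - (if M = 0 then 2 else 1) * (cmod u)\<^sup>2 * zonal 0 M (Re u) ((cmod u)\<^sup>2)"
      using zonal_mult[of 0 "Re u" "M + 1" "(cmod u)\<^sup>2"]
      by (cases "M = 0") (simp_all add: zonal_up_def zonal_down_def)
    moreover have "zonal 0 (M + 1) (Re u) ((cmod u)\<^sup>2) = (if M + 1 = 0 then 1 else 2) * Re (u ^ (M + 1))"
      "zonal 0 M (Re u) ((cmod u)\<^sup>2) = (if M = 0 then 1 else 2) * Re (u ^ M)"
      by (rule less.IH; simp add: 3)+
    ultimately show ?thesis unfolding 3
      by (cases "M = 0") (simp_all del: power_Suc add: algebra_simps)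
  qed (simp_all add: zonal_def)
qed

section \<open>Enumeration of the symbols of one degree\<close>

definition desc_chains :: "nat \<Rightarrow> nat \<Rightarrow> nat list set" where
  "desc_chains n m = {ms. length ms = n \<and> ms ! 0 = m \<and> sorted_wrt (\<ge>) ms}"

lemma desc_chains_1: "desc_chains (Suc 0) m = {[m]}"
  by (auto simp: desc_chains_def length_Suc_conv)

lemma desc_chains_Suc: "desc_chains (Suc (Suc n)) m = (\<Union>k\<in>{..m}. (#) m ` desc_chains (Suc n) k)"
proof (intro equalityI subsetI)
  fix ms assume ms: "ms \<in> desc_chains (Suc (Suc n)) m"
  then obtain k ks where k: "ms = m # k # ks" "length ks = n" by (auto simp: desc_chains_def length_Suc_conv)
  then have "k \<le> m" "k # ks \<in> desc_chains (Suc n) k"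
    using ms by (auto simp: desc_chains_def)
  then show "ms \<in> (\<Union>k\<in>{..m}. (#) m ` desc_chains (Suc n) k)"
    using k by auto
next
  fix ms assume "ms \<in> (\<Union>k\<in>{..m}. (#) m ` desc_chains (Suc n) k)"
  then show "ms \<in> desc_chains (Suc (Suc n)) m"
    by (auto simp: desc_chains_def length_Suc_conv) (meson order_trans)
qed

lemma finite_desc_chains: "finite (desc_chains (Suc n) m)"
  by (induction n arbitrary: m) (auto simp: desc_chains_1 desc_chains_Suc)

text \<open>A sum over chains is an iterated sum over their entries. The offset \<open>j\<close>
  lets the weight depend on the level, so that an induction can consume the head of the
  list.\<close>

lemma sum_chains_Suc:
  "(\<Sum>ms\<in>desc_chains (Suc (Suc n)) m. (\<Prod>i<Suc n. w (j + i) (ms ! i) (ms ! Suc i)) * t (ms ! Suc n)) =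
   (\<Sum>k\<le>m. w j m k * (\<Sum>ms\<in>desc_chains (Suc n) k. (\<Prod>i<n. w (Suc j + i) (ms ! i) (ms ! Suc i)) * t (ms ! n)))"
  for w :: "nat \<Rightarrow> nat \<Rightarrow> nat \<Rightarrow> 'a::comm_semiring_1"
proof -
  have "(\<Sum>ms\<in>desc_chains (Suc (Suc n)) m. (\<Prod>i<Suc n. w (j + i) (ms ! i) (ms ! Suc i)) * t (ms ! Suc n))
    = (\<Sum>k\<le>m. \<Sum>ms\<in>(#) m ` desc_chains (Suc n) k. (\<Prod>i<Suc n. w (j + i) (ms ! i) (ms ! Suc i)) * t (ms ! Suc n))"
    unfolding desc_chains_Suc
    apply (rule sum.UNION_disjoint)
    subgoal by simp
    subgoal by (simp add: finite_desc_chains)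
    subgoal by (auto simp: desc_chains_def)
    done
  also have "\<dots> = (\<Sum>k\<le>m. \<Sum>ms\<in>desc_chains (Suc n) k. w j m k * ((\<Prod>i<n. w (Suc j + i) (ms ! i) (ms ! Suc i)) * t (ms ! n)))"
  proof (rule sum.cong[OF refl])
    fix k
    have "(\<Sum>ms\<in>(#) m ` desc_chains (Suc n) k. (\<Prod>i<Suc n. w (j + i) (ms ! i) (ms ! Suc i)) * t (ms ! Suc n))
      = (\<Sum>ms\<in>desc_chains (Suc n) k. (\<Prod>i<Suc n. w (j + i) ((m # ms) ! i) ((m # ms) ! Suc i)) * t ((m # ms) ! Suc n))"
      by (subst sum.reindex) (auto intro: inj_onI)
    also have "\<dots> = (\<Sum>ms\<in>desc_chains (Suc n) k. w j m k * ((\<Prod>i<n. w (Suc j + i) (ms ! i) (ms ! Suc i)) * t (ms ! n)))"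
      by (intro sum.cong refl, subst prod.lessThan_Suc_shift) (auto simp: desc_chains_def mult.assoc)
    finally show "(\<Sum>ms\<in>(#) m ` desc_chains (Suc n) k. (\<Prod>i<Suc n. w (j + i) (ms ! i) (ms ! Suc i)) * t (ms ! Suc n)) = \<dots>" .
  qed
  finally show ?thesis by (simp add: sum_distrib_left)
qed

text \<open>In a strict linear order the number of predecessors is strictly increasing, hence
  injective; its values lie in a set of the same cardinality.\<close>

lemma rank_bij_betw:
  assumes fin: "finite S" and tr: "trans r" and irr: "irrefl r"
    and tot: "\<And>x y. x \<in> S \<Longrightarrow> y \<in> S \<Longrightarrow> x \<noteq> y \<Longrightarrow> (x, y) \<in> r \<or> (y, x) \<in> r"
  shows "bij_betw (\<lambda>t. card {t' \<in> S. (t', t) \<in> r} + 1) S {1..card S}"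
proof -
  let ?f = "\<lambda>t. card {t' \<in> S. (t', t) \<in> r} + 1"
  have mono: "?f x < ?f y" if "x \<in> S" "y \<in> S" "(x, y) \<in> r" for x y
  proof -
    have "{t' \<in> S. (t', x) \<in> r} \<subset> {t' \<in> S. (t', y) \<in> r}"
      using that tr irr by (auto dest: transD simp: irrefl_def)
    then show ?thesis using psubset_card_mono[of "{t' \<in> S. (t', y) \<in> r}"] fin by simp
  qed
  have inj: "inj_on ?f S"
  proof (rule inj_onI, rule ccontr)
    fix x y assume "x \<in> S" "y \<in> S" "?f x = ?f y" "x \<noteq> y"
    then show False using tot[of x y] mono[of x y] mono[of y x] by auto
  qed
  have "?f ` S \<subseteq> {1..card S}"
  proof safe
    fix x assume x: "x \<in> S"
    have "{t' \<in> S. (t', x) \<in> r} \<subset> S" using x irr by (auto simp: irrefl_def)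
    then have "card {t' \<in> S. (t', x) \<in> r} < card S" using psubset_card_mono[OF fin] by blast
    then show "?f x \<in> {1..card S}" by auto
  qed
  moreover have "card (?f ` S) = card {1..card S}" using inj by (simp add: card_image)
  ultimately have "?f ` S = {1..card S}" by (intro card_subset_eq) auto
  with inj show ?thesis by (simp add: bij_betw_def)
qed

lemma sph_symbols_chains:
  assumes "N \<ge> 2"
  shows "sph_symbols N m = (SIGMA ms:desc_chains (N - 1) m. if ms ! (N - 2) = 0 then {Plus} else {Plus, Minus})"
proof -
  have "s = Plus \<or> s = Minus" for s by (cases s) auto
  then show ?thesis by (auto simp: sph_symbols_def desc_chains_def split: if_splits)
qed

lemma symbol_number_bij:
  assumes "N \<ge> 2"
  shows "bij_betw (symbol_number N m) (sph_symbols N m) {1..card (sph_symbols N m)}"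
proof -
  obtain n where n: "N - 1 = Suc n" using assms by (metis Suc_diff_1 Suc_diff_Suc Suc_1 lessI less_le_trans zero_less_Suc diff_Suc_1)
  have fin: "finite (sph_symbols N m)"
    unfolding sph_symbols_chains[OF assms] n by (intro finite_SigmaI finite_desc_chains) auto
  let ?r = "lexord less_than <*lex*> {(Plus, Minus)}"
  have t1: "trans (lexord less_than)" by (rule lexord_transI) (rule trans_less_than)
  have "trans ?r" using t1 by (intro trans_lex_prod) (auto simp: trans_def)
  moreover have "irrefl ?r"
    using lexord_irreflexive[of less_than] by (auto simp: irrefl_def)
  moreover have "(x, y) \<in> ?r \<or> (y, x) \<in> ?r" if "x \<noteq> y" for x y
  proof -
    obtain a s b s' where xy: "x = (a, s)" "y = (b, s')" by (metis surj_pair)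
    have "(a, b) \<in> lexord less_than \<or> a = b \<or> (b, a) \<in> lexord less_than"
      by (rule lexord_linear) auto
    then show ?thesis using that xy by (cases s; cases s') auto
  qed
  ultimately show ?thesis unfolding symbol_number_def[abs_def] using fin by (intro rank_bij_betw) auto
qed

text \<open>A chain counts with the number of signs that its last entry admits, and the counts obey
  a rule of Pascal's type in length and degree. The closed form is proved with all factorials
  multiplied out, so the exact division in \<open>sph_dim\<close> is performed only at the
  end.\<close>

lemma card_symbols:
  assumes "N \<ge> 2"
  shows "card (sph_symbols N m) = sph_dim m N"
proof -
  define t where "t k = (if k = 0 then 1 else 2 :: nat)" for k :: nat
  define c where "c n m = (\<Sum>ms\<in>desc_chains (Suc n) m. t (ms ! n))" for n m
  have c0: "c 0 m = t m" for m by (simp add: c_def desc_chains_1)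
  have cS: "c (Suc n) m = (\<Sum>k\<le>m. c n k)" for n m
    using sum_chains_Suc[where w = "\<lambda>_ _ _. 1" and j = 0 and t = t and n = n and m = m] by (simp add: c_def)
  have c1: "c (Suc 0) m = 2 * m + 1" for m
    unfolding cS c0 by (induction m) (simp_all add: t_def)
  have main: "fact (Suc n) * fact m * c (Suc n) m = (2 * m + n + 1) * fact (m + n)" for n m
  proof (induction n arbitrary: m)
    case 0
    then show ?case by (simp add: c1)
  next
    case (Suc n)
    note IHn = Suc.IH
    show ?case
    proof (induction m)
      case 0
      have "c (Suc (Suc n)) 0 = 1"
      proof -
        have "c k 0 = 1" for k by (induction k) (simp_all add: c0 t_def cS)
        then show ?thesis .
      qed
      then show ?case by simp
    next
      case (Suc m)
      have "c (Suc (Suc n)) (Suc m) = c (Suc (Suc n)) m + c (Suc n) (Suc m)"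
        unfolding cS[of "Suc n"] by simp
      then have "fact (Suc (Suc n)) * fact (Suc m) * c (Suc (Suc n)) (Suc m) =
        Suc m * (fact (Suc (Suc n)) * fact m * c (Suc (Suc n)) m)
        + Suc (Suc n) * (fact (Suc n) * fact (Suc m) * c (Suc n) (Suc m))"
        by (simp only: fact_Suc of_nat_id) (simp only: algebra_simps)
      also have "\<dots> = Suc m * ((2 * m + Suc n + 1) * fact (m + Suc n))
        + Suc (Suc n) * ((2 * Suc m + n + 1) * fact (Suc m + n))"
        unfolding Suc.IH IHn ..
      also have "\<dots> = (2 * Suc m + Suc n + 1) * fact (Suc m + Suc n)"
        by (simp add: fact_Suc algebra_simps)
      finally show ?case .
    qed
  qed
  obtain n where n: "N = n + 2" using assms by (metis add.commute le_Suc_ex)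
  have nn: "N - 1 = Suc n" "N - 2 = n" using n by auto
  have "card (sph_symbols N m) = (\<Sum>ms\<in>desc_chains (Suc n) m. card (if ms ! n = 0 then {Plus} else {Plus, Minus}))"
    unfolding sph_symbols_chains[OF assms] nn
    by (subst card_SigmaI) (auto simp: finite_desc_chains)
  also have "\<dots> = c n m" unfolding c_def t_def by (intro sum.cong) auto
  also have "c n m = sph_dim m N"
  proof (cases n)
    case 0
    have "(m + m) * fact (m - 1) div fact m = 2" if "m > 0"
    proof -
      have "fact m = m * (fact (m - 1) :: nat)" using that by (simp add: fact_reduce)
      then have "(m + m) * fact (m - 1) = 2 * (fact m :: nat)" by simp
      then show ?thesis by simp
    qed
    then show ?thesis using n 0 by (simp add: sph_dim_def c0 t_def mult_2)
  next
    case (Suc k)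
    have "(2 * m + N - 2) * fact (m + N - 3) = (fact (N - 2) * fact m) * c n m"
      using main[of k m] n Suc by (simp add: numeral_3_eq_3)
    then show ?thesis using n Suc by (simp add: sph_dim_def)
  qed
  finally show ?thesis .
qed

definition symbol_harmonic :: "nat \<Rightarrow> nat list \<times> sign \<Rightarrow> (nat \<Rightarrow> real) \<Rightarrow> real" where
  "symbol_harmonic N t x = (case t of (ms, s) \<Rightarrow>
        if ms ! (N - 2) = 0 then Re (sph_Y N ms Plus x) / sqrt (sph_L N ms)
        else (case s of
                Plus \<Rightarrow> sqrt 2 * Re (sph_Y N ms Plus x) / sqrt (sph_L N ms)
              | Minus \<Rightarrow> - sqrt 2 * Im (sph_Y N ms Minus x) / sqrt (sph_L N ms)))"

text \<open>The sum over \<open>l\<close> is reindexed along the bijection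
  \<open>symbol_number\<close>, whose injectivity also resolves the definite description in
  \<open>sph_harmonic\<close>.\<close>

lemma sum_sph_harmonic_symbols:
  assumes "N \<ge> 2"
  shows "(\<Sum>l = 1..sph_dim m N. sph_harmonic N m l x * sph_harmonic N m l y) =
    (\<Sum>t\<in>sph_symbols N m. symbol_harmonic N t x * symbol_harmonic N t y)"
proof -
  note bij = symbol_number_bij[OF assms, of m, unfolded card_symbols[OF assms]]
  have *: "sph_harmonic N m (symbol_number N m t) z = symbol_harmonic N t z" if "t \<in> sph_symbols N m" for t z
  proof -
    have "(THE t'. t' \<in> sph_symbols N m \<and> symbol_number N m t' = symbol_number N m t) = t"
      using that bij by (intro the_equality) (auto simp: bij_betw_def inj_on_def)
    then show ?thesis using assms by (simp add: sph_harmonic_def symbol_harmonic_def)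
  qed
  show ?thesis
    by (subst sum.reindex_bij_betw[OF bij, symmetric]) (intro sum.cong refl, simp add: *)
qed

section \<open>The reproducing kernel of the harmonics of one degree\<close>

lemma sph_r_sq: "(sph_r N k x)\<^sup>2 = (\<Sum>i = k + 1..N. (x i)\<^sup>2)"
  unfolding sph_r_def by (simp add: sum_nonneg)

lemma sph_r_step: "k < N \<Longrightarrow> (sph_r N k x)\<^sup>2 = (x (k + 1))\<^sup>2 + (sph_r N (k + 1) x)\<^sup>2"
  unfolding sph_r_sq by (simp add: sum.atLeast_Suc_atMost)

lemma sph_r_eq_0: "sph_r N k x = 0 \<Longrightarrow> k < N \<Longrightarrow> x (k + 1) = 0"
  using sph_r_step[of k N x] by (simp add: add_nonneg_eq_0_iff)

lemma sph_r_last: "N \<ge> 2 \<Longrightarrow> sph_r N (N - 2) x = cmod (Complex (x (N - 1)) (x N))"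
proof -
  assume "N \<ge> 2"
  then obtain n where "N = n + 2" by (metis add.commute le_Suc_ex)
  then show ?thesis by (simp add: sph_r_def cmod_def)
qed

text \<open>At \<open>r = 0\<close> the convention \<open>x / 0 = 0\<close> is harmless because
  \<open>x = 0\<close> as well: both sides are 1 for \<open>j = 0\<close> and 0 otherwise.\<close>

lemma radial_gegenbauer:
  assumes "r = 0 \<Longrightarrow> x = 0"
  shows "r ^ j * gegenbauer a j (x / r) = solid_geg a j x (r\<^sup>2)"
proof -
  have "r * (x / r) = x" using assms by auto
  then show ?thesis using solid_geg_scale[of a j r "x / r" 1] by (simp add: gegenbauer_eq_solid)
qed

definition sph_radial :: "nat \<Rightarrow> nat list \<Rightarrow> (nat \<Rightarrow> real) \<Rightarrow> real" where
  "sph_radial N ms x = (\<Prod>k<N - 2. assoc_geg ((real N - real k - 2) / 2) (ms ! k) (ms ! Suc k) (x (k + 1)) ((sph_r N k x)\<^sup>2))"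

lemma sph_H_radial:
  assumes N: "N \<ge> 2" and ms: "ms \<in> desc_chains (N - 1) m"
  shows "sph_H N ms Plus x = Complex (x (N - 1)) (x N) ^ (ms ! (N - 2)) * of_real (sph_radial N ms x)"
    and "sph_H N ms Minus x = cnj (Complex (x (N - 1)) (x N)) ^ (ms ! (N - 2)) * of_real (sph_radial N ms x)"
proof -
  let ?z = "Complex (x (N - 1)) (x N)"
  have r: "(\<Prod>k<N - 2. sph_r N k x ^ (ms ! k - ms ! (k + 1)) *
          gegenbauer (real (ms ! (k + 1)) + (real N - real k - 2) / 2) (ms ! k - ms ! (k + 1))
            (x (k + 1) / sph_r N k x)) = sph_radial N ms x"
    unfolding sph_radial_def
  proof (intro prod.cong refl)
    fix k assume k: "k \<in> {..<N - 2}"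
    then have "ms ! Suc k \<le> ms ! k" using ms
      by (intro sorted_wrt_nth_less[of "(\<ge>)" ms]) (auto simp: desc_chains_def)
    then show "sph_r N k x ^ (ms ! k - ms ! (k + 1)) *
          gegenbauer (real (ms ! (k + 1)) + (real N - real k - 2) / 2) (ms ! k - ms ! (k + 1))
            (x (k + 1) / sph_r N k x) =
       assoc_geg ((real N - real k - 2) / 2) (ms ! k) (ms ! Suc k) (x (k + 1)) ((sph_r N k x)\<^sup>2)"
      using k sph_r_eq_0[of N k x] by (subst radial_gegenbauer) (auto simp: assoc_geg_def add.commute)
  qed
  have z: "sph_r N (N - 2) x = cmod ?z" by (rule sph_r_last[OF N])
  have p: "(?z / of_real (cmod ?z)) ^ b * of_real (cmod ?z ^ b) = ?z ^ b" for b
    by (simp add: power_divide flip: of_real_power)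
  have q: "(?z / of_real (cmod ?z)) powi (- int b) * of_real (cmod ?z ^ b) = cnj ?z ^ b" for b
  proof (cases "?z = 0")
    case False
    have "inverse (?z / of_real (cmod ?z)) * of_real (cmod ?z) = cnj ?z"
      using False complex_norm_square[of ?z] by (simp add: field_simps power2_eq_square)
    then have "(inverse (?z / of_real (cmod ?z)) * of_real (cmod ?z)) ^ b = cnj ?z ^ b" by simp
    moreover have "(?z / of_real (cmod ?z)) powi (- int b) * of_real (cmod ?z ^ b) =
      (inverse (?z / of_real (cmod ?z)) * of_real (cmod ?z)) ^ b"
      by (simp only: power_int_minus power_int_of_nat power_mult_distrib power_inverse of_real_power)
    ultimately show ?thesis by simp
  next
    \<comment> \<open>At the origin of the last coordinate plane the conventions decide: exponent 0
      gives 1 on both sides, a positive exponent gives 0.\<close>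
    case True
    then show ?thesis by (cases b) (simp_all add: power_int_minus)
  qed
  show "sph_H N ms Plus x = ?z ^ (ms ! (N - 2)) * of_real (sph_radial N ms x)"
    unfolding sph_H_def r z using p[of "ms ! (N - 2)"] by (simp del: of_real_power flip: mult.assoc)
  show "sph_H N ms Minus x = cnj ?z ^ (ms ! (N - 2)) * of_real (sph_radial N ms x)"
    unfolding sph_H_def r z using q[of "ms ! (N - 2)"] by (simp del: of_real_power flip: mult.assoc)
qed

lemma addition_weight_pos: "l > 0 \<Longrightarrow> addition_weight l m k > 0"
  unfolding addition_weight_def by (intro divide_pos_pos mult_pos_pos zero_less_power Gamma_real_pos) auto

lemma sph_L_weight:
  assumes N: "N \<ge> 2"
  shows "sph_L N ms = 2 * pi * (\<Prod>k<N - 2. addition_weight ((real N - real k - 2) / 2) (ms ! k) (ms ! Suc k))"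
proof -
  have "(\<Prod>k = 1..N - 2.
       pi * 2 powi (int k - 2 * int (ms ! k) - int N + 2) *
         Gamma (real (ms ! (k - 1)) + real (ms ! k) + real N - 1 - real k) /
       ((real (ms ! (k - 1)) + (real N - 1 - real k) / 2) * fact (ms ! (k - 1) - ms ! k) *
         (Gamma (real (ms ! k) + (real N - 1 - real k) / 2))\<^sup>2))
    = (\<Prod>k<N - 2. addition_weight ((real N - real k - 2) / 2) (ms ! k) (ms ! Suc k))"
  proof (rule prod.reindex_cong[of Suc])
    show "{1..N - 2} = Suc ` {..<N - 2}" by (simp add: image_Suc_lessThan)
    fix k assume "k \<in> {..<N - 2}"
    have "(2::real) powi (int (Suc k) - 2 * int (ms ! Suc k) - int N + 2) =
       2 powr (1 - 2 * real (ms ! Suc k) - 2 * ((real N - real k - 2) / 2))"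
    proof -
      have "(2::real) powi n = 2 powr real_of_int n" for n by (subst powr_real_of_int') auto
      moreover have "real_of_int (int (Suc k) - 2 * int (ms ! Suc k) - int N + 2) = 1 - 2 * real (ms ! Suc k) - 2 * ((real N - real k - 2) / 2)"
        by (simp add: field_simps)
      ultimately show ?thesis by (simp only:)
    qed
    note pw = this
    define l where "l = (real N - real k - 2) / 2"
    have e: "real (ms ! (Suc k - 1)) + real (ms ! Suc k) + real N - 1 - real (Suc k) = real (ms ! k) + real (ms ! Suc k) + 2 * l"
      "(real N - 1 - real (Suc k)) / 2 = l"
      by (simp_all add: l_def field_simps)
    show "pi * 2 powi (int (Suc k) - 2 * int (ms ! (Suc k)) - int N + 2) *
         Gamma (real (ms ! (Suc k - 1)) + real (ms ! (Suc k)) + real N - 1 - real (Suc k)) /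
       ((real (ms ! (Suc k - 1)) + (real N - 1 - real (Suc k)) / 2) * fact (ms ! (Suc k - 1) - ms ! (Suc k)) *
         (Gamma (real (ms ! (Suc k)) + (real N - 1 - real (Suc k)) / 2))\<^sup>2) =
      addition_weight ((real N - real k - 2) / 2) (ms ! k) (ms ! Suc k)"
      unfolding addition_weight_def pw e l_def[symmetric] by simp
  qed simp
  then show ?thesis unfolding sph_L_def by simp
qed

text \<open>Induction from the last two coordinates outwards: a chain with \<open>n\<close>
  transitions accounts for the last \<open>n + 2\<close> coordinates. The circle is the base, and
  every further coordinate is one use of \<open>zonal_addition\<close>.\<close>

lemma sum_chains_zonal:
  fixes x y :: "nat \<Rightarrow> real"
  assumes N: "N \<ge> 2" and n: "n \<le> N - 2"
  defines "w \<equiv> \<lambda>k a b. assoc_geg ((real N - real k - 2) / 2) a b (x (k + 1)) ((sph_r N k x)\<^sup>2)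
      * assoc_geg ((real N - real k - 2) / 2) a b (y (k + 1)) ((sph_r N k y)\<^sup>2)
      / addition_weight ((real N - real k - 2) / 2) a b"
    and "t \<equiv> \<lambda>b. (if b = 0 then 1 else 2) * Re ((Complex (x (N - 1)) (x N) * cnj (Complex (y (N - 1)) (y N))) ^ b) / (2 * pi)"
  shows "(\<Sum>ms\<in>desc_chains (Suc n) m. (\<Prod>i<n. w (N - 2 - n + i) (ms ! i) (ms ! Suc i)) * t (ms ! n)) =
    zonal_norm (real n / 2) * zonal (real n / 2) m (\<Sum>i = N - 2 - n + 1..N. x i * y i)
      ((sph_r N (N - 2 - n) x)\<^sup>2 * (sph_r N (N - 2 - n) y)\<^sup>2)"
  using n
proof (induction n arbitrary: m)
  case 0
  let ?u = "Complex (x (N - 1)) (x N) * cnj (Complex (y (N - 1)) (y N))"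
  obtain k where k: "N = k + 2" using N by (metis add.commute le_Suc_ex)
  have "(\<Sum>i = N - 2 + 1..N. x i * y i) = Re ?u" using k by simp
  moreover have "(sph_r N (N - 2) x)\<^sup>2 * (sph_r N (N - 2) y)\<^sup>2 = (cmod ?u)\<^sup>2"
    unfolding sph_r_last[OF N] norm_mult complex_mod_cnj power_mult_distrib ..
  ultimately show ?case
    using zonal_0_Re[of m ?u] by (simp add: desc_chains_1 t_def zonal_norm_def)
next
  case (Suc n)
  define j where "j = N - 2 - Suc n"
  have j: "N - 2 - n = Suc j" "j < N" "real N - real j - 2 = real (Suc n)"
    using Suc.prems N by (auto simp: j_def of_nat_diff)
  have "(\<Sum>ms\<in>desc_chains (Suc (Suc n)) m. (\<Prod>i<Suc n. w (j + i) (ms ! i) (ms ! Suc i)) * t (ms ! Suc n)) =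
     (\<Sum>k\<le>m. w j m k * (zonal_norm (real n / 2) * zonal (real n / 2) k (\<Sum>i = Suc j + 1..N. x i * y i)
      ((sph_r N (Suc j) x)\<^sup>2 * (sph_r N (Suc j) y)\<^sup>2)))"
    unfolding sum_chains_Suc using Suc.IH Suc.prems unfolding j(1) by simp
  also have "\<dots> = zonal_norm (real (Suc n) / 2) * zonal (real (Suc n) / 2) m
     (x (j + 1) * y (j + 1) + (\<Sum>i = Suc j + 1..N. x i * y i))
     (((x (j + 1))\<^sup>2 + (sph_r N (Suc j) x)\<^sup>2) * ((y (j + 1))\<^sup>2 + (sph_r N (Suc j) y)\<^sup>2))"
  proof -
    have "1 / 2 \<le> real (Suc n) / 2" "real (Suc n) / 2 - 1 / 2 = real n / 2" by (auto simp: field_simps)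
    then show ?thesis
      by (subst zonal_addition) (simp_all only: w_def j sph_r_step[OF j(2)] Suc_eq_plus1)
  qed
  also have "x (j + 1) * y (j + 1) + (\<Sum>i = Suc j + 1..N. x i * y i) = (\<Sum>i = j + 1..N. x i * y i)"
    using j(2) by (simp add: sum.atLeast_Suc_atMost)
  finally show ?case unfolding j_def[symmetric] sph_r_step[OF j(2)] by simp
qed

lemma sum_sph_harmonic_ge2:
  assumes N: "N \<ge> 2" and x: "(\<Sum>i = 1..N. (x i)\<^sup>2) = 1" and y: "(\<Sum>i = 1..N. (y i)\<^sup>2) = 1"
  shows "(\<Sum>l = 1..sph_dim m N. sph_harmonic N m l x * sph_harmonic N m l y) =
    zonal_norm ((real N - 2) / 2) * zonal ((real N - 2) / 2) m (\<Sum>i = 1..N. x i * y i) 1"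
proof -
  obtain n where n: "N = n + 2" using N by (metis add.commute le_Suc_ex)
  have nn: "N - 1 = Suc n" "N - 2 = n" using n by auto
  define w where "w = (\<lambda>k a b. assoc_geg ((real N - real k - 2) / 2) a b (x (k + 1)) ((sph_r N k x)\<^sup>2)
      * assoc_geg ((real N - real k - 2) / 2) a b (y (k + 1)) ((sph_r N k y)\<^sup>2)
      / addition_weight ((real N - real k - 2) / 2) a b)"
  define t where "t = (\<lambda>b. (if b = 0 then 1 else 2) * Re ((Complex (x (N - 1)) (x N) * cnj (Complex (y (N - 1)) (y N))) ^ b) / (2 * pi))"
  have r1: "sph_r N 0 x = 1" "sph_r N 0 y = 1" using x y by (simp_all add: sph_r_def)
  have "(\<Sum>l = 1..sph_dim m N. sph_harmonic N m l x * sph_harmonic N m l y) =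
    (\<Sum>ms\<in>desc_chains (Suc n) m. \<Sum>s\<in>(if ms ! (N - 2) = 0 then {Plus} else {Plus, Minus}).
       symbol_harmonic N (ms, s) x * symbol_harmonic N (ms, s) y)"
    unfolding sum_sph_harmonic_symbols[OF N] sph_symbols_chains[OF N] nn
    by (subst sum.Sigma) (auto simp: finite_desc_chains)
  also have "\<dots> = (\<Sum>ms\<in>desc_chains (Suc n) m. (\<Prod>i<n. w (0 + i) (ms ! i) (ms ! Suc i)) * t (ms ! n))"
  proof (intro sum.cong refl)
    fix ms assume ms: "ms \<in> desc_chains (Suc n) m"
    note H = sph_H_radial[OF N, of ms m, unfolded nn, OF ms]
    define b where "b = ms ! n"
    define zx where "zx = Complex (x (N - 1)) (x N) ^ b"
    define zy where "zy = Complex (y (N - 1)) (y N) ^ b"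
    define Rx where "Rx = sph_radial N ms x"
    define Ry where "Ry = sph_radial N ms y"
    define L where "L = sph_L N ms"
    have L: "L > 0" unfolding L_def sph_L_weight[OF N]
      by (intro mult_pos_pos prod_pos addition_weight_pos) (auto simp: n)
    have Yx: "Re (sph_Y N ms Plus x) = Re zx * Rx" "Im (sph_Y N ms Minus x) = - Im zx * Rx"
      unfolding sph_Y_def r1 H b_def zx_def Rx_def nn by (simp_all flip: complex_cnj_power)
    have Yy: "Re (sph_Y N ms Plus y) = Re zy * Ry" "Im (sph_Y N ms Minus y) = - Im zy * Ry"
      unfolding sph_Y_def r1 H b_def zy_def Ry_def nn by (simp_all flip: complex_cnj_power)
    have W: "(\<Prod>i<n. w (0 + i) (ms ! i) (ms ! Suc i)) = Rx * Ry / (L / (2 * pi))"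
      unfolding w_def Rx_def Ry_def sph_radial_def L_def sph_L_weight[OF N] nn
      by (simp add: prod.distrib prod_dividef)
    have T: "t b = (if b = 0 then 1 else 2) * (Re zx * Re zy + Im zx * Im zy) / (2 * pi)"
      unfolding t_def zx_def zy_def power_mult_distrib by (simp flip: complex_cnj_power)
    have zb: "Im zx = 0" if "b = 0" using that by (simp add: zx_def)
    \<comment> \<open>The two signs give real and imaginary part of the same power, so together they
      contribute the real part of \<open>zx * cnj zy\<close>. The product of the two factors
      \<open>sqrt 2\<close> is the 2 that distinguishes positive degrees on the circle.\<close>
    have X: "(\<Sum>s\<in>(if b = 0 then {Plus} else {Plus, Minus}).
       symbol_harmonic N (ms, s) x * symbol_harmonic N (ms, s) y)
       = (if b = 0 then 1 else 2) * (Re zx * Re zy + Im zx * Im zy) * Rx * Ry / L"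
    proof -
      have r2: "sqrt 2 * (sqrt 2 * a) = 2 * a" for a by (simp flip: mult.assoc)
      show ?thesis
        unfolding symbol_harmonic_def nn prod.case b_def[symmetric] Yx Yy L_def[symmetric]
        using L by (cases "b = 0") (simp_all add: zb, simp add: field_simps r2)
    qed
    show "(\<Sum>s\<in>(if ms ! (N - 2) = 0 then {Plus} else {Plus, Minus}).
       symbol_harmonic N (ms, s) x * symbol_harmonic N (ms, s) y) =
       (\<Prod>i<n. w (0 + i) (ms ! i) (ms ! Suc i)) * t (ms ! n)"
      unfolding W nn b_def[symmetric] T X using L by simp
  qed
  also have "\<dots> = zonal_norm (real n / 2) * zonal (real n / 2) m (\<Sum>i = 1..N. x i * y i)
      ((sph_r N 0 x)\<^sup>2 * (sph_r N 0 y)\<^sup>2)"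
    using sum_chains_zonal[OF N, of n x y m] by (simp add: w_def t_def nn)
  moreover have "(real N - 2) / 2 = real n / 2" by (simp add: n)
  ultimately show ?thesis by (simp only: r1 power_one mult_1)
qed

text \<open>Dimension one stands outside the induction. There the product \<open>c\<close> of two
  unit vectors satisfies \<open>c * c = 1\<close>, Legendre polynomials at \<open>c\<close> are
  powers of \<open>c\<close>, and the zonal polynomials of degree at least 2 vanish together with
  the harmonics.\<close>

theorem sum_sph_harmonic:
  assumes N: "N \<ge> 1" and x: "(\<Sum>i = 1..N. (x i)\<^sup>2) = 1" and y: "(\<Sum>i = 1..N. (y i)\<^sup>2) = 1"
  shows "(\<Sum>l = 1..sph_dim m N. sph_harmonic N m l x * sph_harmonic N m l y) =
    zonal_norm ((real N - 2) / 2) * zonal ((real N - 2) / 2) m (\<Sum>i = 1..N. x i * y i) 1"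
proof (cases "N \<ge> 2")
  case True then show ?thesis by (rule sum_sph_harmonic_ge2[OF _ x y])
next
  case False
  then have N1: "N = 1" using N by simp
  define c where "c = x 1 * y 1"
  have c: "c * c = 1" using x y unfolding N1 c_def by (simp add: power2_eq_square) (metis mult.commute mult.left_commute mult.right_neutral)
  have P: "solid_geg (1 / 2) k c 1 = c ^ k" for k
  proof (induction k rule: less_induct)
    case (less k)
    have "k = 0 \<or> k = 1 \<or> (\<exists>M. k = M + 2)" by presburger
    then consider "k = 0" | "k = 1" | M where "k = M + 2" by blast
    then show ?case
    proof cases
      case 3
      have "(real M + 2) * solid_geg (1 / 2) (M + 2) c 1 = (2 * real M + 3) * (c * c) * c ^ M - (real M + 1) * c ^ M"
        unfolding solid_geg_rec using less.IH[of "M + 1"] less.IH[of M] 3 by (simp add: algebra_simps)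
      also have "\<dots> = (real M + 2) * (c ^ (M + 2))"
      proof -
        have "c * (c * X) = X" for X by (simp add: mult.assoc[symmetric] c)
        note cX = this
        show ?thesis by (simp add: c cX algebra_simps)
      qed
      finally show ?thesis unfolding 3 by (subst (asm) mult_left_cancel) simp_all
    qed simp_all
  qed
  have Z: "zonal (- (1 / 2)) m c 1 = (if m = 0 then 1 else if m = 1 then c else 0)"
  proof (cases "m < 2")
    case True
    then show ?thesis by (auto simp: zonal_def less_2_cases_iff)
  next
    case False
    then have "\<exists>k. m = k + 2" by presburger
    then obtain k where "m = k + 2" by blast
    then show ?thesis using c P by (simp add: zonal_def)
  qed
  have n: "zonal_norm (- (1 / 2)) = 1 / 2"
    by (simp add: zonal_norm_def Gamma_one_half_real powr_half_sqrt)
  have "m = 0 \<or> m = 1 \<or> m \<ge> 2" by linarith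
  then show ?thesis
    unfolding N1 using n Z by (auto simp: sph_dim_def sph_harmonic_def c_def)
qed

section \<open>Fourier-Bessel series\<close>

text \<open>The entire function with \<open>bessel_J \<nu> x = (x / 2) powr \<nu> * clifford \<nu> (x\<^sup>2 / 4)\<close>. Its zeros, simple and
  positive, are the numbers \<open>j\<^sup>2 / 4\<close> for the positive zeros \<open>j\<close> of the Bessel function.\<close>

definition clifford_coeff :: "real \<Rightarrow> nat \<Rightarrow> real" where
  "clifford_coeff \<nu> k = (- 1) ^ k * rGamma (\<nu> + 1 + real k) / fact k"

definition clifford :: "real \<Rightarrow> 'a::{real_normed_field,banach} \<Rightarrow> 'a" where
  "clifford \<nu> z = (\<Sum>k. of_real (clifford_coeff \<nu> k) * z ^ k)"

lemma rGamma_step: "(\<nu> + 1 + real k) * rGamma (\<nu> + 1 + real (Suc k)) = rGamma (\<nu> + 1 + real k)"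
  using rGamma_plus1[of "\<nu> + 1 + real k"] by (simp add: add_ac)

lemma rGamma_pos: "x > 0 \<Longrightarrow> rGamma (x :: real) > 0"
  by (simp add: rGamma_inverse_Gamma)

text \<open>The quotient of consecutive values of \<open>b\<close> is the inverse of
  \<open>\<epsilon> * (\<nu> + 1 + k)\<close>, hence at most 1 from some index on; the sum of the
  earlier values serves as the constant.\<close>

lemma rGamma_decay:
  assumes nu: "\<nu> > -1" and eps: "\<epsilon> > 0"
  shows "\<exists>C>0. \<forall>k. \<bar>rGamma (\<nu> + 1 + real k)\<bar> \<le> C * \<epsilon> ^ k"
proof -
  define b where "b k = rGamma (\<nu> + 1 + real k) / \<epsilon> ^ k" for k
  have pos: "b k > 0" for k using nu eps by (auto simp: b_def intro!: divide_pos_pos rGamma_pos)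
  obtain K where K: "real K \<ge> 1 / \<epsilon> - \<nu> - 1" using real_arch_simple by blast
  have dec: "b (Suc k) \<le> b k" if "K \<le> k" for k
  proof -
    have "\<nu> + 1 + real k \<ge> 1 / \<epsilon>" using K that by linarith
    then have 1: "\<epsilon> * (\<nu> + 1 + real k) \<ge> 1" using eps by (simp add: field_simps)
    have "b k = \<epsilon> * (\<nu> + 1 + real k) * b (Suc k)"
      unfolding b_def rGamma_step[of \<nu> k, symmetric] using eps by simp
    also have "\<dots> \<ge> 1 * b (Suc k)" using 1 pos[of "Suc k"] by (intro mult_right_mono) auto
    finally show ?thesis by simp
  qed
  define C where "C = (\<Sum>i\<le>K. b i)"
  have C: "C > 0" unfolding C_def using pos by (intro sum_pos) auto
  have small: "b k \<le> C" if "k \<le> K" for k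
    unfolding C_def using that pos by (intro member_le_sum) (auto simp: less_imp_le)
  have "b k \<le> C" for k
  proof (cases "k \<le> K")
    case False
    then have "K \<le> k" by simp
    then have "b k \<le> b K" by (induction k rule: dec_induct) (use dec order_trans in blast)+
    then show ?thesis using small[of K] by simp
  qed (rule small)
  moreover have "\<bar>rGamma (\<nu> + 1 + real k)\<bar> = b k * \<epsilon> ^ k" for k
    using pos[of k] eps by (simp add: b_def zero_less_divide_iff)
  ultimately show ?thesis using C eps by (intro exI[of _ C]) auto
qed

text \<open>Growth below every positive exponential rate. This excludes an exponential factor in the
  product over the zeros, so that the logarithmic derivative at 0 is minus the sum of the inverse
  zeros.\<close>

lemma clifford_norm_bound:
  assumes nu: "\<nu> > -1" and eps: "\<epsilon> > 0"
  shows "\<exists>C>0. \<forall>z::'a::{real_normed_field,banach}. summable (\<lambda>k. norm (of_real (clifford_coeff \<nu> k) * z ^ k)) \<and> norm (clifford \<nu> z) \<le> C * exp (\<epsilon> * norm z)"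
proof -
  obtain C where C: "C > 0" "\<And>k. \<bar>rGamma (\<nu> + 1 + real k)\<bar> \<le> C * \<epsilon> ^ k" using rGamma_decay[OF assms] by blast
  have "summable (\<lambda>k. norm (of_real (clifford_coeff \<nu> k) * z ^ k)) \<and> norm (clifford \<nu> z) \<le> C * exp (\<epsilon> * norm z)" for z :: 'a
  proof -
    have le: "norm (of_real (clifford_coeff \<nu> k) * z ^ k) \<le> C * ((\<epsilon> * norm z) ^ k /\<^sub>R fact k)" for k
    proof -
      have "norm (of_real (clifford_coeff \<nu> k) * z ^ k) = \<bar>rGamma (\<nu> + 1 + real k)\<bar> * norm z ^ k / fact k"
      proof -
        have "\<bar>clifford_coeff \<nu> k\<bar> = \<bar>rGamma (\<nu> + 1 + real k)\<bar> / fact k" by (simp add: clifford_coeff_def abs_mult)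
        then show ?thesis by (simp add: norm_mult norm_power)
      qed
      also have "\<dots> \<le> C * \<epsilon> ^ k * norm z ^ k / fact k"
        by (intro divide_right_mono mult_right_mono C(2)) auto
      finally show ?thesis by (simp add: power_mult_distrib divide_inverse_commute mult_ac)
    qed
    have s: "(\<lambda>k. C * ((\<epsilon> * norm z) ^ k /\<^sub>R fact k)) sums (C * exp (\<epsilon> * norm z))"
      by (intro sums_mult exp_converges)
    have sm: "summable (\<lambda>k. norm (of_real (clifford_coeff \<nu> k) * z ^ k))"
      by (rule summable_comparison_test_ev[OF _ sums_summable[OF s]]) (use le in auto)
    moreover have "norm (clifford \<nu> z) \<le> (\<Sum>k. norm (of_real (clifford_coeff \<nu> k) * z ^ k))"
      unfolding clifford_def by (rule summable_norm[OF sm])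
    moreover have "\<dots> \<le> C * exp (\<epsilon> * norm z)"
      using suminf_le[OF le sm sums_summable[OF s]] sums_unique[OF s] by simp
    ultimately show ?thesis by linarith
  qed
  then show ?thesis using C(1) by blast
qed

lemma summable_clifford: "\<nu> > -1 \<Longrightarrow> summable (\<lambda>k. of_real (clifford_coeff \<nu> k) * (z::'a::{real_normed_field,banach}) ^ k)"
  using clifford_norm_bound[of \<nu> 1, where 'a = 'a] summable_norm_cancel[of "\<lambda>k. of_real (clifford_coeff \<nu> k) * z ^ k"] by auto

lemma clifford_sums: "\<nu> > -1 \<Longrightarrow> (\<lambda>k. of_real (clifford_coeff \<nu> k) * z ^ k) sums clifford \<nu> (z::'a::{real_normed_field,banach})"
  unfolding clifford_def by (rule summable_sums[OF summable_clifford])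

lemma clifford_coeff_diffs: "diffs (\<lambda>k. of_real (clifford_coeff \<nu> k)) k = (- of_real (clifford_coeff (\<nu> + 1) k) :: 'a::real_normed_field)"
proof -
  have "real (Suc k) * clifford_coeff \<nu> (Suc k) = - clifford_coeff (\<nu> + 1) k"
    unfolding clifford_coeff_def by (simp add: add_ac divide_simps)
  then show ?thesis unfolding diffs_def by (metis of_real_minus of_real_mult of_real_of_nat_eq)
qed

lemma clifford_deriv [derivative_intros]:
  fixes z :: "'a::{real_normed_field,banach}"
  assumes nu: "\<nu> > -1" and f: "(f has_field_derivative f') (at z within S)"
  shows "((\<lambda>x. clifford \<nu> (f x)) has_field_derivative (- clifford (\<nu> + 1) (f z) * f')) (at z within S)"
proof -
  have "(clifford \<nu> has_field_derivative (\<Sum>n. diffs (\<lambda>k. of_real (clifford_coeff \<nu> k)) n * f z ^ n)) (at (f z))"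
    unfolding clifford_def[abs_def] by (rule termdiffs_strong_converges_everywhere[OF summable_clifford[OF nu]])
  also have "(\<Sum>n. diffs (\<lambda>k. of_real (clifford_coeff \<nu> k)) n * f z ^ n) = - clifford (\<nu> + 1) (f z)"
    unfolding clifford_coeff_diffs clifford_def using suminf_minus[OF summable_clifford[of "\<nu> + 1" "f z"]] nu by simp
  finally show ?thesis by (rule DERIV_chain2[OF _ f])
qed

text \<open>Together with \<open>clifford_deriv\<close> this replaces Bessel's differential
  equation: differentiation raises the order and this relation brings it down again. All
  antiderivatives below are verified with these two rules.\<close>

lemma clifford_contiguous:
  fixes z :: "'a::{real_normed_field,banach}"
  assumes nu: "\<nu> > -1"
  shows "of_real (\<nu> + 1) * clifford (\<nu> + 1) z - z * clifford (\<nu> + 2) z = clifford \<nu> z"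
proof -
  have 1: "(\<lambda>k. of_real (\<nu> + 1) * (of_real (clifford_coeff (\<nu> + 1) k) * z ^ k)) sums (of_real (\<nu> + 1) * clifford (\<nu> + 1) z)"
    using nu by (intro sums_mult clifford_sums) auto
  have "(\<lambda>k. z * (of_real (clifford_coeff (\<nu> + 2) k) * z ^ k)) sums (z * clifford (\<nu> + 2) z)"
    using nu by (intro sums_mult clifford_sums) auto
  then have 2: "(\<lambda>k. if k = 0 then 0 else z * (of_real (clifford_coeff (\<nu> + 2) (k - 1)) * z ^ (k - 1))) sums (z * clifford (\<nu> + 2) z)"
    using sums_Suc[of "\<lambda>k. if k = 0 then 0 else z * (of_real (clifford_coeff (\<nu> + 2) (k - 1)) * z ^ (k - 1))"] by simp
  have "of_real (\<nu> + 1) * (of_real (clifford_coeff (\<nu> + 1) k) * z ^ k) -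
     (if k = 0 then 0 else z * (of_real (clifford_coeff (\<nu> + 2) (k - 1)) * z ^ (k - 1))) = of_real (clifford_coeff \<nu> k) * z ^ k" for k
  proof (cases k)
    case 0
    have "(\<nu> + 1) * clifford_coeff (\<nu> + 1) 0 = clifford_coeff \<nu> 0" using rGamma_step[of \<nu> 0] by (simp add: clifford_coeff_def add_ac)
    then have "of_real (\<nu> + 1) * of_real (clifford_coeff (\<nu> + 1) 0) = (of_real (clifford_coeff \<nu> 0) :: 'a)"
      by (simp only: of_real_mult[symmetric])
    then show ?thesis using 0 by simp
  next
    case (Suc j)
    have "(\<nu> + 1) * clifford_coeff (\<nu> + 1) (Suc j) - clifford_coeff (\<nu> + 2) j = clifford_coeff \<nu> (Suc j)"
    proof -
      define R where "R = rGamma (\<nu> + real j + 3)"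
      define F where "F = (fact (Suc j) :: real)"
      have F: "F > 0" "fact j = F / (real j + 1)" by (auto simp: F_def divide_simps)
      have R1: "rGamma (\<nu> + 1 + real (Suc j)) = (\<nu> + real j + 2) * R"
        using rGamma_step[of \<nu> "Suc j"] by (simp add: R_def add_ac)
      have "\<nu> + 1 + 1 + real (Suc j) = \<nu> + real j + 3" "\<nu> + 2 + 1 + real j = \<nu> + real j + 3" by simp_all
      then show ?thesis
        unfolding clifford_coeff_def R1 F_def[symmetric] F(2) by (simp only: R_def[symmetric] power_Suc)
          (use F(1) in \<open>simp add: field_simps\<close>)
    qed
    then have e: "of_real (\<nu> + 1) * of_real (clifford_coeff (\<nu> + 1) (Suc j)) - of_real (clifford_coeff (\<nu> + 2) j) = (of_real (clifford_coeff \<nu> (Suc j)) :: 'a)"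
      by (simp only: of_real_mult[symmetric] of_real_diff[symmetric])
    show ?thesis unfolding Suc e[symmetric] by (simp add: algebra_simps)
  qed
  then have "(\<lambda>k. of_real (clifford_coeff \<nu> k) * z ^ k) sums (of_real (\<nu> + 1) * clifford (\<nu> + 1) z - z * clifford (\<nu> + 2) z)"
    using sums_diff[OF 1 2] by simp
  then show ?thesis using clifford_sums[OF nu] sums_unique2 by blast
qed

lemma clifford_0 [simp]: "clifford \<nu> 0 = of_real (rGamma (\<nu> + 1))"
  unfolding clifford_def by (subst powser_zero) (simp add: clifford_coeff_def)

lemma continuous_on_clifford [continuous_intros]:
  assumes "\<nu> > -1" "continuous_on A f"
  shows "continuous_on A (\<lambda>x. clifford \<nu> (f x :: 'a::{real_normed_field,banach}))"
proof -
  have "continuous_on UNIV (clifford \<nu> :: 'a \<Rightarrow> 'a)"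
    using clifford_deriv[OF assms(1) DERIV_ident] by (intro DERIV_continuous_on[where D = "\<lambda>z. - clifford (\<nu> + 1) z * 1"]) auto
  then show ?thesis using assms(2) by (auto intro: continuous_on_compose2)
qed

lemma clifford_of_real: "\<nu> > -1 \<Longrightarrow> clifford \<nu> (of_real x) = (of_real (clifford \<nu> x) :: complex)"
  unfolding clifford_def by (subst suminf_of_real) (use summable_clifford[of \<nu> x] in simp_all)

lemma clifford_cnj: "\<nu> > -1 \<Longrightarrow> clifford \<nu> (cnj z) = cnj (clifford \<nu> z)"
proof -
  assume nu: "\<nu> > -1"
  have "(\<lambda>k. cnj (of_real (clifford_coeff \<nu> k) * z ^ k)) sums cnj (clifford \<nu> z)"
    using clifford_sums[OF nu] by (simp only: sums_cnj)
  then show ?thesis unfolding clifford_def using sums_unique by fastforce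
qed

lemma clifford_pos: "\<nu> > -1 \<Longrightarrow> x \<le> 0 \<Longrightarrow> clifford \<nu> x > (0::real)"
proof -
  assume nu: "\<nu> > -1" and x: "x \<le> 0"
  have t: "clifford_coeff \<nu> k * x ^ k = rGamma (\<nu> + 1 + real k) * (- x) ^ k / fact k" for k
    by (simp add: clifford_coeff_def power_mult_distrib[symmetric] mult_ac flip: mult.assoc) 
  have "(\<Sum>k. clifford_coeff \<nu> k * x ^ k) > 0"
  proof (rule suminf_pos2[where i = 0])
    show "summable (\<lambda>k. clifford_coeff \<nu> k * x ^ k)" using summable_clifford[OF nu, of x] by simp
    have r: "rGamma (\<nu> + 1 + real k) > 0" for k using nu by (intro rGamma_pos) auto
    show "0 \<le> clifford_coeff \<nu> n * x ^ n" for n unfolding t using r[of n] x by (intro divide_nonneg_pos mult_nonneg_nonneg) auto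
    show "0 < clifford_coeff \<nu> 0 * x ^ 0" unfolding t using r[of 0] by simp
  qed
  then show ?thesis by (simp add: clifford_def)
qed

lemma bessel_J_clifford:
  assumes "\<nu> > -1" "x > 0"
  shows "bessel_J \<nu> x = (x / 2) powr \<nu> * clifford \<nu> (x\<^sup>2 / 4)"
proof -
  have "(- 1) ^ k * rGamma (\<nu> + real k + 1) / fact k * (x / 2) powr (2 * real k + \<nu>) =
     (x / 2) powr \<nu> * (of_real (clifford_coeff \<nu> k) * (x\<^sup>2 / 4) ^ k)" for k
  proof -
    have "(x / 2) powr (2 * real k + \<nu>) = (x / 2) powr (real (2 * k)) * (x / 2) powr \<nu>"
      by (simp add: powr_add)
    also have "(x / 2) powr (real (2 * k)) = (x / 2) ^ (2 * k)" using assms by (subst powr_realpow) auto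
    also have "\<dots> = (x\<^sup>2 / 4) ^ k" by (simp add: power_mult power_divide)
    finally show ?thesis by (simp add: clifford_coeff_def add_ac)
  qed
  then show ?thesis unfolding bessel_J_def clifford_def
    using suminf_mult[OF summable_clifford[OF assms(1), of "x\<^sup>2 / 4"], of "(x / 2) powr \<nu>"] by simp
qed

section \<open>Lommel's integrals and the location of the zeros\<close>

definition power_measure :: "real \<Rightarrow> real measure" where
  "power_measure \<nu> = density lborel (\<lambda>v. ennreal (indicator {0<..<1} v * v powr \<nu>))"

lemma sets_power_measure [measurable_cong, simp]: "sets (power_measure \<nu>) = sets borel" by (simp add: power_measure_def)
lemma space_power_measure [simp]: "space (power_measure \<nu>) = UNIV" by (simp add: power_measure_def)

lemma power_measure_finite:
  assumes nu: "\<nu> > -1"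
  shows "finite_measure (power_measure \<nu>)"
proof
  have "((\<lambda>x. x powr \<nu>) has_integral (1 powr (\<nu> + 1) / (\<nu> + 1))) {0..1}"
    by (rule has_integral_powr_from_0) (use nu in auto)
  then have "((\<lambda>x. x powr \<nu>) has_integral (1 powr (\<nu> + 1) / (\<nu> + 1))) {0<..<1}"
    using has_integral_Icc_iff_Ioo by blast
  then have "((\<lambda>x. indicator {0<..<1} x * x powr \<nu>) has_integral (1 powr (\<nu> + 1) / (\<nu> + 1))) UNIV"
  proof -
    assume *: "((\<lambda>x. x powr \<nu>) has_integral (1 powr (\<nu> + 1) / (\<nu> + 1))) {0<..<1}"
    have "(\<lambda>x. indicator {0<..<1} x * x powr \<nu>) = (\<lambda>x. if x \<in> {0<..<1} then x powr \<nu> else 0)"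
      by (auto simp: fun_eq_iff indicator_def)
    then show ?thesis using * has_integral_restrict_UNIV[of "{0<..<1}" "\<lambda>x. x powr \<nu>"] by simp
  qed
  then have "integral\<^sup>N lborel (\<lambda>x. indicator {0<..<1} x * x powr \<nu>) = ennreal (1 powr (\<nu> + 1) / (\<nu> + 1))"
    by (intro nn_integral_has_integral_lborel) auto
  then show "emeasure (power_measure \<nu>) (space (power_measure \<nu>)) \<noteq> \<infinity>"
    unfolding power_measure_def by (subst emeasure_density) auto
qed

lemma AE_power_measure: "AE v in power_measure \<nu>. 0 < v \<and> v < 1"
  unfolding power_measure_def by (subst AE_density) (auto intro!: AE_I2 split: split_indicator)

lemma power_measure_integrable:
  fixes f :: "real \<Rightarrow> 'b::{banach,second_countable_topology}"
  assumes nu: "\<nu> > -1" and m: "f \<in> borel_measurable borel" and b: "\<And>v. 0 < v \<Longrightarrow> v < 1 \<Longrightarrow> norm (f v) \<le> B"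
  shows "integrable (power_measure \<nu>) f"
proof -
  interpret finite_measure "power_measure \<nu>" by (rule power_measure_finite[OF nu])
  show ?thesis
  proof (rule integrable_const_bound[where B = B])
    show "AE v in power_measure \<nu>. norm (f v) \<le> B" using AE_power_measure[of \<nu>] by (rule eventually_mono) (use b in auto)
  qed (use m in simp)
qed

lemma power_measure_integrable_continuous:
  fixes f :: "real \<Rightarrow> 'b::{banach,second_countable_topology}"
  assumes nu: "\<nu> > -1" and c: "continuous_on UNIV f"
  shows "integrable (power_measure \<nu>) f"
proof -
  have "compact (f ` {0..1})" using c by (intro compact_continuous_image continuous_on_subset[OF c]) auto
  then obtain B where "\<And>v. v \<in> {0..1} \<Longrightarrow> norm (f v) \<le> B" using compact_imp_bounded bounded_iff by (metis imageI)
  then show ?thesis using c by (intro power_measure_integrable[OF nu, of f B] borel_measurable_continuous_onI) auto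
qed

text \<open>The weight is what \<open>x dx\<close> becomes, up to constants, under
  \<open>v = x^2\<close> when integrated against two Bessel functions of order \<open>\<nu>\<close>.
  The antiderivative is \<open>v powr (\<nu> + 1) * G v\<close>, which vanishes at 0;
  differentiability is required only inside the interval because the weight may be singular at
  0.\<close>

lemma power_measure_integral_FTC:
  fixes f G G' :: "real \<Rightarrow> 'b::euclidean_space"
  assumes nu: "\<nu> > -1" and int: "integrable (power_measure \<nu>) f" and m: "f \<in> borel_measurable borel"
    and G: "continuous_on {0..1} G"
    and d: "\<And>v. 0 < v \<Longrightarrow> v < 1 \<Longrightarrow> (G has_vector_derivative G' v) (at v)"
    and e: "\<And>v. 0 < v \<Longrightarrow> v < 1 \<Longrightarrow> f v = (\<nu> + 1) *\<^sub>R G v + v *\<^sub>R G' v"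
  shows "integral\<^sup>L (power_measure \<nu>) f = G 1"
proof -
  have "((\<lambda>v. v powr \<nu> *\<^sub>R f v) has_integral (1 powr (\<nu> + 1) *\<^sub>R G 1 - 0 powr (\<nu> + 1) *\<^sub>R G 0)) {0..1}"
  proof (rule fundamental_theorem_of_calculus_interior)
    show "continuous_on {0..1} (\<lambda>v. v powr (\<nu> + 1) *\<^sub>R G v)"
      using nu by (intro continuous_intros continuous_on_powr' G) auto
    fix v :: real assume v: "v \<in> {0<..<1}"
    have "((\<lambda>v. v powr (\<nu> + 1)) has_field_derivative (\<nu> + 1) * v powr \<nu>) (at v)"
      using v by (auto intro!: derivative_eq_intros)
    from has_vector_derivative_scaleR[OF this d[of v]]
    have "((\<lambda>v. v powr (\<nu> + 1) *\<^sub>R G v) has_vector_derivative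
       (v powr (\<nu> + 1) *\<^sub>R G' v + ((\<nu> + 1) * v powr \<nu>) *\<^sub>R G v)) (at v)" using v by simp
    also have "v powr (\<nu> + 1) *\<^sub>R G' v + ((\<nu> + 1) * v powr \<nu>) *\<^sub>R G v = v powr \<nu> *\<^sub>R f v"
      using v by (simp add: e powr_add scaleR_add_right mult.commute)
    finally show "((\<lambda>v. v powr (\<nu> + 1) *\<^sub>R G v) has_vector_derivative v powr \<nu> *\<^sub>R f v) (at v)" .
  qed simp
  then have 1: "((\<lambda>v. v powr \<nu> *\<^sub>R f v) has_integral G 1) {0<..<1}"
    using nu by (simp add: has_integral_Icc_iff_Ioo)
  have i: "set_integrable lborel {0<..<1} (\<lambda>v. v powr \<nu> *\<^sub>R f v)"
    using int unfolding power_measure_def set_integrable_def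
    by (subst (asm) integrable_density) (use m in auto)
  have "integral\<^sup>L (power_measure \<nu>) f = (LINT v:{0<..<1}|lborel. v powr \<nu> *\<^sub>R f v)"
    unfolding power_measure_def set_lebesgue_integral_def
    by (subst integral_density) (use m in auto)
  also have "\<dots> = G 1"
    using set_borel_integral_eq_integral[OF i] 1 by (simp add: integral_unique)
  finally show ?thesis .
qed

lemma lommel:
  fixes w w' :: complex
  assumes nu: "\<nu> > -1"
  shows "(w - w') * (\<integral>v. clifford \<nu> (w * of_real v) * clifford \<nu> (w' * of_real v) \<partial>power_measure \<nu>) =
     w * clifford (\<nu> + 1) w * clifford \<nu> w' - w' * clifford (\<nu> + 1) w' * clifford \<nu> w"
proof -
  have c: "continuous_on UNIV (\<lambda>v::real. (w - w') * (clifford \<nu> (w * of_real v) * clifford \<nu> (w' * of_real v)))"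
    using nu by (intro continuous_intros) auto
  define X where "X z = w * clifford (\<nu> + 1) (w * z) * clifford \<nu> (w' * z) - w' * clifford (\<nu> + 1) (w' * z) * clifford \<nu> (w * z)" for z
  define X' where "X' z = w * (- clifford (\<nu> + 2) (w * z) * w * clifford \<nu> (w' * z) + clifford (\<nu> + 1) (w * z) * (- clifford (\<nu> + 1) (w' * z) * w'))
     - w' * (- clifford (\<nu> + 2) (w' * z) * w' * clifford \<nu> (w * z) + clifford (\<nu> + 1) (w' * z) * (- clifford (\<nu> + 1) (w * z) * w))" for z
  have dX: "(X has_field_derivative X' z) (at z)" for z
    unfolding X_def[abs_def] X'_def using nu by (auto intro!: derivative_eq_intros simp: algebra_simps)
  have "(\<integral>v. (w - w') * (clifford \<nu> (w * of_real v) * clifford \<nu> (w' * of_real v)) \<partial>power_measure \<nu>) = X (of_real 1)"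
  proof (rule power_measure_integral_FTC[OF nu])
    show "integrable (power_measure \<nu>) (\<lambda>v. (w - w') * (clifford \<nu> (w * of_real v) * clifford \<nu> (w' * of_real v)))"
      by (rule power_measure_integrable_continuous[OF nu c])
    show "(\<lambda>v. (w - w') * (clifford \<nu> (w * of_real v) * clifford \<nu> (w' * of_real v))) \<in> borel_measurable borel"
      by (rule borel_measurable_continuous_onI[OF c])
    show "continuous_on {0..1} (\<lambda>v. X (of_real v))"
      unfolding X_def using nu by (intro continuous_intros) auto
    show "((\<lambda>v. X (of_real v)) has_vector_derivative X' (of_real v)) (at v)" for v
      by (rule has_vector_derivative_real_field[OF dX])
    fix v :: real
    define z where "z = complex_of_real v"
    have a: "clifford \<nu> (w * z) = of_real (\<nu> + 1) * clifford (\<nu> + 1) (w * z) - w * z * clifford (\<nu> + 2) (w * z)"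
      and b: "clifford \<nu> (w' * z) = of_real (\<nu> + 1) * clifford (\<nu> + 1) (w' * z) - w' * z * clifford (\<nu> + 2) (w' * z)"
      using clifford_contiguous[OF nu, of "w * z"] clifford_contiguous[OF nu, of "w' * z"] by auto
    have "(w - w') * (clifford \<nu> (w * z) * clifford \<nu> (w' * z)) =
      w * clifford \<nu> (w * z) * clifford \<nu> (w' * z) - w' * clifford \<nu> (w' * z) * clifford \<nu> (w * z)" by (simp add: algebra_simps)
    also have "\<dots> = w * (of_real (\<nu> + 1) * clifford (\<nu> + 1) (w * z) - w * z * clifford (\<nu> + 2) (w * z)) * clifford \<nu> (w' * z)
       - w' * (of_real (\<nu> + 1) * clifford (\<nu> + 1) (w' * z) - w' * z * clifford (\<nu> + 2) (w' * z)) * clifford \<nu> (w * z)"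
      by (simp only: a[symmetric] b[symmetric])
    also have "\<dots> = of_real (\<nu> + 1) * X z + z * X' z"
      unfolding X_def X'_def by (simp only: ring_distribs) (simp add: mult_ac)
    finally show "(w - w') * (clifford \<nu> (w * of_real v) * clifford \<nu> (w' * of_real v)) = (\<nu> + 1) *\<^sub>R X (of_real v) + v *\<^sub>R X' (of_real v)"
      unfolding z_def scaleR_conv_of_real .
  qed
  then show ?thesis by (simp add: X_def)
qed

text \<open>Lommel's formula degenerates for equal parameters, so this case has its own
  antiderivative. At the end point 1 two of its three terms contain \<open>clifford \<nu> w\<close>
  and vanish.\<close>

lemma lommel_norm:
  fixes w :: real
  assumes nu: "\<nu> > -1" and w: "clifford \<nu> w = 0"
  shows "(\<integral>v. (clifford \<nu> (w * v))\<^sup>2 \<partial>power_measure \<nu>) = w * (clifford (\<nu> + 1) w)\<^sup>2"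
proof -
  have c: "continuous_on UNIV (\<lambda>v::real. (clifford \<nu> (w * v))\<^sup>2)"
    using nu by (intro continuous_intros) auto
  define X where "X v = (clifford \<nu> (w * v))\<^sup>2 + w * v * (clifford (\<nu> + 1) (w * v))\<^sup>2 - \<nu> * clifford \<nu> (w * v) * clifford (\<nu> + 1) (w * v)" for v
  define X' where "X' v = 2 * clifford \<nu> (w * v) * (- clifford (\<nu> + 1) (w * v) * w) + w * (clifford (\<nu> + 1) (w * v))\<^sup>2
     + w * v * (2 * clifford (\<nu> + 1) (w * v) * (- clifford (\<nu> + 2) (w * v) * w))
     - \<nu> * ((- clifford (\<nu> + 1) (w * v) * w) * clifford (\<nu> + 1) (w * v) + clifford \<nu> (w * v) * (- clifford (\<nu> + 2) (w * v) * w))" for v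
  have dX: "(X has_field_derivative X' z) (at z)" for z
    unfolding X_def[abs_def] X'_def using nu by (auto intro!: derivative_eq_intros simp: algebra_simps)
  have "(\<integral>v. (clifford \<nu> (w * v))\<^sup>2 \<partial>power_measure \<nu>) = X 1"
  proof (rule power_measure_integral_FTC[OF nu])
    show "integrable (power_measure \<nu>) (\<lambda>v. (clifford \<nu> (w * v))\<^sup>2)"
      by (rule power_measure_integrable_continuous[OF nu c])
    show "(\<lambda>v. (clifford \<nu> (w * v))\<^sup>2) \<in> borel_measurable borel"
      by (rule borel_measurable_continuous_onI[OF c])
    show "continuous_on {0..1} X"
      unfolding X_def using nu by (intro continuous_intros) auto
    show "(X has_vector_derivative X' v) (at v)" for v
      using dX by (simp add: has_real_derivative_iff_has_vector_derivative)
    fix v :: real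
    define e0 where "e0 = clifford \<nu> (w * v)"
    define e1 where "e1 = clifford (\<nu> + 1) (w * v)"
    define e2 where "e2 = clifford (\<nu> + 2) (w * v)"
    have a: "w * v * e2 = (\<nu> + 1) * e1 - e0"
      using clifford_contiguous[OF nu, of "w * v"] by (simp add: e0_def e1_def e2_def)
    have "(\<nu> + 1) * X v + v * X' v = (\<nu> + 1) * (e0\<^sup>2 + w * v * e1\<^sup>2 - \<nu> * e0 * e1)
      - 2 * w * v * e0 * e1 + w * v * e1\<^sup>2 - 2 * w * v * e1 * (w * v * e2) + \<nu> * w * v * e1\<^sup>2 + \<nu> * e0 * (w * v * e2)"
      unfolding X_def X'_def e0_def[symmetric] e1_def[symmetric] e2_def[symmetric] power2_eq_square by (simp only: ring_distribs) (simp add: mult_ac)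
    also have "\<dots> = e0\<^sup>2" unfolding a power2_eq_square by (simp only: ring_distribs) (simp add: algebra_simps)
    finally show "(clifford \<nu> (w * v))\<^sup>2 = (\<nu> + 1) *\<^sub>R X v + v *\<^sub>R X' v" by (simp add: e0_def)
  qed
  then show ?thesis using w by (simp add: X_def)
qed

definition bessel_moment :: "real \<Rightarrow> nat \<Rightarrow> real \<Rightarrow> real" where
  "bessel_moment \<nu> k w = (\<integral>v. v ^ k * clifford \<nu> (w * v) \<partial>power_measure \<nu>)"

text \<open>Two integrations by parts packed into one antiderivative; its term with
  \<open>clifford \<nu>\<close> vanishes at 1 because \<open>w\<close> is a zero. The remaining
  boundary value is the moment of index 0, so the recursion closes.\<close>

lemma bessel_moment_rec:
  assumes nu: "\<nu> > -1" and w: "clifford \<nu> w = 0"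
  shows "(real k + 1) * (real k + 1 + \<nu>) * bessel_moment \<nu> k w + w * bessel_moment \<nu> (Suc k) w = w * clifford (\<nu> + 1) w"
    and "bessel_moment \<nu> 0 w = clifford (\<nu> + 1) w"
proof -
  have c: "continuous_on UNIV (\<lambda>v::real. v ^ j * clifford \<nu> (w * v))" for j
    using nu by (intro continuous_intros) auto
  note i = power_measure_integrable_continuous[OF nu c]
  note m = borel_measurable_continuous_onI[OF c]
  define Y where "Y j v = v ^ j * clifford (\<nu> + 1) (w * v)" for j v
  define K where "K = real k + 1"
  have "(\<integral>v. K * (K + \<nu>) * (v ^ k * clifford \<nu> (w * v)) + w * (v ^ Suc k * clifford \<nu> (w * v)) \<partial>power_measure \<nu>)
     = K * 1 ^ k * clifford \<nu> (w * 1) + w * Y (Suc k) 1"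
  proof (rule power_measure_integral_FTC[OF nu, where G = "\<lambda>v. K * v ^ k * clifford \<nu> (w * v) + w * Y (Suc k) v"
       and G' = "\<lambda>v. K * (real k * v ^ (k - 1)) * clifford \<nu> (w * v) + K * v ^ k * (- clifford (\<nu> + 1) (w * v) * w)
        + w * (K * v ^ k * clifford (\<nu> + 1) (w * v) + v ^ Suc k * (- clifford (\<nu> + 2) (w * v) * w))"])
    show "integrable (power_measure \<nu>) (\<lambda>v. K * (K + \<nu>) * (v ^ k * clifford \<nu> (w * v)) + w * (v ^ Suc k * clifford \<nu> (w * v)))"
      by (intro Bochner_Integration.integrable_add integrable_mult_right i)
    show "(\<lambda>v. K * (K + \<nu>) * (v ^ k * clifford \<nu> (w * v)) + w * (v ^ Suc k * clifford \<nu> (w * v))) \<in> borel_measurable borel"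
      by (intro borel_measurable_add borel_measurable_times borel_measurable_const m)
    show "continuous_on {0..1} (\<lambda>v. K * v ^ k * clifford \<nu> (w * v) + w * Y (Suc k) v)"
      unfolding Y_def using nu by (intro continuous_intros) auto
    show "((\<lambda>v. K * v ^ k * clifford \<nu> (w * v) + w * Y (Suc k) v) has_vector_derivative
       K * (real k * v ^ (k - 1)) * clifford \<nu> (w * v) + K * v ^ k * (- clifford (\<nu> + 1) (w * v) * w)
        + w * (K * v ^ k * clifford (\<nu> + 1) (w * v) + v ^ Suc k * (- clifford (\<nu> + 2) (w * v) * w))) (at v)" for v
      unfolding Y_def has_real_derivative_iff_has_vector_derivative[symmetric] using nu
      by (auto intro!: derivative_eq_intros simp: K_def algebra_simps simp del: power_Suc)
    fix v :: real
    define e0 where "e0 = clifford \<nu> (w * v)"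
    define e1 where "e1 = clifford (\<nu> + 1) (w * v)"
    define e2 where "e2 = clifford (\<nu> + 2) (w * v)"
    have a: "e0 = (\<nu> + 1) * e1 - w * v * e2"
      using clifford_contiguous[OF nu, of "w * v"] by (simp add: e0_def e1_def e2_def)
    have p: "v * (real k * v ^ (k - 1)) = real k * v ^ k" by (cases k) auto
    have "(\<nu> + 1) * (K * v ^ k * e0 + w * Y (Suc k) v) + v * (K * (real k * v ^ (k - 1)) * e0 + K * v ^ k * (- e1 * w)
        + w * (K * v ^ k * e1 + v ^ Suc k * (- e2 * w)))
      = (\<nu> + 1) * K * v ^ k * e0 + K * e0 * (v * (real k * v ^ (k - 1))) + w * v ^ Suc k * ((\<nu> + 1) * e1 - w * v * e2)"
      unfolding Y_def e1_def[symmetric] by (simp add: algebra_simps)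
    also have "\<dots> = K * (K + \<nu>) * (v ^ k * e0) + w * (v ^ Suc k * e0)"
      unfolding p a[symmetric] by (simp add: K_def algebra_simps)
    finally show "K * (K + \<nu>) * (v ^ k * clifford \<nu> (w * v)) + w * (v ^ Suc k * clifford \<nu> (w * v)) =
      (\<nu> + 1) *\<^sub>R (K * v ^ k * clifford \<nu> (w * v) + w * Y (Suc k) v) + v *\<^sub>R (K * (real k * v ^ (k - 1)) * clifford \<nu> (w * v) + K * v ^ k * (- clifford (\<nu> + 1) (w * v) * w)
        + w * (K * v ^ k * clifford (\<nu> + 1) (w * v) + v ^ Suc k * (- clifford (\<nu> + 2) (w * v) * w)))"
      by (simp add: e0_def e1_def e2_def)
  qed
  moreover have "(\<integral>v. K * (K + \<nu>) * (v ^ k * clifford \<nu> (w * v)) + w * (v ^ Suc k * clifford \<nu> (w * v)) \<partial>power_measure \<nu>)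
     = K * (K + \<nu>) * bessel_moment \<nu> k w + w * bessel_moment \<nu> (Suc k) w"
    unfolding bessel_moment_def using i by (subst Bochner_Integration.integral_add) (auto simp del: power_Suc)
  ultimately show "(real k + 1) * (real k + 1 + \<nu>) * bessel_moment \<nu> k w + w * bessel_moment \<nu> (Suc k) w = w * clifford (\<nu> + 1) w"
    using w by (simp add: K_def Y_def)
  have "(\<integral>v. v ^ 0 * clifford \<nu> (w * v) \<partial>power_measure \<nu>) = clifford (\<nu> + 1) (w * 1)"
  proof (rule power_measure_integral_FTC[OF nu i m, where G = "\<lambda>v. clifford (\<nu> + 1) (w * v)" and G' = "\<lambda>v. - clifford (\<nu> + 2) (w * v) * w"])
    show "continuous_on {0..1} (\<lambda>v. clifford (\<nu> + 1) (w * v))" using nu by (intro continuous_intros) auto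
    show "((\<lambda>v. clifford (\<nu> + 1) (w * v)) has_vector_derivative - clifford (\<nu> + 2) (w * v) * w) (at v)" for v
      unfolding has_real_derivative_iff_has_vector_derivative[symmetric] using nu
      by (auto intro!: derivative_eq_intros simp: algebra_simps)
    show "v ^ 0 * clifford \<nu> (w * v) = (\<nu> + 1) *\<^sub>R clifford (\<nu> + 1) (w * v) + v *\<^sub>R (- clifford (\<nu> + 2) (w * v) * w)" for v
      using clifford_contiguous[OF nu, of "w * v"] by (simp add: algebra_simps)
  qed
  then show "bessel_moment \<nu> 0 w = clifford (\<nu> + 1) w" by (simp add: bessel_moment_def)
qed

lemma power_measure_AE_ex:
  assumes ae: "AE v in power_measure \<nu>. P v" and ab: "0 \<le> a" "a < b" "b \<le> 1"
  shows "\<exists>v. a < v \<and> v < b \<and> P v"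
proof (rule ccontr)
  assume n: "\<not> ?thesis"
  have "AE v in lborel. 0 < ennreal (indicator {0<..<1} v * v powr \<nu>) \<longrightarrow> P v"
    using ae unfolding power_measure_def by (subst (asm) AE_density) auto
  then have "AE v in lborel. v \<notin> {a<..<b}"
    by (rule eventually_mono) (use n ab in \<open>auto split: split_indicator_asm\<close>)
  moreover have "{x \<in> space lborel. \<not> x \<notin> {a<..<b}} = {a<..<b}" by auto
  ultimately have "emeasure lborel {a<..<b} = 0"
    using AE_iff_measurable[of "{a<..<b}" lborel "\<lambda>x. x \<notin> {a<..<b}"] by simp
  then show False using ab by simp
qed

lemma power_measure_integral_pos:
  assumes nu: "\<nu> > -1" and c: "continuous_on UNIV f" and nn: "\<And>v. f v \<ge> 0" and p: "f 0 > (0::real)"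
  shows "integral\<^sup>L (power_measure \<nu>) f > 0"
proof (rule ccontr)
  assume "\<not> ?thesis"
  moreover have "integral\<^sup>L (power_measure \<nu>) f \<ge> 0" using nn by (intro Bochner_Integration.integral_nonneg) auto
  ultimately have "integral\<^sup>L (power_measure \<nu>) f = 0" by simp
  then have ae: "AE v in power_measure \<nu>. f v = 0"
    using integral_nonneg_eq_0_iff_AE[OF power_measure_integrable_continuous[OF nu c]] nn by auto
  have "isCont f 0" using c continuous_on_eq_continuous_at by blast
  then have "eventually (\<lambda>v. f v > 0) (at 0)" using p by (intro order_tendstoD(1)[of f "f 0"]) (auto simp: isCont_def)
  then obtain d where d: "d > 0" "\<And>v. v \<noteq> 0 \<Longrightarrow> \<bar>v\<bar> < d \<Longrightarrow> f v > 0"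
    unfolding eventually_at by (auto simp: dist_real_def)
  obtain v where "0 < v" "v < min d 1" "f v = 0"
    using power_measure_AE_ex[OF ae, of 0 "min d 1"] d by auto
  then show False using d(2)[of v] by auto
qed

text \<open>The symmetry argument for eigenvalues: \<open>cnj w\<close> is a zero too, and Lommel's
  formula makes \<open>w - cnj w\<close> times a positive integral vanish. A real zero is positive,
  since for arguments at most 0 all terms of the series are nonnegative and the first is
  positive.\<close>

lemma clifford_complex_zero:
  assumes nu: "\<nu> > -1" and w: "clifford \<nu> (w :: complex) = 0"
  shows "Im w = 0 \<and> Re w > 0"
proof -
  have c0: "clifford \<nu> (cnj w) = 0" using w by (simp add: clifford_cnj[OF nu])
  have cont: "continuous_on UNIV (\<lambda>v::real. (cmod (clifford \<nu> (w * of_real v)))\<^sup>2)"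
    using nu by (intro continuous_intros) auto
  have eq: "(w - cnj w) * (\<integral>v. clifford \<nu> (w * of_real v) * clifford \<nu> (cnj w * of_real v) \<partial>power_measure \<nu>) = 0"
    unfolding lommel[OF nu] w c0 by simp
  have prod: "clifford \<nu> (w * of_real v) * clifford \<nu> (cnj w * of_real v) = of_real ((cmod (clifford \<nu> (w * of_real v)))\<^sup>2)" for v
  proof -
    have "clifford \<nu> (cnj w * of_real v) = cnj (clifford \<nu> (w * of_real v))" using clifford_cnj[OF nu, of "w * of_real v"] by simp
    then show ?thesis using complex_norm_square by metis
  qed
  have "(\<integral>v. clifford \<nu> (w * of_real v) * clifford \<nu> (cnj w * of_real v) \<partial>power_measure \<nu>) = of_real (\<integral>v. (cmod (clifford \<nu> (w * of_real v)))\<^sup>2 \<partial>power_measure \<nu>)"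
    unfolding prod integral_complex_of_real ..
  moreover have "(\<integral>v. (cmod (clifford \<nu> (w * of_real v)))\<^sup>2 \<partial>power_measure \<nu>) > 0"
    by (rule power_measure_integral_pos[OF nu cont]) (use rGamma_pos[of "\<nu> + 1"] nu in auto)
  ultimately have "w - cnj w = 0" using eq by auto
  then have im: "Im w = 0" by (simp add: complex_eq_iff)
  then have "w = of_real (Re w)" by (simp add: complex_eq_iff)
  then have "clifford \<nu> (Re w) = 0" using w clifford_of_real[OF nu, of "Re w"] by simp
  then have "Re w > 0" using clifford_pos[OF nu, of "Re w"] by force
  with im show ?thesis by simp
qed

definition clifford_zeros :: "real \<Rightarrow> real set" where
  "clifford_zeros \<nu> = {w. clifford \<nu> w = 0}"

lemma clifford_zeros_pos: "\<nu> > -1 \<Longrightarrow> w \<in> clifford_zeros \<nu> \<Longrightarrow> w > 0"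
  using clifford_pos[of \<nu> w] by (force simp: clifford_zeros_def)

text \<open>This contains the simplicity of the zeros: the squared norm of a mode is positive, hence
  \<open>clifford (\<nu> + 1)\<close>, which is minus the derivative, cannot vanish at
  \<open>w\<close>.\<close>

lemma clifford_zeros_norm_pos:
  assumes nu: "\<nu> > -1" and w: "w \<in> clifford_zeros \<nu>"
  shows "w * (clifford (\<nu> + 1) w)\<^sup>2 > 0"
proof -
  have cont: "continuous_on UNIV (\<lambda>v::real. (clifford \<nu> (w * v))\<^sup>2)"
    using nu by (intro continuous_intros) auto
  have "(\<integral>v. (clifford \<nu> (w * v))\<^sup>2 \<partial>power_measure \<nu>) > 0"
    by (rule power_measure_integral_pos[OF nu cont]) (use rGamma_pos[of "\<nu> + 1"] nu in auto)
  then show ?thesis using lommel_norm[OF nu] w by (simp add: clifford_zeros_def)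
qed

lemma clifford_zeros_simple: "\<nu> > -1 \<Longrightarrow> w \<in> clifford_zeros \<nu> \<Longrightarrow> clifford (\<nu> + 1) w \<noteq> 0"
  using clifford_zeros_norm_pos by force

lemma clifford_zeros_orthogonal:
  assumes nu: "\<nu> > -1" and w: "w \<in> clifford_zeros \<nu>" "w' \<in> clifford_zeros \<nu>" "w \<noteq> w'"
  shows "(\<integral>v. clifford \<nu> (w * v) * clifford \<nu> (w' * v) \<partial>power_measure \<nu>) = 0"
proof -
  have "clifford \<nu> (complex_of_real w) = 0" "clifford \<nu> (complex_of_real w') = 0"
    using w by (simp_all add: clifford_zeros_def clifford_of_real[OF nu])
  then have "(complex_of_real w - of_real w') * (\<integral>v. clifford \<nu> (of_real w * of_real v) * clifford \<nu> (of_real w' * of_real v) \<partial>power_measure \<nu>) = 0"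
    unfolding lommel[OF nu] by simp
  moreover have "(\<integral>v. clifford \<nu> (complex_of_real w * of_real v) * clifford \<nu> (of_real w' * of_real v) \<partial>power_measure \<nu>)
    = of_real (\<integral>v. clifford \<nu> (w * v) * clifford \<nu> (w' * v) \<partial>power_measure \<nu>)"
    by (simp only: of_real_mult[symmetric] clifford_of_real[OF nu] integral_complex_of_real)
  ultimately show ?thesis using w(3) by simp
qed

lemma clifford_holomorphic: "\<nu> > -1 \<Longrightarrow> (clifford \<nu> :: complex \<Rightarrow> complex) holomorphic_on S"
  using clifford_deriv[OF _ DERIV_ident, of \<nu>] unfolding holomorphic_on_def field_differentiable_def by blast

text \<open>Zeros of a nonconstant entire function are isolated; nonconstancy is read off from the
  derivative at 0.\<close>

lemma finite_clifford_zeros: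
  assumes nu: "\<nu> > -1"
  shows "finite {w \<in> clifford_zeros \<nu>. w \<le> R}"
proof -
  have "\<not> (clifford \<nu> :: complex \<Rightarrow> complex) constant_on UNIV"
  proof
    assume "(clifford \<nu> :: complex \<Rightarrow> complex) constant_on UNIV"
    then obtain c where "\<And>z::complex. clifford \<nu> z = c" by (auto simp: constant_on_def)
    then have "clifford \<nu> = (\<lambda>_::complex. c)" by auto
    then have "- clifford (\<nu> + 1) (0::complex) * 1 = 0"
      using clifford_deriv[OF nu DERIV_ident, of "0::complex" UNIV] DERIV_unique[OF _ DERIV_const] by metis
    then show False using rGamma_pos[of "\<nu> + 1 + 1"] nu by simp
  qed
  then have "finite {z \<in> cball 0 R. clifford \<nu> z = (0::complex)}"
    by (intro holomorphic_compact_finite_zeros[of _ UNIV] clifford_holomorphic nu) auto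
  moreover have "complex_of_real ` {w \<in> clifford_zeros \<nu>. w \<le> R} \<subseteq> {z \<in> cball 0 R. clifford \<nu> z = 0}"
    using clifford_zeros_pos[OF nu] by (auto simp: clifford_zeros_def clifford_of_real[OF nu] less_imp_le)
  ultimately have "finite (complex_of_real ` {w \<in> clifford_zeros \<nu>. w \<le> R})" by (rule rev_finite_subset)
  then show ?thesis by (rule finite_imageD) (auto intro: inj_onI)
qed

section \<open>Rayleigh's sum of the inverse zeros\<close>

lemma divide_out_zeros:
  fixes f :: "complex \<Rightarrow> complex"
  assumes f: "f holomorphic_on UNIV" and S: "finite S" "0 \<notin> S" "\<And>a. a \<in> S \<Longrightarrow> f a = 0"
  shows "\<exists>g. g holomorphic_on UNIV \<and> (\<forall>z. f z = g z * (\<Prod>a\<in>S. 1 - z / a)) \<and>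
     deriv f 0 = deriv g 0 - f 0 * (\<Sum>a\<in>S. 1 / a)"
  using S
proof (induction S rule: finite_induct)
  case empty
  then show ?case using f by auto
next
  case (insert a S)
  then obtain g where g: "g holomorphic_on UNIV" "\<And>z. f z = g z * (\<Prod>a\<in>S. 1 - z / a)"
      "deriv f 0 = deriv g 0 - f 0 * (\<Sum>a\<in>S. 1 / a)" by auto
  have a0: "a \<noteq> 0" using insert.prems by auto
  have "(\<Prod>b\<in>S. 1 - a / b) \<noteq> 0"
    using insert.hyps insert.prems by (auto simp: prod_zero_iff)
  moreover have "f a = 0" using insert.prems by auto
  ultimately have ga: "g a = 0" using g(2)[of a] by auto
  \<comment> \<open>The derivative fills the removable singularity at \<open>a\<close>. The factor
    \<open>- a\<close> normalises the divided factor to \<open>1 - z / a\<close>, so the value at 0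
    is preserved and the derivative at 0 changes by a multiple of \<open>1 / a\<close>.\<close>
  define h where "h z = - a * (if z = a then deriv g a else (g z - g a) / (z - a))" for z
  have h: "h holomorphic_on UNIV"
    unfolding h_def[abs_def] using pole_lemma_open[OF g(1) open_UNIV, of a] by (intro holomorphic_intros) auto
  have gh: "g z = h z * (1 - z / a)" for z
    using a0 ga by (auto simp: h_def field_simps)
  have "g = (\<lambda>z. h z * (1 - z / a))" using gh by auto
  moreover have "((\<lambda>z. h z * (1 - z / a)) has_field_derivative (deriv h 0 * (1 - 0 / a) + (0 - 1 / a) * h 0)) (at 0)"
    using holomorphic_derivI[OF h open_UNIV, of 0] a0 by (intro DERIV_mult) (auto intro!: derivative_eq_intros)
  ultimately have dg: "deriv g 0 = deriv h 0 - h 0 / a" using DERIV_imp_deriv by fastforce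
  have h0: "h 0 = f 0" using gh[of 0] g(2)[of 0] by simp
  have "deriv f 0 = deriv h 0 - f 0 * (\<Sum>a\<in>insert a S. 1 / a)"
    unfolding g(3) dg h0 using insert.hyps by (simp add: distrib_left)
  moreover have "f z = h z * (\<Prod>a\<in>insert a S. 1 - z / a)" for z
    using g(2)[of z] gh[of z] insert.hyps by (simp add: algebra_simps)
  ultimately show ?case using h by blast
qed

text \<open>An estimate of Borel-Caratheodory type. A holomorphic logarithm exists on the disc, its
  real part relative to the centre stays below \<open>A\<close>, and \<open>\<phi>\<close> carries
  this half-plane to the unit disc with 0 fixed, where Schwarz's lemma applies.\<close>

lemma log_deriv_bound:
  fixes g :: "complex \<Rightarrow> complex"
  assumes g: "g holomorphic_on UNIV" and R: "R > 0" and nz: "\<And>z. norm z < R \<Longrightarrow> g z \<noteq> 0"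
    and A: "\<And>z. norm z < R \<Longrightarrow> norm (g z) < norm (g 0) * exp A" and A0: "A > 0"
  shows "norm (deriv g 0 / g 0) \<le> 2 * A / R"
proof -
  obtain L where L: "L holomorphic_on ball 0 R" "\<And>z. z \<in> ball 0 R \<Longrightarrow> g z = exp (L z)"
    using contractible_imp_holomorphic_log[of g "ball 0 R"] g nz
    by (metis convex_ball convex_imp_contractible holomorphic_on_subset mem_ball_0 subset_UNIV)
  have "(L has_field_derivative deriv L 0) (at 0)" using L(1) R by (intro holomorphic_derivI[of _ "ball 0 R"]) auto
  then have "((\<lambda>z. exp (L z)) has_field_derivative exp (L 0) * deriv L 0) (at 0)"
    by (auto intro!: derivative_eq_intros)
  then have "(g has_field_derivative exp (L 0) * deriv L 0) (at 0)"
    by (rule has_field_derivative_transform_within_open[of _ _ _ "ball 0 R"]) (use L(2) R in auto)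
  then have dg: "deriv g 0 / g 0 = deriv L 0" using L(2)[of 0] R by (simp add: DERIV_imp_deriv)
  define M where "M z = L z - L 0" for z
  have Re: "Re (M z) < A" if "norm z < R" for z
  proof -
    have "exp (Re (L z)) < exp (Re (L 0)) * exp A"
      using A[OF that] L(2)[of z] L(2)[of 0] that R by (simp add: norm_exp_eq_Re)
    then show ?thesis by (simp add: M_def exp_add[symmetric])
  qed
  define \<phi> where "\<phi> u = M (of_real R * u) / (2 * of_real A - M (of_real R * u))" for u
  have den: "2 * of_real A - M z \<noteq> 0" if "norm z < R" for z
  proof
    assume "2 * of_real A - M z = 0"
    then have "Re (M z) = 2 * A" by (metis Re_complex_of_real eq_iff_diff_eq_0 of_real_mult of_real_numeral)
    then show False using Re[OF that] A0 by simp
  qed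
  have in_ball: "norm (of_real R * u) < R" if "norm u < 1" for u :: complex
    using that R by (simp add: norm_mult)
  have M: "M holomorphic_on ball 0 R" unfolding M_def[abs_def] by (intro holomorphic_intros L)
  have M1: "(\<lambda>u. M (of_real R * u)) holomorphic_on ball 0 1"
    by (rule holomorphic_on_compose_gen[of "\<lambda>u. of_real R * u" "ball 0 1" M "ball 0 R", unfolded o_def])
      (use in_ball M in \<open>auto intro!: holomorphic_intros\<close>)
  have \<phi>: "\<phi> holomorphic_on ball 0 1" unfolding \<phi>_def[abs_def]
    by (intro holomorphic_intros M1) (use den in_ball in auto)
  have \<phi>1: "norm (\<phi> u) < 1" if "norm u < 1" for u
  proof -
    let ?m = "M (of_real R * u)"
    have re: "Re ?m < A" by (rule Re[OF in_ball[OF that]])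
    have "(norm ?m)\<^sup>2 < (norm (2 * of_real A - ?m))\<^sup>2"
    proof -
      have "(norm (2 * of_real A - ?m))\<^sup>2 = (norm ?m)\<^sup>2 + 4 * A * (A - Re ?m)"
        by (simp add: cmod_power2) (simp add: power2_eq_square algebra_simps)
      moreover have "4 * A * (A - Re ?m) > 0" using re A0 by simp
      ultimately show ?thesis by linarith
    qed
    then have "norm ?m < norm (2 * of_real A - ?m)" by (rule power2_less_imp_less) simp
    then show ?thesis unfolding \<phi>_def norm_divide using den[OF in_ball[OF that]] by simp
  qed
  have \<phi>0: "\<phi> 0 = 0" by (simp add: \<phi>_def M_def)
  have le: "norm (deriv \<phi> 0) \<le> 1" using Schwarz_Lemma(2)[OF \<phi> \<phi>0 \<phi>1, of 0] by simp
  have "(M has_field_derivative deriv L 0) (at (of_real R * 0))"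
    using \<open>(L has_field_derivative deriv L 0) (at 0)\<close> unfolding M_def[abs_def] by (auto intro!: derivative_eq_intros)
  then have dM: "((\<lambda>u. M (of_real R * u)) has_field_derivative deriv L 0 * of_real R) (at 0)"
    by (rule DERIV_chain2) (auto intro!: derivative_eq_intros)
  have M0: "M (of_real R * 0) = 0" by (simp add: M_def)
  have "(\<phi> has_field_derivative (deriv L 0 * of_real R * (2 * of_real A - M (of_real R * 0)) - M (of_real R * 0) * (0 - deriv L 0 * of_real R)) /
      ((2 * of_real A - M (of_real R * 0)) * (2 * of_real A - M (of_real R * 0)))) (at 0)"
    unfolding \<phi>_def[abs_def] by (rule DERIV_divide[OF dM DERIV_diff[OF DERIV_const dM]]) (use A0 M0 in simp)
  then have "(\<phi> has_field_derivative (deriv L 0 * of_real R) / (2 * of_real A)) (at 0)"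
  proof -
    assume *: "(\<phi> has_field_derivative (deriv L 0 * of_real R * (2 * of_real A - M (of_real R * 0)) - M (of_real R * 0) * (0 - deriv L 0 * of_real R)) /
      ((2 * of_real A - M (of_real R * 0)) * (2 * of_real A - M (of_real R * 0)))) (at 0)"
    have e: "(x * (B - 0) - 0 * y) / ((B - 0) * (B - 0)) = x / B" if "B \<noteq> 0" for x y B :: complex using that by simp
    from * show ?thesis unfolding M0 by (subst (asm) e) (use A0 in simp_all)
  qed
  then have "deriv \<phi> 0 = deriv L 0 * of_real R / (2 * of_real A)" by (rule DERIV_imp_deriv)
  then have "norm (deriv \<phi> 0) = norm (deriv L 0) * R / (2 * A)" using A0 R by (simp add: norm_mult norm_divide)
  then have "norm (deriv L 0) * R \<le> 2 * A" using le A0 by (simp add: pos_divide_le_eq)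
  then show ?thesis unfolding dg using R by (simp add: field_simps)
qed

text \<open>The zeros up to \<open>R\<close> are divided out. On the circle of radius
  \<open>2 * R\<close> every divided factor has modulus at least 1, so by the maximum principle the
  quotient inherits the growth bound inside. Its logarithmic derivative at 0 is the partial sum
  minus \<open>1 / (\<nu> + 1)\<close>.\<close>

lemma clifford_zeros_inverse_sum_bound:
  assumes nu: "\<nu> > -1" and eps: "\<epsilon> > 0"
  shows "\<exists>K>0. \<forall>R>0. \<bar>(\<Sum>a\<in>{w \<in> clifford_zeros \<nu>. w \<le> R}. 1 / a) - 1 / (\<nu> + 1)\<bar> \<le> 2 * (K + 2 * \<epsilon> * R) / R"
proof -
  define f where "f = (clifford \<nu> :: complex \<Rightarrow> complex)"
  obtain C where C: "C > 0" "\<And>z. norm (f z) \<le> C * exp (\<epsilon> * norm z)"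
    using clifford_norm_bound[OF nu eps, where 'a = complex] unfolding f_def by blast
  have f: "f holomorphic_on UNIV" unfolding f_def by (rule clifford_holomorphic[OF nu])
  have f0: "f 0 = of_real (rGamma (\<nu> + 1))" "rGamma (\<nu> + 1) > 0" using nu by (auto simp: f_def intro: rGamma_pos)
  have f1: "deriv f 0 = - of_real (rGamma (\<nu> + 2))"
    unfolding f_def using DERIV_imp_deriv[OF clifford_deriv[OF nu DERIV_ident, of "0::complex"]] by (simp add: add.commute)
  \<comment> \<open>The logarithm absorbs the constant \<open>C\<close> relative to the value at 0;
    the added 1 makes \<open>K\<close> positive and the resulting bound strict, as
    \<open>log_deriv_bound\<close> demands.\<close>
  define K where "K = \<bar>ln (C / norm (f 0))\<bar> + 1"
  have K: "K > 0" by (simp add: K_def add_nonneg_pos)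
  have "\<bar>(\<Sum>a\<in>{w \<in> clifford_zeros \<nu>. w \<le> R}. 1 / a) - 1 / (\<nu> + 1)\<bar> \<le> 2 * (K + 2 * \<epsilon> * R) / R" if R: "R > 0" for R
  proof -
    define S where "S = complex_of_real ` {w \<in> clifford_zeros \<nu>. w \<le> R}"
    have S: "finite S" "0 \<notin> S" "\<And>a. a \<in> S \<Longrightarrow> f a = 0"
      using finite_clifford_zeros[OF nu, of R] clifford_zeros_pos[OF nu, of 0] by (auto simp: S_def f_def clifford_zeros_def clifford_of_real[OF nu])
    have SR: "norm a \<le> R" if aS: "a \<in> S" for a
    proof -
      obtain w where "w \<in> clifford_zeros \<nu>" "w \<le> R" "a = of_real w" using aS unfolding S_def by blast
      then show ?thesis using clifford_zeros_pos[OF nu, of w] by simp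
    qed
    have Sz: "z \<in> S" if "f z = 0" "norm z < R" for z
    proof -
      have z: "Im z = 0" "Re z > 0" using clifford_complex_zero[OF nu] that(1) by (auto simp: f_def)
      then have zz: "z = of_real (Re z)" by (simp add: complex_eq_iff)
      then have "clifford \<nu> (Re z) = 0" using that(1) clifford_of_real[OF nu, of "Re z"] by (simp add: f_def)
      moreover have "Re z \<le> R" using that(2) complex_Re_le_cmod[of z] by linarith
      ultimately show ?thesis using zz unfolding S_def clifford_zeros_def by (intro image_eqI[of _ _ "Re z"]) auto
    qed
    obtain g where g: "g holomorphic_on UNIV" "\<And>z. f z = g z * (\<Prod>a\<in>S. 1 - z / a)"
      "deriv f 0 = deriv g 0 - f 0 * (\<Sum>a\<in>S. 1 / a)"
      using divide_out_zeros[OF f S] by blast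
    have g0: "g 0 = f 0" using g(2)[of 0] by simp
    \<comment> \<open>Because the zeros are simple, none of the divided points remains a zero of the
      quotient; otherwise the derivative of \<open>f\<close> would vanish there.\<close>
    have gS: "g a \<noteq> 0" if a: "a \<in> S" for a
    proof
      assume ga: "g a = 0"
      define Q where "Q z = (\<Prod>b\<in>S - {a}. 1 - z / b)" for z
      have a0: "a \<noteq> 0" using a S(2) by auto
      have Q: "Q holomorphic_on UNIV" unfolding Q_def[abs_def] using S(2) by (intro holomorphic_intros) auto
      have "f = (\<lambda>z. g z * ((1 - z / a) * Q z))"
        using g(2) prod.remove[OF S(1) a] by (auto simp: Q_def fun_eq_iff)
      moreover have "((\<lambda>z. g z * ((1 - z / a) * Q z)) has_field_derivative
         (deriv g a * ((1 - a / a) * Q a) + ((0 - 1 / a) * Q a + deriv Q a * (1 - a / a)) * g a)) (at a)"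
        using holomorphic_derivI[OF g(1) open_UNIV, of a] holomorphic_derivI[OF Q open_UNIV, of a] a0
        by (intro DERIV_mult) (auto intro!: derivative_eq_intros)
      ultimately have "deriv f a = 0" using ga a0 DERIV_imp_deriv by fastforce
      moreover have "deriv f a = - clifford (\<nu> + 1) a"
        unfolding f_def using DERIV_imp_deriv[OF clifford_deriv[OF nu DERIV_ident, of "a::complex"]] by simp
      moreover obtain w where "w \<in> clifford_zeros \<nu>" "a = of_real w" using a by (auto simp: S_def)
      ultimately show False using clifford_zeros_simple[OF nu, of w] clifford_of_real[of "\<nu> + 1" w] nu by simp
    qed
    have gnz: "g z \<noteq> 0" if "norm z < R" for z
      using gS[of z] Sz[OF _ that] g(2)[of z] by auto
    have bound: "norm (g z) \<le> C * exp (\<epsilon> * (2 * R))" if "norm z < R" for z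
    proof (rule maximum_modulus_frontier[of g "ball 0 (2 * R)"])
      show "g holomorphic_on interior (ball 0 (2 * R))" "continuous_on (closure (ball 0 (2 * R))) g"
        using g(1) by (auto intro: holomorphic_on_subset holomorphic_on_imp_continuous_on continuous_on_subset)
      show "z \<in> ball 0 (2 * R)" using that R by simp
      fix u :: complex assume "u \<in> frontier (ball 0 (2 * R))"
      then have u: "norm u = 2 * R" using R by (simp add: frontier_ball)
      have "norm (1 - u / a) \<ge> 1" if a: "a \<in> S" for a
      proof -
        have "norm a > 0" "norm a \<le> R" using S SR[OF a] a by auto
        then have "norm (u / a) \<ge> 2" using u by (simp add: norm_divide field_simps)
        then show ?thesis using norm_triangle_ineq2[of "u / a" 1] by (simp add: norm_minus_commute)
      qed
      then have "(\<Prod>a\<in>S. norm (1 - u / a)) \<ge> 1" by (intro prod_ge_1) auto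
      then have "norm (g u) * 1 \<le> norm (g u) * (\<Prod>a\<in>S. norm (1 - u / a))" by (intro mult_left_mono) auto
      also have "\<dots> = norm (f u)" unfolding g(2) norm_mult prod_norm ..
      also have "\<dots> \<le> C * exp (\<epsilon> * (2 * R))" using C(2)[of u] u by simp
      finally show "norm (g u) \<le> C * exp (\<epsilon> * (2 * R))" by simp
    qed simp
    define A where "A = K + 2 * \<epsilon> * R"
    have "norm (deriv g 0 / g 0) \<le> 2 * A / R"
    proof (rule log_deriv_bound[OF g(1) R gnz])
      show "A > 0" using K eps R by (simp add: A_def add_pos_pos)
      fix z :: complex assume "norm z < R"
      have f0p: "norm (f 0) > 0" using f0 by simp
      have "C = norm (f 0) * exp (ln (C / norm (f 0)))" using f0p C(1) by simp
      also have "\<dots> < norm (f 0) * exp K" using f0p by (intro mult_strict_left_mono) (auto simp: K_def)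
      finally have "C * exp (\<epsilon> * (2 * R)) < norm (f 0) * exp K * exp (\<epsilon> * (2 * R))" by (intro mult_strict_right_mono) auto
      then have "C * exp (\<epsilon> * (2 * R)) < norm (f 0) * exp A" by (simp add: A_def exp_add mult_ac)
      then show "norm (g z) < norm (g 0) * exp A" using bound[OF \<open>norm z < R\<close>] g0 by simp
    qed
    moreover have "deriv g 0 / g 0 = of_real ((\<Sum>a\<in>{w \<in> clifford_zeros \<nu>. w \<le> R}. 1 / a) - 1 / (\<nu> + 1))"
    proof -
      have s: "(\<Sum>a\<in>S. 1 / a) = of_real (\<Sum>a\<in>{w \<in> clifford_zeros \<nu>. w \<le> R}. 1 / a)"
        unfolding S_def by (subst sum.reindex) (auto intro: inj_onI)
      have "rGamma (\<nu> + 1) = (\<nu> + 1) * rGamma (\<nu> + 2)" using rGamma_step[of \<nu> 0] by (simp add: add_ac)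
      then have r: "rGamma (\<nu> + 2) / rGamma (\<nu> + 1) = 1 / (\<nu> + 1)" using f0(2) nu by (auto simp: field_simps)
      have "deriv g 0 / g 0 = deriv f 0 / f 0 + (\<Sum>a\<in>S. 1 / a)"
        using g(3) g0 f0 by (simp add: field_simps)
      also have "deriv f 0 / f 0 = - of_real (rGamma (\<nu> + 2) / rGamma (\<nu> + 1))" unfolding f1 f0(1) by simp
      finally show ?thesis unfolding s r by simp
    qed
    ultimately show ?thesis unfolding A_def by (simp only: norm_of_real)
  qed
  then show ?thesis using K by blast
qed

theorem clifford_zeros_inverse_sum:
  assumes nu: "\<nu> > -1"
  shows "((\<lambda>a. 1 / a) has_sum 1 / (\<nu> + 1)) (clifford_zeros \<nu>)"
  unfolding has_sum_def tendsto_iff eventually_finite_subsets_at_top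
proof (intro allI impI)
  fix \<delta> :: real assume d: "\<delta> > 0"
  \<comment> \<open>For large \<open>R\<close> the bound tends to four times the growth rate, so the
    rate \<open>\<delta> / 16\<close> leaves \<open>\<delta> / 4\<close>. The choice of
    \<open>R0\<close> reduces the other part, \<open>2 * K / R\<close>, to
    \<open>\<delta> / 4\<close> as well.\<close>
  obtain K where K: "K > 0" "\<And>R. R > 0 \<Longrightarrow> \<bar>(\<Sum>a\<in>{w \<in> clifford_zeros \<nu>. w \<le> R}. 1 / a) - 1 / (\<nu> + 1)\<bar> \<le> 2 * (K + 2 * (\<delta> / 16) * R) / R"
    using clifford_zeros_inverse_sum_bound[OF nu, of "\<delta> / 16"] d by auto
  define R0 where "R0 = 8 * K / \<delta>"
  have R0: "R0 > 0" using K d by (simp add: R0_def)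
  have close: "\<bar>(\<Sum>a\<in>{w \<in> clifford_zeros \<nu>. w \<le> R}. 1 / a) - 1 / (\<nu> + 1)\<bar> \<le> \<delta> / 2" if "R \<ge> R0" for R
  proof -
    have R: "R > 0" using that R0 by simp
    have "2 * (K + 2 * (\<delta> / 16) * R) / R = 2 * K / R + \<delta> / 4" using R by (simp add: field_simps)
    also have "2 * K / R \<le> 2 * K / R0" using that R0 K by (intro divide_left_mono) auto
    also have "2 * K / R0 = \<delta> / 4" using K d by (simp add: R0_def)
    finally show ?thesis using K(2)[OF R] by linarith
  qed
  define kernel_zero where "kernel_zero = {w \<in> clifford_zeros \<nu>. w \<le> R0}"
  have "dist (\<Sum>a\<in>F. 1 / a) (1 / (\<nu> + 1)) < \<delta>" if F: "finite F" "kernel_zero \<subseteq> F" "F \<subseteq> clifford_zeros \<nu>" for F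
  proof -
    have nn: "1 / a \<ge> 0" if "a \<in> clifford_zeros \<nu>" for a using clifford_zeros_pos[OF nu that] by simp
    define R where "R = Max (insert R0 F)"
    have R: "R \<ge> R0" "F \<subseteq> {w \<in> clifford_zeros \<nu>. w \<le> R}" using F by (auto simp: R_def)
    have "(\<Sum>a\<in>kernel_zero. 1 / a) \<le> (\<Sum>a\<in>F. 1 / a)" using F nn by (intro sum_mono2) auto
    moreover have "(\<Sum>a\<in>F. 1 / a) \<le> (\<Sum>a\<in>{w \<in> clifford_zeros \<nu>. w \<le> R}. 1 / a)"
      using R nn finite_clifford_zeros[OF nu] by (intro sum_mono2) auto
    moreover have "\<bar>(\<Sum>a\<in>kernel_zero. 1 / a) - 1 / (\<nu> + 1)\<bar> \<le> \<delta> / 2" unfolding kernel_zero_def by (rule close) simp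
    ultimately show ?thesis using close[OF R(1)] d unfolding dist_real_def by linarith
  qed
  moreover have "finite kernel_zero" "kernel_zero \<subseteq> clifford_zeros \<nu>" using finite_clifford_zeros[OF nu] by (auto simp: kernel_zero_def)
  ultimately show "\<exists>X. finite X \<and> X \<subseteq> clifford_zeros \<nu> \<and> (\<forall>Y. finite Y \<and> X \<subseteq> Y \<and> Y \<subseteq> clifford_zeros \<nu> \<longrightarrow> dist (\<Sum>a\<in>Y. 1 / a) (1 / (\<nu> + 1)) < \<delta>)"
    by blast
qed

section \<open>Orthogonal expansions and completeness of the modes\<close>

definition L2 :: "real \<Rightarrow> (real \<Rightarrow> real) \<Rightarrow> bool" where
  "L2 \<nu> f \<longleftrightarrow> f \<in> borel_measurable borel \<and> integrable (power_measure \<nu>) (\<lambda>v. (f v)\<^sup>2)"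

definition ip :: "real \<Rightarrow> (real \<Rightarrow> real) \<Rightarrow> (real \<Rightarrow> real) \<Rightarrow> real" where
  "ip \<nu> f g = (\<integral>v. f v * g v \<partial>power_measure \<nu>)"

lemma L2_mult: "L2 \<nu> f \<Longrightarrow> L2 \<nu> g \<Longrightarrow> integrable (power_measure \<nu>) (\<lambda>v. f v * g v)"
proof -
  assume f: "L2 \<nu> f" and g: "L2 \<nu> g"
  have int: "integrable (power_measure \<nu>) (\<lambda>v. (f v)\<^sup>2 + (g v)\<^sup>2)" using f g by (auto simp: L2_def)
  have le: "\<bar>x * y\<bar> \<le> x\<^sup>2 + y\<^sup>2" for x y :: real
  proof -
    have "0 \<le> (\<bar>x\<bar> - \<bar>y\<bar>)\<^sup>2" by simp
    then have "2 * \<bar>x * y\<bar> \<le> x\<^sup>2 + y\<^sup>2" by (simp add: power2_diff abs_mult)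
    then show ?thesis by (smt (verit) abs_ge_zero)
  qed
  show ?thesis
  proof (rule Bochner_Integration.integrable_bound[OF int])
    show "AE v in power_measure \<nu>. norm (f v * g v) \<le> norm ((f v)\<^sup>2 + (g v)\<^sup>2)"
      using le by (intro AE_I2) (simp add: order_trans[OF _ abs_ge_self])
  qed (use f g in \<open>auto simp: L2_def\<close>)
qed

lemma L2_add: "L2 \<nu> f \<Longrightarrow> L2 \<nu> g \<Longrightarrow> L2 \<nu> (\<lambda>v. f v + g v)"
proof -
  assume f: "L2 \<nu> f" and g: "L2 \<nu> g"
  have "integrable (power_measure \<nu>) (\<lambda>v. (f v)\<^sup>2 + (g v)\<^sup>2 + 2 * (f v * g v))"
    using f g L2_mult[OF f g] by (auto simp: L2_def)
  then show ?thesis using f g by (auto simp: L2_def power2_sum mult.assoc)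
qed

lemma L2_cmult: "L2 \<nu> f \<Longrightarrow> L2 \<nu> (\<lambda>v. c * f v)"
  by (auto simp: L2_def power_mult_distrib)

lemma L2_diff: "L2 \<nu> f \<Longrightarrow> L2 \<nu> g \<Longrightarrow> L2 \<nu> (\<lambda>v. f v - g v)"
  using L2_add[of \<nu> f "\<lambda>v. (-1) * g v"] L2_cmult[of \<nu> g "-1"] by simp

lemma L2_sum: "(\<And>i. i \<in> I \<Longrightarrow> L2 \<nu> (f i)) \<Longrightarrow> L2 \<nu> (\<lambda>v. \<Sum>i\<in>I. f i v)"
  by (induction I rule: infinite_finite_induct) (auto simp: L2_def intro!: L2_add[unfolded L2_def])

lemma L2_continuous: "\<nu> > -1 \<Longrightarrow> continuous_on UNIV f \<Longrightarrow> L2 \<nu> f"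
  unfolding L2_def by (auto intro!: power_measure_integrable_continuous borel_measurable_continuous_onI continuous_intros)

lemma ip_commute: "ip \<nu> f g = ip \<nu> g f" by (simp add: ip_def mult.commute)

lemma ip_add: "L2 \<nu> f \<Longrightarrow> L2 \<nu> g \<Longrightarrow> L2 \<nu> h \<Longrightarrow> ip \<nu> (\<lambda>v. f v + g v) h = ip \<nu> f h + ip \<nu> g h"
  unfolding ip_def by (simp add: distrib_right L2_mult)

lemma ip_diff: "L2 \<nu> f \<Longrightarrow> L2 \<nu> g \<Longrightarrow> L2 \<nu> h \<Longrightarrow> ip \<nu> (\<lambda>v. f v - g v) h = ip \<nu> f h - ip \<nu> g h"
  unfolding ip_def by (simp add: left_diff_distrib L2_mult)

lemma ip_cmult: "ip \<nu> (\<lambda>v. c * f v) h = c * ip \<nu> f h"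
  unfolding ip_def by (simp add: mult.assoc)

lemma ip_sum: "(\<And>i. i \<in> I \<Longrightarrow> L2 \<nu> (f i)) \<Longrightarrow> L2 \<nu> h \<Longrightarrow> ip \<nu> (\<lambda>v. \<Sum>i\<in>I. f i v) h = (\<Sum>i\<in>I. ip \<nu> (f i) h)"
  unfolding ip_def by (simp add: sum_distrib_right L2_mult)

lemma ip_linear: "L2 \<nu> f \<Longrightarrow> L2 \<nu> g \<Longrightarrow> L2 \<nu> h \<Longrightarrow> ip \<nu> (\<lambda>v. t * f v + g v) h = t * ip \<nu> f h + ip \<nu> g h"
  using ip_add[OF L2_cmult[of \<nu> f t]] by (simp add: ip_cmult)

lemma ip_quad:
  assumes "L2 \<nu> f" "L2 \<nu> g"
  shows "ip \<nu> (\<lambda>v. t * f v + g v) (\<lambda>v. t * f v + g v) = t\<^sup>2 * ip \<nu> f f + 2 * t * ip \<nu> f g + ip \<nu> g g"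
proof -
  define k where "k = (\<lambda>v. t * f v + g v)"
  have k: "L2 \<nu> k" unfolding k_def by (intro L2_add L2_cmult assms)
  have 1: "ip \<nu> k h = t * ip \<nu> f h + ip \<nu> g h" if "L2 \<nu> h" for h
    unfolding k_def by (rule ip_linear[OF assms that])
  have "ip \<nu> k k = t * ip \<nu> k f + ip \<nu> k g"
    using 1[OF k] ip_commute[of \<nu> f k] ip_commute[of \<nu> g k] by simp
  also have "\<dots> = t\<^sup>2 * ip \<nu> f f + 2 * t * ip \<nu> f g + ip \<nu> g g"
    unfolding 1[OF assms(1)] 1[OF assms(2)] ip_commute[of \<nu> g f] by (simp add: power2_eq_square algebra_simps)
  finally show ?thesis unfolding k_def .
qed

lemma ip_nonneg: "ip \<nu> f f \<ge> 0" unfolding ip_def by simp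

definition mode_sq_norm :: "real \<Rightarrow> real \<Rightarrow> real" where "mode_sq_norm \<nu> a = a * (clifford (\<nu> + 1) a)\<^sup>2"

definition phi :: "real \<Rightarrow> real \<Rightarrow> real \<Rightarrow> real" where "phi \<nu> a v = clifford \<nu> (a * v) / sqrt (mode_sq_norm \<nu> a)"

definition fourier_coeff :: "real \<Rightarrow> (real \<Rightarrow> real) \<Rightarrow> real \<Rightarrow> real" where "fourier_coeff \<nu> f a = ip \<nu> f (phi \<nu> a)"

lemma continuous_phi: "\<nu> > -1 \<Longrightarrow> continuous_on UNIV (phi \<nu> a)"
  unfolding phi_def[abs_def] divide_inverse by (intro continuous_intros) auto

lemma L2_phi: "\<nu> > -1 \<Longrightarrow> L2 \<nu> (phi \<nu> a)"
  by (intro L2_continuous continuous_phi)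

lemma phi_orthonormal:
  assumes nu: "\<nu> > -1" and a: "a \<in> clifford_zeros \<nu>" "b \<in> clifford_zeros \<nu>"
  shows "ip \<nu> (phi \<nu> a) (phi \<nu> b) = (if a = b then 1 else 0)"
proof -
  have pos: "mode_sq_norm \<nu> a > 0" "mode_sq_norm \<nu> b > 0" using clifford_zeros_norm_pos[OF nu] a by (auto simp: mode_sq_norm_def)
  have "ip \<nu> (phi \<nu> a) (phi \<nu> b) = (\<integral>v. clifford \<nu> (a * v) * clifford \<nu> (b * v) \<partial>power_measure \<nu>) / (sqrt (mode_sq_norm \<nu> a) * sqrt (mode_sq_norm \<nu> b))"
    unfolding ip_def phi_def by simp
  also have "\<dots> = (if a = b then 1 else 0)"
  proof (cases "a = b")
    case True
    have "(\<integral>v. clifford \<nu> (b * v) * clifford \<nu> (b * v) \<partial>power_measure \<nu>) = mode_sq_norm \<nu> b"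
      using lommel_norm[OF nu, of b] a by (simp add: clifford_zeros_def mode_sq_norm_def power2_eq_square)
    moreover have "sqrt (mode_sq_norm \<nu> b) * sqrt (mode_sq_norm \<nu> b) = mode_sq_norm \<nu> b" using pos by simp
    ultimately show ?thesis using True pos by simp
  qed (use clifford_zeros_orthogonal[OF nu a] in simp)
  finally show ?thesis .
qed

text \<open>Pythagoras' theorem with arbitrary coefficients \<open>d\<close>: taking the Fourier
  coefficients gives Bessel's inequality, and leaving \<open>d\<close> free shows that no other
  choice approximates better.\<close>

lemma ip_expand:
  assumes nu: "\<nu> > -1" and f: "L2 \<nu> f" and F: "finite F" "F \<subseteq> clifford_zeros \<nu>"
  shows "ip \<nu> (\<lambda>v. f v - (\<Sum>a\<in>F. d a * phi \<nu> a v)) (\<lambda>v. f v - (\<Sum>a\<in>F. d a * phi \<nu> a v)) =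
    ip \<nu> f f - (\<Sum>a\<in>F. (fourier_coeff \<nu> f a)\<^sup>2) + (\<Sum>a\<in>F. (d a - fourier_coeff \<nu> f a)\<^sup>2)"
proof -
  define s where "s v = (\<Sum>a\<in>F. d a * phi \<nu> a v)" for v
  have p: "L2 \<nu> (\<lambda>v. d a * phi \<nu> a v)" for a by (intro L2_cmult L2_phi nu)
  have s: "L2 \<nu> s" unfolding s_def[abs_def] by (intro L2_sum p)
  have "ip \<nu> s f = (\<Sum>a\<in>F. d a * ip \<nu> (phi \<nu> a) f)"
    unfolding s_def[abs_def] using f p by (simp add: ip_sum ip_cmult)
  then have fs: "ip \<nu> f s = (\<Sum>a\<in>F. d a * fourier_coeff \<nu> f a)"
    unfolding fourier_coeff_def ip_commute[of \<nu> f] .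
  have "ip \<nu> s s = (\<Sum>a\<in>F. d a * ip \<nu> (phi \<nu> a) s)"
    unfolding s_def[abs_def, of] using p s[unfolded s_def[abs_def]] by (simp add: ip_sum ip_cmult)
  also have "\<dots> = (\<Sum>a\<in>F. d a * (\<Sum>b\<in>F. d b * ip \<nu> (phi \<nu> b) (phi \<nu> a)))"
  proof -
    have "ip \<nu> s (phi \<nu> a) = (\<Sum>b\<in>F. d b * ip \<nu> (phi \<nu> b) (phi \<nu> a))" for a
      unfolding s_def[abs_def] using p by (simp add: ip_sum ip_cmult L2_phi[OF nu])
    then show ?thesis unfolding ip_commute[of \<nu> s, symmetric] by simp
  qed
  also have "\<dots> = (\<Sum>a\<in>F. d a * (\<Sum>b\<in>F. if a = b then d b else 0))"
    using F phi_orthonormal[OF nu] by (intro sum.cong refl arg_cong2[where f = "(*)"]) (auto simp: subset_eq)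
  also have "\<dots> = (\<Sum>a\<in>F. (d a)\<^sup>2)" using F by (simp add: power2_eq_square)
  finally have ss: "ip \<nu> s s = (\<Sum>a\<in>F. (d a)\<^sup>2)" .
  have "ip \<nu> (\<lambda>v. f v - s v) (\<lambda>v. f v - s v) = ip \<nu> f f - 2 * ip \<nu> f s + ip \<nu> s s"
  proof -
    have 1: "ip \<nu> (\<lambda>v. f v - s v) g = ip \<nu> f g - ip \<nu> s g" if "L2 \<nu> g" for g by (rule ip_diff[OF f s that])
    show ?thesis
      using 1[OF L2_diff[OF f s]] 1[OF f] 1[OF s] ip_commute[of \<nu> f "\<lambda>v. f v - s v"] ip_commute[of \<nu> s "\<lambda>v. f v - s v"] ip_commute[of \<nu> f s]
      by simp
  qed
  also have "\<dots> = ip \<nu> f f - (\<Sum>a\<in>F. (fourier_coeff \<nu> f a)\<^sup>2) + (\<Sum>a\<in>F. (d a - fourier_coeff \<nu> f a)\<^sup>2)"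
    unfolding fs ss by (simp add: power2_diff sum.distrib sum_subtractf sum_distrib_left mult_ac)
  finally show ?thesis unfolding s_def .
qed

lemma bessel_finite:
  assumes "\<nu> > -1" "L2 \<nu> f" "finite F" "F \<subseteq> clifford_zeros \<nu>"
  shows "(\<Sum>a\<in>F. (fourier_coeff \<nu> f a)\<^sup>2) \<le> ip \<nu> f f"
  using ip_expand[OF assms, of "fourier_coeff \<nu> f"] ip_nonneg[of \<nu> "\<lambda>v. f v - (\<Sum>a\<in>F. fourier_coeff \<nu> f a * phi \<nu> a v)"] by simp

lemma fourier_coeff_summable_sq:
  assumes "\<nu> > -1" "L2 \<nu> f"
  shows "(\<lambda>a. (fourier_coeff \<nu> f a)\<^sup>2) summable_on clifford_zeros \<nu>" "(\<Sum>\<^sub>\<infinity>a\<in>clifford_zeros \<nu>. (fourier_coeff \<nu> f a)\<^sup>2) \<le> ip \<nu> f f"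
proof -
  show s: "(\<lambda>a. (fourier_coeff \<nu> f a)\<^sup>2) summable_on clifford_zeros \<nu>"
    by (rule nonneg_bdd_above_summable_on) (use bessel_finite[OF assms] in \<open>auto intro!: bdd_aboveI[where M = "ip \<nu> f f"]\<close>)
  show "(\<Sum>\<^sub>\<infinity>a\<in>clifford_zeros \<nu>. (fourier_coeff \<nu> f a)\<^sup>2) \<le> ip \<nu> f f"
    by (rule infsum_le_finite_sums[OF s]) (use bessel_finite[OF assms] in auto)
qed

lemma fourier_coeff_summable_mult:
  assumes "\<nu> > -1" "L2 \<nu> f" "L2 \<nu> g"
  shows "(\<lambda>a. fourier_coeff \<nu> f a * fourier_coeff \<nu> g a) summable_on clifford_zeros \<nu>"
proof -
  have "(\<lambda>a. ((fourier_coeff \<nu> (\<lambda>v. f v + g v) a)\<^sup>2 - (fourier_coeff \<nu> f a)\<^sup>2 - (fourier_coeff \<nu> g a)\<^sup>2) / 2) summable_on clifford_zeros \<nu>"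
    unfolding diff_conv_add_uminus divide_inverse using assms
    by (intro summable_on_cmult_left summable_on_add summable_on_uminus[THEN iffD2] fourier_coeff_summable_sq L2_add)
  also have "(\<lambda>a. ((fourier_coeff \<nu> (\<lambda>v. f v + g v) a)\<^sup>2 - (fourier_coeff \<nu> f a)\<^sup>2 - (fourier_coeff \<nu> g a)\<^sup>2) / 2) = (\<lambda>a. fourier_coeff \<nu> f a * fourier_coeff \<nu> g a)"
    using assms by (auto simp: fun_eq_iff fourier_coeff_def ip_add L2_phi power2_sum)
  finally show ?thesis .
qed

lemma power_measure_power_integral:
  assumes nu: "\<nu> > -1"
  shows "(\<integral>v. v ^ k \<partial>power_measure \<nu>) = 1 / (real k + \<nu> + 1)"
proof -
  have c: "continuous_on UNIV (\<lambda>v::real. v ^ k)" by (intro continuous_intros)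
  have "(\<integral>v. v ^ k \<partial>power_measure \<nu>) = 1 ^ k / (real k + \<nu> + 1)"
  proof (rule power_measure_integral_FTC[OF nu power_measure_integrable_continuous[OF nu c] borel_measurable_continuous_onI[OF c], where G = "\<lambda>v. v ^ k / (real k + \<nu> + 1)" and G' = "\<lambda>v. real k * v ^ (k - 1) / (real k + \<nu> + 1)"])
    show "continuous_on {0..1} (\<lambda>v. v ^ k / (real k + \<nu> + 1))" using nu by (intro continuous_intros) auto
    show "((\<lambda>v. v ^ k / (real k + \<nu> + 1)) has_vector_derivative real k * v ^ (k - 1) / (real k + \<nu> + 1)) (at v)" for v
      unfolding has_real_derivative_iff_has_vector_derivative[symmetric] using nu
      by (auto intro!: derivative_eq_intros)
    fix v :: real
    have p: "v * (real k * v ^ (k - 1)) = real k * v ^ k" by (cases k) auto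
    have "(\<nu> + 1) * (v ^ k / (real k + \<nu> + 1)) + v * (real k * v ^ (k - 1) / (real k + \<nu> + 1)) = ((\<nu> + 1) * v ^ k + v * (real k * v ^ (k - 1))) / (real k + \<nu> + 1)"
      by (simp add: add_divide_distrib)
    also have "\<dots> = v ^ k" unfolding p using nu by (simp add: field_simps)
    finally show "v ^ k = (\<nu> + 1) *\<^sub>R (v ^ k / (real k + \<nu> + 1)) + v *\<^sub>R (real k * v ^ (k - 1) / (real k + \<nu> + 1))" by simp
  qed
  then show ?thesis by simp
qed

abbreviation (input) mpow :: "nat \<Rightarrow> real \<Rightarrow> real" where "mpow k \<equiv> (\<lambda>v. v ^ k)"

lemma L2_mono: "\<nu> > -1 \<Longrightarrow> L2 \<nu> (mpow k)" by (intro L2_continuous continuous_intros)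

lemma ip_mono: "\<nu> > -1 \<Longrightarrow> ip \<nu> (mpow i) (mpow j) = 1 / (real i + real j + \<nu> + 1)"
  unfolding ip_def using power_measure_power_integral[of \<nu> "i + j"] by (simp add: power_add)

lemma fourier_coeff_mono: "fourier_coeff \<nu> (mpow k) a = bessel_moment \<nu> k a / sqrt (mode_sq_norm \<nu> a)"
  unfolding fourier_coeff_def ip_def bessel_moment_def phi_def by simp

definition moment_factor :: "real \<Rightarrow> nat \<Rightarrow> real" where "moment_factor \<nu> i = (real i + 1) * (real i + 1 + \<nu>)"

text \<open>The boundary value in the moment recursion is itself the coefficient of the constant
  function, so the recursion involves Fourier coefficients only.\<close>

lemma fourier_coeff_mono_rec:
  assumes nu: "\<nu> > -1" and a: "a \<in> clifford_zeros \<nu>"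
  shows "moment_factor \<nu> i * fourier_coeff \<nu> (mpow i) a = a * (fourier_coeff \<nu> (mpow 0) a - fourier_coeff \<nu> (mpow (Suc i)) a)"
proof -
  have b: "clifford \<nu> a = 0" using a by (simp add: clifford_zeros_def)
  have "moment_factor \<nu> i * bessel_moment \<nu> i a = a * (bessel_moment \<nu> 0 a - bessel_moment \<nu> (Suc i) a)"
    using bessel_moment_rec[OF nu b] by (simp add: moment_factor_def algebra_simps)
  then show ?thesis unfolding fourier_coeff_mono by (simp add: diff_divide_distrib[symmetric])
qed

text \<open>Rayleigh's sum of the inverse zeros is the case \<open>i = j = 0\<close>. Bessel's inequality then settles \<open>i = 0\<close>, and
  the defects of the remaining cases satisfy a recursion that forces them to vanish.\<close>

lemma parseval_mono:
  assumes nu: "\<nu> > -1"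
  shows "((\<lambda>a. fourier_coeff \<nu> (mpow i) a * fourier_coeff \<nu> (mpow j) a) has_sum 1 / (real i + real j + \<nu> + 1)) (clifford_zeros \<nu>)"
proof -
  define x where "x i = fourier_coeff \<nu> (mpow i)" for i
  define S where "S i j = (\<Sum>\<^sub>\<infinity>a\<in>clifford_zeros \<nu>. x i a * x j a)" for i j
  define D where "D i j = 1 / (real i + real j + \<nu> + 1) - S i j" for i j
  have sm: "(\<lambda>a. x i a * x j a) summable_on clifford_zeros \<nu>" for i j
    unfolding x_def by (intro fourier_coeff_summable_mult nu L2_mono)
  have hs: "((\<lambda>a. x i a * x j a) has_sum S i j) (clifford_zeros \<nu>)" for i j
    unfolding S_def using sm by (rule has_sum_infsum)
  have Dsym: "D i j = D j i" for i j by (simp add: D_def S_def mult.commute add_ac)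
  \<comment> \<open>The squared coefficients of the constant function are the inverse zeros, so
    Rayleigh's sum is Parseval's identity for that function.\<close>
  have "x 0 a * x 0 a = 1 / a" if a: "a \<in> clifford_zeros \<nu>" for a
  proof -
    have b: "clifford \<nu> a = 0" using a by (simp add: clifford_zeros_def)
    have p: "mode_sq_norm \<nu> a > 0" using clifford_zeros_norm_pos[OF nu a] by (simp add: mode_sq_norm_def)
    have "x 0 a * x 0 a = (clifford (\<nu> + 1) a)\<^sup>2 / mode_sq_norm \<nu> a"
      unfolding x_def fourier_coeff_mono bessel_moment_rec(2)[OF nu b] using p by (simp add: power2_eq_square)
    also have "\<dots> = 1 / a" using clifford_zeros_simple[OF nu a] clifford_zeros_pos[OF nu a] by (simp add: mode_sq_norm_def)
    finally show ?thesis .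
  qed
  then have "((\<lambda>a. x 0 a * x 0 a) has_sum 1 / (\<nu> + 1)) (clifford_zeros \<nu>)"
    using clifford_zeros_inverse_sum[OF nu] by (subst has_sum_cong) auto
  then have D00: "D 0 0 = 0" unfolding D_def using hs[of 0 0] has_sum_unique by fastforce
  have D0: "D 0 j = 0" for j
  proof (rule ccontr)
    assume n: "D 0 j \<noteq> 0"
    \<comment> \<open>Bessel's inequality for \<open>t\<close> plus the monomial \<open>v^j\<close>.
      The quadratic term in \<open>t\<close> drops out because the defect \<open>D 0 0\<close> is 0,
      and a linear function bounded above has slope 0.\<close>
    have ineq: "- 2 * t * D 0 j \<le> D j j" for t
    proof -
      have L: "L2 \<nu> (\<lambda>v. t * mpow 0 v + mpow j v)" by (intro L2_add L2_cmult L2_mono nu)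
      have fcx: "fourier_coeff \<nu> (\<lambda>v. t * mpow 0 v + mpow j v) a = t * x 0 a + x j a" for a
        unfolding fourier_coeff_def x_def by (rule ip_linear[OF L2_mono[OF nu] L2_mono[OF nu] L2_phi[OF nu]])
      have ipv: "ip \<nu> (\<lambda>v. t * mpow 0 v + mpow j v) (\<lambda>v. t * mpow 0 v + mpow j v)
        = t\<^sup>2 * (1 / (\<nu> + 1)) + 2 * t * (1 / (real j + \<nu> + 1)) + 1 / (real j + real j + \<nu> + 1)"
        unfolding ip_quad[OF L2_mono[OF nu, of 0] L2_mono[OF nu, of j]] ip_mono[OF nu] by simp
      have "((\<lambda>a. t\<^sup>2 * (x 0 a * x 0 a) + 2 * t * (x 0 a * x j a) + x j a * x j a) has_sum (t\<^sup>2 * S 0 0 + 2 * t * S 0 j + S j j)) (clifford_zeros \<nu>)"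
        by (intro has_sum_add has_sum_cmult_right hs)
      also have "(\<lambda>a. t\<^sup>2 * (x 0 a * x 0 a) + 2 * t * (x 0 a * x j a) + x j a * x j a) = (\<lambda>a. (fourier_coeff \<nu> (\<lambda>v. t * mpow 0 v + mpow j v) a)\<^sup>2)"
        unfolding fcx by (auto simp: fun_eq_iff power2_eq_square algebra_simps)
      finally have "t\<^sup>2 * S 0 0 + 2 * t * S 0 j + S j j \<le> ip \<nu> (\<lambda>v. t * mpow 0 v + mpow j v) (\<lambda>v. t * mpow 0 v + mpow j v)"
        using fourier_coeff_summable_sq(2)[OF nu L] infsumI by fastforce
      then have "t\<^sup>2 * S 0 0 + 2 * t * S 0 j + S j j \<le> t\<^sup>2 * (1 / (\<nu> + 1)) + 2 * t * (1 / (real j + \<nu> + 1)) + 1 / (real j + real j + \<nu> + 1)"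
        unfolding ipv .
      moreover have "S 0 0 = 1 / (\<nu> + 1)" using D00 by (simp add: D_def)
      ultimately show ?thesis by (simp add: D_def algebra_simps)
    qed
    have "- 2 * (- (D j j + 1) / (2 * D 0 j)) * D 0 j = D j j + 1" using n by simp
    then show False using ineq[of "- (D j j + 1) / (2 * D 0 j)"] by linarith
  qed
  \<comment> \<open>After one use of the recursion both sides stand for sums of
    \<open>a * (x 0 a - x (Suc i) a) * (x 0 a - x (Suc j) a)\<close>, which is symmetric in
    \<open>i\<close> and \<open>j\<close>. The exact inner products satisfy the same relation, hence
    so do the defects.\<close>
  have rel: "moment_factor \<nu> i * D i (Suc j) = moment_factor \<nu> j * D j (Suc i)" for i j
  proof -
    have "moment_factor \<nu> i * (x i a * x 0 a - x i a * x (Suc j) a) = moment_factor \<nu> j * (x j a * x 0 a - x j a * x (Suc i) a)"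
      if "a \<in> clifford_zeros \<nu>" for a
    proof -
      have "moment_factor \<nu> i * (x i a * x 0 a - x i a * x (Suc j) a) = (moment_factor \<nu> i * x i a) * (x 0 a - x (Suc j) a)" by (simp add: algebra_simps)
      also have "\<dots> = (moment_factor \<nu> j * x j a) * (x 0 a - x (Suc i) a)"
        unfolding x_def fourier_coeff_mono_rec[OF nu that] by simp
      finally show ?thesis by (simp add: algebra_simps)
    qed
    moreover have "((\<lambda>a. moment_factor \<nu> i * (x i a * x 0 a - x i a * x (Suc j) a)) has_sum moment_factor \<nu> i * (S i 0 - S i (Suc j))) (clifford_zeros \<nu>)" for i j
      unfolding diff_conv_add_uminus by (intro has_sum_cmult_right has_sum_add has_sum_uminus[THEN iffD2] hs) (simp add: hs)
    ultimately have "moment_factor \<nu> i * (S i 0 - S i (Suc j)) = moment_factor \<nu> j * (S j 0 - S j (Suc i))"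
      using has_sum_unique has_sum_cong[of "clifford_zeros \<nu>" "\<lambda>a. moment_factor \<nu> i * (x i a * x 0 a - x i a * x (Suc j) a)" "\<lambda>a. moment_factor \<nu> j * (x j a * x 0 a - x j a * x (Suc i) a)"]
      by blast
    moreover have "S i 0 = 1 / (real i + \<nu> + 1)" for i using D0[of i] Dsym[of 0 i] by (simp add: D_def)
    moreover have "moment_factor \<nu> i * (1 / (real i + \<nu> + 1) - 1 / (real i + real (Suc j) + \<nu> + 1)) = moment_factor \<nu> j * (1 / (real j + \<nu> + 1) - 1 / (real j + real (Suc i) + \<nu> + 1))"
    proof -
      have p: "real i + \<nu> + 1 > 0" "real j + \<nu> + 1 > 0" "real i + real j + \<nu> + 2 > 0" using nu by auto
      have 1: "moment_factor \<nu> i * (1 / (real i + \<nu> + 1) - 1 / (real i + real (Suc j) + \<nu> + 1)) = (real i + 1) * (real j + 1) / (real i + real j + \<nu> + 2)"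
        if "real i + \<nu> + 1 > 0" "real i + real j + \<nu> + 2 > 0" for i j
      proof -
        have e: "real i + real (Suc j) + \<nu> + 1 = real i + real j + \<nu> + 2" "real i + 1 + \<nu> = real i + \<nu> + 1" by simp_all
        have "1 / (real i + \<nu> + 1) - 1 / (real i + real j + \<nu> + 2) = (real j + 1) / ((real i + \<nu> + 1) * (real i + real j + \<nu> + 2))"
          using that by (simp add: field_simps)
        then show ?thesis unfolding moment_factor_def e using that by simp
      qed
      show ?thesis using 1[of i j] 1[of j i] p by (simp add: add_ac mult_ac)
    qed
    ultimately show ?thesis by (simp add: D_def algebra_simps)
  qed
  have "D i j = 0" for i j
  proof (induction i arbitrary: j)
    case 0 then show ?case by (rule D0)
  next
    case (Suc i)
    have "moment_factor \<nu> j * D j (Suc i) = 0" using rel[of i j] Suc.IH[of "Suc j"] by simp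
    moreover have "moment_factor \<nu> j \<noteq> 0" using nu by (simp add: moment_factor_def add_nonneg_eq_0_iff)
    ultimately show ?case using Dsym by simp
  qed
  then have "S i j = 1 / (real i + real j + \<nu> + 1)" by (simp add: D_def)
  then show ?thesis using hs[of i j] by (simp add: x_def)
qed

text \<open>Membership in the closed span of the modes. For square-integrable functions it is
  equivalent to Parseval's identity, but it is visibly stable under sums and limits; this carries
  the identity from monomials to functions with jumps and singularities.\<close>

definition approximable :: "real \<Rightarrow> (real \<Rightarrow> real) \<Rightarrow> bool" where
  "approximable \<nu> f \<longleftrightarrow> L2 \<nu> f \<and> (\<forall>\<epsilon>>0. \<exists>F d. finite F \<and> F \<subseteq> clifford_zeros \<nu> \<and>
     ip \<nu> (\<lambda>v. f v - (\<Sum>a\<in>F. d a * phi \<nu> a v)) (\<lambda>v. f v - (\<Sum>a\<in>F. d a * phi \<nu> a v)) < \<epsilon>)"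

lemma ip_sum_le:
  assumes "L2 \<nu> f" "L2 \<nu> g"
  shows "ip \<nu> (\<lambda>v. f v + g v) (\<lambda>v. f v + g v) \<le> 2 * ip \<nu> f f + 2 * ip \<nu> g g"
proof -
  have "ip \<nu> (\<lambda>v. f v + g v) (\<lambda>v. f v + g v) \<le> (\<integral>v. 2 * (f v * f v) + 2 * (g v * g v) \<partial>power_measure \<nu>)"
    unfolding ip_def
  proof (rule integral_mono)
    show "(f v + g v) * (f v + g v) \<le> 2 * (f v * f v) + 2 * (g v * g v)" for v
      using sum_squares_ge_zero[of "f v - g v" 0] by (simp add: algebra_simps)
  qed (use assms in \<open>auto intro!: L2_mult L2_add integrable_mult_right Bochner_Integration.integrable_add\<close>)
  also have "\<dots> = 2 * ip \<nu> f f + 2 * ip \<nu> g g"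
    unfolding ip_def using assms by (subst Bochner_Integration.integral_add) (auto intro!: L2_mult integrable_mult_right)
  finally show ?thesis .
qed

lemma approximable_parseval:
  assumes nu: "\<nu> > -1" and f: "approximable \<nu> f"
  shows "((\<lambda>a. (fourier_coeff \<nu> f a)\<^sup>2) has_sum ip \<nu> f f) (clifford_zeros \<nu>)"
proof -
  have L: "L2 \<nu> f" using f by (simp add: approximable_def)
  have "ip \<nu> f f \<le> (\<Sum>\<^sub>\<infinity>a\<in>clifford_zeros \<nu>. (fourier_coeff \<nu> f a)\<^sup>2)"
  proof (rule field_le_epsilon)
    fix e :: real assume "e > 0"
    then obtain F d where F: "finite F" "F \<subseteq> clifford_zeros \<nu>"
      "ip \<nu> (\<lambda>v. f v - (\<Sum>a\<in>F. d a * phi \<nu> a v)) (\<lambda>v. f v - (\<Sum>a\<in>F. d a * phi \<nu> a v)) < e"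
      using f unfolding approximable_def by blast
    have "ip \<nu> f f - (\<Sum>a\<in>F. (fourier_coeff \<nu> f a)\<^sup>2) + (\<Sum>a\<in>F. (d a - fourier_coeff \<nu> f a)\<^sup>2) < e"
      using F(3) unfolding ip_expand[OF nu L F(1,2)] .
    moreover have "(\<Sum>a\<in>F. (d a - fourier_coeff \<nu> f a)\<^sup>2) \<ge> 0" by (intro sum_nonneg) auto
    moreover have "(\<Sum>a\<in>F. (fourier_coeff \<nu> f a)\<^sup>2) \<le> (\<Sum>\<^sub>\<infinity>a\<in>clifford_zeros \<nu>. (fourier_coeff \<nu> f a)\<^sup>2)"
      using fourier_coeff_summable_sq(1)[OF nu L] F by (intro finite_sum_le_infsum) auto
    ultimately show "ip \<nu> f f \<le> (\<Sum>\<^sub>\<infinity>a\<in>clifford_zeros \<nu>. (fourier_coeff \<nu> f a)\<^sup>2) + e" by linarith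
  qed
  then have "(\<Sum>\<^sub>\<infinity>a\<in>clifford_zeros \<nu>. (fourier_coeff \<nu> f a)\<^sup>2) = ip \<nu> f f" using fourier_coeff_summable_sq(2)[OF nu L] by simp
  then show ?thesis using fourier_coeff_summable_sq(1)[OF nu L] has_sum_infsum by metis
qed

lemma parseval_approximable:
  assumes nu: "\<nu> > -1" and L: "L2 \<nu> f" and s: "((\<lambda>a. (fourier_coeff \<nu> f a)\<^sup>2) has_sum ip \<nu> f f) (clifford_zeros \<nu>)"
  shows "approximable \<nu> f"
  unfolding approximable_def
proof (intro conjI allI impI L)
  fix e :: real assume e: "e > 0"
  obtain F where F: "finite F" "F \<subseteq> clifford_zeros \<nu>" "dist (\<Sum>a\<in>F. (fourier_coeff \<nu> f a)\<^sup>2) (ip \<nu> f f) < e"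
    using s e unfolding has_sum_def tendsto_iff eventually_finite_subsets_at_top by blast
  have "ip \<nu> (\<lambda>v. f v - (\<Sum>a\<in>F. fourier_coeff \<nu> f a * phi \<nu> a v)) (\<lambda>v. f v - (\<Sum>a\<in>F. fourier_coeff \<nu> f a * phi \<nu> a v)) < e"
    unfolding ip_expand[OF nu L F(1,2)] using F(3) by (simp add: dist_real_def)
  then show "\<exists>F d. finite F \<and> F \<subseteq> clifford_zeros \<nu> \<and>
     ip \<nu> (\<lambda>v. f v - (\<Sum>a\<in>F. d a * phi \<nu> a v)) (\<lambda>v. f v - (\<Sum>a\<in>F. d a * phi \<nu> a v)) < e"
    using F by blast
qed

lemma approximable_limit:
  assumes nu: "\<nu> > -1" and f: "L2 \<nu> f"
    and g: "\<And>e. e > 0 \<Longrightarrow> \<exists>g. approximable \<nu> g \<and> ip \<nu> (\<lambda>v. f v - g v) (\<lambda>v. f v - g v) < e"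
  shows "approximable \<nu> f"
  unfolding approximable_def
proof (intro conjI allI impI f)
  fix e :: real assume e: "e > 0"
  obtain g where g: "approximable \<nu> g" "ip \<nu> (\<lambda>v. f v - g v) (\<lambda>v. f v - g v) < e / 4" using g[of "e / 4"] e by auto
  obtain F d where F: "finite F" "F \<subseteq> clifford_zeros \<nu>"
     "ip \<nu> (\<lambda>v. g v - (\<Sum>a\<in>F. d a * phi \<nu> a v)) (\<lambda>v. g v - (\<Sum>a\<in>F. d a * phi \<nu> a v)) < e / 4"
    using g(1) e unfolding approximable_def by (meson divide_pos_pos zero_less_numeral)
  have Lg: "L2 \<nu> g" using g(1) by (simp add: approximable_def)
  have "L2 \<nu> (\<lambda>v. g v - (\<Sum>a\<in>F. d a * phi \<nu> a v))"
    by (intro L2_diff Lg L2_sum L2_cmult L2_phi nu)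
  from ip_sum_le[OF L2_diff[OF f Lg] this]
  have "ip \<nu> (\<lambda>v. f v - (\<Sum>a\<in>F. d a * phi \<nu> a v)) (\<lambda>v. f v - (\<Sum>a\<in>F. d a * phi \<nu> a v)) < e"
    using g(2) F(3) by simp
  then show "\<exists>F d. finite F \<and> F \<subseteq> clifford_zeros \<nu> \<and>
     ip \<nu> (\<lambda>v. f v - (\<Sum>a\<in>F. d a * phi \<nu> a v)) (\<lambda>v. f v - (\<Sum>a\<in>F. d a * phi \<nu> a v)) < e"
    using F by blast
qed

lemma approximable_add:
  assumes nu: "\<nu> > -1" and f: "approximable \<nu> f" and g: "approximable \<nu> g"
  shows "approximable \<nu> (\<lambda>v. f v + g v)"
proof -
  have L: "L2 \<nu> f" "L2 \<nu> g" using f g by (auto simp: approximable_def)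
  show ?thesis unfolding approximable_def
  proof (intro conjI allI impI L2_add L)
    fix e :: real assume e: "e > 0"
    obtain F d where F: "finite F" "F \<subseteq> clifford_zeros \<nu>"
       "ip \<nu> (\<lambda>v. f v - (\<Sum>a\<in>F. d a * phi \<nu> a v)) (\<lambda>v. f v - (\<Sum>a\<in>F. d a * phi \<nu> a v)) < e / 4"
      using f e unfolding approximable_def by (meson divide_pos_pos zero_less_numeral)
    obtain G c where G: "finite G" "G \<subseteq> clifford_zeros \<nu>"
       "ip \<nu> (\<lambda>v. g v - (\<Sum>a\<in>G. c a * phi \<nu> a v)) (\<lambda>v. g v - (\<Sum>a\<in>G. c a * phi \<nu> a v)) < e / 4"
      using g e unfolding approximable_def by (meson divide_pos_pos zero_less_numeral)
    define b where "b a = (if a \<in> F then d a else 0) + (if a \<in> G then c a else 0)" for a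
    have "(\<Sum>a\<in>F \<union> G. b a * phi \<nu> a v) = (\<Sum>a\<in>F. d a * phi \<nu> a v) + (\<Sum>a\<in>G. c a * phi \<nu> a v)" for v
    proof -
      have "(\<Sum>a\<in>F. d a * phi \<nu> a v) = (\<Sum>a\<in>F \<union> G. (if a \<in> F then d a else 0) * phi \<nu> a v)"
        using F G by (intro sum.mono_neutral_cong_left) auto
      moreover have "(\<Sum>a\<in>G. c a * phi \<nu> a v) = (\<Sum>a\<in>F \<union> G. (if a \<in> G then c a else 0) * phi \<nu> a v)"
        using F G by (intro sum.mono_neutral_cong_left) auto
      ultimately show ?thesis unfolding b_def distrib_right sum.distrib by simp
    qed
    then have e1: "(\<lambda>v. f v + g v - (\<Sum>a\<in>F \<union> G. b a * phi \<nu> a v)) = (\<lambda>v. (f v - (\<Sum>a\<in>F. d a * phi \<nu> a v)) + (g v - (\<Sum>a\<in>G. c a * phi \<nu> a v)))"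
      by auto
    have "L2 \<nu> (\<lambda>v. f v - (\<Sum>a\<in>F. d a * phi \<nu> a v))" "L2 \<nu> (\<lambda>v. g v - (\<Sum>a\<in>G. c a * phi \<nu> a v))"
      by (intro L2_diff L L2_sum L2_cmult L2_phi nu)+
    from ip_sum_le[OF this]
    have "ip \<nu> (\<lambda>v. f v + g v - (\<Sum>a\<in>F \<union> G. b a * phi \<nu> a v)) (\<lambda>v. f v + g v - (\<Sum>a\<in>F \<union> G. b a * phi \<nu> a v)) < e"
      unfolding e1 using F(3) G(3) by linarith
    then show "\<exists>F d. finite F \<and> F \<subseteq> clifford_zeros \<nu> \<and>
     ip \<nu> (\<lambda>v. f v + g v - (\<Sum>a\<in>F. d a * phi \<nu> a v)) (\<lambda>v. f v + g v - (\<Sum>a\<in>F. d a * phi \<nu> a v)) < e"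
      using F(1,2) G(1,2) by (intro exI[of _ "F \<union> G"] exI[of _ b]) auto
  qed
qed

lemma approximable_cmult:
  assumes nu: "\<nu> > -1" and f: "approximable \<nu> f"
  shows "approximable \<nu> (\<lambda>v. c * f v)"
proof (rule parseval_approximable[OF nu])
  show "L2 \<nu> (\<lambda>v. c * f v)" using f by (intro L2_cmult) (simp add: approximable_def)
  have "((\<lambda>a. c\<^sup>2 * (fourier_coeff \<nu> f a)\<^sup>2) has_sum c\<^sup>2 * ip \<nu> f f) (clifford_zeros \<nu>)"
    by (intro has_sum_cmult_right approximable_parseval nu f)
  moreover have "ip \<nu> (\<lambda>v. c * f v) (\<lambda>v. c * f v) = c\<^sup>2 * ip \<nu> f f"
    unfolding ip_cmult by (subst ip_commute) (simp add: ip_cmult power2_eq_square)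
  ultimately show "((\<lambda>a. (fourier_coeff \<nu> (\<lambda>v. c * f v) a)\<^sup>2) has_sum ip \<nu> (\<lambda>v. c * f v) (\<lambda>v. c * f v)) (clifford_zeros \<nu>)"
    by (simp add: fourier_coeff_def ip_cmult power_mult_distrib)
qed

lemma approximable_mono: "\<nu> > -1 \<Longrightarrow> approximable \<nu> (mpow k)"
  using parseval_mono[of \<nu> k k] by (intro parseval_approximable L2_mono) (auto simp: ip_mono power2_eq_square)

lemma approximable_zero: "\<nu> > -1 \<Longrightarrow> approximable \<nu> (\<lambda>v. 0)"
  using approximable_cmult[OF _ approximable_mono[of \<nu> 0], of 0] by simp

lemma approximable_sum: "\<nu> > -1 \<Longrightarrow> (\<And>i. i \<in> I \<Longrightarrow> approximable \<nu> (f i)) \<Longrightarrow> approximable \<nu> (\<lambda>v. \<Sum>i\<in>I. f i v)"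
  by (induction I rule: infinite_finite_induct) (auto simp: approximable_zero approximable_add)

lemma approximable_poly: "\<nu> > -1 \<Longrightarrow> approximable \<nu> (poly p)"
  unfolding poly_altdef[abs_def] by (intro approximable_sum approximable_cmult approximable_mono)

text \<open>Bernstein polynomials approximate uniformly on the unit interval, and the total mass of
  the weight is finite, so they also approximate in mean square.\<close>

lemma approximable_continuous:
  assumes nu: "\<nu> > -1" and c: "continuous_on UNIV f"
  shows "approximable \<nu> f"
proof (rule approximable_limit[OF nu L2_continuous[OF nu c]])
  fix e :: real assume e: "e > 0"
  \<comment> \<open>Chosen so that the squared uniform error times the total mass
    \<open>1 / (\<nu> + 1)\<close> is \<open>e / 2\<close>.\<close>
  define \<eta> where "\<eta> = sqrt (e * (\<nu> + 1) / 2)"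
  have eta: "\<eta> > 0" "\<eta>\<^sup>2 = e * (\<nu> + 1) / 2" using e nu by (auto simp: \<eta>_def)
  have "continuous_on {0..1} f" using c continuous_on_subset by blast
  then obtain n where n: "\<And>x. x \<in> {0..1} \<Longrightarrow> \<bar>f x - (\<Sum>k\<le>n. f (real k / real n) * Bernstein n k x)\<bar> < \<eta>"
    using Bernstein_Weierstrass[of f \<eta>] eta(1) by blast
  define g where "g x = (\<Sum>k\<le>n. f (real k / real n) * Bernstein n k x)" for x
  have B: "Bernstein n k = poly ([:of_nat (n choose k):] * [:0, 1:] ^ k * [:1, -1:] ^ (n - k))" for k
    by (auto simp: fun_eq_iff Bernstein_def)
  have "approximable \<nu> (Bernstein n k)" for k unfolding B by (rule approximable_poly[OF nu])
  then have g: "approximable \<nu> g" unfolding g_def[abs_def] by (intro approximable_sum approximable_cmult nu)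
  have Lg: "L2 \<nu> g" using g by (simp add: approximable_def)
  have "ip \<nu> (\<lambda>v. f v - g v) (\<lambda>v. f v - g v) \<le> (\<integral>v. \<eta>\<^sup>2 * v ^ 0 \<partial>power_measure \<nu>)"
    unfolding ip_def
  proof (rule integral_mono_AE)
    show "integrable (power_measure \<nu>) (\<lambda>v. (f v - g v) * (f v - g v))"
      by (intro L2_mult L2_diff L2_continuous nu c Lg)
    show "integrable (power_measure \<nu>) (\<lambda>v. \<eta>\<^sup>2 * v ^ 0)" by (intro power_measure_integrable_continuous nu continuous_intros)
    show "AE v in power_measure \<nu>. (f v - g v) * (f v - g v) \<le> \<eta>\<^sup>2 * v ^ 0"
      using AE_power_measure[of \<nu>]
    proof (rule eventually_mono)
      fix v :: real assume "0 < v \<and> v < 1"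
      then have "\<bar>f v - g v\<bar> \<le> \<eta>" using n[of v] by (simp add: g_def)
      then have "(f v - g v)\<^sup>2 \<le> \<eta>\<^sup>2" by (rule power2_le_iff_abs_le[THEN iffD2, rotated]) (use eta in simp)
      then show "(f v - g v) * (f v - g v) \<le> \<eta>\<^sup>2 * v ^ 0" by (simp add: power2_eq_square)
    qed
  qed
  also have "\<dots> = e / 2" using power_measure_power_integral[OF nu, of 0] nu eta(2) by simp
  finally show "\<exists>g. approximable \<nu> g \<and> ip \<nu> (\<lambda>v. f v - g v) (\<lambda>v. f v - g v) < e" using g e by (intro exI[of _ g]) auto
qed

text \<open>A factor \<open>ct n\<close> that vanishes near the exceptional set makes
  \<open>f\<close> continuous everywhere. The products converge in mean square with majorant
  \<open>f^2\<close>, so \<open>f\<close> may jump or be unbounded at exceptional points.\<close>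

lemma approximable_piecewise:
  assumes nu: "\<nu> > -1" and f: "L2 \<nu> f" and U: "open U" "U \<noteq> UNIV" "AE v in power_measure \<nu>. v \<in> U" and c: "continuous_on U f"
  shows "approximable \<nu> f"
proof (rule approximable_limit[OF nu f])
  fix e :: real assume e: "e > 0"
  define C where "C = - U"
  have C: "closed C" "C \<noteq> {}" using U by (auto simp: C_def)
  define ct where "ct n v = max 0 (min 1 (real n * infdist v C - 1))" for n v
  define h where "h n v = ct n v * f v" for n v
  have chi: "0 \<le> ct n v" "ct n v \<le> 1" for n v by (auto simp: ct_def)
  have cchi: "continuous_on S (ct n)" for S n unfolding ct_def[abs_def] by (intro continuous_intros)
  have ch: "continuous_on UNIV (h n)" for n
  proof -
    define W where "W = {v. real n * infdist v C < 1}"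
    have W: "open W" unfolding W_def by (intro open_Collect_less continuous_intros)
    have "continuous_on U (h n)" unfolding h_def[abs_def] by (intro continuous_intros cchi c)
    moreover have "continuous_on W (h n)"
      by (rule continuous_on_cong[THEN iffD1, OF refl _ continuous_on_const[of _ 0]]) (auto simp: W_def h_def ct_def)
    moreover have "U \<union> W = UNIV" by (auto simp: W_def C_def)
    ultimately show ?thesis using U(1) W continuous_on_open_Un by metis
  qed
  have lim: "(\<lambda>n. h n v) \<longlonglongrightarrow> f v" if "v \<in> U" for v
  proof -
    have "infdist v C > 0" using that C in_closed_iff_infdist_zero[OF C, of v] infdist_nonneg[of v C] by (auto simp: C_def)
    then obtain N where N: "real N * infdist v C > 2" using reals_Archimedean3 by blast
    have "ct n v = 1" if "n \<ge> N" for n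
    proof -
      have "real n * infdist v C \<ge> real N * infdist v C" using that infdist_nonneg by (intro mult_right_mono) auto
      then show ?thesis using N by (simp add: ct_def)
    qed
    then show ?thesis by (intro tendsto_eventually eventually_sequentiallyI[of N]) (simp add: h_def)
  qed
  have "(\<lambda>n. \<integral>v. (f v - h n v)\<^sup>2 \<partial>power_measure \<nu>) \<longlonglongrightarrow> (\<integral>v. 0 \<partial>power_measure \<nu>)"
  proof (rule integral_dominated_convergence[where w = "\<lambda>v. (f v)\<^sup>2"])
    show "integrable (power_measure \<nu>) (\<lambda>v. (f v)\<^sup>2)" using f by (simp add: L2_def)
    show "(\<lambda>v. (f v - h n v)\<^sup>2) \<in> borel_measurable (power_measure \<nu>)" for n
    proof -
      have "(\<lambda>v. (f v - h n v)\<^sup>2) \<in> borel_measurable borel"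
        using f borel_measurable_continuous_onI[OF ch[of n]] by (auto simp: L2_def)
      then show ?thesis by simp
    qed
    show "AE v in power_measure \<nu>. (\<lambda>n. (f v - h n v)\<^sup>2) \<longlonglongrightarrow> 0"
      using U(3) by (rule eventually_mono) (use lim in \<open>auto intro!: tendsto_eq_intros\<close>)
    show "AE v in power_measure \<nu>. norm ((f v - h n v)\<^sup>2) \<le> (f v)\<^sup>2" for n
    proof (rule AE_I2)
      fix v
      have "f v - h n v = (1 - ct n v) * f v" by (simp add: h_def algebra_simps)
      moreover have "\<bar>(1 - ct n v) * f v\<bar> \<le> \<bar>f v\<bar>" using chi[of n v] by (simp add: abs_mult mult_left_le_one_le)
      ultimately show "norm ((f v - h n v)\<^sup>2) \<le> (f v)\<^sup>2" by (simp add: abs_le_square_iff)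
    qed
  qed simp
  then have "eventually (\<lambda>n. (\<integral>v. (f v - h n v)\<^sup>2 \<partial>power_measure \<nu>) < e) sequentially"
    using e by (auto dest!: order_tendstoD(2)[where a = e])
  then obtain n where "(\<integral>v. (f v - h n v)\<^sup>2 \<partial>power_measure \<nu>) < e" by (auto simp: eventually_sequentially)
  then show "\<exists>g. approximable \<nu> g \<and> ip \<nu> (\<lambda>v. f v - g v) (\<lambda>v. f v - g v) < e"
    using approximable_continuous[OF nu ch[of n]] by (intro exI[of _ "h n"]) (simp add: ip_def power2_eq_square)
qed

theorem parseval:
  assumes nu: "\<nu> > -1" and f: "approximable \<nu> f" and g: "approximable \<nu> g"
  shows "((\<lambda>a. fourier_coeff \<nu> f a * fourier_coeff \<nu> g a) has_sum ip \<nu> f g) (clifford_zeros \<nu>)"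
proof -
  have L: "L2 \<nu> f" "L2 \<nu> g" using f g by (auto simp: approximable_def)
  have "((\<lambda>a. (1 / 2) * ((fourier_coeff \<nu> (\<lambda>v. f v + g v) a)\<^sup>2 + (-1) * (fourier_coeff \<nu> f a)\<^sup>2 + (-1) * (fourier_coeff \<nu> g a)\<^sup>2)) has_sum
     (1 / 2) * (ip \<nu> (\<lambda>v. f v + g v) (\<lambda>v. f v + g v) + (-1) * ip \<nu> f f + (-1) * ip \<nu> g g)) (clifford_zeros \<nu>)"
    by (intro has_sum_cmult_right has_sum_add approximable_parseval nu f g approximable_add)
  moreover have "(1 / 2) * ((fourier_coeff \<nu> (\<lambda>v. f v + g v) a)\<^sup>2 + (-1) * (fourier_coeff \<nu> f a)\<^sup>2 + (-1) * (fourier_coeff \<nu> g a)\<^sup>2) = fourier_coeff \<nu> f a * fourier_coeff \<nu> g a" for a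
    using L nu by (simp add: fourier_coeff_def ip_add L2_phi power2_sum)
  moreover have "(1 / 2) * (ip \<nu> (\<lambda>v. f v + g v) (\<lambda>v. f v + g v) + (-1) * ip \<nu> f f + (-1) * ip \<nu> g g) = ip \<nu> f g"
  proof -
    have 1: "ip \<nu> (\<lambda>v. f v + g v) k = ip \<nu> f k + ip \<nu> g k" if "L2 \<nu> k" for k by (rule ip_add[OF L that])
    show ?thesis
      using 1[OF L2_add[OF L]] 1[OF L(1)] 1[OF L(2)] ip_commute[of \<nu> f "\<lambda>v. f v + g v"] ip_commute[of \<nu> g "\<lambda>v. f v + g v"] ip_commute[of \<nu> f g]
      by simp
  qed
  ultimately show ?thesis by simp
qed

text \<open>Otherwise Parseval's identity would make the constant 1 a finite combination of modes
  almost everywhere. Every mode is continuous and vanishes at 1, which contradicts this close to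
  1.\<close>

lemma infinite_clifford_zeros:
  assumes nu: "\<nu> > -1"
  shows "infinite (clifford_zeros \<nu>)"
proof
  assume fin: "finite (clifford_zeros \<nu>)"
  define h where "h v = 1 - (\<Sum>a\<in>clifford_zeros \<nu>. fourier_coeff \<nu> (mpow 0) a * phi \<nu> a v)" for v
  have "(\<Sum>a\<in>clifford_zeros \<nu>. (fourier_coeff \<nu> (mpow 0) a)\<^sup>2) = ip \<nu> (mpow 0) (mpow 0)"
    using approximable_parseval[OF nu approximable_mono[OF nu, of 0]] fin has_sum_finite has_sum_unique by blast
  then have "ip \<nu> h h = 0"
    using ip_expand[OF nu L2_mono[OF nu, of 0] fin order_refl, of "fourier_coeff \<nu> (mpow 0)"] by (simp add: h_def[abs_def])
  moreover have c: "continuous_on UNIV h" unfolding h_def[abs_def] by (intro continuous_intros continuous_phi nu)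
  ultimately have ae: "AE v in power_measure \<nu>. h v * h v = 0"
    unfolding ip_def by (subst (asm) integral_nonneg_eq_0_iff_AE) (auto intro!: power_measure_integrable_continuous nu continuous_intros)
  have "phi \<nu> a 1 = 0" if "a \<in> clifford_zeros \<nu>" for a using that by (simp add: phi_def clifford_zeros_def)
  then have "h 1 = 1" by (simp add: h_def)
  moreover have "isCont h 1" using c continuous_on_eq_continuous_at by blast
  ultimately have "eventually (\<lambda>v. h v > 0) (at 1)" by (intro order_tendstoD(1)[of h 1]) (auto simp: isCont_def)
  then obtain d where d: "d > 0" "\<And>v. v \<noteq> 1 \<Longrightarrow> \<bar>v - 1\<bar> < d \<Longrightarrow> h v > 0"
    unfolding eventually_at by (auto simp: dist_real_def)
  obtain v where "max 0 (1 - d) < v" "v < 1" "h v * h v = 0"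
    using power_measure_AE_ex[OF ae, of "max 0 (1 - d)" 1] d by auto
  then show False using d(2)[of v] by auto
qed

section \<open>Parseval's identity for dilated kernels\<close>

lemma power_measure_has_integral_nonneg:
  assumes m: "f \<in> borel_measurable borel" and nn: "\<And>v. 0 < v \<Longrightarrow> v < 1 \<Longrightarrow> f v \<ge> (0::real)"
    and i: "((\<lambda>v. v powr \<nu> * f v) has_integral I) {0..1}"
  shows "integrable (power_measure \<nu>) f" "integral\<^sup>L (power_measure \<nu>) f = I"
proof -
  define g where "g v = indicator {0<..<1} v * v powr \<nu> * f v" for v
  have "((\<lambda>v. v powr \<nu> * f v) has_integral I) {0<..<1}" using i by (simp add: has_integral_Icc_iff_Ioo)
  moreover have "g = (\<lambda>v. if v \<in> {0<..<1} then v powr \<nu> * f v else 0)" by (auto simp: g_def fun_eq_iff)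
  ultimately have gi: "(g has_integral I) UNIV" using has_integral_restrict_UNIV[of "{0<..<1}" "\<lambda>v. v powr \<nu> * f v"] by simp
  have gnn: "g v \<ge> 0" for v using nn by (auto simp: g_def split: split_indicator)
  have I: "I \<ge> 0" using gi gnn has_integral_nonneg by blast
  have gm: "g \<in> borel_measurable borel" using m unfolding g_def[abs_def] by measurable
  have "integral\<^sup>N lborel g = ennreal I" using nn_integral_has_integral_lborel[OF gm gnn gi] .
  then have hb: "has_bochner_integral lborel g I"
    using gm gnn I by (intro has_bochner_integral_nn_integral) auto
  show "integrable (power_measure \<nu>) f"
    unfolding power_measure_def using m hb by (subst integrable_density) (auto simp: g_def[abs_def] mult.assoc has_bochner_integral_iff)
  show "integral\<^sup>L (power_measure \<nu>) f = I"
    unfolding power_measure_def using m hb by (subst integral_density) (auto simp: g_def[abs_def] mult.assoc has_bochner_integral_iff)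
qed

lemma power_measure_beta:
  assumes "\<nu> + a > -1" "b > -1"
  shows "integrable (power_measure \<nu>) (\<lambda>u. u powr a * (1 - u) powr b)"
    "(\<integral>u. u powr a * (1 - u) powr b \<partial>power_measure \<nu>) = Beta (\<nu> + a + 1) (b + 1)"
proof -
  have "((\<lambda>t. t powr (\<nu> + a + 1 - 1) * (1 - t) powr (b + 1 - 1)) has_integral Beta (\<nu> + a + 1) (b + 1)) {0..1}"
    by (rule has_integral_Beta_real) (use assms in auto)
  then have i: "((\<lambda>t. t powr \<nu> * (t powr a * (1 - t) powr b)) has_integral Beta (\<nu> + a + 1) (b + 1)) {0..1}"
    by (simp add: powr_add mult.assoc)
  have m: "(\<lambda>u::real. u powr a * (1 - u) powr b) \<in> borel_measurable borel" by measurable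
  show "integrable (power_measure \<nu>) (\<lambda>u. u powr a * (1 - u) powr b)"
    "(\<integral>u. u powr a * (1 - u) powr b \<partial>power_measure \<nu>) = Beta (\<nu> + a + 1) (b + 1)"
    using power_measure_has_integral_nonneg[OF m _ i] by auto
qed

lemma AE_power_measure_neq: "AE v in power_measure \<nu>. v \<noteq> c"
  unfolding power_measure_def by (subst AE_density) (use AE_lborel_singleton[of c] in \<open>auto elim!: eventually_mono\<close>)

lemma AE_jacD: "AE v in power_measure \<nu>. P v" if "\<And>v. 0 < v \<Longrightarrow> v < 1 \<Longrightarrow> P v"
  using AE_power_measure[of \<nu>] by (rule eventually_mono) (use that in auto)

text \<open>A dilation extended by zero. With \<open>\<sigma>\<close> the squared norm of a point,
  scaling the point changes the function that is expanded, while the system of modes and its zeros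
  stay fixed.\<close>

definition cutoff :: "(real \<Rightarrow> real) \<Rightarrow> real \<Rightarrow> real \<Rightarrow> real" where
  "cutoff g \<sigma> v = (if v < \<sigma> then g (v / \<sigma>) else 0)"

lemma cutoff_measurable:
  assumes [measurable]: "g \<in> borel_measurable borel"
  shows "cutoff g \<sigma> \<in> borel_measurable borel"
  unfolding cutoff_def[abs_def] by measurable

lemma power_measure_cutoff:
  assumes m: "g \<in> borel_measurable borel" and s: "0 < \<sigma>" "\<sigma> \<le> 1"
  shows "integral\<^sup>L (power_measure \<nu>) (cutoff g \<sigma>) = \<sigma> powr (\<nu> + 1) * integral\<^sup>L (power_measure \<nu>) g"
    and "integrable (power_measure \<nu>) (cutoff g \<sigma>) \<longleftrightarrow> integrable (power_measure \<nu>) g"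
proof -
  define h where "h v = indicator {0<..<1} v * v powr \<nu> * cutoff g \<sigma> v" for v
  define k where "k v = indicator {0<..<1} v * v powr \<nu> * g v" for v
  have hk: "h (0 + \<sigma> * u) = \<sigma> powr \<nu> * k u" for u
  proof -
    have "\<sigma> * u < 1 \<and> u < 1 \<and> 0 < u \<longleftrightarrow> 0 < u \<and> u < 1"
      using s by (auto intro: order_le_less_trans[of "\<sigma> * u" "1 * u"] mult_right_mono)
    then show ?thesis using s by (auto simp: h_def k_def cutoff_def powr_mult zero_less_mult_iff split: split_indicator)
  qed
  have jh: "integral\<^sup>L (power_measure \<nu>) (cutoff g \<sigma>) = integral\<^sup>L lborel h"
    unfolding power_measure_def using cutoff_measurable[OF m] by (subst integral_density) (auto simp: h_def[abs_def] mult.assoc)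
  have jk: "integral\<^sup>L (power_measure \<nu>) g = integral\<^sup>L lborel k"
    unfolding power_measure_def using m by (subst integral_density) (auto simp: k_def[abs_def] mult.assoc)
  have ih: "integrable (power_measure \<nu>) (cutoff g \<sigma>) \<longleftrightarrow> integrable lborel h"
    unfolding power_measure_def using cutoff_measurable[OF m] by (subst integrable_density) (auto simp: h_def[abs_def] mult.assoc)
  have ik: "integrable (power_measure \<nu>) g \<longleftrightarrow> integrable lborel k"
    unfolding power_measure_def using m by (subst integrable_density) (auto simp: k_def[abs_def] mult.assoc)
  have "integral\<^sup>L lborel h = \<bar>\<sigma>\<bar> *\<^sub>R (\<integral>u. h (0 + \<sigma> * u) \<partial>lborel)"
    by (rule lborel_integral_real_affine) (use s in simp)
  then show "integral\<^sup>L (power_measure \<nu>) (cutoff g \<sigma>) = \<sigma> powr (\<nu> + 1) * integral\<^sup>L (power_measure \<nu>) g"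
    unfolding hk jh jk using s by (simp add: powr_add)
  have "integrable lborel (\<lambda>u. h (0 + \<sigma> * u)) \<longleftrightarrow> integrable (power_measure \<nu>) g" unfolding hk ik using s by simp
  then show "integrable (power_measure \<nu>) (cutoff g \<sigma>) \<longleftrightarrow> integrable (power_measure \<nu>) g"
    unfolding ih using s lborel_integrable_real_affine_iff[of \<sigma> h 0] by simp
qed

text \<open>The change of variables is used backwards: dilating \<open>F\<close> by
  \<open>\<rho>\<close> and cutting off at \<open>\<rho>\<close> gives back \<open>F\<close> itself
  below \<open>\<rho>\<close>.\<close>

lemma L2_dilate:
  assumes F: "L2 \<nu> F" and r: "0 < \<rho>" "\<rho> \<le> 1"
  shows "L2 \<nu> (\<lambda>u. F (\<rho> * u))"
proof -
  have [measurable]: "F \<in> borel_measurable borel" using F by (simp add: L2_def)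
  have i: "integrable (power_measure \<nu>) (\<lambda>v. (F v)\<^sup>2)" using F by (simp add: L2_def)
  have m: "(\<lambda>u. (F (\<rho> * u))\<^sup>2) \<in> borel_measurable borel" by measurable
  have "integrable (power_measure \<nu>) (cutoff (\<lambda>u. (F (\<rho> * u))\<^sup>2) \<rho>)"
  proof (rule Bochner_Integration.integrable_bound[OF i])
    show "cutoff (\<lambda>u. (F (\<rho> * u))\<^sup>2) \<rho> \<in> borel_measurable (power_measure \<nu>)" using cutoff_measurable[OF m] by simp
    show "AE v in power_measure \<nu>. norm (cutoff (\<lambda>u. (F (\<rho> * u))\<^sup>2) \<rho> v) \<le> norm ((F v)\<^sup>2)"
      using r by (intro AE_I2) (auto simp: cutoff_def)
  qed
  then have "integrable (power_measure \<nu>) (\<lambda>u. (F (\<rho> * u))\<^sup>2)" unfolding power_measure_cutoff(2)[OF m r] .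
  moreover have "(\<lambda>u. F (\<rho> * u)) \<in> borel_measurable borel" by measurable
  ultimately show ?thesis by (simp add: L2_def)
qed

text \<open>The exceptional points are 0 and the jump at \<open>\<sigma>\<close>, where also the
  singularity of the kernel at its right end is moved; the open set left over has full
  measure.\<close>

lemma approximable_cutoff:
  assumes nu: "\<nu> > -1" and F: "L2 \<nu> F" and c: "continuous_on {0<..<1} F" and s: "0 < \<sigma>" "\<sigma> \<le> 1"
  shows "approximable \<nu> (cutoff F \<sigma>)"
proof (rule approximable_piecewise[OF nu, where U = "{0<..<\<sigma>} \<union> {\<sigma><..<1}"])
  have m: "F \<in> borel_measurable borel" using F by (simp add: L2_def)
  have "(\<lambda>v. (cutoff F \<sigma> v)\<^sup>2) = cutoff (\<lambda>v. (F v)\<^sup>2) \<sigma>" by (auto simp: cutoff_def fun_eq_iff)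
  then show "L2 \<nu> (cutoff F \<sigma>)"
    using F power_measure_cutoff(2)[of "\<lambda>v. (F v)\<^sup>2" \<sigma> \<nu>] s cutoff_measurable[OF m] by (auto simp: L2_def)
  show "AE v in power_measure \<nu>. v \<in> {0<..<\<sigma>} \<union> {\<sigma><..<1}"
    using AE_power_measure[of \<nu>] AE_power_measure_neq[where \<nu> = \<nu> and c = \<sigma>] by eventually_elim auto
  have "0 \<notin> {0<..<\<sigma>} \<union> {\<sigma><..<1}" using s by auto
  then show "{0<..<\<sigma>} \<union> {\<sigma><..<1} \<noteq> (UNIV::real set)" by blast
  have "continuous_on {0<..<\<sigma>} (\<lambda>v. F (v / \<sigma>))"
    by (rule continuous_on_compose2[OF c]) (use s in \<open>auto intro!: continuous_intros\<close>)
  then have "continuous_on {0<..<\<sigma>} (cutoff F \<sigma>)" by (rule continuous_on_cong[THEN iffD1, rotated 2]) (auto simp: cutoff_def)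
  moreover have "continuous_on {\<sigma><..<1} (cutoff F \<sigma>)"
    by (rule continuous_on_cong[THEN iffD1, OF refl _ continuous_on_const[of _ 0]]) (auto simp: cutoff_def)
  ultimately show "continuous_on ({0<..<\<sigma>} \<union> {\<sigma><..<1}) (cutoff F \<sigma>)"
    by (intro continuous_on_open_Un) auto
qed auto

definition bessel_transform :: "real \<Rightarrow> (real \<Rightarrow> real) \<Rightarrow> real \<Rightarrow> real" where
  "bessel_transform \<nu> F w = (\<integral>u. F u * clifford \<nu> (w * u) \<partial>power_measure \<nu>)"

lemma fourier_coeff_cutoff:
  assumes nu: "\<nu> > -1" and m: "F \<in> borel_measurable borel" and s: "0 < \<sigma>" "\<sigma> \<le> 1"
  shows "fourier_coeff \<nu> (cutoff F \<sigma>) a = \<sigma> powr (\<nu> + 1) * bessel_transform \<nu> F (a * \<sigma>) / sqrt (mode_sq_norm \<nu> a)"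
proof -
  have "(\<lambda>v. cutoff F \<sigma> v * phi \<nu> a v) = cutoff (\<lambda>u. F u * clifford \<nu> (a * \<sigma> * u) / sqrt (mode_sq_norm \<nu> a)) \<sigma>"
    using s by (auto simp: cutoff_def phi_def fun_eq_iff)
  moreover have "(\<lambda>u. F u * clifford \<nu> (a * \<sigma> * u) / sqrt (mode_sq_norm \<nu> a)) \<in> borel_measurable borel"
    using m nu by (intro borel_measurable_divide borel_measurable_times borel_measurable_continuous_onI[of "\<lambda>u. clifford \<nu> (a * \<sigma> * u)"] continuous_intros) auto
  ultimately show ?thesis
    unfolding fourier_coeff_def ip_def bessel_transform_def using power_measure_cutoff(1)[of _ \<sigma> \<nu>, OF _ s] by simp
qed

text \<open>The supports overlap on the smaller interval. Rescaling it to the unit interval leaves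
  the kernel against its own dilation, so up to a power of \<open>\<tau>\<close> the sum over the
  zeros depends on the ratio \<open>\<sigma> / \<tau>\<close> alone.\<close>

theorem parseval_cutoff:
  assumes nu: "\<nu> > -1" and F: "L2 \<nu> F" and c: "continuous_on {0<..<1} F"
    and s: "0 < \<sigma>" "\<sigma> \<le> \<tau>" "\<tau> \<le> 1"
  shows "((\<lambda>a. bessel_transform \<nu> F (a * \<sigma>) * bessel_transform \<nu> F (a * \<tau>) / mode_sq_norm \<nu> a) has_sum
     \<tau> powr (- \<nu> - 1) * ip \<nu> F (\<lambda>u. F (\<sigma> / \<tau> * u))) (clifford_zeros \<nu>)"
proof -
  have m: "F \<in> borel_measurable borel" using F by (simp add: L2_def)
  have t: "0 < \<tau>" "\<sigma> \<le> 1" using s by auto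
  have "ip \<nu> (cutoff F \<sigma>) (cutoff F \<tau>) = \<sigma> powr (\<nu> + 1) * ip \<nu> F (\<lambda>u. F (\<sigma> / \<tau> * u))"
  proof -
    have "(\<lambda>v. cutoff F \<sigma> v * cutoff F \<tau> v) = cutoff (\<lambda>u. F u * F (\<sigma> / \<tau> * u)) \<sigma>"
      using s by (auto simp: cutoff_def fun_eq_iff)
    then show ?thesis unfolding ip_def using power_measure_cutoff(1)[of "\<lambda>u. F u * F (\<sigma> / \<tau> * u)" \<sigma> \<nu>] m s t by simp
  qed
  then have "((\<lambda>a. fourier_coeff \<nu> (cutoff F \<sigma>) a * fourier_coeff \<nu> (cutoff F \<tau>) a) has_sum \<sigma> powr (\<nu> + 1) * ip \<nu> F (\<lambda>u. F (\<sigma> / \<tau> * u))) (clifford_zeros \<nu>)"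
    using parseval[OF nu approximable_cutoff[OF nu F c s(1) t(2)] approximable_cutoff[OF nu F c t(1) s(3)]] by simp
  then have "((\<lambda>a. \<sigma> powr (- \<nu> - 1) * \<tau> powr (- \<nu> - 1) * (fourier_coeff \<nu> (cutoff F \<sigma>) a * fourier_coeff \<nu> (cutoff F \<tau>) a)) has_sum
     \<sigma> powr (- \<nu> - 1) * \<tau> powr (- \<nu> - 1) * (\<sigma> powr (\<nu> + 1) * ip \<nu> F (\<lambda>u. F (\<sigma> / \<tau> * u)))) (clifford_zeros \<nu>)"
    by (rule has_sum_cmult_right)
  moreover have "\<sigma> powr (- \<nu> - 1) * \<tau> powr (- \<nu> - 1) * (\<sigma> powr (\<nu> + 1) * X) = \<tau> powr (- \<nu> - 1) * X" for X
  proof -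
    have "\<sigma> powr (- \<nu> - 1) * \<tau> powr (- \<nu> - 1) * (\<sigma> powr (\<nu> + 1) * X) = (\<sigma> powr (- \<nu> - 1) * \<sigma> powr (\<nu> + 1)) * (\<tau> powr (- \<nu> - 1) * X)"
      by (simp only: mult_ac)
    then show ?thesis using s t by (simp add: powr_add[symmetric])
  qed
  ultimately have hs: "((\<lambda>a. \<sigma> powr (- \<nu> - 1) * \<tau> powr (- \<nu> - 1) * (fourier_coeff \<nu> (cutoff F \<sigma>) a * fourier_coeff \<nu> (cutoff F \<tau>) a)) has_sum
     \<tau> powr (- \<nu> - 1) * ip \<nu> F (\<lambda>u. F (\<sigma> / \<tau> * u))) (clifford_zeros \<nu>)" by (simp only:)
  have eq: "\<sigma> powr (- \<nu> - 1) * \<tau> powr (- \<nu> - 1) * (fourier_coeff \<nu> (cutoff F \<sigma>) a * fourier_coeff \<nu> (cutoff F \<tau>) a)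
     = bessel_transform \<nu> F (a * \<sigma>) * bessel_transform \<nu> F (a * \<tau>) / mode_sq_norm \<nu> a" if a: "a \<in> clifford_zeros \<nu>" for a
  proof -
    have "mode_sq_norm \<nu> a > 0" using clifford_zeros_norm_pos[OF nu a] by (simp add: mode_sq_norm_def)
    then have n: "sqrt (mode_sq_norm \<nu> a) * sqrt (mode_sq_norm \<nu> a) = mode_sq_norm \<nu> a" by simp
    have "\<sigma> powr (- \<nu> - 1) * \<tau> powr (- \<nu> - 1) * (fourier_coeff \<nu> (cutoff F \<sigma>) a * fourier_coeff \<nu> (cutoff F \<tau>) a)
      = (\<sigma> powr (- \<nu> - 1) * \<sigma> powr (\<nu> + 1)) * (\<tau> powr (- \<nu> - 1) * \<tau> powr (\<nu> + 1)) *
        (bessel_transform \<nu> F (a * \<sigma>) * bessel_transform \<nu> F (a * \<tau>)) / (sqrt (mode_sq_norm \<nu> a) * sqrt (mode_sq_norm \<nu> a))"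
      unfolding fourier_coeff_cutoff[OF nu m s(1) t(2)] fourier_coeff_cutoff[OF nu m t(1) s(3)] by (simp add: mult_ac)
    then show ?thesis
      unfolding n using s t by (simp add: powr_add[symmetric])
  qed
  show ?thesis by (rule has_sum_cong[THEN iffD1, OF _ hs]) (rule eq)
qed

lemma power_measure_power_series:
  assumes F: "integrable (power_measure \<nu>) F" and c: "summable (\<lambda>k. \<bar>c k\<bar>)"
  shows "(\<lambda>k. c k * (\<integral>u. F u * u ^ k \<partial>power_measure \<nu>)) sums (\<integral>u. F u * (\<Sum>k. c k * u ^ k) \<partial>power_measure \<nu>)"
proof -
  have m: "F \<in> borel_measurable borel" using borel_measurable_integrable[OF F] by simp
  have le: "AE u in power_measure \<nu>. norm (F u * u ^ k) \<le> norm (F u)" for k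
    by (rule AE_jacD) (auto simp: abs_mult power_le_one intro!: mult_left_le)
  have i: "integrable (power_measure \<nu>) (\<lambda>u. F u * u ^ k)" for k
    by (rule Bochner_Integration.integrable_bound[OF F _ le]) (use m in simp)
  have i2: "integrable (power_measure \<nu>) (\<lambda>u. c k * (F u * u ^ k))" for k using i by simp
  have s: "summable (\<lambda>k. \<bar>c k * u ^ k\<bar>)" if "0 < u" "u < 1" for u :: real
  proof (rule summable_comparison_test'[OF c])
    fix k :: nat
    show "norm \<bar>c k * u ^ k\<bar> \<le> \<bar>c k\<bar>" using that by (auto simp: abs_mult power_le_one intro!: mult_left_le)
  qed
  have "(\<lambda>k. integral\<^sup>L (power_measure \<nu>) (\<lambda>u. c k * (F u * u ^ k))) sums (\<integral>u. (\<Sum>k. c k * (F u * u ^ k)) \<partial>power_measure \<nu>)"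
  proof (rule sums_integral[OF i2])
    show "AE u in power_measure \<nu>. summable (\<lambda>k. norm (c k * (F u * u ^ k)))"
    proof (rule AE_jacD)
      fix u :: real assume u: "0 < u" "u < 1"
      have "summable (\<lambda>k. \<bar>F u\<bar> * \<bar>c k * u ^ k\<bar>)" by (rule summable_mult[OF s[OF u]])
      then show "summable (\<lambda>k. norm (c k * (F u * u ^ k)))" by (simp add: abs_mult mult_ac)
    qed
    show "summable (\<lambda>k. \<integral>u. norm (c k * (F u * u ^ k)) \<partial>power_measure \<nu>)"
    proof (rule summable_comparison_test'[OF summable_mult2[OF c, of "\<integral>u. norm (F u) \<partial>power_measure \<nu>"]])
      fix k
      have "(\<integral>u. norm (c k * (F u * u ^ k)) \<partial>power_measure \<nu>) = \<bar>c k\<bar> * (\<integral>u. norm (F u * u ^ k) \<partial>power_measure \<nu>)"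
        by (simp add: abs_mult)
      also have "\<dots> \<le> \<bar>c k\<bar> * (\<integral>u. norm (F u) \<partial>power_measure \<nu>)"
        using le i F by (intro mult_left_mono integral_mono_AE) auto
      finally show "norm (\<integral>u. norm (c k * (F u * u ^ k)) \<partial>power_measure \<nu>) \<le> \<bar>c k\<bar> * (\<integral>u. norm (F u) \<partial>power_measure \<nu>)" by simp
    qed
  qed
  also have "(\<integral>u. (\<Sum>k. c k * (F u * u ^ k)) \<partial>power_measure \<nu>) = (\<integral>u. F u * (\<Sum>k. c k * u ^ k) \<partial>power_measure \<nu>)"
  proof (rule integral_cong_AE)
    show "(\<lambda>u. \<Sum>k. c k * (F u * u ^ k)) \<in> borel_measurable (power_measure \<nu>)" "(\<lambda>u. F u * (\<Sum>k. c k * u ^ k)) \<in> borel_measurable (power_measure \<nu>)"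
      using m by simp_all
    show "AE u in power_measure \<nu>. (\<Sum>k. c k * (F u * u ^ k)) = F u * (\<Sum>k. c k * u ^ k)"
    proof (rule AE_jacD)
      fix u :: real assume u: "0 < u" "u < 1"
      have "(\<Sum>k. c k * (F u * u ^ k)) = (\<Sum>k. F u * (c k * u ^ k))" by (simp add: mult_ac)
      also have "\<dots> = F u * (\<Sum>k. c k * u ^ k)" by (rule suminf_mult[OF summable_rabs_cancel[OF s[OF u]]])
      finally show "(\<Sum>k. c k * (F u * u ^ k)) = F u * (\<Sum>k. c k * u ^ k)" .
    qed
  qed
  finally show ?thesis by simp
qed

lemma summable_clifford_abs: "\<nu> > -1 \<Longrightarrow> summable (\<lambda>k. \<bar>clifford_coeff \<nu> k * w ^ k\<bar>)"
  using clifford_norm_bound[of \<nu> 1, where 'a = real] by auto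

lemma bessel_transform_sums:
  assumes nu: "\<nu> > -1" and F: "integrable (power_measure \<nu>) F"
  shows "(\<lambda>k. clifford_coeff \<nu> k * w ^ k * (\<integral>u. F u * u ^ k \<partial>power_measure \<nu>)) sums bessel_transform \<nu> F w"
  using power_measure_power_series[OF F summable_clifford_abs[OF nu, of w]]
  by (simp add: bessel_transform_def clifford_def power_mult_distrib mult.assoc)

lemma L2_integrable: "\<nu> > -1 \<Longrightarrow> L2 \<nu> F \<Longrightarrow> integrable (power_measure \<nu>) F"
  using L2_mult[of \<nu> F "\<lambda>_. 1"] L2_continuous[of \<nu> "\<lambda>_. 1"] by simp

lemma beta_rGamma:
  assumes "a > 0" "b > (0::real)"
  shows "rGamma a * Beta a b = Gamma b * rGamma (a + b)"
proof -
  have "Gamma a > 0" "Gamma (a + b) > 0" using assms by (auto intro: Gamma_real_pos)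
  then have "Gamma a \<noteq> 0" "Gamma (a + b) \<noteq> 0" by linarith+
  then show ?thesis by (simp add: Beta_def rGamma_inverse_Gamma field_simps)
qed

section \<open>Sonine kernels for positive degree and for degree 0\<close>

definition kernel_pos :: "real \<Rightarrow> real \<Rightarrow> real" where "kernel_pos \<alpha> u = (1 - u) powr (\<alpha> - 1)"

lemma kernel_pos_L2:
  assumes "\<nu> > -1" "\<alpha> > 1 / 2"
  shows "L2 \<nu> (kernel_pos \<alpha>)" "continuous_on {0<..<1} (kernel_pos \<alpha>)"
proof -
  have e: "AE u in power_measure \<nu>. (kernel_pos \<alpha> u)\<^sup>2 = u powr 0 * (1 - u) powr (2 * \<alpha> - 2)"
  proof (rule AE_jacD)
    fix u :: real assume "0 < u" "u < 1"
    then show "(kernel_pos \<alpha> u)\<^sup>2 = u powr 0 * (1 - u) powr (2 * \<alpha> - 2)"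
      by (simp add: kernel_pos_def power2_eq_square powr_add[symmetric])
  qed
  have m: "kernel_pos \<alpha> \<in> borel_measurable borel" unfolding kernel_pos_def[abs_def] by measurable
  have "integrable (power_measure \<nu>) (\<lambda>u. (kernel_pos \<alpha> u)\<^sup>2)"
    by (subst integrable_cong_AE[OF _ _ e]) (use m power_measure_beta(1)[of \<nu> 0 "2 * \<alpha> - 2"] assms in auto)
  then show "L2 \<nu> (kernel_pos \<alpha>)" using m by (simp add: L2_def)
  show "continuous_on {0<..<1} (kernel_pos \<alpha>)" unfolding kernel_pos_def[abs_def] by (intro continuous_intros) auto
qed

lemma kernel_pos_moment:
  assumes "\<nu> > -1" "\<alpha> > 0"
  shows "(\<integral>u. kernel_pos \<alpha> u * u ^ k \<partial>power_measure \<nu>) = Beta (\<nu> + real k + 1) \<alpha>"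
proof -
  have "(\<integral>u. kernel_pos \<alpha> u * u ^ k \<partial>power_measure \<nu>) = (\<integral>u. u powr real k * (1 - u) powr (\<alpha> - 1) \<partial>power_measure \<nu>)"
    by (rule integral_cong_AE) (auto simp: kernel_pos_def powr_realpow intro!: AE_jacD)
  then show ?thesis using power_measure_beta(2)[of \<nu> "real k" "\<alpha> - 1"] assms by simp
qed

text \<open>Sonine's first integral: the moments of the kernel are Beta values, which turn the
  series coefficients of order \<open>\<nu>\<close> into those of order
  \<open>\<nu> + \<alpha>\<close>. The bound on \<open>\<alpha>\<close> is that of square
  integrability at 1.\<close>

lemma kernel_pos_transform:
  assumes nu: "\<nu> > -1" and al: "\<alpha> > 1 / 2"
  shows "bessel_transform \<nu> (kernel_pos \<alpha>) w = Gamma \<alpha> * clifford (\<nu> + \<alpha>) w"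
proof -
  have "clifford_coeff \<nu> k * Beta (\<nu> + real k + 1) \<alpha> = Gamma \<alpha> * clifford_coeff (\<nu> + \<alpha>) k" for k
    using beta_rGamma[of "\<nu> + real k + 1" \<alpha>] nu al by (simp add: clifford_coeff_def add_ac)
  then have e: "clifford_coeff \<nu> k * w ^ k * Beta (\<nu> + real k + 1) \<alpha> = Gamma \<alpha> * (clifford_coeff (\<nu> + \<alpha>) k * w ^ k)" for k
    by (metis mult.assoc mult.commute)
  have "(\<lambda>k. clifford_coeff \<nu> k * w ^ k * Beta (\<nu> + real k + 1) \<alpha>) sums bessel_transform \<nu> (kernel_pos \<alpha>) w"
    using bessel_transform_sums[OF nu L2_integrable[OF nu kernel_pos_L2(1)[OF nu al]], of w] kernel_pos_moment[OF nu, of \<alpha>] al by simp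
  then have "(\<lambda>k. Gamma \<alpha> * (clifford_coeff (\<nu> + \<alpha>) k * w ^ k)) sums bessel_transform \<nu> (kernel_pos \<alpha>) w"
    unfolding e .
  moreover have "(\<lambda>k. Gamma \<alpha> * (clifford_coeff (\<nu> + \<alpha>) k * w ^ k)) sums (Gamma \<alpha> * clifford (\<nu> + \<alpha>) w)"
    using clifford_sums[of "\<nu> + \<alpha>" w] nu al by (intro sums_mult) auto
  ultimately show ?thesis by (rule sums_unique2)
qed

definition binomial_coeff :: "real \<Rightarrow> nat \<Rightarrow> real" where "binomial_coeff \<alpha> k = pochhammer (1 - \<alpha>) k / fact k"

lemma binomial_coeff_sums: "\<bar>x\<bar> < 1 \<Longrightarrow> (\<lambda>k. binomial_coeff \<alpha> k * x ^ k) sums ((1 - x) powr (\<alpha> - 1))"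
proof -
  assume x: "\<bar>x\<bar> < 1"
  have "(\<alpha> - 1 gchoose k) * (- x) ^ k = binomial_coeff \<alpha> k * x ^ k" for k
  proof -
    have "(- 1) ^ k * (- x) ^ k = x ^ k" by (simp add: power_mult_distrib[symmetric])
    moreover have "(\<alpha> - 1 gchoose k) = (- 1) ^ k * binomial_coeff \<alpha> k" by (simp add: binomial_coeff_def gbinomial_pochhammer)
    ultimately show ?thesis by (metis mult.assoc mult.commute)
  qed
  then show ?thesis using gen_binomial_real[of "- x" "\<alpha> - 1"] x by simp
qed

lemma binomial_coeff_summable: "\<bar>x\<bar> < 1 \<Longrightarrow> summable (\<lambda>k. \<bar>binomial_coeff \<alpha> k * x ^ k\<bar>)"
proof -
  assume x: "\<bar>x\<bar> < 1"
  have "summable (\<lambda>k. binomial_coeff \<alpha> k * ((1 + \<bar>x\<bar>) / 2) ^ k)" using binomial_coeff_sums[of "(1 + \<bar>x\<bar>) / 2" \<alpha>] x by (simp add: sums_summable)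
  from powser_insidea[OF this, of x] x show ?thesis by simp
qed

text \<open>Only the dilated factor is expanded, as \<open>\<rho> < 1\<close> keeps it away from its
  singularity; the other factor enters through its moments.\<close>

lemma kernel_pos_ip_sums:
  assumes nu: "\<nu> > -1" and al: "\<alpha> > 1 / 2" and r: "0 \<le> \<rho>" "\<rho> < 1"
  shows "(\<lambda>k. binomial_coeff \<alpha> k * \<rho> ^ k * Beta (\<nu> + real k + 1) \<alpha>) sums ip \<nu> (kernel_pos \<alpha>) (\<lambda>u. kernel_pos \<alpha> (\<rho> * u))"
proof -
  have "(\<lambda>k. binomial_coeff \<alpha> k * \<rho> ^ k * Beta (\<nu> + real k + 1) \<alpha>) sums (\<integral>u. kernel_pos \<alpha> u * (\<Sum>k. binomial_coeff \<alpha> k * \<rho> ^ k * u ^ k) \<partial>power_measure \<nu>)"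
    using power_measure_power_series[OF L2_integrable[OF nu kernel_pos_L2(1)[OF nu al]] binomial_coeff_summable[of \<rho> \<alpha>]] r al kernel_pos_moment[OF nu, of \<alpha>] by simp
  also have "(\<integral>u. kernel_pos \<alpha> u * (\<Sum>k. binomial_coeff \<alpha> k * \<rho> ^ k * u ^ k) \<partial>power_measure \<nu>) = ip \<nu> (kernel_pos \<alpha>) (\<lambda>u. kernel_pos \<alpha> (\<rho> * u))"
    unfolding ip_def
  proof (rule integral_cong_AE)
    show "AE u in power_measure \<nu>. kernel_pos \<alpha> u * (\<Sum>k. binomial_coeff \<alpha> k * \<rho> ^ k * u ^ k) = kernel_pos \<alpha> u * kernel_pos \<alpha> (\<rho> * u)"
    proof (rule AE_jacD)
      fix u :: real assume u: "0 < u" "u < 1"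
      have "\<bar>\<rho> * u\<bar> < 1" using r u mult_strict_mono'[of \<rho> 1 u 1] by (simp add: abs_mult)
      from sums_unique[OF binomial_coeff_sums[OF this, of \<alpha>]] show "kernel_pos \<alpha> u * (\<Sum>k. binomial_coeff \<alpha> k * \<rho> ^ k * u ^ k) = kernel_pos \<alpha> u * kernel_pos \<alpha> (\<rho> * u)"
        by (simp add: kernel_pos_def power_mult_distrib mult.assoc)
    qed
  qed (auto simp: kernel_pos_def)
  finally show ?thesis .
qed

text \<open>The upper part of an incomplete Beta integral. Integrated against \<open>u^k\<close> it
  gives a Beta value divided by \<open>k + 1\<close>, the kind of factor that degree 0 calls
  for.\<close>

definition inc_beta :: "real \<Rightarrow> real \<Rightarrow> real \<Rightarrow> real" where
  "inc_beta H \<alpha> u = integral {u..1} (\<lambda>y. y powr (- H) * (1 - y) powr (\<alpha> - 1))"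

context
  fixes H \<alpha> l :: real
  assumes H: "0 < H" "H < 1" and l: "l > -1" and al: "\<alpha> = l + 1 + H" "\<alpha> > 1 / 2"
begin

lemma inc_beta_integrable: "(\<lambda>y. y powr (- H) * (1 - y) powr (\<alpha> - 1)) integrable_on {0..1}"
  and inc_beta_0: "inc_beta H \<alpha> 0 = Beta (1 - H) \<alpha>"
proof -
  have "((\<lambda>y. y powr (1 - H - 1) * (1 - y) powr (\<alpha> - 1)) has_integral Beta (1 - H) \<alpha>) {0..1}"
    by (rule has_integral_Beta_real) (use H al in auto)
  then have i: "((\<lambda>y. y powr (- H) * (1 - y) powr (\<alpha> - 1)) has_integral Beta (1 - H) \<alpha>) {0..1}" by simp
  then show "(\<lambda>y. y powr (- H) * (1 - y) powr (\<alpha> - 1)) integrable_on {0..1}" by blast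
  show "inc_beta H \<alpha> 0 = Beta (1 - H) \<alpha>" unfolding inc_beta_def using i by (rule integral_unique)
qed

lemma inc_beta_continuous: "continuous_on {0..1} (inc_beta H \<alpha>)"
  unfolding inc_beta_def[abs_def] by (rule indefinite_integral_continuous_1'[OF inc_beta_integrable])

lemma inc_beta_1: "inc_beta H \<alpha> 1 = 0" by (simp add: inc_beta_def)

lemma inc_beta_split: "0 \<le> u \<Longrightarrow> u \<le> 1 \<Longrightarrow> inc_beta H \<alpha> u = inc_beta H \<alpha> 0 - integral {0..u} (\<lambda>y. y powr (- H) * (1 - y) powr (\<alpha> - 1))"
  unfolding inc_beta_def using Henstock_Kurzweil_Integration.integral_combine[of 0 u 1 "\<lambda>y. y powr (- H) * (1 - y) powr (\<alpha> - 1)"] inc_beta_integrable by simp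

lemma inc_beta_deriv:
  assumes "0 < u" "u < 1"
  shows "(inc_beta H \<alpha> has_field_derivative - (u powr (- H) * (1 - u) powr (\<alpha> - 1))) (at u)"
proof -
  let ?f = "\<lambda>y. y powr (- H) * (1 - y) powr (\<alpha> - 1)"
  have "((\<lambda>u. integral {0..u} ?f) has_vector_derivative ?f u) (at u within {0..1})"
  proof (rule integral_has_vector_derivative_continuous_at[where S = "{}", OF inc_beta_integrable, simplified])
    show "0 \<le> u \<and> u \<le> 1" using assms by auto
    have "isCont ?f u" using assms by (intro continuous_intros) auto
    then show "continuous (at u within {0..1}) ?f" by (rule continuous_at_imp_continuous_at_within)
  qed
  then have "((\<lambda>u. integral {0..u} ?f) has_field_derivative ?f u) (at u)"
    using assms by (simp add: has_real_derivative_iff_has_vector_derivative at_within_Icc_at)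
  then have "((\<lambda>u. inc_beta H \<alpha> 0 - integral {0..u} ?f) has_field_derivative - ?f u) (at u)"
    by (auto intro!: derivative_eq_intros)
  then show ?thesis
  proof (rule has_field_derivative_transform_within_open[of _ _ _ "{0<..<1}"])
    fix x :: real assume "x \<in> {0<..<1}"
    then show "inc_beta H \<alpha> 0 - integral {0..x} ?f = inc_beta H \<alpha> x" using inc_beta_split[of x] by auto
  qed (use assms in auto)
qed

lemma inc_beta_bounds: "0 \<le> u \<Longrightarrow> u \<le> 1 \<Longrightarrow> 0 \<le> inc_beta H \<alpha> u \<and> inc_beta H \<alpha> u \<le> inc_beta H \<alpha> 0"
proof -
  assume u: "0 \<le> u" "u \<le> 1"
  have "0 \<le> integral {0..u} (\<lambda>y. y powr (- H) * (1 - y) powr (\<alpha> - 1))" by (rule Henstock_Kurzweil_Integration.integral_nonneg)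
      (use integrable_on_subinterval[OF inc_beta_integrable] u in auto)
  moreover have "0 \<le> inc_beta H \<alpha> u" unfolding inc_beta_def by (rule Henstock_Kurzweil_Integration.integral_nonneg)
      (use integrable_on_subinterval[OF inc_beta_integrable] u in auto)
  ultimately show ?thesis using inc_beta_split[OF u] by simp
qed

text \<open>Integration by parts: the boundary term vanishes at 1 because \<open>inc_beta\<close>
  does, and at 0 because \<open>q > 0\<close>.\<close>

lemma inc_beta_moment:
  assumes q: "q > 0"
  shows "((\<lambda>u. u powr (q - 1) * inc_beta H \<alpha> u) has_integral Beta (q + 1 - H) \<alpha> / q) {0..1}"
proof -
  have b: "((\<lambda>u. u powr (q + 1 - H - 1) * (1 - u) powr (\<alpha> - 1)) has_integral Beta (q + 1 - H) \<alpha>) {0..1}"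
    by (rule has_integral_Beta_real) (use H al q in auto)
  have "((\<lambda>u. u powr (q - 1) * inc_beta H \<alpha> u - u powr (q + 1 - H - 1) * (1 - u) powr (\<alpha> - 1) / q) has_integral
     (1 powr q * inc_beta H \<alpha> 1 / q - 0 powr q * inc_beta H \<alpha> 0 / q)) {0..1}"
  proof (rule fundamental_theorem_of_calculus_interior)
    show "continuous_on {0..1} (\<lambda>u. u powr q * inc_beta H \<alpha> u / q)"
      using q by (intro continuous_intros continuous_on_powr' inc_beta_continuous) auto
    fix u :: real assume "u \<in> {0<..<1}"
    then have u: "0 < u" "u < 1" by auto
    have "((\<lambda>u. u powr q * inc_beta H \<alpha> u / q) has_field_derivative
       (q * u powr (q - 1) * inc_beta H \<alpha> u + - (u powr (- H) * (1 - u) powr (\<alpha> - 1)) * u powr q) / q) (at u)"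
      using u by (intro DERIV_cdivide DERIV_mult inc_beta_deriv) (auto intro!: derivative_eq_intros)
    also have "(q * u powr (q - 1) * inc_beta H \<alpha> u + - (u powr (- H) * (1 - u) powr (\<alpha> - 1)) * u powr q) / q
      = u powr (q - 1) * inc_beta H \<alpha> u - u powr (q + 1 - H - 1) * (1 - u) powr (\<alpha> - 1) / q"
    proof -
      have "u powr (q + 1 - H - 1) = u powr (- H) * u powr q" by (simp add: powr_add[symmetric])
      then show ?thesis using q by (simp add: diff_divide_distrib mult_ac)
    qed
    finally show "((\<lambda>u. u powr q * inc_beta H \<alpha> u / q) has_vector_derivative
       u powr (q - 1) * inc_beta H \<alpha> u - u powr (q + 1 - H - 1) * (1 - u) powr (\<alpha> - 1) / q) (at u)"
      unfolding has_real_derivative_iff_has_vector_derivative .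
  qed simp
  from has_integral_add[OF this has_integral_divide[OF b, of q]] show ?thesis by (simp add: inc_beta_1)
qed

text \<open>Dividing the series without its constant term by \<open>w\<close> shifts the index by
  one, and the moments that produce the shifted coefficients carry the factor
  \<open>(k + l + 2) / (k + 1) = 1 + (l + 1) / (k + 1)\<close>. The two summands realise the two
  parts. The singularity \<open>u powr (H - 1)\<close> is square integrable for the weight
  \<open>u powr (1 - H)\<close>.\<close>

definition kernel_zero :: "real \<Rightarrow> real" where
  "kernel_zero u = indicator {0<..<1} u * ((1 - u) powr (\<alpha> - 1) + (l + 1) * u powr (H - 1) * inc_beta H \<alpha> u)"

lemma kernel_zero_continuous: "continuous_on {0<..<1} kernel_zero"
proof -
  have "continuous_on {0<..<1} (\<lambda>u. (1 - u) powr (\<alpha> - 1) + (l + 1) * u powr (H - 1) * inc_beta H \<alpha> u)"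
    by (intro continuous_intros continuous_on_subset[OF inc_beta_continuous]) auto
  then show ?thesis by (rule continuous_on_cong[THEN iffD1, rotated 2]) (auto simp: kernel_zero_def)
qed

lemma kernel_zero_measurable: "kernel_zero \<in> borel_measurable borel"
proof -
  have "(\<lambda>u. if u \<in> {0<..<1} then kernel_zero u else 0) \<in> borel_measurable borel"
    by (rule borel_measurable_continuous_on_if) (auto intro!: kernel_zero_continuous continuous_intros)
  moreover have "(\<lambda>u. if u \<in> {0<..<1} then kernel_zero u else 0) = kernel_zero" by (auto simp: kernel_zero_def fun_eq_iff)
  ultimately show ?thesis by simp
qed

lemma kernel_zero_nonneg: "kernel_zero u \<ge> 0"
  using inc_beta_bounds[of u] l by (auto simp: kernel_zero_def split: split_indicator)

lemma kernel_zero_moment: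
  assumes s: "s > -1"
  shows "integrable (power_measure (1 - H)) (\<lambda>u. u powr s * kernel_zero u)" (is ?A)
    and "s + H > 0 \<or> s = H - 1 \<Longrightarrow> True"
    and "(\<integral>u. u powr s * kernel_zero u \<partial>power_measure (1 - H)) = Beta (2 - H + s) \<alpha> * (1 + (l + 1) / (1 + s))" (is ?B)
proof -
  have b: "((\<lambda>u. u powr (2 - H + s - 1) * (1 - u) powr (\<alpha> - 1)) has_integral Beta (2 - H + s) \<alpha>) {0..1}"
    by (rule has_integral_Beta_real) (use H al s in auto)
  have i: "((\<lambda>u. u powr (1 + s - 1) * inc_beta H \<alpha> u) has_integral Beta (1 + s + 1 - H) \<alpha> / (1 + s)) {0..1}"
    by (rule inc_beta_moment) (use s in simp)
  have "((\<lambda>u. u powr (2 - H + s - 1) * (1 - u) powr (\<alpha> - 1) + (l + 1) * (u powr (1 + s - 1) * inc_beta H \<alpha> u)) has_integral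
     (Beta (2 - H + s) \<alpha> + (l + 1) * (Beta (1 + s + 1 - H) \<alpha> / (1 + s)))) {0..1}"
    by (intro has_integral_add has_integral_mult_right b i)
  also have "Beta (2 - H + s) \<alpha> + (l + 1) * (Beta (1 + s + 1 - H) \<alpha> / (1 + s)) = Beta (2 - H + s) \<alpha> * (1 + (l + 1) / (1 + s))"
    by (simp add: algebra_simps)
  finally have "((\<lambda>u. u powr (2 - H + s - 1) * (1 - u) powr (\<alpha> - 1) + (l + 1) * (u powr (1 + s - 1) * inc_beta H \<alpha> u)) has_integral
      Beta (2 - H + s) \<alpha> * (1 + (l + 1) / (1 + s))) {0<..<1}" unfolding has_integral_Icc_iff_Ioo .
  then have "((\<lambda>u. u powr (1 - H) * (u powr s * kernel_zero u)) has_integral Beta (2 - H + s) \<alpha> * (1 + (l + 1) / (1 + s))) {0<..<1}"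
  proof (rule has_integral_eq[rotated])
    fix u :: real assume "u \<in> {0<..<1}"
    then have u: "0 < u" "u < 1" by auto
    have "u powr (1 - H) * u powr s = u powr (2 - H + s - 1)" "u powr (1 - H) * u powr s * u powr (H - 1) = u powr (1 + s - 1)"
      by (simp_all add: powr_add[symmetric] algebra_simps)
    note X = this[symmetric]
    show "u powr (2 - H + s - 1) * (1 - u) powr (\<alpha> - 1) + (l + 1) * (u powr (1 + s - 1) * inc_beta H \<alpha> u) = u powr (1 - H) * (u powr s * kernel_zero u)"
      unfolding X using u by (simp add: kernel_zero_def distrib_left mult_ac)
  qed
  then have hi: "((\<lambda>u. u powr (1 - H) * (u powr s * kernel_zero u)) has_integral Beta (2 - H + s) \<alpha> * (1 + (l + 1) / (1 + s))) {0..1}"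
    unfolding has_integral_Icc_iff_Ioo .
  have m: "(\<lambda>u. u powr s * kernel_zero u) \<in> borel_measurable borel" using kernel_zero_measurable by measurable
  show ?A ?B using power_measure_has_integral_nonneg[OF m _ hi] kernel_zero_nonneg by auto
qed simp

lemma kernel_zero_L2: "L2 (1 - H) kernel_zero"
proof -
  have "integrable (power_measure (1 - H)) (\<lambda>u. 2 * (u powr 0 * (1 - u) powr (2 * \<alpha> - 2)) + 2 * ((l + 1)\<^sup>2 * (inc_beta H \<alpha> 0)\<^sup>2) * (u powr (2 * H - 2) * (1 - u) powr 0))"
    using power_measure_beta(1)[of "1 - H" 0 "2 * \<alpha> - 2"] power_measure_beta(1)[of "1 - H" "2 * H - 2" 0] H al by (intro Bochner_Integration.integrable_add integrable_mult_right) auto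
  then have "integrable (power_measure (1 - H)) (\<lambda>u. (kernel_zero u)\<^sup>2)"
  proof (rule Bochner_Integration.integrable_bound)
    show "(\<lambda>u. (kernel_zero u)\<^sup>2) \<in> borel_measurable (power_measure (1 - H))" using kernel_zero_measurable by simp
    show "AE u in power_measure (1 - H). norm ((kernel_zero u)\<^sup>2) \<le> norm (2 * (u powr 0 * (1 - u) powr (2 * \<alpha> - 2)) + 2 * ((l + 1)\<^sup>2 * (inc_beta H \<alpha> 0)\<^sup>2) * (u powr (2 * H - 2) * (1 - u) powr 0))"
    proof (rule AE_jacD)
      fix u :: real assume u: "0 < u" "u < 1"
      define A where "A = (1 - u) powr (\<alpha> - 1)"
      define B where "B = (l + 1) * u powr (H - 1) * inc_beta H \<alpha> u"
      have "(A + B)\<^sup>2 \<le> 2 * A\<^sup>2 + 2 * B\<^sup>2" using sum_squares_ge_zero[of "A - B" 0] by (simp add: power2_eq_square algebra_simps)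
      moreover have "A\<^sup>2 = (1 - u) powr (2 * \<alpha> - 2)" unfolding A_def using u by (simp add: power2_eq_square powr_add[symmetric])
      moreover have "B\<^sup>2 = (l + 1)\<^sup>2 * (inc_beta H \<alpha> u)\<^sup>2 * u powr (2 * H - 2)"
        unfolding B_def power_mult_distrib using u by (simp add: power2_eq_square powr_add[symmetric] mult_ac)
      moreover have "(l + 1)\<^sup>2 * (inc_beta H \<alpha> u)\<^sup>2 * u powr (2 * H - 2) \<le> (l + 1)\<^sup>2 * (inc_beta H \<alpha> 0)\<^sup>2 * u powr (2 * H - 2)"
        using inc_beta_bounds[of u] u by (intro mult_right_mono mult_left_mono power_mono) auto
      moreover have "kernel_zero u = A + B" using u by (simp add: kernel_zero_def A_def B_def)
      ultimately show "norm ((kernel_zero u)\<^sup>2) \<le> norm (2 * (u powr 0 * (1 - u) powr (2 * \<alpha> - 2)) + 2 * ((l + 1)\<^sup>2 * (inc_beta H \<alpha> 0)\<^sup>2) * (u powr (2 * H - 2) * (1 - u) powr 0))"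
        using u by simp
    qed
  qed
  then show ?thesis using kernel_zero_measurable by (simp add: L2_def)
qed

lemma kernel_zero_moment_nat: "(\<integral>u. kernel_zero u * u ^ k \<partial>power_measure (1 - H)) = Beta (2 - H + real k) \<alpha> * ((real k + l + 2) / (real k + 1))"
proof -
  have "(\<integral>u. kernel_zero u * u ^ k \<partial>power_measure (1 - H)) = (\<integral>u. u powr real k * kernel_zero u \<partial>power_measure (1 - H))"
  proof (rule integral_cong_AE)
    show "AE u in power_measure (1 - H). kernel_zero u * u ^ k = u powr real k * kernel_zero u" by (rule AE_jacD) (simp add: powr_realpow)
  qed (use kernel_zero_measurable in measurable)
  also have "\<dots> = Beta (2 - H + real k) \<alpha> * (1 + (l + 1) / (1 + real k))" by (rule kernel_zero_moment(3)) simp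
  finally show ?thesis by (simp add: field_simps)
qed

text \<open>In the product of moment and coefficient, \<open>k + l + 2\<close> is consumed by the
  functional equation of the Gamma function and \<open>k + 1\<close> completes the next factorial,
  so the coefficient of index \<open>k + 1\<close> and order \<open>l\<close> appears. Index 0 is
  what the subtraction removes.\<close>

lemma kernel_zero_transform:
  assumes w: "w \<noteq> 0"
  shows "bessel_transform (1 - H) kernel_zero w = Gamma \<alpha> * (clifford l 0 - clifford l w) / w"
proof -
  have nu: "1 - H > -1" using H by simp
  have e: "w * (clifford_coeff (1 - H) k * w ^ k * (Beta (2 - H + real k) \<alpha> * ((real k + l + 2) / (real k + 1)))) = - Gamma \<alpha> * (clifford_coeff l (Suc k) * w ^ Suc k)" for k
  proof -
    have "rGamma (2 - H + real k) * Beta (2 - H + real k) \<alpha> = Gamma \<alpha> * rGamma (l + 3 + real k)"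
      using beta_rGamma[of "2 - H + real k" \<alpha>] H al by (simp add: add_ac)
    moreover have "(l + 2 + real k) * rGamma (l + 3 + real k) = rGamma (l + 2 + real k)"
      using rGamma_step[of l "Suc k"] by (simp add: add_ac)
    ultimately have "(rGamma (2 - H + real k) * Beta (2 - H + real k) \<alpha>) * (real k + l + 2) = Gamma \<alpha> * rGamma (l + 2 + real k)"
      by (simp add: add_ac mult_ac)
    moreover have "clifford_coeff (1 - H) k * (Beta (2 - H + real k) \<alpha> * ((real k + l + 2) / (real k + 1)))
      = (-1) ^ k * ((rGamma (2 - H + real k) * Beta (2 - H + real k) \<alpha>) * (real k + l + 2)) / (fact k * (real k + 1))"
      by (simp add: clifford_coeff_def add_ac)
    ultimately have "clifford_coeff (1 - H) k * (Beta (2 - H + real k) \<alpha> * ((real k + l + 2) / (real k + 1))) = - Gamma \<alpha> * clifford_coeff l (Suc k)"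
      by (simp add: clifford_coeff_def add_ac mult_ac)
    then have "w * w ^ k * (clifford_coeff (1 - H) k * (Beta (2 - H + real k) \<alpha> * ((real k + l + 2) / (real k + 1)))) = w * w ^ k * (- Gamma \<alpha> * clifford_coeff l (Suc k))"
      by (simp only:)
    then show ?thesis by (simp only: mult_ac power_Suc)
  qed
  have "(\<lambda>k. w * (clifford_coeff (1 - H) k * w ^ k * (Beta (2 - H + real k) \<alpha> * ((real k + l + 2) / (real k + 1))))) sums (w * bessel_transform (1 - H) kernel_zero w)"
    using sums_mult[OF bessel_transform_sums[OF nu L2_integrable[OF nu kernel_zero_L2], of w], of w] unfolding kernel_zero_moment_nat .
  then have 1: "(\<lambda>k. - Gamma \<alpha> * (clifford_coeff l (Suc k) * w ^ Suc k)) sums (w * bessel_transform (1 - H) kernel_zero w)" unfolding e .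
  have "(\<lambda>k. clifford_coeff l (Suc k) * w ^ Suc k) sums (clifford l w - clifford_coeff l 0 * w ^ 0)"
    using clifford_sums[OF l, of w] by (subst sums_Suc_iff) simp
  moreover have "clifford_coeff l 0 = clifford l (0::real)" by (simp add: clifford_coeff_def)
  ultimately have 2: "(\<lambda>k. - Gamma \<alpha> * (clifford_coeff l (Suc k) * w ^ Suc k)) sums (- Gamma \<alpha> * (clifford l w - clifford l 0))"
    by (intro sums_mult) simp
  show ?thesis using sums_unique2[OF 1 2] w by (simp add: field_simps)
qed

text \<open>Termwise integration of the binomial series from 0 to \<open>u\<close>, carried out as a
  differential equation: \<open>W\<close> has derivative 0, and at 0 the positive power
  \<open>1 - H\<close> leaves only the full Beta integral.\<close>

lemma inc_beta_series:
  assumes u: "0 < u" "u < 1"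
  shows "(\<lambda>k. binomial_coeff \<alpha> k * u ^ k / (real k + 1 - H)) sums (u powr (H - 1) * (inc_beta H \<alpha> 0 - inc_beta H \<alpha> u))"
proof -
  have p: "real k + 1 - H > 0" for k using H by simp
  define c where "c k = binomial_coeff \<alpha> k / (real k + 1 - H)" for k
  define T where "T x = (\<Sum>k. c k * x ^ k)" for x
  have sc: "summable (\<lambda>k. c k * x ^ k)" if x: "\<bar>x\<bar> < 1" for x
  proof (rule summable_comparison_test'[OF summable_mult[OF binomial_coeff_summable[OF x, of \<alpha>], of "1 / (1 - H)"]])
    fix k
    have "\<bar>c k * x ^ k\<bar> = \<bar>binomial_coeff \<alpha> k * x ^ k\<bar> / (real k + 1 - H)" using p[of k] by (simp add: c_def abs_mult)
    also have "\<dots> \<le> \<bar>binomial_coeff \<alpha> k * x ^ k\<bar> / (1 - H)" using H by (intro divide_left_mono) auto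
    finally show "norm (c k * x ^ k) \<le> 1 / (1 - H) * \<bar>binomial_coeff \<alpha> k * x ^ k\<bar>" by simp
  qed
  have dT: "(T has_field_derivative (\<Sum>k. diffs c k * x ^ k)) (at x)" if x: "\<bar>x\<bar> < 1" for x
    unfolding T_def[abs_def] by (rule termdiffs_strong'[where K = 1]) (use x sc in auto)
  have key: "(1 - H) * T x + x * (\<Sum>k. diffs c k * x ^ k) = (1 - x) powr (\<alpha> - 1)" if x: "\<bar>x\<bar> < 1" for x
  proof -
    have "summable (\<lambda>k. diffs c k * x ^ k)" by (rule termdiff_converges[of x 1]) (use x sc in auto)
    then have "(\<lambda>k. x * (diffs c k * x ^ k)) sums (x * (\<Sum>k. diffs c k * x ^ k))" by (intro sums_mult summable_sums)
    then have "(\<lambda>k. real (Suc k) * c (Suc k) * x ^ Suc k) sums (x * (\<Sum>k. diffs c k * x ^ k))" by (simp add: diffs_def mult_ac)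
    then have "(\<lambda>k. real k * c k * x ^ k) sums (x * (\<Sum>k. diffs c k * x ^ k))" by (subst (asm) sums_Suc_iff) simp
    from sums_add[OF sums_mult[OF summable_sums[OF sc[OF x]], of "1 - H"] this]
    have "(\<lambda>k. (real k + 1 - H) * c k * x ^ k) sums ((1 - H) * T x + x * (\<Sum>k. diffs c k * x ^ k))"
      by (simp add: T_def algebra_simps)
    moreover have "(real k + 1 - H) * c k = binomial_coeff \<alpha> k" for k using p[of k] by (simp add: c_def)
    ultimately show ?thesis using sums_unique2[OF _ binomial_coeff_sums[OF x, of \<alpha>]] by simp
  qed
  define W where "W x = x powr (1 - H) * T x + inc_beta H \<alpha> x" for x
  have cT: "continuous_on {-1<..<1} T" 
  proof (rule DERIV_continuous_on[where D = "\<lambda>x. \<Sum>k. diffs c k * x ^ k"])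
    fix x :: real assume "x \<in> {-1<..<1}"
    then have "\<bar>x\<bar> < 1" by auto
    then show "(T has_field_derivative (\<Sum>k. diffs c k * x ^ k)) (at x within {-1<..<1})"
      by (rule has_field_derivative_at_within[OF dT])
  qed
  have "W u = W 0"
  proof (rule DERIV_isconst2[of 0 u W u])
    show "0 < u" "0 \<le> u" "u \<le> u" using u by auto
    show "continuous_on {0..u} W" unfolding W_def[abs_def]
      by (intro continuous_intros continuous_on_powr' continuous_on_subset[OF cT] continuous_on_subset[OF inc_beta_continuous]) (use u H in auto)
    fix x assume x: "0 < x" "x < u"
    then have x1: "x < 1" "\<bar>x\<bar> < 1" using u by auto
    have "(W has_field_derivative ((1 - H) * x powr (1 - H - 1) * T x + (\<Sum>k. diffs c k * x ^ k) * x powr (1 - H) + - (x powr (- H) * (1 - x) powr (\<alpha> - 1)))) (at x)"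
      unfolding W_def[abs_def] by (intro DERIV_add DERIV_mult dT inc_beta_deriv) (use x x1 in \<open>auto intro!: derivative_eq_intros\<close>)
    moreover have "x powr (1 - H) = x powr (- H) * x" using x by (simp add: powr_add[symmetric] powr_mult_base mult.commute)
    then have "(1 - H) * x powr (1 - H - 1) * T x + (\<Sum>k. diffs c k * x ^ k) * x powr (1 - H) = x powr (- H) * ((1 - H) * T x + x * (\<Sum>k. diffs c k * x ^ k))"
      by (simp add: algebra_simps)
    ultimately show "(W has_field_derivative 0) (at x)" unfolding key[OF x1(2)] by simp
  qed
  moreover have "W 0 = inc_beta H \<alpha> 0" using H by (simp add: W_def)
  ultimately have "u powr (1 - H) * T u = inc_beta H \<alpha> 0 - inc_beta H \<alpha> u" by (simp add: W_def)
  then have "u powr (H - 1) * (u powr (1 - H) * T u) = u powr (H - 1) * (inc_beta H \<alpha> 0 - inc_beta H \<alpha> u)" by simp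
  moreover have "u powr (H - 1) * u powr (1 - H) = 1" using u by (simp add: powr_add[symmetric])
  ultimately have "T u = u powr (H - 1) * (inc_beta H \<alpha> 0 - inc_beta H \<alpha> u)" by (simp add: mult.assoc[symmetric])
  moreover have "(\<lambda>k. c k * u ^ k) sums T u" unfolding T_def by (intro summable_sums sc) (use u in simp)
  ultimately show ?thesis by (simp add: c_def)
qed

text \<open>Near 0 the kernel is analytic up to a multiple of \<open>u powr (H - 1)\<close>. This
  one term is what turns into \<open>norm x powr (2 * H)\<close> of the smaller point in the
  covariance.\<close>

lemma kernel_zero_series:
  assumes u: "0 < u" "u < 1"
  shows "(\<lambda>k. binomial_coeff \<alpha> k * (1 - (l + 1) / (real k + 1 - H)) * u ^ k) sums (kernel_zero u - (l + 1) * Beta (1 - H) \<alpha> * u powr (H - 1))"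
proof -
  have "(\<lambda>k. binomial_coeff \<alpha> k * u ^ k - (l + 1) * (binomial_coeff \<alpha> k * u ^ k / (real k + 1 - H))) sums
     ((1 - u) powr (\<alpha> - 1) - (l + 1) * (u powr (H - 1) * (inc_beta H \<alpha> 0 - inc_beta H \<alpha> u)))"
    by (intro sums_diff sums_mult inc_beta_series binomial_coeff_sums) (use u in auto)
  also have "(1 - u) powr (\<alpha> - 1) - (l + 1) * (u powr (H - 1) * (inc_beta H \<alpha> 0 - inc_beta H \<alpha> u)) = kernel_zero u - (l + 1) * Beta (1 - H) \<alpha> * u powr (H - 1)"
    using u unfolding inc_beta_0[symmetric] by (simp add: kernel_zero_def algebra_simps)
  finally show ?thesis by (simp add: algebra_simps)
qed

lemma kernel_zero_ip_sums:
  assumes r: "0 < \<rho>" "\<rho> < 1"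
  shows "(\<lambda>k. binomial_coeff \<alpha> k * (1 - (l + 1) / (real k + 1 - H)) * \<rho> ^ k * (Beta (2 - H + real k) \<alpha> * ((real k + l + 2) / (real k + 1)))) sums
    (ip (1 - H) kernel_zero (\<lambda>u. kernel_zero (\<rho> * u)) - (l + 1) * Beta (1 - H) \<alpha> * \<rho> powr (H - 1) / H)"
proof -
  have nu: "1 - H > -1" using H by simp
  define c where "c k = binomial_coeff \<alpha> k * (1 - (l + 1) / (real k + 1 - H))" for k
  have csum: "summable (\<lambda>k. \<bar>c k * \<rho> ^ k\<bar>)"
  proof (rule summable_comparison_test'[OF summable_mult[OF binomial_coeff_summable[of \<rho> \<alpha>], of "1 + (l + 1) / (1 - H)"]])
    show "\<bar>\<rho>\<bar> < 1" using r by simp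
    fix k
    have "\<bar>1 - (l + 1) / (real k + 1 - H)\<bar> \<le> 1 + (l + 1) / (real k + 1 - H)" using l H
      by (intro abs_triangle_ineq4[THEN order_trans]) (auto simp: abs_of_nonneg)
    also have "\<dots> \<le> 1 + (l + 1) / (1 - H)" using l H by (intro add_left_mono divide_left_mono) auto
    finally have "\<bar>1 - (l + 1) / (real k + 1 - H)\<bar> * \<bar>binomial_coeff \<alpha> k * \<rho> ^ k\<bar> \<le> (1 + (l + 1) / (1 - H)) * \<bar>binomial_coeff \<alpha> k * \<rho> ^ k\<bar>"
      by (intro mult_right_mono) auto
    then show "norm \<bar>c k * \<rho> ^ k\<bar> \<le> (1 + (l + 1) / (1 - H)) * \<bar>binomial_coeff \<alpha> k * \<rho> ^ k\<bar>"
      by (simp add: c_def abs_mult mult_ac)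
  qed
  note iF = L2_integrable[OF nu kernel_zero_L2]
  have A: "(\<lambda>k. c k * \<rho> ^ k * (Beta (2 - H + real k) \<alpha> * ((real k + l + 2) / (real k + 1)))) sums (\<integral>u. kernel_zero u * (\<Sum>k. c k * \<rho> ^ k * u ^ k) \<partial>power_measure (1 - H))"
    using power_measure_power_series[OF iF csum] unfolding kernel_zero_moment_nat .
  have s: "H - 1 > -1" using H by simp
  \<comment> \<open>The moment factor \<open>1 + (l + 1) / H\<close> equals
    \<open>\<alpha> / H\<close>, which cancels against
    \<open>Beta 1 \<alpha> = 1 / \<alpha>\<close>.\<close>
  have mom: "(\<integral>u. u powr (H - 1) * kernel_zero u \<partial>power_measure (1 - H)) = 1 / H"
  proof -
    have a0: "\<alpha> > 0" using al by simp
    then have "\<alpha> \<notin> \<int>\<^sub>\<le>\<^sub>0" by (auto elim!: nonpos_Ints_cases)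
    from Gamma_plus1[OF this] have "Gamma (1 + \<alpha>) = \<alpha> * Gamma \<alpha>" by (simp add: add.commute)
    moreover have "Gamma \<alpha> \<noteq> 0" using Gamma_real_pos[OF a0] by linarith
    ultimately have "Beta 1 \<alpha> = 1 / \<alpha>" by (simp add: Beta_def)
    then show ?thesis using kernel_zero_moment(3)[OF s] H al l by (simp add: field_simps)
  qed
  have iL: "integrable (power_measure (1 - H)) (\<lambda>u. (l + 1) * Beta (1 - H) \<alpha> * \<rho> powr (H - 1) * (u powr (H - 1) * kernel_zero u))"
    using kernel_zero_moment(1)[OF s] by (rule integrable_mult_right)
  have mm: "(\<lambda>u. kernel_zero (\<rho> * u)) \<in> borel_measurable borel" using kernel_zero_measurable by measurable
  have "L2 (1 - H) (\<lambda>u. kernel_zero (\<rho> * u))" using r by (intro L2_dilate kernel_zero_L2) auto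
  then have iP: "integrable (power_measure (1 - H)) (\<lambda>u. kernel_zero u * kernel_zero (\<rho> * u))" by (rule L2_mult[OF kernel_zero_L2])
  have "(\<integral>u. kernel_zero u * (\<Sum>k. c k * \<rho> ^ k * u ^ k) \<partial>power_measure (1 - H)) =
     (\<integral>u. kernel_zero u * kernel_zero (\<rho> * u) - (l + 1) * Beta (1 - H) \<alpha> * \<rho> powr (H - 1) * (u powr (H - 1) * kernel_zero u) \<partial>power_measure (1 - H))"
  proof (rule integral_cong_AE)
    show "AE u in power_measure (1 - H). kernel_zero u * (\<Sum>k. c k * \<rho> ^ k * u ^ k) = kernel_zero u * kernel_zero (\<rho> * u) - (l + 1) * Beta (1 - H) \<alpha> * \<rho> powr (H - 1) * (u powr (H - 1) * kernel_zero u)"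
    proof (rule AE_jacD)
      fix u :: real assume u: "0 < u" "u < 1"
      have "0 < \<rho> * u" "\<rho> * u < 1" using r u mult_strict_mono'[of \<rho> 1 u 1] by auto
      from sums_unique[OF kernel_zero_series[OF this]]
      have eq: "(\<Sum>k. c k * \<rho> ^ k * u ^ k) = kernel_zero (\<rho> * u) - (l + 1) * Beta (1 - H) \<alpha> * (\<rho> * u) powr (H - 1)"
        by (simp add: c_def power_mult_distrib mult.assoc)
      show "kernel_zero u * (\<Sum>k. c k * \<rho> ^ k * u ^ k) = kernel_zero u * kernel_zero (\<rho> * u) - (l + 1) * Beta (1 - H) \<alpha> * \<rho> powr (H - 1) * (u powr (H - 1) * kernel_zero u)"
        unfolding eq using r u by (simp add: powr_mult right_diff_distrib mult_ac)
    qed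
    show "(\<lambda>u. kernel_zero u * (\<Sum>k. c k * \<rho> ^ k * u ^ k)) \<in> borel_measurable (power_measure (1 - H))"
      using kernel_zero_measurable by simp
    show "(\<lambda>u. kernel_zero u * kernel_zero (\<rho> * u) - (l + 1) * Beta (1 - H) \<alpha> * \<rho> powr (H - 1) * (u powr (H - 1) * kernel_zero u)) \<in> borel_measurable (power_measure (1 - H))"
      using kernel_zero_measurable mm by simp
  qed
  also have "\<dots> = ip (1 - H) kernel_zero (\<lambda>u. kernel_zero (\<rho> * u)) - (l + 1) * Beta (1 - H) \<alpha> * \<rho> powr (H - 1) * (1 / H)"
    unfolding ip_def mom[symmetric] using iP iL by (subst Bochner_Integration.integral_diff) auto
  finally show ?thesis using A by (simp add: c_def)
qed

end

section \<open>The expansion of the covariance\<close>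

text \<open>The coefficients in the expansion of Gegenbauer polynomials of order \<open>a\<close> in zonal polynomials of order \<open>l\<close>.\<close>

definition connection_coeff :: "real \<Rightarrow> real \<Rightarrow> nat \<Rightarrow> nat \<Rightarrow> real" where
  "connection_coeff a l k j = pochhammer a (k - j) * pochhammer (a - l) j / (fact j * pochhammer (l + 1) (k - j))"

text \<open>The recurrence of the connection coefficients after division by a common factor:
  \<open>R\<close> and \<open>Q\<close> are quotients of neighbouring Pochhammer factors,
  \<open>u\<close> is an up coefficient and \<open>2 - u\<close> the matching down
  coefficient.\<close>

lemma connection_coeff_identity:
  fixes a l n j u R Q :: real
  assumes j: "j > 0" and D: "l + 1 + n > 0" and R: "R = (a + n) / (l + 1 + n)" and Q: "Q = (a - l + j - 1) / j"
    and u: "u * (n + 1 - j + l) = n + 1 - j" and p: "n + 1 - j = 0 \<Longrightarrow> u = 0" and nz: "n + 1 - j + l \<noteq> 0 \<or> n + 1 - j = 0"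
  shows "(n + j + 1) * (R * Q) = (n + j + a) * (Q * u + R * (2 - u)) - (n + j - 1 + 2 * a)"
proof (cases "n + 1 - j = 0")
  case True
  then have n: "n = j - 1" and u0: "u = 0" using p by auto
  show ?thesis unfolding R Q u0 using j D unfolding n by (simp add: divide_simps) (simp add: algebra_simps)
next
  case False
  then have pl: "n + 1 - j + l \<noteq> 0" using nz by auto
  define E where "E = l + 1 + n"
  have E: "E > 0" "n = E - l - 1" using D by (auto simp: E_def)
  have u': "u = (n + 1 - j) / (E - j)" using u pl by (simp add: E_def field_simps)
  have nz': "E - j \<noteq> 0" using pl by (simp add: E_def)
  define G where "G = E - j"
  have G: "G \<noteq> 0" "E = G + j" using nz' by (auto simp: G_def)
  have "(n + j + 1) * ((a + n) * (a - l + j - 1) * G) =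
     (n + j + a) * ((a - l + j - 1) * (n + 1 - j) * E + (a + n) * j * (2 * G - (n + 1 - j))) - (n + j - 1 + 2 * a) * (j * E * G)"
    unfolding E(2) unfolding G(2) by (simp add: algebra_simps)
  then have "(n + j + 1) * ((a + n) * (a - l + j - 1) * G) / (j * E * G) =
     ((n + j + a) * ((a - l + j - 1) * (n + 1 - j) * E + (a + n) * j * (2 * G - (n + 1 - j))) - (n + j - 1 + 2 * a) * (j * E * G)) / (j * E * G)"
    by simp
  moreover have "(n + j + 1) * ((a + n) * (a - l + j - 1) * G) / (j * E * G) = (n + j + 1) * (R * Q)"
    unfolding R Q E_def[symmetric] using j E(1) G(1) by (simp add: divide_simps)
  moreover have "((n + j + a) * ((a - l + j - 1) * (n + 1 - j) * E + (a + n) * j * (2 * G - (n + 1 - j))) - (n + j - 1 + 2 * a) * (j * E * G)) / (j * E * G)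
      = (n + j + a) * (Q * u + R * (2 - u)) - (n + j - 1 + 2 * a)"
  proof -
    have "Q * u + R * (2 - u) = ((a - l + j - 1) * (n + 1 - j) * E + (a + n) * j * (2 * G - (n + 1 - j))) / (j * E * G)"
      unfolding R Q u' E_def[symmetric] G_def[symmetric] using j E(1) G(1) by (simp add: divide_simps)
    then show ?thesis using j E(1) G(1) by (simp add: diff_divide_distrib)
  qed
  ultimately show ?thesis by simp
qed

text \<open>Gegenbauer's connection formula. The right side is shown to satisfy the recurrence of
  the left one, with multiplication by \<open>2 * c\<close> carried out on the zonal polynomials.
  Negative \<open>a\<close> is the case of interest, for then the left side generates a positive
  power of the quadratic.\<close>

lemma solid_geg_connection:
  assumes l: "l > -1"
  shows "solid_geg a k c 1 = (\<Sum>j\<le>k. if 2 * j \<le> k then connection_coeff a l k j * zonal l (k - 2 * j) c 1 else 0)"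
    (is "?P k = ?S k")
proof (induction k rule: less_induct)
  case (less k)
  define Z where "Z p = zonal l p c 1" for p
  define G where "G k j = (if 2 * j \<le> k then connection_coeff a l k j * Z (k - 2 * j) else 0)" for k j
  have S: "?S n = (\<Sum>j\<le>n. G n j)" for n unfolding G_def Z_def ..
  have S': "?S n = (\<Sum>j\<le>N. G n j)" if "n \<le> N" for n N
    unfolding S using that by (intro sum.mono_neutral_left) (auto simp: G_def)
  have "k = 0 \<or> k = 1 \<or> (\<exists>M. k = M + 2)" by presburger
  then consider "k = 0" | "k = 1" | M where "k = M + 2" by blast
  then show ?case
  proof cases
    case 1 then show ?thesis by (simp add: connection_coeff_def zonal_def)
  next
    case 2 then show ?thesis using l by (simp add: connection_coeff_def zonal_def field_simps)
  next
    case 3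
    have mult: "2 * c * Z p = zonal_up l p * Z (p + 1) + zonal_down l p * Z (p - 1)" for p
      using zonal_mult[OF l, of c p 1] by (simp add: Z_def)
    define U where "U j = (if 2 * j \<le> M + 1 then connection_coeff a l (M + 1) j * zonal_up l (M + 1 - 2 * j) else 0)" for j
    define W where "W j = (if 2 * j \<le> M + 1 then connection_coeff a l (M + 1) j * zonal_down l (M + 1 - 2 * j) else 0)" for j
    define V where "V j = (if 2 * j \<le> M then connection_coeff a l M j else 0)" for j
    have "2 * c * ?S (M + 1) = (\<Sum>j\<le>M+1. 2 * c * G (M + 1) j)" unfolding S by (simp only: sum_distrib_left)
    also have "\<dots> = (\<Sum>j\<le>M+1. U j * Z (M + 2 - 2 * j) + W j * Z (M + 2 - 2 * Suc j))"
    proof (rule sum.cong[OF refl])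
      fix j
      show "2 * c * G (M + 1) j = U j * Z (M + 2 - 2 * j) + W j * Z (M + 2 - 2 * Suc j)"
      proof (cases "2 * j \<le> M + 1")
        case True
        then have e: "M + 1 - 2 * j + 1 = M + 2 - 2 * j" "M + 1 - 2 * j - 1 = M + 2 - 2 * Suc j" by auto
        have "2 * c * G (M + 1) j = connection_coeff a l (M + 1) j * (2 * c * Z (M + 1 - 2 * j))" using True by (simp add: G_def)
        then show ?thesis unfolding mult e using True by (simp add: U_def W_def algebra_simps)
      qed (simp add: G_def U_def W_def)
    qed
    also have "\<dots> = (\<Sum>j\<le>M+2. U j * Z (M + 2 - 2 * j)) + (\<Sum>j\<le>M+2. (if j = 0 then 0 else W (j - 1)) * Z (M + 2 - 2 * j))"
      using sum.atMost_Suc_shift[of "\<lambda>j. (if j = 0 then 0 else W (j - 1)) * Z (M + 2 - 2 * j)" "M + 1"]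
      by (simp add: sum.distrib U_def)
    finally have 1: "2 * c * ?S (M + 1) = (\<Sum>j\<le>M+2. (U j + (if j = 0 then 0 else W (j - 1))) * Z (M + 2 - 2 * j))"
      by (simp only: sum.distrib[symmetric] distrib_right)
    have "?S M = (\<Sum>j\<le>M+1. V j * Z (M + 2 - 2 * Suc j))"
    proof -
      have "?S M = (\<Sum>j\<le>M+1. G M j)" by (rule S') simp
      also have "\<dots> = (\<Sum>j\<le>M+1. V j * Z (M + 2 - 2 * Suc j))"
        by (intro sum.cong refl) (auto simp: G_def V_def)
      finally show ?thesis .
    qed
    also have "\<dots> = (\<Sum>j\<le>M+2. (if j = 0 then 0 else V (j - 1)) * Z (M + 2 - 2 * j))"
      using sum.atMost_Suc_shift[of "\<lambda>j. (if j = 0 then 0 else V (j - 1)) * Z (M + 2 - 2 * j)" "M + 1"] by simp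
    finally have 2: "?S M = (\<Sum>j\<le>M+2. (if j = 0 then 0 else V (j - 1)) * Z (M + 2 - 2 * j))" .
    \<comment> \<open>The coefficient of the zonal polynomial of degree
      \<open>M + 2 - 2 * j\<close>. Once \<open>2 * j\<close> exceeds \<open>M + 2\<close>,
      truncated subtraction would produce degree 0 again, but all contributions are 0 there.\<close>
    have key: "(real M + 1 + a) * (U j + (if j = 0 then 0 else W (j - 1))) - (real M + 2 * a) * (if j = 0 then 0 else V (j - 1))
       = (if 2 * j \<le> M + 2 then (real M + 2) * connection_coeff a l (M + 2) j else 0)" for j
    proof (cases "2 * j \<le> M + 2")
      case False
      have "W (j - 1) = 0"
      proof (cases "2 * (j - 1) \<le> M + 1")
        case True
        then have "M + 1 - 2 * (j - 1) = 0" using False by auto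
        then show ?thesis by (simp add: W_def zonal_down_def)
      qed (simp add: W_def)
      then show ?thesis using False by (auto simp: U_def V_def)
    next
      case True
      have jM: "j \<le> M + 1" using True by auto
      define n where "n = M + 1 - j"
      have n: "M = n + j - 1" "M + 1 = n + j" "M + 2 - j = Suc n" "M + 1 - j = n" using jM by (auto simp: n_def)
      have rM: "real M = real n + real j - 1" using n(2) by linarith
      \<comment> \<open>In the extreme case \<open>2 * j = M + 2\<close> no step up exists;
        \<open>u = 0\<close> is then consistent with the exceptional value 2 of
        \<open>zonal_down\<close> at 1, which again equals \<open>2 - u\<close>.\<close>
      define u where "u = (if 2 * j \<le> M + 1 then zonal_up l (M + 1 - 2 * j) else 0)"
      have pn: "real n + 1 - real j \<ge> 0" using True n(2) by linarith
      have u: "u * (real n + 1 - real j + l) = real n + 1 - real j"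
      proof (cases "2 * j \<le> M + 1")
        case t: True
        have e: "real (M + 1 - 2 * j) = real n - real j" using t n(2) by linarith
        have p: "real n - real j \<ge> 0" using e by linarith
        have "u = (real n - real j + 1) / (real n - real j + 1 + l)" using t by (simp add: u_def zonal_up_def e[simplified])
        moreover have "real n - real j + 1 + l > 0" using p l by linarith
        ultimately show ?thesis by (simp add: field_simps)
      next
        case False
        then have "M + 2 = 2 * j" using True by linarith
        then have "real n + 1 - real j = 0" using n(2) by linarith
        then show ?thesis using False by (simp add: u_def)
      qed
      have u0: "u = 0" if "real n + 1 - real j = 0"
      proof -
        have "\<not> 2 * j \<le> M + 1" using that n(2) by linarith
        then show ?thesis by (simp add: u_def)
      qed
      have nz: "real n + 1 - real j + l \<noteq> 0 \<or> real n + 1 - real j = 0"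
      proof (cases "real n + 1 - real j = 0")
        case False
        moreover have "j \<le> n + 1" using pn by linarith
        ultimately have "j \<le> n" by (cases "j = n + 1") auto
        then have "real n + 1 - real j \<ge> 1" by simp
        then show ?thesis using l by linarith
      qed simp
      define A where "A = pochhammer a n / pochhammer (l + 1) n"
      define R where "R = (a + real n) / (l + 1 + real n)"
      have D: "l + 1 + real n > 0" using l by linarith
      have pl: "pochhammer (l + 1) n > 0" using l by (intro pochhammer_pos) auto
      have AR: "pochhammer a (Suc n) / pochhammer (l + 1) (Suc n) = A * R" by (simp add: A_def R_def pochhammer_Suc)
      have U: "U j = connection_coeff a l (M + 1) j * u" by (simp add: U_def u_def)
      show ?thesis
      proof (cases j)
        case 0
        have c1: "connection_coeff a l (M + 1) j = A" "connection_coeff a l (M + 2) j = A * R"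
          unfolding connection_coeff_def n(3,4) AR[symmetric] by (simp_all add: 0 A_def)
        have "u = (real n + 1) / (real n + 1 + l)" using u 0 D by (simp add: field_simps)
        then have "(real n + a) * u = (real n + 1) * R" by (simp add: R_def add_ac mult_ac)
        then have "A * ((real n + a) * u) = A * ((real n + 1) * R)" by simp
        then show ?thesis unfolding U c1 using 0 True rM by (simp add: mult_ac add_ac)
      next
        case (Suc i)
        define B where "B = pochhammer (a - l) i / fact i"
        define Q where "Q = (a - l + real j - 1) / real j"
        have BQ: "pochhammer (a - l) j / fact j = B * Q"
        proof -
          have "Q = (a - l + real i) / (1 + real i)" by (simp add: Q_def Suc algebra_simps)
          then show ?thesis by (simp add: B_def Suc pochhammer_Suc mult_ac)
        qed
        have i: "M - i = n" "M + 1 - i = Suc n" using jM by (auto simp: n_def Suc)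
        have e: "M + 1 - 2 * (j - 1) = (M + 1 - 2 * j) + 2 \<or> 2 * j = M + 2 \<and> M + 1 - 2 * (j - 1) = 1" using True Suc by auto
        have c: "connection_coeff a l (M + 1) j = A * B * Q" "connection_coeff a l (M + 2) j = A * R * (B * Q)" "connection_coeff a l (M + 1) i = A * R * B" "connection_coeff a l M i = A * B"
          unfolding connection_coeff_def n(3,4) i AR[symmetric] BQ[symmetric] mult.assoc by (simp_all add: A_def B_def BQ[symmetric])
        have W: "W (j - 1) = A * R * B * (2 - u)"
        proof -
          have "zonal_down l (M + 1 - 2 * (j - 1)) = 2 - u"
          proof (cases "2 * j = M + 2")
            case t: True
            then have "M + 1 - 2 * (j - 1) = 1" using Suc by auto
            moreover have "\<not> 2 * j \<le> M + 1" using t by simp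
            ultimately show ?thesis by (simp add: zonal_down_def u_def)
          next
            case False
            then have t: "2 * j \<le> M + 1" using True by auto
            have e1: "M + 1 - 2 * (j - 1) = (M + 1 - 2 * j) + 2" using t Suc by auto
            have e2: "real (M + 1 - 2 * j) + 1 + l \<noteq> 0" using l by (smt (verit) of_nat_0_le_iff)
            show ?thesis unfolding e1 using t e2 by (simp add: zonal_down_def u_def zonal_up_def field_simps)
          qed
          moreover have "2 * (j - 1) \<le> M + 1" using True by auto
          ultimately show ?thesis using Suc c(3) by (simp add: W_def)
        qed
        have V: "V (j - 1) = A * B" using True Suc c(4) by (auto simp: V_def)
        have "(real n + real j + 1) * (R * Q) = (real n + real j + a) * (Q * u + R * (2 - u)) - (real n + real j - 1 + 2 * a)"
          by (rule connection_coeff_identity[OF _ D R_def Q_def u u0 nz]) (simp add: Suc)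
        then have "A * B * ((real n + real j + 1) * (R * Q)) = A * B * ((real n + real j + a) * (Q * u + R * (2 - u)) - (real n + real j - 1 + 2 * a))"
          by simp
        moreover have "(real M + 1 + a) * (A * B * Q * u + A * R * B * (2 - u)) - (real M + 2 * a) * (A * B) =
          A * B * ((real n + real j + a) * (Q * u + R * (2 - u)) - (real n + real j - 1 + 2 * a))"
          unfolding rM by (simp add: algebra_simps)
        ultimately show ?thesis unfolding U W V c using Suc True rM by (auto simp: mult_ac add_ac)
      qed
    qed
    have "2 * c * (real M + 1 + a) * ?S (M + 1) - (real M + 2 * a) * ?S M =
      (real M + 1 + a) * (2 * c * ?S (M + 1)) - (real M + 2 * a) * ?S M" by (simp add: mult_ac)
    also have "\<dots> = (\<Sum>j\<le>M+2. ((real M + 1 + a) * (U j + (if j = 0 then 0 else W (j - 1))) - (real M + 2 * a) * (if j = 0 then 0 else V (j - 1))) * Z (M + 2 - 2 * j))"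
      unfolding 1 2 by (simp only: sum_distrib_left sum_subtractf left_diff_distrib mult.assoc)
    also have "\<dots> = (real M + 2) * ?S (M + 2)"
      unfolding key S sum_distrib_left by (intro sum.cong refl) (simp add: G_def)
    finally have "2 * c * (real M + 1 + a) * ?S (M + 1) - (real M + 2 * a) * ?S M = (real M + 2) * ?S (M + 2)" .
    moreover have "?P (M + 1) = ?S (M + 1)" "?P M = ?S M" by (rule less.IH; simp add: 3)+
    ultimately have "(real M + 2) * ?P (M + 2) = (real M + 2) * ?S (M + 2)"
      using solid_geg_rec[of M a c 1] by (simp only:) (simp add: mult_ac)
    then have "?P (M + 2) = ?S (M + 2)" by (subst (asm) mult_left_cancel) simp_all
    then show ?thesis unfolding 3 .
  qed
qed

text \<open>The quotient is nonincreasing as soon as \<open>|x + n| <= y + n\<close>, that is from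
  \<open>n >= - (x + y) / 2\<close> on; the finitely many earlier values are absorbed in
  \<open>K\<close>.\<close>

lemma pochhammer_bound:
  fixes x y :: real
  assumes y: "y > 0" and xy: "x \<le> y"
  shows "\<exists>K>0. \<forall>n. \<bar>pochhammer x n\<bar> \<le> K * pochhammer y n"
proof -
  have p: "pochhammer y n > 0" for n using y by (rule pochhammer_pos)
  define b where "b n = \<bar>pochhammer x n\<bar> / pochhammer y n" for n
  have b0: "b n \<ge> 0" for n using p[of n] by (simp add: b_def)
  obtain N where N: "real N \<ge> - (x + y) / 2" using real_arch_simple by blast
  have dec: "b (Suc n) \<le> b n" if "N \<le> n" for n
  proof -
    have "real n \<ge> - (x + y) / 2" using N that by linarith
    then have "\<bar>x + real n\<bar> \<le> y + real n" using xy by (simp add: abs_le_iff)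
    then have "b n * (\<bar>x + real n\<bar> / (y + real n)) \<le> b n * 1" using y b0 by (intro mult_left_mono) auto
    then show ?thesis by (simp add: b_def pochhammer_Suc abs_mult)
  qed
  define K where "K = 1 + (\<Sum>i\<le>N. b i)"
  have small: "b n \<le> K" if "n \<le> N" for n
    using member_le_sum[of n "{..N}" b] that b0 by (simp add: K_def)
  have bK: "b n \<le> K" for n
  proof (cases "n \<le> N")
    case False
    then have "N \<le> n" by simp
    then have "b n \<le> b N" by (induction n rule: dec_induct) (use dec order_trans in blast)+
    then show ?thesis using small[of N] by simp
  qed (rule small)
  have "\<bar>pochhammer x n\<bar> \<le> K * pochhammer y n" for n
    using bK[of n] unfolding b_def pos_divide_le_eq[OF p[of n]] .
  moreover have "K > 0" unfolding K_def using b0 by (intro add_pos_nonneg sum_nonneg) auto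
  ultimately show ?thesis by blast
qed

lemma solid_geg_at_1: "solid_geg a m 1 1 = pochhammer (2 * a) m / fact m"
proof (induction m rule: less_induct)
  case (less m)
  have "m = 0 \<or> m = 1 \<or> (\<exists>M. m = M + 2)" by presburger
  then consider "m = 0" | "m = 1" | M where "m = M + 2" by blast
  then show ?case
  proof cases
    case 3
    have I: "solid_geg a (M + 1) 1 1 = pochhammer (2 * a) M * (2 * a + real M) / ((real M + 1) * fact M)"
      "solid_geg a M 1 1 = pochhammer (2 * a) M / fact M"
      using less.IH[of "M + 1"] less.IH[of M] 3 by (simp_all add: pochhammer_Suc add.commute[of 1 "real M"])
    define F where "F = pochhammer (2 * a) M / fact M"
    have "(real M + 2) * solid_geg a (M + 2) 1 1 = 2 * (real M + 1 + a) * (F * (2 * a + real M) / (real M + 1)) - (real M + 2 * a) * F"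
      using solid_geg_rec[of M a 1 1] unfolding I F_def by (simp add: mult_ac)
    also have "\<dots> = F * (2 * a + real M) * (2 * a + real M + 1) / (real M + 1)"
      by (simp add: divide_simps) (simp add: algebra_simps)
    finally have *: "(real M + 2) * solid_geg a (M + 2) 1 1 = F * (2 * a + real M) * (2 * a + real M + 1) / (real M + 1)" .
    have "solid_geg a (M + 2) 1 1 = (real M + 2) * solid_geg a (M + 2) 1 1 / (real M + 2)" by simp
    then have "solid_geg a (M + 2) 1 1 = F * (2 * a + real M) * (2 * a + real M + 1) / ((real M + 1) * (real M + 2))"
      unfolding * by simp
    also have "\<dots> = pochhammer (2 * a) (M + 2) / fact (M + 2)"
      by (simp add: F_def pochhammer_Suc mult_ac add_ac)
    finally show ?thesis unfolding 3 .
  qed simp_all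
qed

lemma pochhammer_powser_summable: "\<bar>x\<bar> < 1 \<Longrightarrow> summable (\<lambda>k. \<bar>pochhammer b k / fact k * x ^ k\<bar>)" for b x :: real
proof -
  assume x: "\<bar>x\<bar> < 1"
  define y where "y = (1 + \<bar>x\<bar>) / 2"
  have y: "\<bar>x\<bar> < \<bar>y\<bar>" "\<bar>- y\<bar> < 1" using x by (auto simp: y_def)
  have "summable (\<lambda>k. (- b gchoose k) * (- y) ^ k)" using gen_binomial_real[OF y(2), of "- b"] by (simp add: sums_summable)
  moreover have "(- b gchoose k) * (- y) ^ k = pochhammer b k / fact k * y ^ k" for k
  proof -
    have "(- 1) ^ k * (- y) ^ k = y ^ k" by (simp add: power_mult_distrib[symmetric])
    moreover have "(- b gchoose k) = (- 1) ^ k * (pochhammer b k / fact k)" by (simp add: gbinomial_pochhammer)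
    ultimately show ?thesis by (metis mult.assoc mult.commute)
  qed
  ultimately have "summable (\<lambda>k. pochhammer b k / fact k * y ^ k)" by simp
  from powser_insidea[OF this, of x] y show ?thesis by simp
qed

text \<open>The values at 1 are differences of coefficients of the binomial series of
  \<open>(1 - t)\<close> to the power \<open>- 2 * (l + 1)\<close>, which converges absolutely
  inside the unit disc.\<close>

lemma zonal_1_summable:
  assumes l: "l > -1" and r: "0 \<le> r" "r < 1"
  shows "summable (\<lambda>m. \<bar>zonal l m 1 1 * r ^ m\<bar>)"
proof -
  define P where "P m = pochhammer (2 * (l + 1)) m / fact m" for m
  have P: "P m \<ge> 0" for m using l by (auto simp: P_def intro!: divide_nonneg_pos pochhammer_nonneg)
  have s: "summable (\<lambda>m. \<bar>P m * r ^ m\<bar>)" unfolding P_def by (rule pochhammer_powser_summable) (use r in auto)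
  have s2: "summable (\<lambda>m. if m < 2 then 0 else \<bar>P (m - 2) * r ^ (m - 2)\<bar>)"
    by (rule summable_iff_shift[THEN iffD1, of _ 2]) (use s in simp)
  show ?thesis
  proof (rule summable_comparison_test'[OF summable_add[OF s s2]])
    fix m :: nat
    have z: "zonal l m 1 1 = P m - (if m < 2 then 0 else P (m - 2))"
      by (simp add: zonal_def solid_geg_at_1 P_def)
    show "norm \<bar>zonal l m 1 1 * r ^ m\<bar> \<le> \<bar>P m * r ^ m\<bar> + (if m < 2 then 0 else \<bar>P (m - 2) * r ^ (m - 2)\<bar>)"
    proof (cases "m < 2")
      case False
      have "r ^ m \<le> r ^ (m - 2)" using r by (intro power_decreasing) auto
      then have "P (m - 2) * r ^ m \<le> P (m - 2) * r ^ (m - 2)" using P by (intro mult_left_mono)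
      moreover have "\<bar>zonal l m 1 1 * r ^ m\<bar> \<le> (P m + P (m - 2)) * r ^ m"
      proof -
        have "\<bar>zonal l m 1 1\<bar> \<le> P m + P (m - 2)" unfolding z using False P[of m] P[of "m - 2"] by simp
        then show ?thesis using r by (simp add: abs_mult mult_right_mono)
      qed
      moreover have "\<bar>P m * r ^ m\<bar> = P m * r ^ m" "\<bar>P (m - 2) * r ^ (m - 2)\<bar> = P (m - 2) * r ^ (m - 2)"
        using P[of m] P[of "m - 2"] r by simp_all
      ultimately have "\<bar>zonal l m 1 1 * r ^ m\<bar> \<le> \<bar>P m * r ^ m\<bar> + \<bar>P (m - 2) * r ^ (m - 2)\<bar>" by (simp add: distrib_right)
      then show ?thesis using False by simp
    qed (simp add: z)
  qed
qed

text \<open>The connection coefficients are bounded and the zonal polynomials are dominated by their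
  values at 1, so the double series converges absolutely and may be regrouped along
  \<open>k = m + 2 * j\<close>. The regrouped series is identified through its differential
  equation, which covers the nonintegral power.\<close>

theorem gegenbauer_expansion:
  assumes H: "0 < H" "H < 1" and l: "l \<ge> -1 / 2" and r: "0 \<le> r" "r < 1" and c: "\<bar>c\<bar> \<le> 1"
    and Z: "\<And>m. \<bar>zonal l m c 1\<bar> \<le> zonal l m 1 1"
  shows "(\<lambda>j. connection_coeff (- H) l (m + 2 * j) j * r ^ (2 * j)) summable_on UNIV"
    and "((\<lambda>m. zonal l m c 1 * r ^ m * (\<Sum>\<^sub>\<infinity>j. connection_coeff (- H) l (m + 2 * j) j * r ^ (2 * j))) has_sum (1 - 2 * r * c + r\<^sup>2) powr H) UNIV"
proof -
  have l1: "l > -1" using l by simp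
  obtain K1 where K1: "K1 > 0" "\<And>n. \<bar>pochhammer (- H) n\<bar> \<le> K1 * pochhammer (l + 1) n"
    using pochhammer_bound[of "l + 1" "- H"] H l by auto
  obtain K2 where K2: "K2 > 0" "\<And>n. \<bar>pochhammer (- H - l) n\<bar> \<le> K2 * pochhammer 1 n"
    using pochhammer_bound[of 1 "- H - l"] H l by auto
  have connection_coeff_le: "\<bar>connection_coeff (- H) l k j\<bar> \<le> K1 * K2" for k j
  proof -
    have p: "pochhammer (l + 1) (k - j) > 0" using l1 by (intro pochhammer_pos) auto
    have "\<bar>connection_coeff (- H) l k j\<bar> = (\<bar>pochhammer (- H) (k - j)\<bar> / pochhammer (l + 1) (k - j)) * (\<bar>pochhammer (- H - l) j\<bar> / fact j)"
      using p by (simp add: connection_coeff_def abs_mult)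
    also have "\<dots> \<le> K1 * K2"
      using K1 K2 p by (intro mult_mono) (auto simp: pos_divide_le_eq pochhammer_fact[symmetric])
    finally show ?thesis .
  qed
  have geo: "(\<lambda>j. \<bar>x\<bar> ^ (2 * j)) summable_on UNIV" if "\<bar>x\<bar> < 1" for x :: real
  proof -
    have "\<bar>x\<^sup>2\<bar> < 1" using that by (simp add: abs_square_less_1)
    then have "summable (\<lambda>j. (x\<^sup>2) ^ j)" by (intro summable_geometric) simp
    then show ?thesis by (subst summable_on_UNIV_nonneg_real_iff) (auto simp: power_mult)
  qed
  have f: "(\<lambda>(m, j). connection_coeff (- H) l (m + 2 * j) j * zonal l m c 1 * x ^ (m + 2 * j)) summable_on UNIV"
    if x: "\<bar>x\<bar> < 1" for x
  proof -
    have s1: "(\<lambda>m. zonal l m 1 1 * \<bar>x\<bar> ^ m) summable_on UNIV"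
      using zonal_1_summable[OF l1, of "\<bar>x\<bar>"] x Z order_trans[OF abs_ge_zero Z]
      by (subst summable_on_UNIV_nonneg_real_iff) (auto simp: abs_mult)
    have "(\<lambda>(m, j). (zonal l m 1 1 * \<bar>x\<bar> ^ m) * \<bar>x\<bar> ^ (2 * j)) summable_on (UNIV \<times> UNIV)"
      using s1 geo[OF x] order_trans[OF abs_ge_zero Z]
      by (intro summable_on_SigmaI[where g = "\<lambda>m. (zonal l m 1 1 * \<bar>x\<bar> ^ m) * (\<Sum>\<^sub>\<infinity>j. \<bar>x\<bar> ^ (2 * j))"])
        (auto intro!: has_sum_cmult_right summable_on_cmult_left)
    then have "(\<lambda>p. K1 * K2 * (case p of (m, j) \<Rightarrow> (zonal l m 1 1 * \<bar>x\<bar> ^ m) * \<bar>x\<bar> ^ (2 * j))) summable_on UNIV"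
      by (intro summable_on_cmult_right) simp
    then have "(\<lambda>p. norm (case p of (m, j) \<Rightarrow> connection_coeff (- H) l (m + 2 * j) j * zonal l m c 1 * x ^ (m + 2 * j))) summable_on UNIV"
    proof (rule Infinite_Sum.abs_summable_on_comparison_test')
      fix p :: "nat \<times> nat"
      obtain m j where p: "p = (m, j)" by (metis surj_pair)
      have "\<bar>connection_coeff (- H) l (m + 2 * j) j\<bar> * (\<bar>zonal l m c 1\<bar> * \<bar>x\<bar> ^ (m + 2 * j)) \<le> (K1 * K2) * (zonal l m 1 1 * \<bar>x\<bar> ^ (m + 2 * j))"
        using connection_coeff_le Z K1 K2 order_trans[OF abs_ge_zero Z] by (intro mult_mono) auto
      then show "norm (case p of (m, j) \<Rightarrow> connection_coeff (- H) l (m + 2 * j) j * zonal l m c 1 * x ^ (m + 2 * j)) \<le> K1 * K2 * (case p of (m, j) \<Rightarrow> zonal l m 1 1 * \<bar>x\<bar> ^ m * \<bar>x\<bar> ^ (2 * j))"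
        unfolding p by (simp add: abs_mult power_abs power_add mult_ac)
    qed
    then show ?thesis by (rule Infinite_Sum.abs_summable_summable)
  qed
  show A: "(\<lambda>j. connection_coeff (- H) l (m + 2 * j) j * r ^ (2 * j)) summable_on UNIV" for m
  proof (rule Infinite_Sum.abs_summable_summable, rule Infinite_Sum.abs_summable_on_comparison_test'[OF summable_on_cmult_right[OF geo[of r], of "K1 * K2"]])
    show "\<bar>r\<bar> < 1" using r by simp
    fix j
    show "norm (connection_coeff (- H) l (m + 2 * j) j * r ^ (2 * j)) \<le> K1 * K2 * \<bar>r\<bar> ^ (2 * j)"
      using connection_coeff_le[of "m + 2 * j" j] by (simp add: abs_mult power_abs mult_right_mono)
  qed
  define S where "S x = (\<Sum>\<^sub>\<infinity>(m, j)\<in>UNIV. connection_coeff (- H) l (m + 2 * j) j * zonal l m c 1 * x ^ (m + 2 * j))" for x :: real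
  have P: "((\<lambda>k. solid_geg (- H) k c 1 * x ^ k) has_sum S x) UNIV" if x: "\<bar>x\<bar> < 1" for x
  proof -
    have hs: "((\<lambda>(m, j). connection_coeff (- H) l (m + 2 * j) j * zonal l m c 1 * x ^ (m + 2 * j)) has_sum S x) UNIV"
      unfolding S_def using f[OF x] by simp
    have "((\<lambda>(k, j). connection_coeff (- H) l k j * zonal l (k - 2 * j) c 1 * x ^ k) has_sum S x) (SIGMA k:UNIV. {j. 2 * j \<le> k})"
    proof -
      have "((\<lambda>(k, j). connection_coeff (- H) l k j * zonal l (k - 2 * j) c 1 * x ^ k) has_sum S x) (SIGMA k:UNIV. {j. 2 * j \<le> k})
          \<longleftrightarrow> ((\<lambda>(m, j). connection_coeff (- H) l (m + 2 * j) j * zonal l m c 1 * x ^ (m + 2 * j)) has_sum S x) UNIV"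
        by (rule has_sum_reindex_bij_witness[where j = "\<lambda>(k, j). (k - 2 * j, j)" and i = "\<lambda>(m, j). (m + 2 * j, j)"]) auto
      then show ?thesis using hs by blast
    qed
    then show ?thesis
    proof (rule has_sum_SigmaD)
      fix k :: nat
      have "{j. 2 * j \<le> k} \<subseteq> {..k}" by auto
      then have fin: "finite {j. 2 * j \<le> k}" using finite_subset by blast
      have "((\<lambda>j. connection_coeff (- H) l k j * zonal l (k - 2 * j) c 1 * x ^ k) has_sum (\<Sum>j\<in>{j. 2 * j \<le> k}. connection_coeff (- H) l k j * zonal l (k - 2 * j) c 1 * x ^ k)) {j. 2 * j \<le> k}"
        by (rule has_sum_finite[OF fin])
      also have "(\<Sum>j\<in>{j. 2 * j \<le> k}. connection_coeff (- H) l k j * zonal l (k - 2 * j) c 1 * x ^ k) = solid_geg (- H) k c 1 * x ^ k"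
        unfolding solid_geg_connection[OF l1, of "- H" k c] sum_distrib_right
        by (rule sum.mono_neutral_cong_left) auto
      finally show "((\<lambda>y. case (k, y) of (k, j) \<Rightarrow> connection_coeff (- H) l k j * zonal l (k - 2 * j) c 1 * x ^ k) has_sum solid_geg (- H) k c 1 * x ^ k) {j. 2 * j \<le> k}"
        by simp
    qed
  qed
  define p where "p k = solid_geg (- H) k c 1" for k
  have ps: "(\<lambda>k. p k * x ^ k) sums S x" if "\<bar>x\<bar> < 1" for x
    using has_sum_imp_sums[OF P[OF that]] by (simp add: p_def)
  have Sdef: "S x = (\<Sum>k. p k * x ^ k)" if "\<bar>x\<bar> < 1" for x using ps[OF that] sums_unique by blast
  define S' where "S' x = (\<Sum>k. diffs p k * x ^ k)" for x
  have dS: "(S has_field_derivative S' x) (at x)" if x: "\<bar>x\<bar> < 1" for x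
  proof -
    have "((\<lambda>x. \<Sum>k. p k * x ^ k) has_field_derivative S' x) (at x)"
      unfolding S'_def by (rule termdiffs_strong'[where K = 1]) (use x in \<open>auto intro: sums_summable[OF ps]\<close>)
    then show ?thesis
      by (rule has_field_derivative_transform_within_open[of _ _ _ "{-1<..<1}"]) (use x Sdef in auto)
  qed
  have q: "1 - 2 * c * x + x\<^sup>2 > 0" if x: "\<bar>x\<bar> < 1" for x
  proof -
    have "c * x \<le> \<bar>c\<bar> * \<bar>x\<bar>" by (metis abs_ge_self abs_mult)
    also have "\<dots> \<le> 1 * \<bar>x\<bar>" using c by (intro mult_right_mono) auto
    finally have "1 - 2 * c * x + x\<^sup>2 \<ge> (1 - \<bar>x\<bar>)\<^sup>2" by (simp add: power2_eq_square algebra_simps)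
    moreover have "(1 - \<bar>x\<bar>)\<^sup>2 > 0" using x by simp
    ultimately show ?thesis by linarith
  qed
  \<comment> \<open>The three-term recurrence read as a linear differential equation. The shifted
    copies of the series carry explicit zero initial terms, so that all five can be added at the
    same index.\<close>
  have ode: "S' x * (1 - 2 * c * x + x\<^sup>2) = H * (2 * x - 2 * c) * S x" if x: "\<bar>x\<bar> < 1" for x
  proof -
    have sd: "(\<lambda>k. diffs p k * x ^ k) sums S' x"
      unfolding S'_def by (rule summable_sums, rule termdiff_converges[of x 1]) (use x in \<open>auto intro: sums_summable[OF ps]\<close>)
    then have d0: "(\<lambda>k. real (k + 1) * p (k + 1) * x ^ k) sums S' x" by (simp add: diffs_def)
    have shift: "(\<lambda>k. if k = 0 then 0 else g (k - 1)) sums s" if "g sums s" for g :: "nat \<Rightarrow> real" and s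
      using sums_Suc[of "\<lambda>k. if k = 0 then 0 else g (k - 1)" s] that by simp
    have d1: "(\<lambda>k. x * (real (k + 1) * p (k + 1) * x ^ k)) sums (x * S' x)" by (rule sums_mult[OF d0])
    have p1: "(\<lambda>k. x * (p k * x ^ k)) sums (x * S x)" by (rule sums_mult[OF ps[OF x]])
    have "(\<lambda>k. real (k + 1) * p (k + 1) * x ^ k
        - 2 * c * (if k = 0 then 0 else x * (real (k - 1 + 1) * p (k - 1 + 1) * x ^ (k - 1)))
        + (if k = 0 then 0 else x * (if k - 1 = 0 then 0 else x * (real (k - 1 - 1 + 1) * p (k - 1 - 1 + 1) * x ^ (k - 1 - 1))))
        - (H * 2 * (if k = 0 then 0 else x * (p (k - 1) * x ^ (k - 1))) - H * 2 * c * (p k * x ^ k)))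
      sums (S' x - 2 * c * (x * S' x) + x * (x * S' x) - (H * 2 * (x * S x) - H * 2 * c * S x))"
      by (intro sums_add sums_diff sums_mult d0 shift[OF d1] shift[OF sums_mult[OF shift[OF d1], of x]] shift[OF p1] ps[OF x])
    moreover have "real (k + 1) * p (k + 1) * x ^ k
        - 2 * c * (if k = 0 then 0 else x * (real (k - 1 + 1) * p (k - 1 + 1) * x ^ (k - 1)))
        + (if k = 0 then 0 else x * (if k - 1 = 0 then 0 else x * (real (k - 1 - 1 + 1) * p (k - 1 - 1 + 1) * x ^ (k - 1 - 1))))
        - (H * 2 * (if k = 0 then 0 else x * (p (k - 1) * x ^ (k - 1))) - H * 2 * c * (p k * x ^ k)) = 0" for k
    proof (cases k)
      case 0
      then show ?thesis by (simp add: p_def)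
    next
      case (Suc i)
      have "(real i + 2) * p (i + 2) = 2 * (real i + 1 - H) * c * p (i + 1) - (real i - 2 * H) * p i"
        using solid_geg_rec[of i "- H" c 1] by (simp add: p_def)
      then have rec: "x ^ Suc i * ((real i + 2) * p (i + 2)) = x ^ Suc i * (2 * (real i + 1 - H) * c * p (i + 1) - (real i - 2 * H) * p i)" by simp
      have T: "(if i = 0 then 0 else x * (real (i - 1 + 1) * p (i - 1 + 1) * x ^ (i - 1))) = real i * p i * x ^ i"
        by (cases i) auto
      show ?thesis unfolding Suc diff_Suc_1 T using rec by (simp add: algebra_simps)
    qed
    ultimately have "S' x - 2 * c * (x * S' x) + x * (x * S' x) - (H * 2 * (x * S x) - H * 2 * c * S x) = 0"
      by (simp only: sums_zero sums_unique2[OF _ sums_zero])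
    then show ?thesis by (simp add: algebra_simps power2_eq_square)
  qed
  have val: "S r = (1 - 2 * c * r + r\<^sup>2) powr H"
  proof (cases "r = 0")
    case True
    have "p 0 = 1" by (simp add: p_def)
    then show ?thesis using True Sdef[of 0] powser_zero[of p] by simp
  next
    case False
    define W where "W x = S x * (1 - 2 * c * x + x\<^sup>2) powr (- H)" for x
    have dW: "(W has_field_derivative 0) (at x)" if x: "\<bar>x\<bar> < 1" for x
    proof -
      define y where "y = 1 - 2 * c * x + x\<^sup>2"
      have y: "y > 0" using q[OF x] by (simp add: y_def)
      have "(W has_field_derivative (S' x * y powr (- H) + (- H * y powr (- H - 1) * (- 2 * c + 2 * x)) * S x)) (at x)"
        unfolding W_def[abs_def] y_def using dS[OF x] q[OF x]
        by (intro DERIV_mult) (auto intro!: derivative_eq_intros simp: power2_eq_square)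
      moreover have "y powr (- H) = y powr (- H - 1) * y" using y by (simp add: powr_diff)
      then have "S' x * y powr (- H) + (- H * y powr (- H - 1) * (- 2 * c + 2 * x)) * S x = y powr (- H - 1) * (S' x * y - H * (2 * x - 2 * c) * S x)"
        by (simp add: algebra_simps)
      ultimately show ?thesis using ode[OF x] by (simp add: y_def)
    qed
    have "W r = W 0"
    proof (rule DERIV_isconst2[of 0 r W r])
      show "continuous_on {0..r} W"
        by (rule DERIV_continuous_on[where D = "\<lambda>_. 0"]) (rule has_field_derivative_at_within[OF dW], use r in auto)
    qed (use r False dW in auto)
    moreover have "S 0 = 1" using Sdef[of 0] powser_zero[of p] by (simp add: p_def)
    ultimately have "S r * (1 - 2 * c * r + r\<^sup>2) powr (- H) = 1" by (simp add: W_def)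
    then show ?thesis using q[of r] r by (simp add: powr_minus field_simps)
  qed
  have "((\<lambda>(m, j). connection_coeff (- H) l (m + 2 * j) j * zonal l m c 1 * r ^ (m + 2 * j)) has_sum S r) (UNIV \<times> UNIV)"
    unfolding S_def using f[of r] r by simp
  then have "((\<lambda>m. zonal l m c 1 * r ^ m * (\<Sum>\<^sub>\<infinity>j. connection_coeff (- H) l (m + 2 * j) j * r ^ (2 * j))) has_sum S r) UNIV"
  proof (rule has_sum_SigmaD)
    fix m
    have "((\<lambda>j. zonal l m c 1 * r ^ m * (connection_coeff (- H) l (m + 2 * j) j * r ^ (2 * j))) has_sum zonal l m c 1 * r ^ m * (\<Sum>\<^sub>\<infinity>j. connection_coeff (- H) l (m + 2 * j) j * r ^ (2 * j))) UNIV"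
      by (intro has_sum_cmult_right has_sum_infsum A)
    then show "((\<lambda>y. case (m, y) of (m, j) \<Rightarrow> connection_coeff (- H) l (m + 2 * j) j * zonal l m c 1 * r ^ (m + 2 * j)) has_sum zonal l m c 1 * r ^ m * (\<Sum>\<^sub>\<infinity>j. connection_coeff (- H) l (m + 2 * j) j * r ^ (2 * j))) UNIV"
      by (simp add: power_add mult_ac)
  qed
  then show "((\<lambda>m. zonal l m c 1 * r ^ m * (\<Sum>\<^sub>\<infinity>j. connection_coeff (- H) l (m + 2 * j) j * r ^ (2 * j))) has_sum (1 - 2 * r * c + r\<^sup>2) powr H) UNIV"
    unfolding val by (simp add: mult_ac)
qed

section \<open>Numbered zeros, normalising constants and radial sums\<close>

lemma count_bij_betw:
  fixes S :: "real set"
  assumes inf: "infinite S" and fin: "\<And>z. finite {y \<in> S. y \<le> z}"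
  shows "bij_betw (\<lambda>z. card {y \<in> S. y \<le> z}) S {1..}"
proof -
  let ?c = "\<lambda>z. card {y \<in> S. y \<le> z}"
  have mono: "?c x < ?c y" if "x \<in> S" "y \<in> S" "x < y" for x y
  proof (rule psubset_card_mono[OF fin])
    have "y \<in> {w \<in> S. w \<le> y} \<and> y \<notin> {w \<in> S. w \<le> x}" "{w \<in> S. w \<le> x} \<subseteq> {w \<in> S. w \<le> y}" using that by auto
    then show "{w \<in> S. w \<le> x} \<subset> {w \<in> S. w \<le> y}" by blast
  qed
  have inj: "inj_on ?c S"
  proof (rule inj_onI, rule ccontr)
    fix x y assume "x \<in> S" "y \<in> S" "?c x = ?c y" "x \<noteq> y"
    then show False using mono[of x y] mono[of y x] by (cases "x < y") auto
  qed
  have pos: "?c z \<ge> 1" if "z \<in> S" for z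
  proof -
    have "{y \<in> S. y \<le> z} \<noteq> {}" using that by auto
    then have "?c z > 0" using fin[of z] by (simp add: card_gt_0_iff)
    then show ?thesis by simp
  qed
  \<comment> \<open>The largest point below \<open>z\<close> has a count smaller by exactly one.
    Counts are unbounded on an infinite set, so descending reaches every positive integer.\<close>
  have pred: "n \<in> ?c ` S" if mem: "Suc n \<in> ?c ` S" and n: "n \<ge> 1" for n
  proof -
    obtain z where z: "z \<in> S" "?c z = Suc n" using mem by auto
    define T where "T = {y \<in> S. y < z}"
    have T: "finite T" unfolding T_def by (rule finite_subset[OF _ fin[of z]]) auto
    have e: "{y \<in> S. y \<le> z} = insert z T" "z \<notin> T" using z by (auto simp: T_def)
    then have cT: "card T = n" using z(2) T by simp
    then have "T \<noteq> {}" using n by auto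
    define w where "w = Max T"
    have w: "w \<in> T" unfolding w_def by (rule Max_in[OF T \<open>T \<noteq> {}\<close>])
    have "{y \<in> S. y \<le> w} = T"
      using w T by (auto simp: T_def w_def intro!: Max_ge[OF T[unfolded T_def]])
    then show ?thesis using w cT by (intro image_eqI[of _ _ w]) (auto simp: T_def)
  qed
  have "infinite (?c ` S)" using inf inj finite_imageD by blast
  have "n \<in> ?c ` S" if "n \<ge> 1" for n
  proof -
    obtain m where "m \<ge> n" "m \<in> ?c ` S" using \<open>infinite (?c ` S)\<close> by (meson finite_nat_set_iff_bounded_le nat_le_linear)
    then show ?thesis
    proof (induction m rule: dec_induct)
      case (step m)
      then show ?case using pred[of m] that by auto
    qed simp
  qed
  then have "?c ` S = {1..}" using pos by auto
  with inj show ?thesis by (simp add: bij_betw_def)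
qed

lemma bessel_zero_set:
  assumes nu: "\<nu> > -1"
  shows "bij_betw (\<lambda>z. z\<^sup>2 / 4) {z. 0 < z \<and> bessel_J \<nu> z = 0} (clifford_zeros \<nu>)"
proof (rule bij_betwI[where g = "\<lambda>a. 2 * sqrt a"])
  show "(\<lambda>z. z\<^sup>2 / 4) \<in> {z. 0 < z \<and> bessel_J \<nu> z = 0} \<rightarrow> clifford_zeros \<nu>"
    using bessel_J_clifford[OF nu] by (auto simp: clifford_zeros_def)
  show "(\<lambda>a. 2 * sqrt a) \<in> clifford_zeros \<nu> \<rightarrow> {z. 0 < z \<and> bessel_J \<nu> z = 0}"
  proof
    fix a assume a: "a \<in> clifford_zeros \<nu>"
    then have "a > 0" by (rule clifford_zeros_pos[OF nu])
    then show "2 * sqrt a \<in> {z. 0 < z \<and> bessel_J \<nu> z = 0}"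
      using a bessel_J_clifford[OF nu, of "2 * sqrt a"] by (simp add: clifford_zeros_def power_mult_distrib)
  qed
qed (auto simp: real_sqrt_divide power_mult_distrib dest: clifford_zeros_pos[OF nu])

text \<open>The function that counts zeros up to a given one is a bijection onto the positive
  integers, so the definite description in \<open>bessel_zero\<close> denotes the value of its
  inverse.\<close>

lemma bessel_zero_bij:
  assumes nu: "\<nu> > -1"
  shows "bij_betw (bessel_zero \<nu>) {1..} {z. 0 < z \<and> bessel_J \<nu> z = 0}"
proof -
  define S where "S = {z. 0 < z \<and> bessel_J \<nu> z = 0}"
  have bij: "bij_betw (\<lambda>z. z\<^sup>2 / 4) S (clifford_zeros \<nu>)" unfolding S_def by (rule bessel_zero_set[OF nu])
  have inf: "infinite S" using bij_betw_finite[OF bij] infinite_clifford_zeros[OF nu] by simp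
  have fin: "finite {y \<in> S. y \<le> z}" for z
  proof (rule finite_imageD[of "\<lambda>z. z\<^sup>2 / 4"])
    have "(\<lambda>z. z\<^sup>2 / 4) ` {y \<in> S. y \<le> z} \<subseteq> {w \<in> clifford_zeros \<nu>. w \<le> z\<^sup>2 / 4}"
      using bij by (auto simp: bij_betw_def S_def power_mono)
    then show "finite ((\<lambda>z. z\<^sup>2 / 4) ` {y \<in> S. y \<le> z})" using finite_clifford_zeros[OF nu] finite_subset by blast
    show "inj_on (\<lambda>z. z\<^sup>2 / 4) {y \<in> S. y \<le> z}" using bij by (auto simp: bij_betw_def inj_on_def)
  qed
  let ?c = "\<lambda>z. card {y \<in> S. y \<le> z}"
  have c: "bij_betw ?c S {1..}" by (rule count_bij_betw[OF inf fin])
  have eq: "bessel_zero \<nu> n = the_inv_into S ?c n" if n: "n \<in> {1..}" for n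
  proof -
    have "{y. 0 < y \<and> y \<le> z \<and> bessel_J \<nu> y = 0} = {y \<in> S. y \<le> z}" for z by (auto simp: S_def)
    then have "bessel_zero \<nu> n = (THE z. z \<in> S \<and> ?c z = n)" by (simp add: bessel_zero_def S_def conj_assoc)
    then show ?thesis by (simp add: the_inv_into_def)
  qed
  have "bij_betw (the_inv_into S ?c) {1..} S" by (rule bij_betw_the_inv_into[OF c])
  then show ?thesis unfolding S_def[symmetric] using eq by (subst bij_betw_cong[of "{1..}"]) auto
qed

lemma bessel_zero_pos: "\<nu> > -1 \<Longrightarrow> n \<ge> 1 \<Longrightarrow> bessel_zero \<nu> n > 0"
  using bessel_zero_bij[of \<nu>] by (auto simp: bij_betw_def)

lemma has_sum_bessel_zero:
  assumes nu: "\<nu> > -1" and s: "(f has_sum S) (clifford_zeros \<nu>)"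
  shows "((\<lambda>n. f ((bessel_zero \<nu> n)\<^sup>2 / 4)) has_sum S) {1..}"
  using has_sum_reindex_bij_betw[OF bij_betw_trans[OF bessel_zero_bij[OF nu] bessel_zero_set[OF nu]], of f S] s by (simp add: o_def)

lemma g_fun_clifford:
  assumes N: "N \<ge> 1" and u: "u > 0"
  defines "l \<equiv> (real N - 2) / 2"
  shows "g_fun N m u = Gamma (l + 1) * (u\<^sup>2 / 4) powr (real m / 2) * clifford (real m + l) (u\<^sup>2 / 4)"
proof -
  have "real N \<ge> 1" using N by simp
  then have l: "real m + l > -1" by (simp add: l_def field_simps)
  have N2: "real N / 2 = l + 1" by (simp add: l_def field_simps)
  have "g_fun N m u = 2 powr l * Gamma (l + 1) * bessel_J (real m + l) u / u powr l"
    using u unfolding g_fun_def Let_def N2 l_def[symmetric] by simp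
  also have "bessel_J (real m + l) u = (u / 2) powr (real m + l) * clifford (real m + l) (u\<^sup>2 / 4)"
    by (rule bessel_J_clifford[OF l u])
  also have "(u / 2) powr (real m + l) = (u\<^sup>2 / 4) powr (real m / 2) * (u powr l / 2 powr l)"
  proof -
    have "(u\<^sup>2 / 4) powr (real m / 2) = (u / 2) powr real m"
    proof -
      have "u\<^sup>2 / 4 = (u / 2) powr 2" using u by (simp add: power_divide)
      then show ?thesis by (simp add: powr_powr)
    qed
    then show ?thesis using u by (simp add: powr_add powr_divide)
  qed
  finally show ?thesis using u by (simp add: field_simps)
qed

text \<open>At a zero the square of \<open>bessel_J (\<nu> + 1)\<close> is, up to a power of
  \<open>a\<close>, the squared norm of the mode. Hence the square of the series coefficient
  supplies exactly the denominator of Parseval's identity.\<close>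

lemma tau_sq:
  fixes m :: nat
  assumes N: "N \<ge> 1" and H: "0 < H" "H < 1" and n: "n \<ge> 1"
  defines "l \<equiv> (real N - 2) / 2" and "\<nu> \<equiv> bessel_order H m"
  defines "a \<equiv> (bessel_zero \<nu> n)\<^sup>2 / 4"
  shows "(tau N H m n)\<^sup>2 = pi powr l * Gamma (l + 1 + H) * Gamma (H + 1) * sin (pi * H) / ((Gamma (l + 1))\<^sup>2 * (a powr (\<nu> + H + 1) * mode_sq_norm \<nu> a))"
proof -
  have nu: "\<nu> > -1" unfolding \<nu>_def bessel_order_def using H by linarith
  define j where "j = bessel_zero \<nu> n"
  have j: "j > 0" unfolding j_def by (rule bessel_zero_pos[OF nu n])
  have a: "a = j\<^sup>2 / 4" "a > 0" using j by (auto simp: a_def j_def)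
  have N2: "real N / 2 = l + 1" by (simp add: l_def field_simps)
  have "real N \<ge> 1" using N by simp
  then have l: "l + 1 > 0" by (simp add: l_def field_simps)
  have sinp: "sin (pi * H) > 0" using H by (intro sin_gt_zero) auto
  define K where "K = pi powr l * Gamma (l + 1 + H) * Gamma (H + 1) * sin (pi * H)"
  have K: "K \<ge> 0" unfolding K_def using l H sinp by (intro mult_nonneg_nonneg less_imp_le[OF Gamma_real_pos] less_imp_le[OF sinp]) auto
  have p: "a powr x = (j / 2) powr (2 * x)" for x
  proof -
    have "a = (j / 2) powr 2" using j by (simp add: a power_divide)
    then show ?thesis by (simp add: powr_powr)
  qed
  have J: "(bessel_J (\<nu> + 1) j)\<^sup>2 = a powr \<nu> * mode_sq_norm \<nu> a"
  proof -
    have "bessel_J (\<nu> + 1) j = (j / 2) powr (\<nu> + 1) * clifford (\<nu> + 1) a" unfolding a by (rule bessel_J_clifford) (use nu j in auto)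
    then have "(bessel_J (\<nu> + 1) j)\<^sup>2 = ((j / 2) powr (\<nu> + 1))\<^sup>2 * (clifford (\<nu> + 1) a)\<^sup>2" by (simp add: power_mult_distrib)
    also have "((j / 2) powr (\<nu> + 1))\<^sup>2 = a powr (\<nu> + 1)" unfolding p using j by (simp add: power2_eq_square powr_add[symmetric])
    also have "a powr (\<nu> + 1) = a powr \<nu> * a" using a(2) by (simp add: powr_add)
    finally show ?thesis by (simp add: mode_sq_norm_def)
  qed
  have j2: "(j powr (H + 1))\<^sup>2 = (2 powr (H + 1))\<^sup>2 * a powr (H + 1)"
  proof -
    have "a powr (H + 1) = ((j / 2) powr (H + 1))\<^sup>2" unfolding p using j by (simp add: power2_eq_square powr_add[symmetric])
    then show ?thesis using j by (simp add: powr_divide power_divide)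
  qed
  have "tau N H m n = 2 powr (H + 1) * sqrt K / (Gamma (l + 1) * bessel_J (\<nu> + 1) j * j powr (H + 1))"
    unfolding tau_def Let_def N2 l_def[symmetric] \<nu>_def[symmetric] j_def[symmetric] K_def by (simp add: add_ac)
  then have "(tau N H m n)\<^sup>2 = (2 powr (H + 1))\<^sup>2 * K / ((Gamma (l + 1))\<^sup>2 * (bessel_J (\<nu> + 1) j)\<^sup>2 * (j powr (H + 1))\<^sup>2)"
    using K by (simp add: power_divide power_mult_distrib)
  also have "\<dots> = K / ((Gamma (l + 1))\<^sup>2 * (a powr \<nu> * mode_sq_norm \<nu> a * a powr (H + 1)))"
    unfolding J j2 by simp
  also have "a powr \<nu> * mode_sq_norm \<nu> a * a powr (H + 1) = a powr (\<nu> + H + 1) * mode_sq_norm \<nu> a" by (simp add: powr_add mult_ac)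
  finally show ?thesis by (simp add: K_def)
qed

definition radial_term :: "nat \<Rightarrow> real \<Rightarrow> nat \<Rightarrow> nat \<Rightarrow> real \<Rightarrow> real" where
  "radial_term N H m n s = tau N H m n * (g_fun N m (bessel_zero (bessel_order H m) n * s) - (if m = 0 then 1 else 0))"

definition kern_fun :: "real \<Rightarrow> real \<Rightarrow> nat \<Rightarrow> real \<Rightarrow> real" where
  "kern_fun H l m = (if m = 0 then kernel_zero H (l + 1 + H) l else kernel_pos (l + 1 + H))"

text \<open>The value that Parseval's identity predicts for the sum over \<open>n\<close>. In degree
  0 the exponent of \<open>s / t\<close> is 2 because \<open>kernel_zero_transform\<close> divides
  by an argument proportional to the squared radius.\<close>

definition radial_kernel :: "nat \<Rightarrow> real \<Rightarrow> nat \<Rightarrow> real \<Rightarrow> real \<Rightarrow> real" where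
  "radial_kernel N H m s t = (let l = (real N - 2) / 2 in
     pi powr l * Gamma (H + 1) * sin (pi * H) / Gamma (l + 1 + H) * t powr (2 * H) * (s / t) ^ (if m = 0 then 2 else m) *
       ip (bessel_order H m) (kern_fun H l m) (\<lambda>u. kern_fun H l m ((s / t)\<^sup>2 * u)))"

lemma kern_fun_props:
  assumes H: "0 < H" "H < 1" and l: "l \<ge> -1 / 2"
  shows "L2 (bessel_order H m) (kern_fun H l m)" "continuous_on {0<..<1} (kern_fun H l m)" "kern_fun H l m u \<ge> 0"
proof -
  have al: "l + 1 + H > 1 / 2" "l > -1" using l H by auto
  have nu: "bessel_order H m > -1" unfolding bessel_order_def using H by linarith
  show "L2 (bessel_order H m) (kern_fun H l m)"
    using kernel_zero_L2[OF H al(2) refl al(1)] kernel_pos_L2(1)[OF nu al(1)] by (auto simp: kern_fun_def bessel_order_def)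
  show "continuous_on {0<..<1} (kern_fun H l m)"
    using kernel_zero_continuous[OF H al(2) refl al(1)] kernel_pos_L2(2)[OF nu al(1)] by (auto simp: kern_fun_def)
  show "kern_fun H l m u \<ge> 0"
    using kernel_zero_nonneg[OF H al(2) refl al(1)] by (auto simp: kern_fun_def kernel_pos_def)
qed

text \<open>In both cases the two radial functions carry the power
  \<open>2 * e = \<nu> + H + 1\<close> of \<open>a\<close>, the very power in \<open>tau_sq\<close>.
  This is what the order \<open>|m - 1| - H\<close> achieves: no power of the zeros is left over,
  and Parseval's identity applies.\<close>

lemma radial_sum:
  assumes N: "N \<ge> 1" and H: "0 < H" "H < 1" and s: "0 < s" "s \<le> t" "t \<le> 1"
  shows "((\<lambda>n. radial_term N H m n s * radial_term N H m n t) has_sum radial_kernel N H m s t) {1..}"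
proof -
  define l where "l = (real N - 2) / 2"
  define \<nu> where "\<nu> = bessel_order H m"
  define \<alpha> where "\<alpha> = l + 1 + H"
  have l: "l \<ge> -1 / 2" using N by (simp add: l_def)
  have nu: "\<nu> > -1" unfolding \<nu>_def bessel_order_def using H by linarith
  have al: "\<alpha> > 1 / 2" "l > -1" using l H by (auto simp: \<alpha>_def)
  have G: "Gamma (l + 1) > 0" "Gamma \<alpha> > 0" using al by (auto intro!: Gamma_real_pos)
  define F where "F = kern_fun H l m"
  note kp = kern_fun_props[OF H l, of m, folded \<nu>_def F_def]
  define K where "K = pi powr l * Gamma \<alpha> * Gamma (H + 1) * sin (pi * H)"
  define e where "e = (if m = 0 then 1 else real m / 2)"
  have t: "t > 0" using s by simp
  have st: "0 < s\<^sup>2" "s\<^sup>2 \<le> t\<^sup>2" "t\<^sup>2 \<le> 1" using s t by (auto simp: power_mono power_le_one)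
  have "((\<lambda>a. bessel_transform \<nu> F (a * s\<^sup>2) * bessel_transform \<nu> F (a * t\<^sup>2) / mode_sq_norm \<nu> a) has_sum
     (t\<^sup>2) powr (- \<nu> - 1) * ip \<nu> F (\<lambda>u. F (s\<^sup>2 / t\<^sup>2 * u))) (clifford_zeros \<nu>)"
    by (rule parseval_cutoff[OF nu kp(1,2) st])
  then have hs: "((\<lambda>n. let a = (bessel_zero \<nu> n)\<^sup>2 / 4 in K / (Gamma \<alpha>)\<^sup>2 * (s\<^sup>2 * t\<^sup>2) powr e * (bessel_transform \<nu> F (a * s\<^sup>2) * bessel_transform \<nu> F (a * t\<^sup>2) / mode_sq_norm \<nu> a)) has_sum
     K / (Gamma \<alpha>)\<^sup>2 * (s\<^sup>2 * t\<^sup>2) powr e * ((t\<^sup>2) powr (- \<nu> - 1) * ip \<nu> F (\<lambda>u. F (s\<^sup>2 / t\<^sup>2 * u)))) {1..}"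
    unfolding Let_def by (intro has_sum_cmult_right has_sum_bessel_zero[OF nu])
  have "radial_term N H m n s * radial_term N H m n t = (let a = (bessel_zero \<nu> n)\<^sup>2 / 4 in K / (Gamma \<alpha>)\<^sup>2 * (s\<^sup>2 * t\<^sup>2) powr e * (bessel_transform \<nu> F (a * s\<^sup>2) * bessel_transform \<nu> F (a * t\<^sup>2) / mode_sq_norm \<nu> a))"
    if n: "n \<in> {1..}" for n
  proof -
    define a where "a = (bessel_zero \<nu> n)\<^sup>2 / 4"
    have j: "bessel_zero \<nu> n > 0" using bessel_zero_pos[OF nu] n by simp
    have a: "a > 0" using j by (simp add: a_def)
    have T: "(tau N H m n)\<^sup>2 = K / ((Gamma (l + 1))\<^sup>2 * (a powr (\<nu> + H + 1) * mode_sq_norm \<nu> a))"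
      using tau_sq[OF N H, of n m] n unfolding K_def \<alpha>_def l_def[symmetric] \<nu>_def[symmetric] a_def[symmetric] by simp
    have gs: "g_fun N m (bessel_zero \<nu> n * x) = Gamma (l + 1) * (a * x\<^sup>2) powr (real m / 2) * clifford (real m + l) (a * x\<^sup>2)" if "x > 0" for x
      using g_fun_clifford[OF N, of "bessel_zero \<nu> n * x" m] j that by (simp add: l_def a_def power_mult_distrib)
    define D where "D x = g_fun N m (bessel_zero \<nu> n * x) - (if m = 0 then 1 else 0)" for x
    \<comment> \<open>The sign in degree 0 comes from subtracting in the opposite order in the
      transform; it occurs at \<open>s\<close> and at \<open>t\<close> and cancels in the
      product.\<close>
    have Dx: "D x = (if m = 0 then -1 else 1) * (Gamma (l + 1) / Gamma \<alpha> * (a powr e * (x\<^sup>2) powr e) * bessel_transform \<nu> F (a * x\<^sup>2))" if x: "x > 0" for x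
    proof (cases "m = 0")
      case True
      have F: "F = kernel_zero H \<alpha> l" by (simp add: F_def kern_fun_def True \<alpha>_def)
      have n1: "\<nu> = 1 - H" by (simp add: \<nu>_def bessel_order_def True)
      have ax: "a * x\<^sup>2 > 0" using a x by simp
      have "bessel_transform \<nu> F (a * x\<^sup>2) = Gamma \<alpha> * (clifford l 0 - clifford l (a * x\<^sup>2)) / (a * x\<^sup>2)"
        unfolding F n1 by (rule kernel_zero_transform[OF H al(2) \<alpha>_def al(1)]) (use a x in simp)
      then have bt: "a * x\<^sup>2 * bessel_transform \<nu> F (a * x\<^sup>2) = Gamma \<alpha> * (clifford l 0 - clifford l (a * x\<^sup>2))" using ax by simp
      have "Gamma (l + 1) * clifford l (0::real) = 1" using G(1) by (simp add: rGamma_inverse_Gamma)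
      then have "D x = - (Gamma (l + 1) * (clifford l 0 - clifford l (a * x\<^sup>2)))"
        unfolding D_def gs[OF x] using True a x by (simp add: right_diff_distrib)
      also have "\<dots> = - (Gamma (l + 1) / Gamma \<alpha> * (a * x\<^sup>2 * bessel_transform \<nu> F (a * x\<^sup>2)))"
        unfolding bt using G by simp
      finally show ?thesis using True a x by (simp add: e_def mult_ac)
    next
      case False
      have F: "F = kernel_pos \<alpha>" by (simp add: F_def kern_fun_def False \<alpha>_def)
      have "\<nu> + \<alpha> = real m + l" using False by (simp add: \<nu>_def bessel_order_def \<alpha>_def)
      then have "bessel_transform \<nu> F (a * x\<^sup>2) = Gamma \<alpha> * clifford (real m + l) (a * x\<^sup>2)"
        unfolding F kernel_pos_transform[OF nu al(1)] by simp
      then show ?thesis unfolding D_def gs[OF x] using False G a x by (simp add: e_def powr_mult)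
    qed
    have e2: "a powr e * a powr e = a powr (\<nu> + H + 1)"
      by (simp add: powr_add[symmetric] e_def \<nu>_def bessel_order_def)
    have "radial_term N H m n s * radial_term N H m n t = (tau N H m n)\<^sup>2 * (D s * D t)"
      by (simp add: radial_term_def D_def \<nu>_def power2_eq_square mult_ac)
    also have "D s * D t = (Gamma (l + 1))\<^sup>2 / (Gamma \<alpha>)\<^sup>2 * (a powr e * a powr e) * ((s\<^sup>2) powr e * (t\<^sup>2) powr e) * (bessel_transform \<nu> F (a * s\<^sup>2) * bessel_transform \<nu> F (a * t\<^sup>2))"
      unfolding Dx[OF s(1)] Dx[OF t] by (simp add: power2_eq_square mult_ac)
    also have "(s\<^sup>2) powr e * (t\<^sup>2) powr e = (s\<^sup>2 * t\<^sup>2) powr e" by (simp add: powr_mult)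
    finally show ?thesis
      unfolding T e2 Let_def a_def[symmetric] using G a by (simp add: mult_ac)
  qed
  then have "((\<lambda>n. radial_term N H m n s * radial_term N H m n t) has_sum
     K / (Gamma \<alpha>)\<^sup>2 * (s\<^sup>2 * t\<^sup>2) powr e * ((t\<^sup>2) powr (- \<nu> - 1) * ip \<nu> F (\<lambda>u. F (s\<^sup>2 / t\<^sup>2 * u)))) {1..}"
    using hs by (subst has_sum_cong) auto
  moreover have "K / (Gamma \<alpha>)\<^sup>2 * (s\<^sup>2 * t\<^sup>2) powr e * ((t\<^sup>2) powr (- \<nu> - 1) * ip \<nu> F (\<lambda>u. F (s\<^sup>2 / t\<^sup>2 * u))) = radial_kernel N H m s t"
  proof -
    have R: "(s\<^sup>2 * t\<^sup>2) powr e * (t\<^sup>2) powr (- \<nu> - 1) = t powr (2 * H) * (s / t) ^ (if m = 0 then 2 else m)"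
    proof -
      have sq: "(x\<^sup>2) powr y = x powr (2 * y)" if "x > 0" for x y :: real
      proof -
        have "x\<^sup>2 = x powr 2" using that by simp
        then show ?thesis by (simp add: powr_powr)
      qed
      have "(s\<^sup>2 * t\<^sup>2) powr e * (t\<^sup>2) powr (- \<nu> - 1) = s powr (2 * e) * (t powr (2 * e) * t powr (2 * (- \<nu> - 1)))"
        using s t by (simp add: powr_mult sq)
      also have "t powr (2 * e) * t powr (2 * (- \<nu> - 1)) = t powr (2 * H) * t powr (- (2 * e))"
        by (simp add: powr_add[symmetric] e_def \<nu>_def bessel_order_def)
      also have "s powr (2 * e) * (t powr (2 * H) * t powr (- (2 * e))) = t powr (2 * H) * (s / t) powr (2 * e)"
        using s t by (simp add: powr_divide powr_minus field_simps)
      also have "(s / t) powr (2 * e) = (s / t) ^ (if m = 0 then 2 else m)"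
        using s t by (auto simp: e_def powr_realpow)
      finally show ?thesis .
    qed
    have "K / (Gamma \<alpha>)\<^sup>2 * (s\<^sup>2 * t\<^sup>2) powr e * ((t\<^sup>2) powr (- \<nu> - 1) * ip \<nu> F (\<lambda>u. F (s\<^sup>2 / t\<^sup>2 * u)))
      = K / (Gamma \<alpha>)\<^sup>2 * (t powr (2 * H) * (s / t) ^ (if m = 0 then 2 else m)) * ip \<nu> F (\<lambda>u. F (s\<^sup>2 / t\<^sup>2 * u))"
      unfolding R[symmetric] by (simp only: mult_ac)
    moreover have "K / (Gamma \<alpha>)\<^sup>2 = pi powr l * Gamma (H + 1) * sin (pi * H) / Gamma \<alpha>"
      using G by (simp add: K_def power2_eq_square field_simps)
    ultimately show ?thesis
      unfolding radial_kernel_def Let_def l_def[symmetric] \<nu>_def[symmetric] F_def[symmetric] \<alpha>_def[symmetric]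
      by (simp add: power_divide mult_ac)
  qed
  ultimately show ?thesis by simp
qed

lemma Gamma_reflect:
  assumes H: "0 < H" "H < 1"
  shows "Gamma (H + 1) * sin (pi * H) * Gamma (1 - H) = pi * H"
proof -
  have "Gamma (complex_of_real H) * Gamma (1 - complex_of_real H) = of_real pi / sin (of_real pi * of_real H)"
    by (rule Gamma_reflection_complex)
  moreover have "1 - complex_of_real H = of_real (1 - H)" "sin (of_real pi * of_real H) = complex_of_real (sin (pi * H))"
    by (simp_all flip: sin_of_real)
  ultimately have "Gamma H * Gamma (1 - H) = pi / sin (pi * H)"
    by (simp only: Gamma_complex_of_real of_real_mult[symmetric] of_real_divide[symmetric] of_real_eq_iff)
  moreover have "Gamma (H + 1) = H * Gamma H" using H by (intro Gamma_plus1) (auto elim!: nonpos_Ints_cases)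
  moreover have "sin (pi * H) > 0" using H by (intro sin_gt_zero) auto
  ultimately show ?thesis by (simp add: field_simps)
qed

text \<open>The origin of the sine in \<open>tau\<close>: the Pochhammer symbol hides
  \<open>1 / Gamma (- H)\<close>, which the reflection formula expresses through
  \<open>Gamma (H + 1)\<close> and the sine.\<close>

lemma pochhammer_neg:
  assumes H: "0 < H" "H < 1"
  shows "- pochhammer (- H) (Suc n) * pi = Gamma (H + 1) * sin (pi * H) * Gamma (real n + 1 - H)"
proof -
  have "pochhammer (- H) (Suc n) = - H * pochhammer (1 - H) n" by (simp add: pochhammer_rec)
  moreover have "pochhammer (1 - H) n = Gamma (1 - H + real n) / Gamma (1 - H)"
    using H by (intro pochhammer_Gamma) (auto elim!: nonpos_Ints_cases)
  moreover have "Gamma (1 - H) > 0" using H by (intro Gamma_real_pos) auto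
  ultimately have "- pochhammer (- H) (Suc n) * pi = (pi * H) / Gamma (1 - H) * Gamma (real n + 1 - H)" by (simp add: algebra_simps)
  also have "\<dots> = Gamma (H + 1) * sin (pi * H) * Gamma (real n + 1 - H)"
    by (subst Gamma_reflect[OF H, symmetric]) (use \<open>Gamma (1 - H) > 0\<close> in simp)
  finally show ?thesis .
qed

text \<open>For positive degree the inner product and the connection series agree term by term. In
  degree 0 the inner product matches the connection series only from index 1 on: the absent
  \<open>cc 0 = 1\<close> gives the summand 1, and the singular part of the kernel gives
  \<open>(s / t) powr (2 * H)\<close>.\<close>

theorem radial_kernel_expansion:
  assumes N: "N \<ge> 1" and H: "0 < H" "H < 1" and s: "0 < s" "s < t"
  defines "l \<equiv> (real N - 2) / 2"
  assumes sm: "(\<lambda>j. connection_coeff (- H) l (m + 2 * j) j * (s / t) ^ (2 * j)) summable_on UNIV"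
  shows "zonal_norm l * radial_kernel N H m s t = t powr (2 * H) / 2 *
     ((if m = 0 then 1 + (s / t) powr (2 * H) else 0) - (s / t) ^ m * (\<Sum>\<^sub>\<infinity>j. connection_coeff (- H) l (m + 2 * j) j * (s / t) ^ (2 * j)))"
proof -
  define \<nu> where "\<nu> = bessel_order H m"
  define \<alpha> where "\<alpha> = l + 1 + H"
  define \<rho> where "\<rho> = (s / t)\<^sup>2"
  have l: "l \<ge> -1 / 2" using N by (simp add: l_def)
  have nu: "\<nu> > -1" unfolding \<nu>_def bessel_order_def using H by linarith
  have al: "\<alpha> > 1 / 2" "l > -1" using l H by (auto simp: \<alpha>_def)
  have G: "Gamma (l + 1) > 0" "Gamma \<alpha> > 0" using al by (auto intro!: Gamma_real_pos)
  have r: "0 < \<rho>" "\<rho> < 1" using s by (auto simp: \<rho>_def power_less_one_iff)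
  have np: "x \<notin> \<int>\<^sub>\<le>\<^sub>0" if "x > 0" for x :: real using that by (auto elim!: nonpos_Ints_cases)
  define C where "C = pi powr l * Gamma (H + 1) * sin (pi * H) / Gamma \<alpha>"
  have zC: "zonal_norm l * C = Gamma (l + 1) * (Gamma (H + 1) * sin (pi * H)) / (2 * pi * Gamma \<alpha>)"
    by (simp add: zonal_norm_def C_def powr_add)
  define cc where "cc j = connection_coeff (- H) l (m + 2 * j) j" for j
  have cs: "(\<lambda>j. cc j * \<rho> ^ j) sums (\<Sum>\<^sub>\<infinity>j. cc j * (s / t) ^ (2 * j))"
    using has_sum_imp_sums[OF has_sum_infsum[OF sm]] by (simp add: cc_def \<rho>_def power_mult)
  have coef: "- cc j / 2 = zonal_norm l * C * (binomial_coeff \<alpha> j * (Gamma (real (m + j) - H) * Gamma \<alpha> / Gamma (real (m + j) + l + 1)))"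
    if mj: "m + j > 0" for j
  proof -
    obtain i where i: "m + j = Suc i" using mj by (metis Suc_pred)
    have p1: "pochhammer (l + 1) (m + j) = Gamma (real (m + j) + l + 1) / Gamma (l + 1)"
      using pochhammer_Gamma[OF np[of "l + 1"], of "m + j"] al by (simp add: add_ac)
    have p2: "pochhammer (- H) (m + j) = - (Gamma (H + 1) * sin (pi * H) * Gamma (real (m + j) - H)) / pi"
      using pochhammer_neg[OF H, of i] unfolding i by (simp add: field_simps)
    have "- H - l = 1 - \<alpha>" by (simp add: \<alpha>_def)
    then have p3: "pochhammer (- H - l) j / fact j = binomial_coeff \<alpha> j" by (simp only: binomial_coeff_def)
    have e: "m + 2 * j - j = m + j" by simp
    have "cc j = pochhammer (- H) (m + j) / pochhammer (l + 1) (m + j) * (pochhammer (- H - l) j / fact j)"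
      unfolding cc_def connection_coeff_def e by simp
    also have "\<dots> = - (Gamma (H + 1) * sin (pi * H) * Gamma (real (m + j) - H)) / pi * Gamma (l + 1) / Gamma (real (m + j) + l + 1) * binomial_coeff \<alpha> j"
      unfolding p1 p2 p3 by simp
    finally show ?thesis unfolding zC using G by (simp add: mult_ac)
  qed
  have main: "zonal_norm l * C * \<rho> ^ (if m = 0 then 1 else 0) * ip \<nu> (kern_fun H l m) (\<lambda>u. kern_fun H l m (\<rho> * u))
     = ((if m = 0 then 1 + \<rho> powr H else 0) - (\<Sum>\<^sub>\<infinity>j. cc j * (s / t) ^ (2 * j))) / 2"
  proof (cases "m = 0")
    case False
    have n1: "\<nu> = real m - 1 - H" using False by (simp add: \<nu>_def bessel_order_def)
    have K: "kern_fun H l m = kernel_pos \<alpha>" using False by (simp add: kern_fun_def \<alpha>_def)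
    have "(\<lambda>k. zonal_norm l * C * (binomial_coeff \<alpha> k * \<rho> ^ k * Beta (\<nu> + real k + 1) \<alpha>)) sums (zonal_norm l * C * ip \<nu> (kernel_pos \<alpha>) (\<lambda>u. kernel_pos \<alpha> (\<rho> * u)))"
      by (intro sums_mult kernel_pos_ip_sums nu al) (use r in auto)
    moreover have "zonal_norm l * C * (binomial_coeff \<alpha> k * \<rho> ^ k * Beta (\<nu> + real k + 1) \<alpha>) = - (1 / 2) * (cc k * \<rho> ^ k)" for k
    proof -
      have "Beta (\<nu> + real k + 1) \<alpha> = Gamma (real (m + k) - H) * Gamma \<alpha> / Gamma (real (m + k) + l + 1)"
        unfolding Beta_def n1 by (simp add: \<alpha>_def algebra_simps)
      then have "zonal_norm l * C * (binomial_coeff \<alpha> k * \<rho> ^ k * Beta (\<nu> + real k + 1) \<alpha>) = (- cc k / 2) * \<rho> ^ k"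
        using coef[of k] False by simp
      then show ?thesis by simp
    qed
    ultimately have "(\<lambda>k. - (1 / 2) * (cc k * \<rho> ^ k)) sums (zonal_norm l * C * ip \<nu> (kernel_pos \<alpha>) (\<lambda>u. kernel_pos \<alpha> (\<rho> * u)))" by simp
    from sums_unique2[OF this sums_mult[OF cs, of "- (1 / 2)"]] show ?thesis using False K by simp
  next
    case True
    have n1: "\<nu> = 1 - H" using True by (simp add: \<nu>_def bessel_order_def)
    have K: "kern_fun H l m = kernel_zero H \<alpha> l" using True by (simp add: kern_fun_def \<alpha>_def)
    define I where "I = ip \<nu> (kern_fun H l m) (\<lambda>u. kern_fun H l m (\<rho> * u))"
    have A: "(\<lambda>k. zonal_norm l * C * \<rho> * (binomial_coeff \<alpha> k * (1 - (l + 1) / (real k + 1 - H)) * \<rho> ^ k * (Beta (2 - H + real k) \<alpha> * ((real k + l + 2) / (real k + 1))))) sums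
       (zonal_norm l * C * \<rho> * (I - (l + 1) * Beta (1 - H) \<alpha> * \<rho> powr (H - 1) / H))"
      unfolding I_def K n1 by (intro sums_mult kernel_zero_ip_sums[OF H al(2) \<alpha>_def al(1)] r)
    have "zonal_norm l * C * \<rho> * (binomial_coeff \<alpha> k * (1 - (l + 1) / (real k + 1 - H)) * \<rho> ^ k * (Beta (2 - H + real k) \<alpha> * ((real k + l + 2) / (real k + 1)))) = - (1 / 2) * (cc (Suc k) * \<rho> ^ Suc k)" for k
    proof -
      have pk: "real k + 1 - H > 0" "real k + l + 2 > 0" using H al by auto
      have g1: "Gamma (real k + 2 - H) = (real k + 1 - H) * Gamma (real k + 1 - H)"
        using Gamma_plus1[OF np[OF pk(1)]] by (simp add: algebra_simps)
      have g2: "Gamma (real k + l + 3) = (real k + l + 2) * Gamma (real k + l + 2)"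
        using Gamma_plus1[OF np[OF pk(2)]] by (simp add: algebra_simps)
      have gp: "Gamma (real k + l + 2) > 0" using pk by (intro Gamma_real_pos)
      have B: "Beta (2 - H + real k) \<alpha> = (real k + 1 - H) * Gamma (real k + 1 - H) * Gamma \<alpha> / ((real k + l + 2) * Gamma (real k + l + 2))"
        unfolding Beta_def g1[symmetric] g2[symmetric] by (simp add: \<alpha>_def algebra_simps)
      have bS: "binomial_coeff \<alpha> (Suc k) = binomial_coeff \<alpha> k * (real k - H - l) / (real k + 1)"
        by (simp add: binomial_coeff_def pochhammer_Suc \<alpha>_def algebra_simps)
      have f: "(1 - (l + 1) / (real k + 1 - H)) = (real k - H - l) / (real k + 1 - H)" using pk by (simp add: field_simps)
      have "binomial_coeff \<alpha> k * (1 - (l + 1) / (real k + 1 - H)) * (Beta (2 - H + real k) \<alpha> * ((real k + l + 2) / (real k + 1)))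
        = binomial_coeff \<alpha> (Suc k) * (Gamma (real k + 1 - H) * Gamma \<alpha> / Gamma (real k + l + 2))"
        unfolding B bS f using pk gp by (simp add: mult_ac)
      also have "\<dots> = binomial_coeff \<alpha> (Suc k) * (Gamma (real (m + Suc k) - H) * Gamma \<alpha> / Gamma (real (m + Suc k) + l + 1))"
        using True by (simp add: algebra_simps)
      finally have "zonal_norm l * C * (binomial_coeff \<alpha> k * (1 - (l + 1) / (real k + 1 - H)) * (Beta (2 - H + real k) \<alpha> * ((real k + l + 2) / (real k + 1)))) = - cc (Suc k) / 2"
        using coef[of "Suc k"] by simp
      then have "zonal_norm l * C * (binomial_coeff \<alpha> k * (1 - (l + 1) / (real k + 1 - H)) * (Beta (2 - H + real k) \<alpha> * ((real k + l + 2) / (real k + 1)))) * \<rho> ^ Suc k = - cc (Suc k) / 2 * \<rho> ^ Suc k"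
        by simp
      then show ?thesis by (simp add: mult_ac)
    qed
    then have "(\<lambda>k. - (1 / 2) * (cc (Suc k) * \<rho> ^ Suc k)) sums (zonal_norm l * C * \<rho> * (I - (l + 1) * Beta (1 - H) \<alpha> * \<rho> powr (H - 1) / H))"
      using A by simp
    moreover have "(\<lambda>k. - (1 / 2) * (cc (Suc k) * \<rho> ^ Suc k)) sums (- (1 / 2) * ((\<Sum>\<^sub>\<infinity>j. cc j * (s / t) ^ (2 * j)) - cc 0 * \<rho> ^ 0))"
      by (intro sums_mult) (subst sums_Suc_iff, use cs in simp)
    ultimately have B: "zonal_norm l * C * \<rho> * (I - (l + 1) * Beta (1 - H) \<alpha> * \<rho> powr (H - 1) / H) = - (1 / 2) * ((\<Sum>\<^sub>\<infinity>j. cc j * (s / t) ^ (2 * j)) - cc 0 * \<rho> ^ 0)"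
      by (rule sums_unique2)
    have "cc 0 = 1" using True by (simp add: cc_def connection_coeff_def)
    moreover have "zonal_norm l * C * \<rho> * ((l + 1) * Beta (1 - H) \<alpha> * \<rho> powr (H - 1) / H) = \<rho> powr H / 2"
    proof -
      have g2: "Gamma (l + 2) = (l + 1) * Gamma (l + 1)" using Gamma_plus1[OF np[of "l + 1"]] al by (simp add: add_ac)
      have la: "1 - H + \<alpha> = l + 2" by (simp add: \<alpha>_def)
      have "(l + 1) * Beta (1 - H) \<alpha> = (l + 1) * (Gamma (1 - H) * Gamma \<alpha>) / ((l + 1) * Gamma (l + 1))"
        unfolding Beta_def la g2 by simp
      also have "\<dots> = Gamma (1 - H) * Gamma \<alpha> / Gamma (l + 1)" using al by simp
      finally have "(l + 1) * Beta (1 - H) \<alpha> = Gamma (1 - H) * Gamma \<alpha> / Gamma (l + 1)" .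
      then have "zonal_norm l * C * ((l + 1) * Beta (1 - H) \<alpha>) = (Gamma (H + 1) * sin (pi * H) * Gamma (1 - H)) / (2 * pi)"
        unfolding zC using G by simp
      then have R1: "zonal_norm l * C * ((l + 1) * Beta (1 - H) \<alpha>) = H / 2" unfolding Gamma_reflect[OF H] by simp
      have R2: "\<rho> * \<rho> powr (H - 1) = \<rho> powr H" using r by (simp add: powr_diff)
      have R3: "zonal_norm l * C * \<rho> * ((l + 1) * Beta (1 - H) \<alpha> * \<rho> powr (H - 1) / H) = (zonal_norm l * C * ((l + 1) * Beta (1 - H) \<alpha>)) * (\<rho> * \<rho> powr (H - 1)) / H"
        by simp
      show ?thesis unfolding R3 R1 R2 using H by simp
    qed
    ultimately have "zonal_norm l * C * \<rho> * I = \<rho> powr H / 2 - (1 / 2) * ((\<Sum>\<^sub>\<infinity>j. cc j * (s / t) ^ (2 * j)) - 1)"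
      using B by (simp add: right_diff_distrib)
    then show ?thesis using True unfolding I_def by (simp add: field_simps)
  qed
  have e: "(s / t) ^ (if m = 0 then 2 else m) = (s / t) ^ m * \<rho> ^ (if m = 0 then 1 else 0)" by (simp add: \<rho>_def)
  have rH: "\<rho> powr H = (s / t) powr (2 * H)"
  proof -
    have "\<rho> = (s / t) powr 2" using s by (simp add: \<rho>_def)
    then show ?thesis by (simp add: powr_powr)
  qed
  have "zonal_norm l * radial_kernel N H m s t = t powr (2 * H) * (s / t) ^ m * (zonal_norm l * C * \<rho> ^ (if m = 0 then 1 else 0) * ip \<nu> (kern_fun H l m) (\<lambda>u. kern_fun H l m (\<rho> * u)))"
    unfolding radial_kernel_def Let_def l_def[symmetric] \<nu>_def[symmetric] \<alpha>_def[symmetric] C_def[symmetric] \<rho>_def[symmetric] e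
    by (simp only: mult_ac)
  also have "\<dots> = t powr (2 * H) / 2 *
     ((if m = 0 then 1 + (s / t) powr (2 * H) else 0) - (s / t) ^ m * (\<Sum>\<^sub>\<infinity>j. cc j * (s / t) ^ (2 * j)))"
    unfolding main rH by (cases "m = 0") (simp_all add: right_diff_distrib)
  finally show ?thesis by (simp only: cc_def)
qed

lemma radial_kernel_nonneg:
  assumes N: "N \<ge> 1" and H: "0 < H" "H < 1" and s: "0 \<le> s" "0 < t"
  shows "radial_kernel N H m s t \<ge> 0"
proof -
  define l where "l = (real N - 2) / 2"
  have "real N \<ge> 1" using N by simp
  then have l: "l \<ge> -1 / 2" by (simp add: l_def field_simps)
  have ipn: "ip (bessel_order H m) (kern_fun H l m) (\<lambda>u. kern_fun H l m ((s / t)\<^sup>2 * u)) \<ge> 0"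
    unfolding ip_def using kern_fun_props(3)[OF H l] by (intro integral_nonneg_AE AE_I2 mult_nonneg_nonneg)
  have "sin (pi * H) > 0" using H by (intro sin_gt_zero) auto
  moreover have "Gamma (H + 1) > 0" "Gamma (l + 1 + H) > 0" using H l by (auto intro!: Gamma_real_pos)
  ultimately show ?thesis
    unfolding radial_kernel_def Let_def l_def[symmetric] using s
    by (intro mult_nonneg_nonneg ipn divide_nonneg_pos zero_le_power) auto
qed

text \<open>The kernel is nonnegative and continuous inside the interval, so the products with its
  dilations converge pointwise and Fatou's lemma gives the bound without a dominating
  function.\<close>

lemma radial_kernel_liminf:
  assumes N: "N \<ge> 1" and H: "0 < H" "H < 1" and s: "0 < s" and c: "c \<ge> 0"
    and r: "r \<longlonglongrightarrow> 1" "\<And>k. 0 < r k" "\<And>k. r k < 1"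
  shows "ennreal (c * radial_kernel N H m s s) \<le> liminf (\<lambda>k. ennreal (c * radial_kernel N H m (r k * s) s))"
proof -
  define l where "l = (real N - 2) / 2"
  have "real N \<ge> 1" using N by simp
  then have l: "l \<ge> -1 / 2" by (simp add: l_def field_simps)
  define \<nu> where "\<nu> = bessel_order H m"
  define F where "F = kern_fun H l m"
  note kp = kern_fun_props[OF H l, of m, folded \<nu>_def F_def]
  have [measurable]: "F \<in> borel_measurable borel" using kp(1) by (simp add: L2_def)
  define C where "C = c * (pi powr l * Gamma (H + 1) * sin (pi * H) / Gamma (l + 1 + H) * s powr (2 * H))"
  have "sin (pi * H) > 0" using H by (intro sin_gt_zero) auto
  moreover have "Gamma (H + 1) > 0" "Gamma (l + 1 + H) > 0" using H l by (auto intro!: Gamma_real_pos)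
  ultimately have C: "C \<ge> 0" unfolding C_def using c by (intro mult_nonneg_nonneg divide_nonneg_pos) auto
  define q where "q = (if m = 0 then 2 else m)"
  have rk: "c * radial_kernel N H m (x * s) s = C * x ^ q * ip \<nu> F (\<lambda>u. F (x\<^sup>2 * u))" for x
    unfolding radial_kernel_def Let_def l_def[symmetric] \<nu>_def[symmetric] F_def[symmetric] C_def q_def
    using s by simp
  have nn: "ennreal (c * radial_kernel N H m (x * s) s) = (\<integral>\<^sup>+u. ennreal (C * x ^ q * (F u * F (x\<^sup>2 * u))) \<partial>power_measure \<nu>)"
    if x: "0 < x" "x \<le> 1" for x
  proof -
    have L: "L2 \<nu> (\<lambda>u. F (x\<^sup>2 * u))" by (rule L2_dilate[OF kp(1)]) (use x in \<open>auto simp: power_le_one\<close>)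
    have i: "integrable (power_measure \<nu>) (\<lambda>u. C * x ^ q * (F u * F (x\<^sup>2 * u)))"
      by (intro integrable_mult_right L2_mult kp(1) L)
    have "(\<integral>\<^sup>+u. ennreal (C * x ^ q * (F u * F (x\<^sup>2 * u))) \<partial>power_measure \<nu>) = ennreal (\<integral>u. C * x ^ q * (F u * F (x\<^sup>2 * u)) \<partial>power_measure \<nu>)"
      by (intro nn_integral_eq_integral i AE_I2 mult_nonneg_nonneg C kp(3) zero_le_power) (use x in auto)
    then show ?thesis unfolding rk ip_def by simp
  qed
  have "ennreal (c * radial_kernel N H m s s) = (\<integral>\<^sup>+u. ennreal (C * (F u * F u)) \<partial>power_measure \<nu>)"
    using nn[of 1] by simp
  also have "\<dots> = (\<integral>\<^sup>+u. liminf (\<lambda>k. ennreal (C * r k ^ q * (F u * F ((r k)\<^sup>2 * u)))) \<partial>power_measure \<nu>)"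
  proof (rule nn_integral_cong_AE, rule AE_jacD)
    fix u :: real assume u: "0 < u" "u < 1"
    have "isCont F u" using kp(2) u by (simp add: continuous_on_eq_continuous_at)
    moreover have "(\<lambda>k. (r k)\<^sup>2 * u) \<longlonglongrightarrow> 1\<^sup>2 * u" by (intro tendsto_intros r)
    ultimately have "(\<lambda>k. F ((r k)\<^sup>2 * u)) \<longlonglongrightarrow> F u" by (metis isCont_tendsto_compose mult_1 one_power2)
    then have "(\<lambda>k. C * r k ^ q * (F u * F ((r k)\<^sup>2 * u))) \<longlonglongrightarrow> C * 1 ^ q * (F u * F u)"
      by (intro tendsto_intros r)
    then have "(\<lambda>k. ennreal (C * r k ^ q * (F u * F ((r k)\<^sup>2 * u)))) \<longlonglongrightarrow> ennreal (C * (F u * F u))"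
      by (intro tendsto_ennrealI) simp
    then show "ennreal (C * (F u * F u)) = liminf (\<lambda>k. ennreal (C * r k ^ q * (F u * F ((r k)\<^sup>2 * u))))"
      by (intro lim_imp_Liminf[symmetric]) auto
  qed
  also have "\<dots> \<le> liminf (\<lambda>k. \<integral>\<^sup>+u. ennreal (C * r k ^ q * (F u * F ((r k)\<^sup>2 * u))) \<partial>power_measure \<nu>)"
    by (rule nn_integral_liminf) simp
  also have "\<dots> = liminf (\<lambda>k. ennreal (c * radial_kernel N H m (r k * s) s))"
    using nn r by (simp add: less_imp_le)
  finally show ?thesis .
qed

section \<open>Square-summable coefficients and the covariance\<close>

lemma has_sum_diff:
  fixes f g :: "'i \<Rightarrow> real"
  assumes "(f has_sum a) A" "(g has_sum b) A"
  shows "((\<lambda>i. f i - g i) has_sum (a - b)) A"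
  using has_sum_add[OF assms(1) has_sum_cmult_right[OF assms(2), of "- 1"]] by simp

lemma has_sum_Cauchy_Schwarz:
  fixes a b :: "'i \<Rightarrow> real"
  assumes a: "((\<lambda>i. (a i)\<^sup>2) has_sum A) I" and b: "((\<lambda>i. (b i)\<^sup>2) has_sum B) I"
  shows "(\<lambda>i. a i * b i) summable_on I"
    and "((\<lambda>i. a i * b i) has_sum S) I \<Longrightarrow> S\<^sup>2 \<le> A * B"
proof -
  have "(\<lambda>i. (a i)\<^sup>2 + (b i)\<^sup>2) summable_on I"
    using a b by (intro summable_on_add) (auto simp: summable_on_def)
  then have "(\<lambda>i. norm (a i * b i)) summable_on I"
  proof (rule Infinite_Sum.abs_summable_on_comparison_test')
    fix i
    have "0 \<le> (\<bar>a i\<bar> - \<bar>b i\<bar>)\<^sup>2" by simp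
    then have "2 * \<bar>a i * b i\<bar> \<le> (a i)\<^sup>2 + (b i)\<^sup>2" by (simp add: power2_diff abs_mult)
    then show "norm (a i * b i) \<le> (a i)\<^sup>2 + (b i)\<^sup>2" unfolding real_norm_def by linarith
  qed
  then show "(\<lambda>i. a i * b i) summable_on I" by (rule Infinite_Sum.abs_summable_summable)
  assume S: "((\<lambda>i. a i * b i) has_sum S) I"
  show "S\<^sup>2 \<le> A * B"
  proof (rule tendsto_le[OF finite_subsets_at_top_neq_bot])
    show "(((\<lambda>F. (\<Sum>i\<in>F. a i * b i)\<^sup>2)) \<longlongrightarrow> S\<^sup>2) (finite_subsets_at_top I)"
      using S by (intro tendsto_intros) (simp add: has_sum_def)
    show "((\<lambda>F. (\<Sum>i\<in>F. (a i)\<^sup>2) * (\<Sum>i\<in>F. (b i)\<^sup>2)) \<longlongrightarrow> A * B) (finite_subsets_at_top I)"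
      using a b by (intro tendsto_intros) (simp_all add: has_sum_def)
    show "\<forall>\<^sub>F F in finite_subsets_at_top I. (\<Sum>i\<in>F. a i * b i)\<^sup>2 \<le> (\<Sum>i\<in>F. (a i)\<^sup>2) * (\<Sum>i\<in>F. (b i)\<^sup>2)"
      by (intro always_eventually allI Cauchy_Schwarz_ineq_sum)
  qed
qed

definition series_index :: "nat \<Rightarrow> (nat \<times> nat \<times> nat) set" where
  "series_index N = {(m, n, l). 1 \<le> n \<and> 1 \<le> l \<and> l \<le> sph_dim m N}"

lemma series_index_Sigma: "series_index N = (SIGMA m:UNIV. SIGMA n:{1..}. {1..sph_dim m N})"
  by (auto simp: series_index_def)

text \<open>The coefficient sequence of a point: an embedding of the ball into square-summable
  sequences, in which inner products are to reproduce the covariance.\<close>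

definition feature :: "(nat \<Rightarrow> 'n::finite) \<Rightarrow> real \<Rightarrow> real ^ 'n \<Rightarrow> nat \<times> nat \<times> nat \<Rightarrow> real" where
  "feature e H x = (\<lambda>(m, n, l). series_term e H m n l x)"

lemma mfbm_cov_commute: "mfbm_cov H x y = mfbm_cov H y x"
  by (simp add: mfbm_cov_def norm_minus_commute)

lemma mfbm_cov_diag: "mfbm_cov H x x = norm x powr (2 * H)"
  by (simp add: mfbm_cov_def)

lemma mfbm_cov_increment:
  "mfbm_cov H x x + mfbm_cov H y y - 2 * mfbm_cov H x y = norm (x - y) powr (2 * H)"
  by (simp add: mfbm_cov_def field_simps)

lemma tendsto_mfbm_cov:
  assumes "0 < H" "(f \<longlongrightarrow> x) F" "(g \<longlongrightarrow> y) F"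
  shows "((\<lambda>k. mfbm_cov H (f k) (g k)) \<longlongrightarrow> mfbm_cov H x y) F"
  unfolding mfbm_cov_def using assms by (intro tendsto_intros) auto

context
  fixes H :: real and e :: "nat \<Rightarrow> 'n::finite" and N :: nat
  assumes N: "N = CARD('n)" and H: "0 < H" "H < 1" and e: "bij_betw e {1..N} UNIV"
begin

abbreviation (input) "lam \<equiv> (real N - 2) / 2"

lemma dim_ge_1: "N \<ge> 1" by (simp add: N Suc_le_eq)
lemma lam: "lam \<ge> -1 / 2"
proof -
  have "real N \<ge> 1" using dim_ge_1 by simp
  then show ?thesis by (simp add: field_simps)
qed

lemma sum_coords: "(\<Sum>i=1..N. u $ e i * v $ e i) = u \<bullet> v" for u v :: "real ^ 'n"
  using sum.reindex_bij_betw[OF e, of "\<lambda>i. u $ i * v $ i"] by (simp add: inner_vec_def)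

lemma zonal_norm_pos: "zonal_norm lam > 0"
  using lam by (auto simp: zonal_norm_def field_simps intro!: divide_pos_pos mult_pos_pos Gamma_real_pos)

lemma harmonics_sum:
  fixes u v :: "real ^ 'n"
  assumes "norm u = 1" "norm v = 1"
  shows "(\<Sum>l=1..sph_dim m N. sph_harmonic N m l (\<lambda>i. u $ e i) * sph_harmonic N m l (\<lambda>i. v $ e i)) =
    zonal_norm lam * zonal lam m (u \<bullet> v) 1"
proof -
  have "(\<Sum>i=1..N. (w $ e i)\<^sup>2) = 1" if "norm w = 1" for w :: "real ^ 'n"
    using sum_coords[of w w] that by (simp add: power2_eq_square dot_square_norm)
  then show ?thesis
    using sum_sph_harmonic[OF dim_ge_1, of "\<lambda>i. u $ e i" "\<lambda>i. v $ e i" m] assms by (simp only: sum_coords)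
qed

text \<open>By the addition theorem the zonal polynomial is an inner product of two vectors of
  harmonics, and both vectors have the value at 1 as squared length; the bound is the Cauchy-Schwarz
  inequality.\<close>

lemma zonal_abs_le:
  fixes u v :: "real ^ 'n"
  assumes uv: "norm u = 1" "norm v = 1"
  shows "\<bar>zonal lam m (u \<bullet> v) 1\<bar> \<le> zonal lam m 1 1" "zonal lam m 1 1 \<ge> 0"
proof -
  let ?z = "zonal_norm lam"
  have d: "(\<Sum>l=1..sph_dim m N. (sph_harmonic N m l (\<lambda>i. w $ e i))\<^sup>2) = ?z * zonal lam m 1 1" if "norm w = 1" for w :: "real ^ 'n"
    using harmonics_sum[OF that that, of m] that by (simp add: power2_eq_square dot_square_norm)
  have "?z * zonal lam m 1 1 \<ge> 0" unfolding d[OF uv(1), symmetric] by (intro sum_nonneg) auto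
  then show p: "zonal lam m 1 1 \<ge> 0" using zonal_norm_pos by (simp add: zero_le_mult_iff)
  have "(?z * zonal lam m (u \<bullet> v) 1)\<^sup>2 \<le> (?z * zonal lam m 1 1) * (?z * zonal lam m 1 1)"
    unfolding harmonics_sum[OF uv, symmetric] d[OF uv(1), symmetric] 
    by (subst (2) d[OF uv(1)], subst d[OF uv(2), symmetric]) (rule Cauchy_Schwarz_ineq_sum)
  then have "(zonal lam m (u \<bullet> v) 1)\<^sup>2 \<le> (zonal lam m 1 1)\<^sup>2"
    using zonal_norm_pos by (simp add: power2_eq_square mult_ac)
  then show "\<bar>zonal lam m (u \<bullet> v) 1\<bar> \<le> zonal lam m 1 1" using p by (simp add: abs_le_square_iff[symmetric])
qed

definition direction :: "real ^ 'n \<Rightarrow> real ^ 'n" where "direction x = x /\<^sub>R norm x"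

lemma norm_direction: "x \<noteq> 0 \<Longrightarrow> norm (direction x) = 1" by (simp add: direction_def)

lemma feature_eq:
  "x \<noteq> 0 \<Longrightarrow> feature e H x (m, n, l) = radial_term N H m n (norm x) * sph_harmonic N m l (\<lambda>i. direction x $ e i)"
  by (simp add: feature_def series_term_def radial_term_def direction_def N)

lemma feature_0 [simp]: "feature e H 0 = (\<lambda>_. 0)" by (auto simp: feature_def series_term_def)

text \<open>The angular factor does not depend on \<open>n\<close>, so the addition theorem splits
  it off before the radial sum is taken.\<close>

lemma feature_block:
  assumes x: "x \<noteq> 0" "norm x \<le> norm y" "norm y \<le> 1"
  shows "((\<lambda>n. \<Sum>l=1..sph_dim m N. feature e H x (m, n, l) * feature e H y (m, n, l)) has_sum
    radial_kernel N H m (norm x) (norm y) * (zonal_norm lam * zonal lam m (direction x \<bullet> direction y) 1)) {1..}"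
proof -
  have y: "y \<noteq> 0" using x by auto
  have "(\<Sum>l=1..sph_dim m N. feature e H x (m, n, l) * feature e H y (m, n, l)) =
    radial_term N H m n (norm x) * radial_term N H m n (norm y) * (zonal_norm lam * zonal lam m (direction x \<bullet> direction y) 1)" for n
    unfolding harmonics_sum[OF norm_direction[OF x(1)] norm_direction[OF y], symmetric] sum_distrib_left feature_eq[OF x(1)] feature_eq[OF y]
    by (simp only: mult_ac)
  then show ?thesis using x by (simp only:) (intro has_sum_cmult_left radial_sum[OF dim_ge_1 H], auto)
qed

text \<open>Only degree 0 receives the two pure powers. The remaining terms sum to the power of
  \<open>1 - 2 * r * c + r^2\<close>, which the law of cosines turns into the distance of the
  points.\<close>

lemma off_diagonal:
  assumes x: "x \<noteq> 0" "norm x < norm y" "norm y \<le> 1"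
  shows "((\<lambda>m. radial_kernel N H m (norm x) (norm y) * (zonal_norm lam * zonal lam m (direction x \<bullet> direction y) 1)) has_sum mfbm_cov H x y) UNIV"
proof -
  define s t where "s = norm x" and "t = norm y"
  define r where "r = s / t"
  define c where "c = direction x \<bullet> direction y"
  have y: "y \<noteq> 0" using x by auto
  have st: "0 < s" "s < t" using x by (auto simp: s_def t_def)
  have r: "0 \<le> r" "r < 1" using st by (auto simp: r_def)
  have c: "\<bar>c\<bar> \<le> 1" using Cauchy_Schwarz_ineq2[of "direction x" "direction y"] x y by (simp add: c_def norm_direction)
  note ge = gegenbauer_expansion[OF H lam r c zonal_abs_le(1)[OF norm_direction[OF x(1)] norm_direction[OF y], folded c_def]]
  define G where "G m = zonal lam m c 1 * r ^ m * (\<Sum>\<^sub>\<infinity>j. connection_coeff (- H) lam (m + 2 * j) j * r ^ (2 * j))" for m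
  have "((\<lambda>m. if m = 0 then 1 + r powr (2 * H) else 0) has_sum (1 + r powr (2 * H))) (UNIV :: nat set)"
    by (rule has_sum_finite_neutralI[of "{0}"]) auto
  then have "((\<lambda>m. t powr (2 * H) / 2 * ((if m = 0 then 1 + r powr (2 * H) else 0) - G m)) has_sum
     t powr (2 * H) / 2 * (1 + r powr (2 * H) - (1 - 2 * r * c + r\<^sup>2) powr H)) UNIV"
    using ge(2) unfolding G_def by (intro has_sum_cmult_right has_sum_diff)
  moreover have "t powr (2 * H) / 2 * ((if m = 0 then 1 + r powr (2 * H) else 0) - G m) =
    radial_kernel N H m s t * (zonal_norm lam * zonal lam m c 1)" for m
  proof -
    have "radial_kernel N H m s t * (zonal_norm lam * zonal lam m c 1) = zonal lam m c 1 * (zonal_norm lam * radial_kernel N H m s t)"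
      by (simp only: mult_ac)
    also have "\<dots> = zonal lam m c 1 * (t powr (2 * H) / 2 * ((if m = 0 then 1 + r powr (2 * H) else 0) - r ^ m * (\<Sum>\<^sub>\<infinity>j. connection_coeff (- H) lam (m + 2 * j) j * r ^ (2 * j))))"
      by (simp only: radial_kernel_expansion[OF dim_ge_1 H st ge(1)[unfolded r_def], folded r_def])
    also have "\<dots> = t powr (2 * H) / 2 * ((if m = 0 then 1 + r powr (2 * H) else 0) - G m)"
    proof -
      have "zonal lam 0 c 1 = 1" by (simp add: zonal_def)
      then show ?thesis by (cases "m = 0") (simp_all add: G_def mult_ac)
    qed
    finally show ?thesis ..
  qed
  moreover have "t powr (2 * H) / 2 * (1 + r powr (2 * H) - (1 - 2 * r * c + r\<^sup>2) powr H) = mfbm_cov H x y"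
  proof -
    have xy: "x \<bullet> y = s * t * c" using x y by (simp add: s_def t_def c_def direction_def field_simps)
    have n2: "(norm (x - y))\<^sup>2 = t\<^sup>2 * (1 - 2 * r * c + r\<^sup>2)"
    proof -
      have "x \<bullet> x = s\<^sup>2" "y \<bullet> y = t\<^sup>2" by (simp_all add: s_def t_def dot_square_norm)
      then have "(norm (x - y))\<^sup>2 = s\<^sup>2 + t\<^sup>2 - 2 * (s * t * c)"
        by (simp add: power2_norm_eq_inner inner_diff_left inner_diff_right inner_commute[of y x] xy)
      also have "\<dots> = t\<^sup>2 * (1 - 2 * r * c + r\<^sup>2)" using st by (simp add: r_def field_simps power2_eq_square)
      finally show ?thesis .
    qed
    have sq: "(a\<^sup>2) powr H = a powr (2 * H)" if "a \<ge> 0" for a :: real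
      using that by (cases "a = 0") (simp_all add: powr_powr flip: powr_numeral)
    have "norm (x - y) powr (2 * H) = (t\<^sup>2 * (1 - 2 * r * c + r\<^sup>2)) powr H" unfolding n2[symmetric] by (simp add: sq)
    also have "\<dots> = t powr (2 * H) * (1 - 2 * r * c + r\<^sup>2) powr H"
      using st by (simp add: powr_mult sq)
    finally have A: "norm (x - y) powr (2 * H) = t powr (2 * H) * (1 - 2 * r * c + r\<^sup>2) powr H" .
    have "t powr (2 * H) * r powr (2 * H) = s powr (2 * H)" using st by (simp add: r_def powr_divide)
    then show ?thesis unfolding mfbm_cov_def A s_def[symmetric] t_def[symmetric] by (simp add: algebra_simps)
  qed
  ultimately show ?thesis by (simp only: c_def s_def t_def)
qed

text \<open>Fatou's lemma is used twice, for each radial kernel and for the sum over the degrees,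
  along points that approach \<open>x\<close> from inside. It yields summability and one inequality;
  equality is left to \<open>feature_diag\<close>.\<close>

lemma feature_sq_summable:
  assumes x: "norm x \<le> 1"
  shows "\<exists>A \<le> norm x powr (2 * H). ((\<lambda>i. (feature e H x i)\<^sup>2) has_sum A) (series_index N)"
proof (cases "x = 0")
  case True
  then show ?thesis by (intro exI[of _ 0]) simp
next
  case False
  define s where "s = norm x"
  have s: "0 < s" "s \<le> 1" using False x by (auto simp: s_def)
  define W where "W m = zonal_norm lam * zonal lam m 1 1" for m
  have W: "W m \<ge> 0" for m unfolding W_def using zonal_norm_pos zonal_abs_le(2)[OF norm_direction[OF False] norm_direction[OF False]]
    by (intro mult_nonneg_nonneg) auto
  have uu: "direction x \<bullet> direction x = 1" using norm_direction[OF False] by (simp add: dot_square_norm)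
  \<comment> \<open>The factors increase from 1/2 to 1, so the scaled points are nonzero and
    strictly shorter than \<open>x\<close>.\<close>
  define r where "r k = 1 - 1 / (real k + 2)" for k
  have r: "r \<longlonglongrightarrow> 1" "0 < r k" "r k < 1" for k
    unfolding r_def by (real_asymp, simp_all add: field_simps)
  define b where "b m k = radial_kernel N H m (r k * s) s * W m" for m k
  have b0: "b m k \<ge> 0" for m k
    unfolding b_def using radial_kernel_nonneg[OF dim_ge_1 H, of "r k * s" s m] W r(2)[of k] s by (intro mult_nonneg_nonneg) auto
  have hb: "((\<lambda>m. b m k) has_sum mfbm_cov H (r k *\<^sub>R x) x) UNIV" for k
  proof -
    have u: "direction (r k *\<^sub>R x) = direction x" using r(2)[of k] by (simp add: direction_def)
    have nr: "norm (r k *\<^sub>R x) = r k * s" using r(2)[of k] by (simp add: s_def)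
    have "((\<lambda>m. radial_kernel N H m (norm (r k *\<^sub>R x)) (norm x) * (zonal_norm lam * zonal lam m (direction (r k *\<^sub>R x) \<bullet> direction x) 1)) has_sum mfbm_cov H (r k *\<^sub>R x) x) UNIV"
      by (rule off_diagonal) (use r(2,3)[of k] False s in \<open>auto simp: nr s_def[symmetric]\<close>)
    then show ?thesis unfolding u nr uu b_def W_def s_def[symmetric] .
  qed
  define b' where "b' m = radial_kernel N H m s s * W m" for m
  have b'0: "b' m \<ge> 0" for m unfolding b'_def using radial_kernel_nonneg[OF dim_ge_1 H, of s s m] W s by (intro mult_nonneg_nonneg) auto
  have "(\<integral>\<^sup>+m. ennreal (b' m) \<partial>count_space UNIV) \<le> (\<integral>\<^sup>+m. liminf (\<lambda>k. ennreal (b m k)) \<partial>count_space UNIV)"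
  proof (rule nn_integral_mono)
    fix m :: nat
    show "ennreal (b' m) \<le> liminf (\<lambda>k. ennreal (b m k))"
      using radial_kernel_liminf[OF dim_ge_1 H s(1) W[of m] r, of m] by (simp add: b'_def b_def mult.commute)
  qed
  also have "\<dots> \<le> liminf (\<lambda>k. \<integral>\<^sup>+m. ennreal (b m k) \<partial>count_space UNIV)" by (rule nn_integral_liminf) simp
  also have "(\<lambda>k. \<integral>\<^sup>+m. ennreal (b m k) \<partial>count_space UNIV) = (\<lambda>k. ennreal (mfbm_cov H (r k *\<^sub>R x) x))"
  proof
    fix k
    show "(\<integral>\<^sup>+m. ennreal (b m k) \<partial>count_space UNIV) = ennreal (mfbm_cov H (r k *\<^sub>R x) x)"
      unfolding nn_integral_count_space_nat using has_sum_imp_sums[OF hb] b0 by (intro suminf_ennreal_eq) auto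
  qed
  also have "liminf (\<lambda>k. ennreal (mfbm_cov H (r k *\<^sub>R x) x)) = ennreal (mfbm_cov H x x)"
  proof (rule lim_imp_Liminf)
    have "(\<lambda>k. r k *\<^sub>R x) \<longlonglongrightarrow> 1 *\<^sub>R x" by (intro tendsto_intros r)
    then show "(\<lambda>k. ennreal (mfbm_cov H (r k *\<^sub>R x) x)) \<longlonglongrightarrow> ennreal (mfbm_cov H x x)"
      by (intro tendsto_ennrealI tendsto_mfbm_cov H) auto
  qed simp
  finally have le: "(\<Sum>m. ennreal (b' m)) \<le> ennreal (norm x powr (2 * H))"
    unfolding nn_integral_count_space_nat mfbm_cov_diag .
  then have "(\<Sum>m. ennreal (b' m)) \<noteq> \<top>" by (auto simp: top_unique)
  then have sb: "summable b'" using b'0 by (intro summable_suminf_not_top) auto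
  have "ennreal (suminf b') \<le> ennreal (norm x powr (2 * H))" using le suminf_ennreal2[OF b'0 sb] by simp
  then have sle: "suminf b' \<le> norm x powr (2 * H)" by simp
  have hb': "(b' has_sum suminf b') UNIV"
    using sb b'0 by (intro norm_summable_imp_has_sum summable_sums) auto
  have inner: "((\<lambda>(n, l). (feature e H x (m, n, l))\<^sup>2) has_sum b' m) (SIGMA n:{1..}. {1..sph_dim m N})" for m
  proof -
    have fb: "((\<lambda>n. \<Sum>l=1..sph_dim m N. (feature e H x (m, n, l))\<^sup>2) has_sum b' m) {1..}"
      using feature_block[OF False order_refl x, of m] by (simp add: uu b'_def W_def s_def power2_eq_square)
    have f1: "((\<lambda>l. case (n, l) of (n, l) \<Rightarrow> (feature e H x (m, n, l))\<^sup>2) has_sum (\<Sum>l=1..sph_dim m N. (feature e H x (m, n, l))\<^sup>2)) {1..sph_dim m N}" for n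
      by (simp add: has_sum_finite)
    show ?thesis
      by (rule has_sum_SigmaI[OF f1 fb], rule summable_on_SigmaI[OF f1 has_sum_imp_summable[OF fb]]) auto
  qed
  have f2: "((\<lambda>y. case (m, y) of (m, n, l) \<Rightarrow> (feature e H x (m, n, l))\<^sup>2) has_sum b' m) (SIGMA n:{1..}. {1..sph_dim m N})" for m
    using inner[of m] by (simp add: case_prod_unfold)
  have "((\<lambda>(m, n, l). (feature e H x (m, n, l))\<^sup>2) has_sum suminf b') (series_index N)"
    unfolding series_index_Sigma
    by (rule has_sum_SigmaI[OF f2 hb'], rule summable_on_SigmaI[OF f2 has_sum_imp_summable[OF hb']]) auto
  then have "((\<lambda>i. (feature e H x i)\<^sup>2) has_sum suminf b') (series_index N)"
    by (rule has_sum_cong[THEN iffD1, rotated]) auto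
  then show ?thesis using sle by blast
qed

lemma feature_mult_summable:
  assumes "norm x \<le> 1" "norm y \<le> 1"
  shows "(\<lambda>i. feature e H x i * feature e H y i) summable_on series_index N"
  using feature_sq_summable[OF assms(1)] feature_sq_summable[OF assms(2)] has_sum_Cauchy_Schwarz(1) by blast

text \<open>The iterated sums are known; square summability of both sequences makes the triple
  family summable as a whole, which allows them to be merged into one unordered sum.\<close>

lemma feature_less:
  assumes x: "norm x < norm y" "norm y \<le> 1"
  shows "((\<lambda>i. feature e H x i * feature e H y i) has_sum mfbm_cov H x y) (series_index N)"
proof (cases "x = 0")
  case True
  then show ?thesis by (simp add: mfbm_cov_def)
next
  case False
  define f where "f = (\<lambda>(m, n, l). feature e H x (m, n, l) * feature e H y (m, n, l))"
  have ff: "f = (\<lambda>i. feature e H x i * feature e H y i)" by (auto simp: f_def)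
  have sm: "f summable_on (SIGMA m:UNIV. SIGMA n:{1..}. {1..sph_dim m N})"
    unfolding ff series_index_Sigma[symmetric] by (rule feature_mult_summable) (use x in auto)
  let ?b = "\<lambda>m. radial_kernel N H m (norm x) (norm y) * (zonal_norm lam * zonal lam m (direction x \<bullet> direction y) 1)"
  have inner: "((\<lambda>p. f (m, p)) has_sum ?b m) (SIGMA n:{1..}. {1..sph_dim m N})" for m
  proof (rule has_sum_SigmaI)
    show "((\<lambda>l. f (m, n, l)) has_sum (\<Sum>l=1..sph_dim m N. f (m, n, l))) {1..sph_dim m N}" for n
      by (simp add: has_sum_finite)
    show "((\<lambda>n. \<Sum>l=1..sph_dim m N. f (m, n, l)) has_sum ?b m) {1..}"
      unfolding ff by (rule feature_block) (use False x in auto)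
    show "(\<lambda>p. f (m, p)) summable_on (SIGMA n:{1..}. {1..sph_dim m N})"
      using sm by (intro summable_on_SigmaD1[of "\<lambda>m p. f (m, p)" UNIV]) auto
  qed
  have "(f has_sum mfbm_cov H x y) (SIGMA m:UNIV. SIGMA n:{1..}. {1..sph_dim m N})"
    by (rule has_sum_SigmaI[OF inner off_diagonal sm]) (use False x in auto)
  then show ?thesis unfolding ff series_index_Sigma .
qed

text \<open>The reverse inequality comes from Cauchy-Schwarz: the known covariance of
  \<open>r k *\<^sub>R x\<close> and \<open>x\<close> is bounded by the two square sums, and in the
  limit the fourth power \<open>norm x powr (4 * H)\<close> is at most
  \<open>norm x powr (2 * H) * A\<close>.\<close>

lemma feature_diag:
  assumes x: "norm x \<le> 1"
  shows "((\<lambda>i. (feature e H x i)\<^sup>2) has_sum norm x powr (2 * H)) (series_index N)"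
proof (cases "x = 0")
  case True
  then show ?thesis by simp
next
  case False
  obtain A where A: "A \<le> norm x powr (2 * H)" "((\<lambda>i. (feature e H x i)\<^sup>2) has_sum A) (series_index N)"
    using feature_sq_summable[OF x] by blast
  have A0: "A \<ge> 0" using A(2) by (rule has_sum_nonneg) auto
  define r where "r k = 1 - 1 / (real k + 2)" for k
  have r: "r \<longlonglongrightarrow> 1" "0 < r k" "r k < 1" for k
    unfolding r_def by (real_asymp, simp_all add: field_simps)
  have lim: "(\<lambda>k. r k *\<^sub>R x) \<longlonglongrightarrow> x" using tendsto_scaleR[OF r(1) tendsto_const[of x]] by simp
  have le: "(mfbm_cov H (r k *\<^sub>R x) x)\<^sup>2 \<le> norm (r k *\<^sub>R x) powr (2 * H) * A" for k
  proof -
    have nr: "norm (r k *\<^sub>R x) < norm x" using r(2,3)[of k] False by simp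
    obtain B where B: "B \<le> norm (r k *\<^sub>R x) powr (2 * H)" "((\<lambda>i. (feature e H (r k *\<^sub>R x) i)\<^sup>2) has_sum B) (series_index N)"
      using feature_sq_summable[of "r k *\<^sub>R x"] nr x by auto
    have "(mfbm_cov H (r k *\<^sub>R x) x)\<^sup>2 \<le> B * A"
      by (rule has_sum_Cauchy_Schwarz(2)[OF B(2) A(2) feature_less[OF nr x]])
    then show ?thesis using B(1) A0 by (meson mult_right_mono order_trans)
  qed
  have "(mfbm_cov H x x)\<^sup>2 \<le> norm x powr (2 * H) * A"
  proof (rule LIMSEQ_le[OF _ _ exI[of _ 0]])
    show "(\<lambda>k. (mfbm_cov H (r k *\<^sub>R x) x)\<^sup>2) \<longlonglongrightarrow> (mfbm_cov H x x)\<^sup>2"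
      by (intro tendsto_intros tendsto_mfbm_cov H lim)
    show "(\<lambda>k. norm (r k *\<^sub>R x) powr (2 * H) * A) \<longlonglongrightarrow> norm x powr (2 * H) * A"
      by (intro tendsto_intros lim) (use H in auto)
  qed (use le in auto)
  moreover have "norm x powr (2 * H) > 0" using False by simp
  ultimately have "norm x powr (2 * H) \<le> A" by (simp add: mfbm_cov_diag power2_eq_square)
  then have "A = norm x powr (2 * H)" using A(1) by simp
  then show ?thesis using A(2) by simp
qed

theorem feature_covariance:
  assumes x: "norm x \<le> 1" and y: "norm y \<le> 1"
  shows "((\<lambda>i. feature e H x i * feature e H y i) has_sum mfbm_cov H x y) (series_index N)"
proof -
  consider "norm x < norm y" | "norm y < norm x" | "norm x = norm y" by linarith
  then show ?thesis
  proof cases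
    case 1
    then show ?thesis using feature_less y by blast
  next
    case 2
    then show ?thesis using feature_less[OF 2 x] by (simp add: mfbm_cov_commute mult.commute)
  next
    case 3
    show ?thesis
    proof (cases "x = 0")
      case True
      then show ?thesis using 3 by (simp add: mfbm_cov_def)
    next
      case False
      define r where "r k = 1 - 1 / (real k + 2)" for k
      have r: "r \<longlonglongrightarrow> 1" "0 < r k" "r k < 1" for k
        unfolding r_def by (real_asymp, simp_all add: field_simps)
      have lim: "(\<lambda>k. r k *\<^sub>R x) \<longlonglongrightarrow> x" using tendsto_scaleR[OF r(1) tendsto_const[of x]] by simp
      obtain S where S: "((\<lambda>i. feature e H x i * feature e H y i) has_sum S) (series_index N)"
        using feature_mult_summable[OF x y] by (auto simp: summable_on_def)
      \<comment> \<open>Replacing \<open>x\<close> by the shorter \<open>z\<close> changes the inner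
        product with \<open>y\<close> by at most the length of the increment times that of
        \<open>y\<close>. The length of this increment is already known, since it involves only
        diagonal sums and a pair of different norms.\<close>
      have le: "(S - mfbm_cov H (r k *\<^sub>R x) y)\<^sup>2 \<le> norm (x - r k *\<^sub>R x) powr (2 * H) * norm y powr (2 * H)" for k
      proof -
        define z where "z = r k *\<^sub>R x"
        have nr: "norm z < norm x" using r(2,3)[of k] False by (simp add: z_def)
        have hz: "((\<lambda>i. feature e H z i * feature e H w i) has_sum mfbm_cov H z w) (series_index N)" if "w = x \<or> w = y" for w
          using feature_less[of z w] that nr 3 x by auto
        have d: "((\<lambda>i. (feature e H x i - feature e H z i) * feature e H y i) has_sum S - mfbm_cov H z y) (series_index N)"
          unfolding left_diff_distrib by (intro has_sum_diff S hz) simp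
        have "((\<lambda>i. (feature e H x i)\<^sup>2 + (feature e H z i)\<^sup>2 - 2 * (feature e H z i * feature e H x i)) has_sum
           norm x powr (2 * H) + norm z powr (2 * H) - 2 * mfbm_cov H z x) (series_index N)"
          by (intro has_sum_diff has_sum_add has_sum_cmult_right feature_diag hz) (use x nr in auto)
        moreover have "norm x powr (2 * H) + norm z powr (2 * H) - 2 * mfbm_cov H z x = norm (x - z) powr (2 * H)"
          using mfbm_cov_increment[of H x z] by (simp add: mfbm_cov_diag mfbm_cov_commute)
        moreover have "(feature e H x i)\<^sup>2 + (feature e H z i)\<^sup>2 - 2 * (feature e H z i * feature e H x i) = (feature e H x i - feature e H z i)\<^sup>2" for i
          by (simp add: power2_eq_square algebra_simps)
        ultimately have "((\<lambda>i. (feature e H x i - feature e H z i)\<^sup>2) has_sum norm (x - z) powr (2 * H)) (series_index N)" by simp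
        from has_sum_Cauchy_Schwarz(2)[OF this feature_diag[OF y] d] show ?thesis by (simp add: z_def)
      qed
      have "(S - mfbm_cov H x y)\<^sup>2 \<le> norm (x - x) powr (2 * H) * norm y powr (2 * H)"
      proof (rule LIMSEQ_le[OF _ _ exI[of _ 0]])
        show "(\<lambda>k. (S - mfbm_cov H (r k *\<^sub>R x) y)\<^sup>2) \<longlonglongrightarrow> (S - mfbm_cov H x y)\<^sup>2"
          by (intro tendsto_intros tendsto_mfbm_cov H lim)
        show "(\<lambda>k. norm (x - r k *\<^sub>R x) powr (2 * H) * norm y powr (2 * H)) \<longlonglongrightarrow> norm (x - x) powr (2 * H) * norm y powr (2 * H)"
          by (intro tendsto_intros lim) (use H in auto)
      qed (use le in auto)
      then have "S = mfbm_cov H x y" by simp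
      then show ?thesis using S by simp
    qed
  qed
qed

theorem feature_increment:
  assumes x: "norm x \<le> 1" and y: "norm y \<le> 1"
  shows "((\<lambda>i. (feature e H x i - feature e H y i)\<^sup>2) has_sum norm (x - y) powr (2 * H)) (series_index N)"
proof -
  have "((\<lambda>i. feature e H x i * feature e H x i + feature e H y i * feature e H y i - 2 * (feature e H x i * feature e H y i)) has_sum
     mfbm_cov H x x + mfbm_cov H y y - 2 * mfbm_cov H x y) (series_index N)"
    by (intro has_sum_diff has_sum_add has_sum_cmult_right feature_covariance x y)
  moreover have "feature e H x i * feature e H x i + feature e H y i * feature e H y i - 2 * (feature e H x i * feature e H y i) = (feature e H x i - feature e H y i)\<^sup>2" for i
    by (simp add: power2_eq_square algebra_simps)
  ultimately show ?thesis by (simp add: mfbm_cov_increment)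
qed

end

section \<open>Gaussian series\<close>

locale iid_normal = prob_space P for P :: "'a measure" +
  fixes \<xi> :: "'i \<Rightarrow> 'a \<Rightarrow> real" and I :: "'i set" and A :: "nat \<Rightarrow> 'i set"
  assumes normal: "\<And>i. i \<in> I \<Longrightarrow> distributed P lborel (\<xi> i) std_normal_density"
    and indep: "indep_vars (\<lambda>_. borel) \<xi> I"
    and finite_A: "\<And>k. finite (A k)" and incseq_A: "incseq A" and Union_A: "(\<Union>k. A k) = I"
begin

definition gauss_sum :: "('i \<Rightarrow> real) \<Rightarrow> 'i set \<Rightarrow> 'a \<Rightarrow> real" where
  "gauss_sum a F \<omega> = (\<Sum>i\<in>F. a i * \<xi> i \<omega>)"

lemma A_subset: "A k \<subseteq> I" using Union_A by auto

lemma A_mono: "m \<le> n \<Longrightarrow> A m \<subseteq> A n" using incseq_A by (auto simp: incseq_def)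

lemma xi_measurable: "i \<in> I \<Longrightarrow> \<xi> i \<in> borel_measurable P"
  using distributed_measurable[OF normal] by simp

lemma gauss_sum_measurable: "F \<subseteq> I \<Longrightarrow> gauss_sum a F \<in> borel_measurable P"
  unfolding gauss_sum_def[abs_def] by (intro borel_measurable_sum borel_measurable_times borel_measurable_const xi_measurable) auto

lemma gauss_sum_A_measurable [measurable]: "gauss_sum a (A k) \<in> borel_measurable P"
  by (rule gauss_sum_measurable[OF A_subset])

lemma gauss_sum_zero:
  assumes "finite F" "(\<Sum>i\<in>F. (a i)\<^sup>2) = 0"
  shows "gauss_sum a F \<omega> = 0"
  using assms by (auto simp: gauss_sum_def sum_nonneg_eq_0_iff)

lemma gauss_sum_normal:
  assumes F: "finite F" "F \<subseteq> I" and V: "(\<Sum>i\<in>F. (a i)\<^sup>2) > 0"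
  shows "distributed P lborel (gauss_sum a F) (normal_density 0 (sqrt (\<Sum>i\<in>F. (a i)\<^sup>2)))"
proof -
  \<comment> \<open>Vanishing coefficients are removed first, since each summand must have a normal
    density and hence positive deviation.\<close>
  define G where "G = {i \<in> F. a i \<noteq> 0}"
  have G: "finite G" "G \<subseteq> I" using F by (auto simp: G_def)
  have e: "gauss_sum a F \<omega> = (\<Sum>i\<in>G. a i * \<xi> i \<omega>)" for \<omega>
    unfolding gauss_sum_def G_def using F by (intro sum.mono_neutral_right) auto
  have v: "(\<Sum>i\<in>F. (a i)\<^sup>2) = (\<Sum>i\<in>G. (a i)\<^sup>2)"
    unfolding G_def using F by (intro sum.mono_neutral_right) auto
  have ne: "G \<noteq> {}" using V unfolding v by auto
  have "distributed P lborel (\<lambda>\<omega>. \<Sum>i\<in>G. a i * \<xi> i \<omega>) (normal_density (\<Sum>i\<in>G. 0) (sqrt (\<Sum>i\<in>G. \<bar>a i\<bar>\<^sup>2)))"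
  proof (rule sum_indep_normal[OF G(1) ne])
    show "indep_vars (\<lambda>i. borel) (\<lambda>i \<omega>. a i * \<xi> i \<omega>) G"
      by (rule indep_vars_compose2[OF indep_vars_subset[OF indep G(2)]]) simp
    fix i assume i: "i \<in> G"
    show "0 < \<bar>a i\<bar>" using i by (simp add: G_def)
    show "distributed P lborel (\<lambda>\<omega>. a i * \<xi> i \<omega>) (normal_density 0 \<bar>a i\<bar>)"
      using normal_density_affine[OF normal, of i "a i" 0] i G(2) by (auto simp: G_def)
  qed
  then show ?thesis unfolding v e[abs_def] by simp
qed

lemma gauss_sum_standard:
  assumes F: "finite F" "F \<subseteq> I" and V: "(\<Sum>i\<in>F. (a i)\<^sup>2) > 0"
  shows "distributed P lborel (\<lambda>\<omega>. gauss_sum a F \<omega> / sqrt (\<Sum>i\<in>F. (a i)\<^sup>2)) std_normal_density"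
  using normal_standard_normal_convert[of "sqrt (\<Sum>i\<in>F. (a i)\<^sup>2)" "gauss_sum a F" 0] gauss_sum_normal[OF assms] V by simp

lemma standard_moments:
  assumes X: "distributed P lborel X std_normal_density"
  shows "integrable P (\<lambda>\<omega>. X \<omega> ^ (2 * p))" "expectation (\<lambda>\<omega>. X \<omega> ^ (2 * p)) = fact (2 * p) / (2 ^ p * fact p)"
    and "integrable P X" "expectation X = 0"
proof -
  show "integrable P (\<lambda>\<omega>. X \<omega> ^ (2 * p))"
    using distributed_integrable[OF X, of "\<lambda>x. x ^ (2 * p)"] integrable.intros[OF std_normal_moment_even[of p]] by simp
  show "expectation (\<lambda>\<omega>. X \<omega> ^ (2 * p)) = fact (2 * p) / (2 ^ p * fact p)"
    using distributed_integral[OF X, of "\<lambda>x. x ^ (2 * p)"] has_bochner_integral_integral_eq[OF std_normal_moment_even[of p]] by simp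
  show "integrable P X"
    using distributed_integrable[OF X, of "\<lambda>x. x"] integrable.intros[OF std_normal_moment_odd[of 0]] by simp
  show "expectation X = 0"
    using distributed_integral[OF X, of "\<lambda>x. x"] has_bochner_integral_integral_eq[OF std_normal_moment_odd[of 0]] by simp
qed

definition moment :: "nat \<Rightarrow> real" where "moment p = fact (2 * p) / (2 ^ p * fact p)"

lemma moment_pos: "moment p > 0" by (simp add: moment_def)

lemma gauss_sum_moment:
  assumes F: "finite F" "F \<subseteq> I" and p: "p \<ge> 1"
  shows "integrable P (\<lambda>\<omega>. gauss_sum a F \<omega> ^ (2 * p))" "expectation (\<lambda>\<omega>. gauss_sum a F \<omega> ^ (2 * p)) = moment p * (\<Sum>i\<in>F. (a i)\<^sup>2) ^ p"
proof -
  define V where "V = (\<Sum>i\<in>F. (a i)\<^sup>2)"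
  have "V \<ge> 0" by (simp add: V_def sum_nonneg)
  then consider "V = 0" | "V > 0" by linarith
  then have "integrable P (\<lambda>\<omega>. gauss_sum a F \<omega> ^ (2 * p)) \<and> expectation (\<lambda>\<omega>. gauss_sum a F \<omega> ^ (2 * p)) = moment p * V ^ p"
  proof cases
    case 1
    then have "gauss_sum a F \<omega> = 0" for \<omega> using gauss_sum_zero F by (simp add: V_def)
    then show ?thesis using 1 p by (cases p) simp_all
  next
    case 2
    note X = standard_moments(1,2)[OF gauss_sum_standard[OF F 2[unfolded V_def]], folded V_def, of p]
    have e: "gauss_sum a F \<omega> ^ (2 * p) = V ^ p * (gauss_sum a F \<omega> / sqrt V) ^ (2 * p)" for \<omega>
    proof -
      have "(sqrt V) ^ (2 * p) = V ^ p" using 2 by (simp add: power_mult)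
      then show ?thesis using 2 by (simp add: power_divide)
    qed
    show ?thesis unfolding e using X by (simp add: moment_def)
  qed
  then show "integrable P (\<lambda>\<omega>. gauss_sum a F \<omega> ^ (2 * p))" "expectation (\<lambda>\<omega>. gauss_sum a F \<omega> ^ (2 * p)) = moment p * (\<Sum>i\<in>F. (a i)\<^sup>2) ^ p"
    by (auto simp: V_def)
qed

text \<open>Markov's inequality for the moment of order \<open>2 * p\<close>. A polynomial tail of
  arbitrarily high order is all that chaining requires.\<close>

lemma gauss_sum_tail:
  assumes F: "finite F" "F \<subseteq> I" and p: "p \<ge> 1" and t: "t > 0"
  shows "prob {\<omega> \<in> space P. t \<le> \<bar>gauss_sum a F \<omega>\<bar>} \<le> moment p * (\<Sum>i\<in>F. (a i)\<^sup>2) ^ p / t ^ (2 * p)"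
proof -
  have [measurable]: "gauss_sum a F \<in> borel_measurable P" by (rule gauss_sum_measurable[OF F(2)])
  have "t ^ (2 * p) * prob {\<omega> \<in> space P. t \<le> \<bar>gauss_sum a F \<omega>\<bar>} = (\<integral>\<omega>. t ^ (2 * p) * indicator {\<omega> \<in> space P. t \<le> \<bar>gauss_sum a F \<omega>\<bar>} \<omega> \<partial>P)"
    by simp
  also have "\<dots> \<le> expectation (\<lambda>\<omega>. gauss_sum a F \<omega> ^ (2 * p))"
  proof (rule integral_mono)
    show "integrable P (\<lambda>\<omega>. gauss_sum a F \<omega> ^ (2 * p))" by (rule gauss_sum_moment[OF F p])
    show "integrable P (\<lambda>\<omega>. t ^ (2 * p) * indicator {\<omega> \<in> space P. t \<le> \<bar>gauss_sum a F \<omega>\<bar>} \<omega>)"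
      by (intro integrable_mult_right integrable_real_indicator) (auto simp: emeasure_eq_measure)
    fix \<omega>
    show "t ^ (2 * p) * indicator {\<omega> \<in> space P. t \<le> \<bar>gauss_sum a F \<omega>\<bar>} \<omega> \<le> gauss_sum a F \<omega> ^ (2 * p)"
    proof (cases "t \<le> \<bar>gauss_sum a F \<omega>\<bar>")
      case True
      have "t ^ (2 * p) \<le> \<bar>gauss_sum a F \<omega>\<bar> ^ (2 * p)" using t True by (intro power_mono) auto
      also have "\<dots> = gauss_sum a F \<omega> ^ (2 * p)" by (simp add: power_even_abs)
      finally show ?thesis by (auto simp: indicator_def)
    qed (simp add: indicator_def)
  qed
  also have "\<dots> = moment p * (\<Sum>i\<in>F. (a i)\<^sup>2) ^ p" by (rule gauss_sum_moment[OF F p])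
  finally show ?thesis using t by (simp add: field_simps)
qed

lemma gauss_sum_uminus: "gauss_sum (\<lambda>i. - a i) F \<omega> = - gauss_sum a F \<omega>"
  by (simp add: gauss_sum_def sum_negf)

text \<open>Coefficients \<open>a\<close> and \<open>- a\<close> have the same square sum and hence
  give the same law, while the two closed half-lines cover the line.\<close>

lemma gauss_sum_symmetric:
  assumes F: "finite F" "F \<subseteq> I"
  shows "prob {\<omega> \<in> space P. 0 \<le> gauss_sum a F \<omega>} \<ge> 1 / 2"
proof -
  have [measurable]: "gauss_sum a F \<in> borel_measurable P" by (rule gauss_sum_measurable[OF F(2)])
  define V where "V = (\<Sum>i\<in>F. (a i)\<^sup>2)"
  have "V \<ge> 0" by (simp add: V_def sum_nonneg)
  then consider "V = 0" | "V > 0" by linarith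
  then show ?thesis
  proof cases
    case 1
    then have "gauss_sum a F \<omega> = 0" for \<omega> using gauss_sum_zero F by (simp add: V_def)
    then show ?thesis using prob_space by simp
  next
    case 2
    have d: "prob {\<omega> \<in> space P. 0 \<le> gauss_sum b F \<omega>} = measure (density lborel (normal_density 0 (sqrt V))) {0..}"
      if b: "(\<Sum>i\<in>F. (b i)\<^sup>2) = V" for b
    proof -
      have [measurable]: "gauss_sum b F \<in> borel_measurable P" by (rule gauss_sum_measurable[OF F(2)])
      have "distr P lborel (gauss_sum b F) = density lborel (normal_density 0 (sqrt V))"
        using gauss_sum_normal[OF F, of b] 2 by (simp add: b distributed_distr_eq_density)
      then have "measure (density lborel (normal_density 0 (sqrt V))) {0..} = measure (distr P lborel (gauss_sum b F)) {0..}" by simp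
      also have "\<dots> = prob (gauss_sum b F -` {0..} \<inter> space P)" by (intro measure_distr) auto
      also have "gauss_sum b F -` {0..} \<inter> space P = {\<omega> \<in> space P. 0 \<le> gauss_sum b F \<omega>}" by auto
      finally show ?thesis ..
    qed
    have "prob {\<omega> \<in> space P. 0 \<le> gauss_sum a F \<omega>} = prob {\<omega> \<in> space P. 0 \<le> - gauss_sum a F \<omega>}"
      using d[of a] d[of "\<lambda>i. - a i"] by (simp add: V_def gauss_sum_uminus)
    moreover have "1 \<le> prob {\<omega> \<in> space P. 0 \<le> gauss_sum a F \<omega>} + prob {\<omega> \<in> space P. 0 \<le> - gauss_sum a F \<omega>}"
    proof -
      have "space P = {\<omega> \<in> space P. 0 \<le> gauss_sum a F \<omega>} \<union> {\<omega> \<in> space P. 0 \<le> - gauss_sum a F \<omega>}" by auto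
      then have "1 = prob ({\<omega> \<in> space P. 0 \<le> gauss_sum a F \<omega>} \<union> {\<omega> \<in> space P. 0 \<le> - gauss_sum a F \<omega>})" using prob_space by simp
      also have "\<dots> \<le> prob {\<omega> \<in> space P. 0 \<le> gauss_sum a F \<omega>} + prob {\<omega> \<in> space P. 0 \<le> - gauss_sum a F \<omega>}"
        by (rule measure_Un_le) auto
      finally show ?thesis .
    qed
    ultimately show ?thesis by simp
  qed
qed

text \<open>Levy's maximal inequality: after the first passage above \<open>t\<close>, the remaining increment is
  independent of the past and nonnegative with probability at least \<open>1 / 2\<close>.\<close>

lemma levy_maximal:
  assumes B: "\<And>k. finite (B k)" "\<And>k. B k \<subseteq> I" "incseq B"
  shows "prob {\<omega> \<in> space P. \<exists>k\<le>n. t \<le> gauss_sum a (B k) \<omega>} \<le> 2 * prob {\<omega> \<in> space P. t \<le> gauss_sum a (B n) \<omega>}"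
proof -
  have [measurable]: "gauss_sum a (B k) \<in> borel_measurable P" for k by (rule gauss_sum_measurable[OF B(2)])
  define T where "T = {\<omega> \<in> space P. t \<le> gauss_sum a (B n) \<omega>}"
  define E where "E k = {\<omega> \<in> space P. t \<le> gauss_sum a (B k) \<omega> \<and> (\<forall>j<k. gauss_sum a (B j) \<omega> < t)}" for k
  have [measurable]: "E k \<in> events" "T \<in> events" for k unfolding E_def T_def by measurable
  have Bm: "B j \<subseteq> B k" if "j \<le> k" for j k using B(3) that by (auto simp: incseq_def)
  have half: "prob (E k) \<le> 2 * prob (E k \<inter> T)" if k: "k \<le> n" for k
  proof -
    define C where "C = B n - B k"
    have C: "finite C" "C \<subseteq> I" "B k \<inter> C = {}" using B by (auto simp: C_def)
    have [measurable]: "gauss_sum a C \<in> borel_measurable P" by (rule gauss_sum_measurable[OF C(2)])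
    define D where "D = {\<omega> \<in> space P. 0 \<le> gauss_sum a C \<omega>}"
    have [measurable]: "D \<in> events" unfolding D_def by measurable
    \<comment> \<open>The past is written as a function of the variables in \<open>B k\<close> and
      the remaining increment as one of those in \<open>C\<close>, so that independence of the two
      restrictions applies. Earlier partial sums are obtained by setting coefficients to
      zero.\<close>
    define L where "L j f = (\<Sum>i\<in>B k. (if i \<in> B j then a i else 0) * f i)" for j and f :: "'i \<Rightarrow> real"
    have [measurable]: "L j \<in> borel_measurable (PiM (B k) (\<lambda>_. borel))" for j
      unfolding L_def by (intro borel_measurable_sum borel_measurable_times borel_measurable_const measurable_component_singleton)
    define L' where "L' f = (\<Sum>i\<in>C. a i * f i)" for f :: "'i \<Rightarrow> real"
    have [measurable]: "L' \<in> borel_measurable (PiM C (\<lambda>_. borel))"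
      unfolding L'_def by (intro borel_measurable_sum borel_measurable_times borel_measurable_const measurable_component_singleton)
    define Xa where "Xa = {f \<in> space (PiM (B k) (\<lambda>_. borel)). t \<le> L k f \<and> (\<forall>j<k. L j f < t)}"
    define Xb where "Xb = {f \<in> space (PiM C (\<lambda>_. borel)). 0 \<le> L' f}"
    have sets: "Xa \<in> sets (PiM (B k) (\<lambda>_. borel))" "Xb \<in> sets (PiM C (\<lambda>_. borel))"
      unfolding Xa_def Xb_def by measurable
    let ?R = "\<lambda>S \<omega>. \<lambda>i\<in>S. \<xi> i \<omega>"
    have L: "L j (?R (B k) \<omega>) = gauss_sum a (B j) \<omega>" if "j \<le> k" for j \<omega>
    proof -
      have "L j (?R (B k) \<omega>) = (\<Sum>i\<in>B k. if i \<in> B j then a i * \<xi> i \<omega> else 0)" unfolding L_def by (intro sum.cong) auto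
      also have "\<dots> = (\<Sum>i\<in>B j. a i * \<xi> i \<omega>)" using Bm[OF that] B(1) by (subst sum.inter_filter[symmetric]) (auto intro!: sum.cong)
      finally show ?thesis by (simp add: gauss_sum_def)
    qed
    have L': "L' (?R C \<omega>) = gauss_sum a C \<omega>" for \<omega> unfolding L'_def gauss_sum_def by (intro sum.cong) auto
    have va: "?R (B k) -` Xa \<inter> space P = E k"
      by (auto simp: Xa_def E_def L space_PiM)
    have vb: "?R C -` Xb \<inter> space P = D"
      by (auto simp: Xb_def D_def L' space_PiM)
    have "prob ((\<lambda>\<omega>. (?R (B k) \<omega>, ?R C \<omega>)) -` (Xa \<times> Xb) \<inter> space P) = prob (?R (B k) -` Xa \<inter> space P) * prob (?R C -` Xb \<inter> space P)"
      by (rule indep_varD[OF indep_var_restrict[OF indep C(3) B(2) C(2)] sets])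
    moreover have "(\<lambda>\<omega>. (?R (B k) \<omega>, ?R C \<omega>)) -` (Xa \<times> Xb) \<inter> space P = E k \<inter> D" using va vb by auto
    ultimately have pe: "prob (E k \<inter> D) = prob (E k) * prob D" by (simp only: va vb)
    have "1 / 2 \<le> prob D" unfolding D_def by (rule gauss_sum_symmetric[OF C(1,2)])
    then have "prob (E k) * (1 / 2) \<le> prob (E k \<inter> D)" unfolding pe by (intro mult_left_mono) auto
    also have "\<dots> \<le> prob (E k \<inter> T)"
    proof (rule finite_measure_mono)
      have "gauss_sum a (B n) \<omega> = gauss_sum a (B k) \<omega> + gauss_sum a C \<omega>" for \<omega>
        unfolding gauss_sum_def C_def using sum.subset_diff[OF Bm[OF k] B(1), of "\<lambda>i. a i * \<xi> i \<omega>"] by simp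
      then show "E k \<inter> D \<subseteq> E k \<inter> T" by (auto simp: E_def D_def T_def)
    qed auto
    finally show ?thesis by simp
  qed
  have disj: "disjoint_family_on E {..n}"
    unfolding disjoint_family_on_def
  proof (intro ballI impI)
    fix i j :: nat assume "i \<noteq> j"
    then show "E i \<inter> E j = {}" by (cases "i < j") (auto simp: E_def dest: leD)
  qed
  have "{\<omega> \<in> space P. \<exists>k\<le>n. t \<le> gauss_sum a (B k) \<omega>} \<subseteq> (\<Union>k\<le>n. E k)"
  proof
    fix \<omega> assume w: "\<omega> \<in> {\<omega> \<in> space P. \<exists>k\<le>n. t \<le> gauss_sum a (B k) \<omega>}"
    then obtain k where k: "k \<le> n" "t \<le> gauss_sum a (B k) \<omega>" by auto
    define m where "m = (LEAST k. t \<le> gauss_sum a (B k) \<omega>)"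
    have "t \<le> gauss_sum a (B m) \<omega>" unfolding m_def by (rule LeastI[of _ k]) (rule k)
    moreover have "m \<le> k" unfolding m_def by (rule Least_le) (rule k)
    moreover have "gauss_sum a (B j) \<omega> < t" if "j < m" for j using not_less_Least[of j "\<lambda>k. t \<le> gauss_sum a (B k) \<omega>"] that by (simp add: m_def)
    ultimately have "\<omega> \<in> E m" "m \<le> n" using w k by (auto simp: E_def)
    then show "\<omega> \<in> (\<Union>k\<le>n. E k)" by auto
  qed
  then have "prob {\<omega> \<in> space P. \<exists>k\<le>n. t \<le> gauss_sum a (B k) \<omega>} \<le> prob (\<Union>k\<le>n. E k)"
    by (intro finite_measure_mono) auto
  also have "\<dots> = (\<Sum>k\<le>n. prob (E k))" by (rule finite_measure_finite_Union[OF _ _ disj]) auto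
  also have "\<dots> \<le> (\<Sum>k\<le>n. 2 * prob (E k \<inter> T))" by (intro sum_mono half) auto
  also have "\<dots> = 2 * prob (\<Union>k\<le>n. E k \<inter> T)"
    unfolding sum_distrib_left[symmetric] using disj
    by (subst finite_measure_finite_Union) (auto simp: disjoint_family_on_def)
  also have "\<dots> \<le> 2 * prob T" by (intro mult_left_mono finite_measure_mono) auto
  finally show ?thesis unfolding T_def .
qed

text \<open>The factor 4 is a 2 for the two signs and a 2 from Levy's inequality. The bound is
  uniform in the finite horizon and passes to the union of the increasing events.\<close>

lemma maximal_tail:
  assumes B: "\<And>k. finite (B k)" "\<And>k. B k \<subseteq> I" "incseq B"
    and V: "\<And>k. (\<Sum>i\<in>B k. (a i)\<^sup>2) \<le> V" and p: "p \<ge> 1" and t: "t > 0"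
  shows "prob {\<omega> \<in> space P. \<exists>k. t \<le> \<bar>gauss_sum a (B k) \<omega>\<bar>} \<le> 4 * (moment p * V ^ p / t ^ (2 * p))"
proof -
  have [measurable]: "gauss_sum b (B k) \<in> borel_measurable P" for b k by (rule gauss_sum_measurable[OF B(2)])
  define E where "E n = {\<omega> \<in> space P. \<exists>k\<le>n. t \<le> \<bar>gauss_sum a (B k) \<omega>\<bar>}" for n
  have [measurable]: "E n \<in> events" for n unfolding E_def by measurable
  have le: "prob (E n) \<le> 4 * (moment p * V ^ p / t ^ (2 * p))" for n
  proof -
    let ?T = "{\<omega> \<in> space P. t \<le> \<bar>gauss_sum a (B n) \<omega>\<bar>}"
    have "prob (E n) \<le> prob ({\<omega> \<in> space P. \<exists>k\<le>n. t \<le> gauss_sum a (B k) \<omega>} \<union> {\<omega> \<in> space P. \<exists>k\<le>n. t \<le> gauss_sum (\<lambda>i. - a i) (B k) \<omega>})"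
      by (intro finite_measure_mono) (auto simp: E_def gauss_sum_uminus abs_if split: if_splits)
    also have "\<dots> \<le> prob {\<omega> \<in> space P. \<exists>k\<le>n. t \<le> gauss_sum a (B k) \<omega>} + prob {\<omega> \<in> space P. \<exists>k\<le>n. t \<le> gauss_sum (\<lambda>i. - a i) (B k) \<omega>}"
      by (rule measure_Un_le) auto
    also have "\<dots> \<le> 2 * prob ?T + 2 * prob ?T"
    proof (rule add_mono)
      have T: "2 * prob {\<omega> \<in> space P. t \<le> gauss_sum b (B n) \<omega>} \<le> 2 * prob ?T" if "b = a \<or> b = (\<lambda>i. - a i)" for b
        using that by (intro mult_left_mono finite_measure_mono) (auto simp: gauss_sum_uminus)
      show "prob {\<omega> \<in> space P. \<exists>k\<le>n. t \<le> gauss_sum a (B k) \<omega>} \<le> 2 * prob ?T"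
        by (rule order_trans[OF levy_maximal[OF B] T]) simp
      show "prob {\<omega> \<in> space P. \<exists>k\<le>n. t \<le> gauss_sum (\<lambda>i. - a i) (B k) \<omega>} \<le> 2 * prob ?T"
        by (rule order_trans[OF levy_maximal[OF B] T]) simp
    qed
    also have "\<dots> = 4 * prob ?T" by simp
    also have "\<dots> \<le> 4 * (moment p * (\<Sum>i\<in>B n. (a i)\<^sup>2) ^ p / t ^ (2 * p))"
      by (intro mult_left_mono gauss_sum_tail[OF B(1,2) p t]) auto
    also have "\<dots> \<le> 4 * (moment p * V ^ p / t ^ (2 * p))"
      using moment_pos[of p] t V by (intro mult_left_mono divide_right_mono power_mono) (auto intro: sum_nonneg less_imp_le)
    finally show ?thesis .
  qed
  have "(\<lambda>n. prob (E n)) \<longlonglongrightarrow> prob (\<Union>n. E n)"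
    by (rule finite_Lim_measure_incseq) (auto simp: incseq_def E_def intro: order_trans)
  then have "prob (\<Union>n. E n) \<le> 4 * (moment p * V ^ p / t ^ (2 * p))" using le by (intro LIMSEQ_le_const2) auto
  moreover have "(\<Union>n. E n) = {\<omega> \<in> space P. \<exists>k. t \<le> \<bar>gauss_sum a (B k) \<omega>\<bar>}" by (auto simp: E_def)
  ultimately show ?thesis by simp
qed

section \<open>Almost sure convergence and Gaussian limits\<close>

lemma filterlim_A: "filterlim A (finite_subsets_at_top I) sequentially"
  unfolding filterlim_iff eventually_finite_subsets_at_top
proof safe
  fix Q X assume X: "finite X" "X \<subseteq> I" and Q: "\<forall>Y. finite Y \<and> X \<subseteq> Y \<and> Y \<subseteq> I \<longrightarrow> Q Y"
  have "\<exists>n. X \<subseteq> A n" using X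
  proof (induction X rule: finite_induct)
    case (insert x X)
    then obtain n where n: "X \<subseteq> A n" by auto
    obtain k where "x \<in> A k" using insert.prems Union_A by auto
    then have "insert x X \<subseteq> A (max n k)" using n A_mono[of n "max n k"] A_mono[of k "max n k"] by auto
    then show ?case by blast
  qed simp
  then obtain n where n: "X \<subseteq> A n" by blast
  have "Q (A k)" if "k \<ge> n" for k
    using Q finite_A A_subset n incseq_A that by (meson incseq_def order_trans)
  then show "\<forall>\<^sub>F k in sequentially. Q (A k)" by (auto simp: eventually_sequentially)
qed

lemma has_sum_A: "(f has_sum s) I \<Longrightarrow> (\<lambda>k. sum f (A k)) \<longlonglongrightarrow> s"
  unfolding has_sum_def by (rule filterlim_compose[OF _ filterlim_A])

lemma sum_A_le:
  fixes f :: "'i \<Rightarrow> real"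
  assumes "(f has_sum s) I" "\<And>i. f i \<ge> 0"
  shows "sum f (A k) \<le> s"
  using assms by (intro incseq_le[OF _ has_sum_A]) (auto intro!: incseq_SucI sum_mono2 finite_A incseq_SucD[OF incseq_A])

text \<open>The maximal inequality is applied to the blocks after \<open>A m\<close>, whose variance
  is the tail of a convergent sum. Letting \<open>m\<close> grow shows that oscillations of any
  fixed size have probability 0, so the partial sums are almost surely Cauchy.\<close>

lemma AE_convergent:
  assumes V: "((\<lambda>i. (a i)\<^sup>2) has_sum V) I"
  shows "AE \<omega> in P. convergent (\<lambda>k. gauss_sum a (A k) \<omega>)"
proof -
  have inc: "A m \<subseteq> A (m + k)" for m k using incseq_A by (auto simp: incseq_def)
  define B where "B m k = A (m + k) - A m" for m k
  have B: "finite (B m k)" "B m k \<subseteq> I" "incseq (B m)" for m k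
  proof -
    show "finite (B m k)" "B m k \<subseteq> I" using finite_A A_subset by (auto simp: B_def)
    show "incseq (B m)" unfolding incseq_def B_def by (intro allI impI Diff_mono A_mono) auto
  qed
  have [measurable]: "gauss_sum a (B m k) \<in> borel_measurable P" for m k by (rule gauss_sum_measurable[OF B(2)])
  have vB: "(\<Sum>i\<in>B m k. (a i)\<^sup>2) \<le> V - (\<Sum>i\<in>A m. (a i)\<^sup>2)" for m k
    using sum_A_le[OF V, of "m + k"] sum.subset_diff[OF inc finite_A, of "\<lambda>i. (a i)\<^sup>2" m k] by (simp add: B_def)
  have lB: "gauss_sum a (B m k) \<omega> = gauss_sum a (A (m + k)) \<omega> - gauss_sum a (A m) \<omega>" for m k \<omega>
    using sum.subset_diff[OF inc finite_A, of "\<lambda>i. a i * \<xi> i \<omega>" m k] by (simp add: B_def gauss_sum_def)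
  define E where "E \<epsilon> m = {\<omega> \<in> space P. \<exists>k. \<epsilon> \<le> \<bar>gauss_sum a (B m k) \<omega>\<bar>}" for \<epsilon> m
  have [measurable]: "E \<epsilon> m \<in> events" for \<epsilon> m unfolding E_def by measurable
  have "AE \<omega> in P. \<omega> \<notin> (\<Inter>m. E \<epsilon> m)" if \<epsilon>: "\<epsilon> > 0" for \<epsilon>
  proof -
    have "prob (\<Inter>m. E \<epsilon> m) \<le> 4 * (moment 1 * (V - (\<Sum>i\<in>A m. (a i)\<^sup>2)) ^ 1 / \<epsilon> ^ (2 * 1))" for m
    proof -
      have "prob (\<Inter>m. E \<epsilon> m) \<le> prob (E \<epsilon> m)" by (intro finite_measure_mono) auto
      also have "\<dots> \<le> 4 * (moment 1 * (V - (\<Sum>i\<in>A m. (a i)\<^sup>2)) ^ 1 / \<epsilon> ^ (2 * 1))"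
        unfolding E_def by (rule maximal_tail[OF B vB _ \<epsilon>]) simp
      finally show ?thesis .
    qed
    moreover have "(\<lambda>m. 4 * (moment 1 * (V - (\<Sum>i\<in>A m. (a i)\<^sup>2)) ^ 1 / \<epsilon> ^ (2 * 1))) \<longlonglongrightarrow> 4 * (moment 1 * (V - V) ^ 1 / \<epsilon> ^ (2 * 1))"
      using \<epsilon> by (intro tendsto_intros has_sum_A[OF V]) auto
    ultimately have "prob (\<Inter>m. E \<epsilon> m) \<le> 4 * (moment 1 * (V - V) ^ 1 / \<epsilon> ^ (2 * 1))"
      by (intro LIMSEQ_le_const) auto
    then have "prob (\<Inter>m. E \<epsilon> m) = 0" by (simp add: measure_le_0_iff)
    then have "(\<Inter>m. E \<epsilon> m) \<in> null_sets P" by (auto simp: null_sets_def emeasure_eq_measure)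
    then show ?thesis by (rule AE_not_in)
  qed
  then have "AE \<omega> in P. \<forall>j. \<omega> \<notin> (\<Inter>m. E (1 / real (Suc j)) m)" unfolding AE_all_countable by simp
  then show ?thesis using AE_space
  proof eventually_elim
    case (elim \<omega>)
    have "Cauchy (\<lambda>k. gauss_sum a (A k) \<omega>)"
    proof (rule metric_CauchyI)
      fix e :: real assume "e > 0"
      then obtain j where j: "1 / real (Suc j) < e / 2" using nat_approx_posE[of "e / 2"] by (auto simp: inverse_eq_divide)
      obtain m where m: "\<omega> \<notin> E (1 / real (Suc j)) m" using elim by auto
      have c: "\<bar>gauss_sum a (A k) \<omega> - gauss_sum a (A m) \<omega>\<bar> < e / 2" if "k \<ge> m" for k
      proof -
        have "\<bar>gauss_sum a (B m (k - m)) \<omega>\<bar> < 1 / real (Suc j)" using m elim by (auto simp: E_def not_le)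
        then show ?thesis using that j by (simp add: lB)
      qed
      show "\<exists>M. \<forall>k\<ge>M. \<forall>n\<ge>M. dist (gauss_sum a (A k) \<omega>) (gauss_sum a (A n) \<omega>) < e"
      proof (intro exI allI impI)
        fix k n assume "k \<ge> m" "n \<ge> m"
        from c[OF this(1)] c[OF this(2)] show "dist (gauss_sum a (A k) \<omega>) (gauss_sum a (A n) \<omega>) < e"
          unfolding dist_real_def by linarith
      qed
    qed
    then show ?case by (rule Cauchy_convergent)
  qed
qed

lemma iexp_gauss_sum:
  assumes F: "finite F" "F \<subseteq> I"
  shows "(CLINT \<omega>|P. iexp (t * gauss_sum c F \<omega>)) = of_real (exp (- ((\<Sum>i\<in>F. (c i)\<^sup>2) * t\<^sup>2) / 2))"
proof -
  define V where "V = (\<Sum>i\<in>F. (c i)\<^sup>2)"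
  have "V \<ge> 0" by (simp add: V_def sum_nonneg)
  then consider "V = 0" | "V > 0" by linarith
  then show ?thesis
  proof cases
    case 1
    then have "gauss_sum c F \<omega> = 0" for \<omega> using gauss_sum_zero F by (simp add: V_def)
    then show ?thesis using 1 prob_space by (simp add: V_def[symmetric])
  next
    case 2
    define X where "X \<omega> = gauss_sum c F \<omega> / sqrt V" for \<omega>
    have X: "distributed P lborel X std_normal_density" unfolding X_def[abs_def] V_def by (rule gauss_sum_standard[OF F 2[unfolded V_def]])
    have [measurable]: "X \<in> borel_measurable P" using distributed_measurable[OF X] by simp
    have "distr P borel X = std_normal_distribution"
      using distributed_distr_eq_density[OF X] by (metis distr_cong sets_lborel)
    then have "(CLINT \<omega>|P. iexp (t * sqrt V * X \<omega>)) = char std_normal_distribution (t * sqrt V)"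
      unfolding char_def by (subst \<open>distr P borel X = std_normal_distribution\<close>[symmetric], subst integral_distr) auto
    moreover have "t * sqrt V * X \<omega> = t * gauss_sum c F \<omega>" for \<omega> using 2 by (simp add: X_def)
    ultimately have "(CLINT \<omega>|P. iexp (t * gauss_sum c F \<omega>)) = char std_normal_distribution (t * sqrt V)" by (simp only:)
    then show ?thesis using 2 by (simp add: char_std_normal_distribution V_def[symmetric] power_mult_distrib mult.commute)
  qed
qed

text \<open>Characteristic functions converge by dominated convergence and Levy's uniqueness theorem
  identifies the law; the moments are then read off from the normal law instead of being passed to
  the limit. Variance 0 is the degenerate case.\<close>

lemma gaussian_limit:
  assumes V: "((\<lambda>i. (c i)\<^sup>2) has_sum V) I" and Y [measurable]: "Y \<in> borel_measurable P"
    and lim: "AE \<omega> in P. (\<lambda>k. gauss_sum c (A k) \<omega>) \<longlonglongrightarrow> Y \<omega>"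
  shows "gaussian_rv P Y" "integrable P Y" "expectation Y = 0"
    "integrable P (\<lambda>\<omega>. (Y \<omega>)\<^sup>2)" "expectation (\<lambda>\<omega>. (Y \<omega>)\<^sup>2) = V"
proof -
  have "V \<ge> 0" using V by (rule has_sum_nonneg) auto
  then consider "V = 0" | "V > 0" by linarith
  then have "gaussian_rv P Y \<and> integrable P Y \<and> expectation Y = 0 \<and> integrable P (\<lambda>\<omega>. (Y \<omega>)\<^sup>2) \<and> expectation (\<lambda>\<omega>. (Y \<omega>)\<^sup>2) = V"
  proof cases
    case 1
    have "(\<Sum>i\<in>A k. (c i)\<^sup>2) = 0" for k using sum_A_le[OF V, of k] 1 by (simp add: order_antisym sum_nonneg)
    then have "gauss_sum c (A k) \<omega> = 0" for k \<omega> using gauss_sum_zero finite_A by blast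
    then have Y0: "AE \<omega> in P. Y \<omega> = 0" using lim by (auto elim!: eventually_mono dest: LIMSEQ_unique[OF tendsto_const])
    have "integrable P Y \<longleftrightarrow> integrable P (\<lambda>_. 0 :: real)" by (rule integrable_cong_AE) (use Y0 in auto)
    moreover have "expectation Y = expectation (\<lambda>_. 0)" by (rule integral_cong_AE) (use Y0 in auto)
    moreover have "integrable P (\<lambda>\<omega>. (Y \<omega>)\<^sup>2) \<longleftrightarrow> integrable P (\<lambda>_. 0 :: real)"
      by (rule integrable_cong_AE) (use Y0 in \<open>auto elim!: eventually_mono\<close>)
    moreover have "expectation (\<lambda>\<omega>. (Y \<omega>)\<^sup>2) = expectation (\<lambda>_. 0)"
      by (rule integral_cong_AE) (use Y0 in \<open>auto elim!: eventually_mono\<close>)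
    ultimately show ?thesis using Y0 1 by (auto simp: gaussian_rv_def)
  next
    case 2
    define X where "X \<omega> = Y \<omega> / sqrt V" for \<omega>
    have [measurable]: "X \<in> borel_measurable P" unfolding X_def[abs_def] by measurable
    have "char (distr P borel X) = char std_normal_distribution"
    proof
      fix t :: real
      define u where "u = t / sqrt V"
      have "(\<lambda>k. CLINT \<omega>|P. iexp (u * gauss_sum c (A k) \<omega>)) \<longlonglongrightarrow> (CLINT \<omega>|P. iexp (u * Y \<omega>))"
      proof (rule integral_dominated_convergence[where w = "\<lambda>_. 1"])
        show "AE \<omega> in P. (\<lambda>k. iexp (u * gauss_sum c (A k) \<omega>)) \<longlonglongrightarrow> iexp (u * Y \<omega>)"
          using lim by eventually_elim (intro tendsto_intros)
      qed auto
      moreover have "(\<lambda>k. CLINT \<omega>|P. iexp (u * gauss_sum c (A k) \<omega>)) \<longlonglongrightarrow> of_real (exp (- (V * u\<^sup>2) / 2))"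
        unfolding iexp_gauss_sum[OF finite_A A_subset] by (intro tendsto_intros has_sum_A[OF V]) auto
      ultimately have "(CLINT \<omega>|P. iexp (u * Y \<omega>)) = of_real (exp (- (V * u\<^sup>2) / 2))" by (rule LIMSEQ_unique)
      moreover have "V * u\<^sup>2 = t\<^sup>2" using 2 by (simp add: u_def power_divide)
      moreover have "u * Y \<omega> = t * X \<omega>" for \<omega> by (simp add: u_def X_def)
      ultimately show "char (distr P borel X) t = char std_normal_distribution t"
        unfolding char_std_normal_distribution by (simp add: char_def integral_distr)
    qed
    then have "distr P borel X = std_normal_distribution"
      by (intro Levy_uniqueness real_distribution_distr real_dist_normal_dist) auto
    then have "distr P lborel X = std_normal_distribution" by (metis distr_cong sets_lborel)
    then have sX: "distributed P lborel X std_normal_density" by (simp add: distributed_def)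
    have eY: "Y = (\<lambda>\<omega>. sqrt V * X \<omega>)" "(\<lambda>\<omega>. (Y \<omega>)\<^sup>2) = (\<lambda>\<omega>. V * X \<omega> ^ (2 * 1))"
      using 2 by (auto simp: X_def power_divide)
    have "distributed P lborel Y (normal_density 0 (sqrt V))"
      using normal_standard_normal_convert[of "sqrt V" Y 0] sX 2 by (simp add: X_def[abs_def])
    moreover have "0 < sqrt V" using 2 by simp
    ultimately have "gaussian_rv P Y" unfolding gaussian_rv_def using Y by blast
    moreover have "integrable P (\<lambda>\<omega>. V * X \<omega> ^ (2 * 1))" by (intro integrable_mult_right standard_moments(1)[OF sX])
    moreover have "expectation (\<lambda>\<omega>. V * X \<omega> ^ (2 * 1)) = V" using standard_moments(2)[OF sX, of 1] by simp
    moreover have "integrable P (\<lambda>\<omega>. sqrt V * X \<omega>)" by (intro integrable_mult_right standard_moments(3)[OF sX])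
    moreover have "expectation (\<lambda>\<omega>. sqrt V * X \<omega>) = 0" using standard_moments(4)[OF sX] by simp
    ultimately show ?thesis by (simp only: eY(2)) (simp only: eY(1)[symmetric])
  qed
  then show "gaussian_rv P Y" "integrable P Y" "expectation Y = 0"
    "integrable P (\<lambda>\<omega>. (Y \<omega>)\<^sup>2)" "expectation (\<lambda>\<omega>. (Y \<omega>)\<^sup>2) = V" by auto
qed

lemma gauss_sum_diff: "gauss_sum (\<lambda>i. a i - b i) F \<omega> = gauss_sum a F \<omega> - gauss_sum b F \<omega>"
  by (simp add: gauss_sum_def left_diff_distrib sum_subtractf)

section \<open>Chaining and uniform convergence\<close>

context
  fixes a :: "'x :: real_normed_vector \<Rightarrow> 'i \<Rightarrow> real" and E :: "'x set" and h :: real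
  assumes h: "h > 0"
    and increment: "\<And>x y. x \<in> E \<Longrightarrow> y \<in> E \<Longrightarrow> ((\<lambda>i. (a x i - a y i)\<^sup>2) has_sum norm (x - y) powr (2 * h)) I"
begin

text \<open>A single squared difference is one term of the square sum of the increment, so each
  coefficient inherits the Hoelder bound.\<close>

lemma coefficient_hoelder:
  assumes xy: "x \<in> E" "y \<in> E" and i: "i \<in> I"
  shows "\<bar>a x i - a y i\<bar> \<le> norm (x - y) powr h"
proof -
  obtain k where k: "i \<in> A k" using i Union_A by auto
  have "(a x i - a y i)\<^sup>2 \<le> (\<Sum>i\<in>A k. (a x i - a y i)\<^sup>2)"
    using member_le_sum[OF k, of "\<lambda>i. (a x i - a y i)\<^sup>2"] finite_A by simp
  also have "\<dots> \<le> norm (x - y) powr (2 * h)" by (rule sum_A_le[OF increment[OF xy]]) simp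
  also have "\<dots> = (norm (x - y) powr h)\<^sup>2" by (simp add: power2_eq_square powr_add[symmetric])
  finally show ?thesis using abs_le_square_iff[of "a x i - a y i" "norm (x - y) powr h"] by simp
qed

lemma coefficient_continuous: "i \<in> I \<Longrightarrow> continuous_on E (\<lambda>x. a x i)"
  unfolding continuous_on_def
proof
  fix x assume i: "i \<in> I" and x: "x \<in> E"
  show "((\<lambda>y. a y i) \<longlongrightarrow> a x i) (at x within E)"
  proof (rule LIM_zero_cancel, rule Lim_null_comparison)
    show "eventually (\<lambda>y. norm (a y i - a x i) \<le> norm (y - x) powr h) (at x within E)"
      using coefficient_hoelder[OF _ x i] by (auto simp: eventually_at_filter)
    have "((\<lambda>y. norm (y - x) powr h) \<longlongrightarrow> norm (x - x) powr h) (at x within E)"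
      using h by (intro tendsto_intros) auto
    then show "((\<lambda>y. norm (y - x) powr h) \<longlongrightarrow> 0) (at x within E)" by simp
  qed
qed

lemma gauss_sum_continuous: "continuous_on E (\<lambda>x. gauss_sum (a x) (A k) \<omega>)"
  unfolding gauss_sum_def using A_subset by (intro continuous_intros coefficient_continuous) auto

text \<open>Chaining along nets of mesh \<open>2\<close> to the power \<open>- n\<close>. The order \<open>2 p\<close> of the moments is chosen so large
  that it beats the growth of the number of pairs of net points.\<close>

theorem AE_uniformly_convergent:
  fixes \<pi> :: "nat \<Rightarrow> 'x \<Rightarrow> 'x"
  assumes sq: "\<And>x. x \<in> E \<Longrightarrow> (\<lambda>i. (a x i)\<^sup>2) summable_on I"
    and net: "\<And>n x. x \<in> E \<Longrightarrow> \<pi> n x \<in> E" "\<And>n x. x \<in> E \<Longrightarrow> norm (x - \<pi> n x) \<le> c / 2 ^ n"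
    and card: "\<And>n. finite (\<pi> n ` E)" "\<And>n. real (card (\<pi> n ` E)) \<le> K * B ^ n"
    and c: "c > 0" and B: "B > 0"
  shows "AE \<omega> in P. uniformly_convergent_on E (\<lambda>k x. gauss_sum (a x) (A k) \<omega>)"
proof -
  define \<theta> where "\<theta> = 2 powr h"
  have th: "\<theta> > 1" unfolding \<theta>_def using h by simp
  \<comment> \<open>The pairs of neighbouring net points at level \<open>n\<close> number about
    \<open>B\<close> to the power \<open>2 * n\<close>, and each fails with probability of order
    \<open>\<theta>\<close> to the power \<open>- p * n\<close>. The exponent makes the ratio of the
    two rates less than 1.\<close>
  obtain p0 where p0: "2 * B\<^sup>2 < \<theta> ^ p0" using real_arch_pow[OF th] by blast
  define p where "p = Suc p0"
  have "\<theta> ^ p0 \<le> \<theta> ^ p" unfolding p_def using th by (intro power_increasing) auto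
  then have p: "2 * B\<^sup>2 < \<theta> ^ p" "p \<ge> 1" using p0 by (auto simp: p_def)
  \<comment> \<open>The tolerated increment at level \<open>n\<close> is \<open>q^n\<close>, whereas
    its standard deviation decays like \<open>q^(2 * n)\<close>: large against the deviation and
    still summable over the levels.\<close>
  define q where "q = 2 powr (- h / 2)"
  have q: "0 < q" "q < 1" unfolding q_def using h powr_less_cancel_iff[of 2 "- h / 2" 0] by auto
  have q2: "q\<^sup>2 = 1 / \<theta>" by (simp add: q_def \<theta>_def power2_eq_square powr_add[symmetric] powr_minus_divide)
  define D where "D = (2 * c) powr (2 * h)"
  define V where "V n = (2 * c / 2 ^ n) powr (2 * h)" for n
  have V: "V n = D * (q ^ n) ^ 4" for n
  proof -
    have q4: "q ^ 4 = 1 / 2 powr (2 * h)"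
    proof -
      have "q ^ 4 = (q\<^sup>2)\<^sup>2" by simp
      then show ?thesis unfolding q2 by (simp add: \<theta>_def power_divide power2_eq_square powr_add[symmetric])
    qed
    have "V n = D / (2 ^ n) powr (2 * h)" using c by (simp add: V_def D_def powr_divide)
    also have "(2 ^ n :: real) powr (2 * h) = (2 powr (2 * h)) ^ n"
      by (simp add: powr_powr powr_power mult.commute flip: powr_realpow)
    also have "D / (2 powr (2 * h)) ^ n = D * (q ^ 4) ^ n" unfolding q4 by (simp add: power_divide)
    finally show ?thesis by (simp add: power_mult[symmetric] mult.commute)
  qed
  define T where "T n = {(u, v). u \<in> \<pi> n ` E \<and> v \<in> \<pi> (Suc n) ` E \<and> norm (u - v) \<le> 2 * c / 2 ^ n}" for n
  have Tsub: "T n \<subseteq> \<pi> n ` E \<times> \<pi> (Suc n) ` E" for n by (auto simp: T_def)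
  have fT: "finite (T n)" for n by (rule finite_subset[OF Tsub]) (intro finite_cartesian_product card)
  have cT: "real (card (T n)) \<le> K\<^sup>2 * B * (B\<^sup>2) ^ n" for n
  proof -
    have K: "K * B ^ n \<ge> 0" using card(2)[of n] by (meson of_nat_0_le_iff order_trans)
    have "card (T n) \<le> card (\<pi> n ` E) * card (\<pi> (Suc n) ` E)"
      using card_mono[OF _ Tsub, of n] card(1) by (simp add: card_cartesian_product)
    then have "real (card (T n)) \<le> real (card (\<pi> n ` E)) * real (card (\<pi> (Suc n) ` E))" by (simp flip: of_nat_mult)
    also have "\<dots> \<le> (K * B ^ n) * (K * B ^ Suc n)" by (intro mult_mono card K) auto
    also have "\<dots> = K\<^sup>2 * B * (B\<^sup>2) ^ n" by (simp add: power2_eq_square power_mult_distrib)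
    finally show ?thesis .
  qed
  \<comment> \<open>One bad event for all partial sums at once. The maximal inequality bounds its
    probability, and the later estimates become uniform in \<open>k\<close>.\<close>
  define F where "F n uv = {\<omega> \<in> space P. \<exists>k. q ^ n \<le> \<bar>gauss_sum (\<lambda>i. a (fst uv) i - a (snd uv) i) (A k) \<omega>\<bar>}" for n uv
  have Fm [measurable]: "F n uv \<in> events" for n uv unfolding F_def by measurable
  have pF: "prob (F n uv) \<le> 4 * moment p * D ^ p * (1 / \<theta> ^ p) ^ n" if uv: "uv \<in> T n" for n uv
  proof -
    obtain u v where e: "uv = (u, v)" by fastforce
    have E: "u \<in> E" "v \<in> E" and d: "norm (u - v) \<le> 2 * c / 2 ^ n" using uv net(1) by (auto simp: e T_def)
    have "prob (F n uv) \<le> 4 * (moment p * V n ^ p / (q ^ n) ^ (2 * p))"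
      unfolding F_def
    proof (rule maximal_tail[OF finite_A A_subset incseq_A _ p(2)])
      fix k
      have "(\<Sum>i\<in>A k. (a u i - a v i)\<^sup>2) \<le> norm (u - v) powr (2 * h)" by (rule sum_A_le[OF increment[OF E]]) simp
      also have "\<dots> \<le> V n" unfolding V_def using d h by (intro powr_mono2) auto
      finally show "(\<Sum>i\<in>A k. (a (fst uv) i - a (snd uv) i)\<^sup>2) \<le> V n" by (simp add: e)
    qed (use q in simp)
    also have "4 * (moment p * V n ^ p / (q ^ n) ^ (2 * p)) = 4 * moment p * (V n ^ p / (q ^ n) ^ (2 * p))" by simp
    also have "V n ^ p / (q ^ n) ^ (2 * p) = D ^ p * (1 / \<theta> ^ p) ^ n"
    proof -
      have "V n ^ p = D ^ p * (q ^ n) ^ (2 * p) * (q ^ n) ^ (2 * p)"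
        unfolding V by (simp add: power_mult_distrib power_mult[symmetric] power_add[symmetric] mult_ac)
      then have a1: "V n ^ p / (q ^ n) ^ (2 * p) = D ^ p * (q ^ n) ^ (2 * p)" using q by simp
      have a2: "(q ^ n) ^ (2 * p) = (1 / \<theta> ^ p) ^ n"
      proof -
        have "(q ^ n) ^ (2 * p) = ((q\<^sup>2) ^ p) ^ n" by (simp add: power_mult[symmetric] mult_ac)
        then show ?thesis unfolding q2 by (simp add: power_divide)
      qed
      show ?thesis by (rule trans[OF a1]) (simp only: a2)
    qed
    finally show ?thesis by simp
  qed
  define G where "G n = (\<Union>uv\<in>T n. F n uv)" for n
  have Gm: "G n \<in> events" for n unfolding G_def by (intro sets.finite_UN fT Fm)
  define C where "C = K\<^sup>2 * B * (4 * moment p * D ^ p)"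
  have pG: "prob (G n) \<le> C * (B\<^sup>2 / \<theta> ^ p) ^ n" for n
  proof -
    have "prob (G n) \<le> (\<Sum>uv\<in>T n. prob (F n uv))" unfolding G_def by (rule measure_UNION_le[OF fT Fm])
    also have "\<dots> \<le> (\<Sum>uv\<in>T n. 4 * moment p * D ^ p * (1 / \<theta> ^ p) ^ n)" by (intro sum_mono pF)
    also have "\<dots> = real (card (T n)) * (4 * moment p * D ^ p * (1 / \<theta> ^ p) ^ n)" by simp
    also have "\<dots> \<le> (K\<^sup>2 * B * (B\<^sup>2) ^ n) * (4 * moment p * D ^ p * (1 / \<theta> ^ p) ^ n)"
      using moment_pos[of p] th by (intro mult_right_mono cT mult_nonneg_nonneg zero_le_power) (auto simp: D_def)
    also have "\<dots> = C * (B\<^sup>2 / \<theta> ^ p) ^ n" by (simp add: C_def power_divide)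
    finally show ?thesis .
  qed
  have ratio: "0 \<le> B\<^sup>2 / \<theta> ^ p" "B\<^sup>2 / \<theta> ^ p < 1"
  proof -
    have "B\<^sup>2 < \<theta> ^ p" using p(1) B zero_le_power2[of B] by linarith
    then show "B\<^sup>2 / \<theta> ^ p < 1" using th by (simp add: divide_less_eq)
  qed (use th in simp)
  have sG: "summable (\<lambda>n. prob (G n))"
  proof (rule summable_comparison_test')
    show "summable (\<lambda>n. C * (B\<^sup>2 / \<theta> ^ p) ^ n)" using ratio by (intro summable_mult summable_geometric) simp
  qed (use pG in simp)
  have "AE \<omega> in P. eventually (\<lambda>n. \<omega> \<in> space P - G n) sequentially"
    by (rule borel_cantelli_AE1[OF Gm _ sG]) (simp add: emeasure_eq_measure)
  moreover have "AE \<omega> in P. \<forall>n. \<forall>u\<in>\<pi> n ` E. convergent (\<lambda>k. gauss_sum (a u) (A k) \<omega>)"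
    unfolding AE_all_countable
  proof
    fix n
    have "AE \<omega> in P. convergent (\<lambda>k. gauss_sum (a u) (A k) \<omega>)" if "u \<in> \<pi> n ` E" for u
    proof -
      have "u \<in> E" using that net(1) by auto
      then show ?thesis using sq[of u] AE_convergent[of "a u"] by (auto simp: summable_on_def)
    qed
    then show "AE \<omega> in P. \<forall>u\<in>\<pi> n ` E. convergent (\<lambda>k. gauss_sum (a u) (A k) \<omega>)"
      by (intro AE_finite_allI card) auto
  qed
  ultimately show ?thesis
  proof eventually_elim
    case (elim \<omega>)
    define S where "S k x = gauss_sum (a x) (A k) \<omega>" for k x
    \<comment> \<open>The Borel-Cantelli lemma supplies a level, depending on the outcome, beyond
      which no bad event occurs.\<close>
    obtain N0 where N0: "\<And>n. n \<ge> N0 \<Longrightarrow> \<omega> \<in> space P - G n" using elim(1) by (auto simp: eventually_sequentially)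
    have step: "\<bar>S k (\<pi> n x) - S k (\<pi> (Suc n) x)\<bar> \<le> q ^ n" if x: "x \<in> E" and n: "n \<ge> N0" for k n x
    proof -
      have "norm (\<pi> n x - \<pi> (Suc n) x) \<le> norm (x - \<pi> n x) + norm (x - \<pi> (Suc n) x)"
        using norm_triangle_ineq4[of "x - \<pi> (Suc n) x" "x - \<pi> n x"] by simp
      also have "\<dots> \<le> c / 2 ^ n + c / 2 ^ Suc n" by (intro add_mono net(2) x)
      also have "\<dots> \<le> 2 * c / 2 ^ n" using c by (simp add: field_simps)
      finally have "(\<pi> n x, \<pi> (Suc n) x) \<in> T n" using x by (auto simp: T_def)
      then have "\<omega> \<notin> F n (\<pi> n x, \<pi> (Suc n) x)" using N0[OF n] by (auto simp: G_def)
      then show ?thesis using N0[OF n] by (auto simp: F_def S_def gauss_sum_diff not_le intro: less_imp_le)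
    qed
    have chain: "\<bar>S k (\<pi> n x) - S k (\<pi> (n + m) x)\<bar> \<le> (\<Sum>j<m. q ^ (n + j))" if x: "x \<in> E" and n: "n \<ge> N0" for k n m x
    proof (induction m)
      case (Suc m)
      have "n + m \<ge> N0" using n by simp
      from step[OF x this, of k] Suc show ?case by simp
    qed simp
    \<comment> \<open>The net points of higher levels converge to \<open>x\<close> and every finite
      sum is continuous on \<open>E\<close>, so the geometric bound along the chain survives in the
      limit.\<close>
    have near: "\<bar>S k (\<pi> n x) - S k x\<bar> \<le> q ^ n / (1 - q)" if x: "x \<in> E" and n: "n \<ge> N0" for k n x
    proof (rule LIMSEQ_le_const2)
      have "(\<lambda>m. c * (1 / 2) ^ (m + n)) \<longlonglongrightarrow> c * 0" by (intro tendsto_mult tendsto_const LIMSEQ_ignore_initial_segment LIMSEQ_power_zero) simp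
      then have lim: "(\<lambda>m. c / 2 ^ (n + m)) \<longlonglongrightarrow> 0" by (simp add: power_divide add.commute)
      have "(\<lambda>m. \<pi> (n + m) x) \<longlonglongrightarrow> x"
        by (rule LIM_zero_cancel, rule Lim_null_comparison[OF always_eventually lim]) (use net(2)[OF x] in \<open>simp add: norm_minus_commute\<close>)
      then have "(\<lambda>m. S k (\<pi> (n + m) x)) \<longlonglongrightarrow> S k x"
        unfolding S_def using continuous_on_tendsto_compose[OF gauss_sum_continuous] x net(1) by force
      then show "(\<lambda>m. \<bar>S k (\<pi> n x) - S k (\<pi> (n + m) x)\<bar>) \<longlonglongrightarrow> \<bar>S k (\<pi> n x) - S k x\<bar>" by (intro tendsto_intros)
      have "(\<Sum>j<m. q ^ (n + j)) \<le> q ^ n / (1 - q)" for m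
      proof -
        have "(\<Sum>j<m. q ^ j) \<le> 1 / (1 - q)"
          using q sum_le_suminf[of "\<lambda>j. q ^ j" "{..<m}"] by (simp add: suminf_geometric summable_geometric)
        then have "q ^ n * (\<Sum>j<m. q ^ j) \<le> q ^ n * (1 / (1 - q))" using q by (intro mult_left_mono) auto
        then show ?thesis by (simp add: sum_distrib_left power_add)
      qed
      then show "\<exists>N. \<forall>m\<ge>N. \<bar>S k (\<pi> n x) - S k (\<pi> (n + m) x)\<bar> \<le> q ^ n / (1 - q)"
        using chain[OF x n] order_trans by blast
    qed
    have "uniformly_Cauchy_on E S"
    proof (rule uniformly_Cauchy_onI)
      fix \<epsilon> :: real assume \<epsilon>: "\<epsilon> > 0"
      have "(\<lambda>n. q ^ n / (1 - q)) \<longlonglongrightarrow> 0 / (1 - q)" using q by (intro tendsto_divide LIMSEQ_power_zero tendsto_const) auto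
      then have "eventually (\<lambda>n. q ^ n / (1 - q) < \<epsilon> / 4) sequentially" using \<epsilon> by (intro order_tendstoD(2)[of _ "0 / (1 - q)"]) auto
      then have "eventually (\<lambda>n. q ^ n / (1 - q) < \<epsilon> / 4 \<and> n \<ge> N0) sequentially" using eventually_ge_at_top by (rule eventually_conj)
      then obtain n where n: "q ^ n / (1 - q) < \<epsilon> / 4" "n \<ge> N0" by (auto simp: eventually_sequentially)
      have "\<forall>u\<in>\<pi> n ` E. eventually (\<lambda>k. dist (S k u) (lim (\<lambda>k. S k u)) < \<epsilon> / 4) sequentially"
      proof
        fix u assume "u \<in> \<pi> n ` E"
        then have "(\<lambda>k. S k u) \<longlonglongrightarrow> lim (\<lambda>k. S k u)" using elim(2) by (auto simp: S_def convergent_LIMSEQ_iff)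
        then show "eventually (\<lambda>k. dist (S k u) (lim (\<lambda>k. S k u)) < \<epsilon> / 4) sequentially"
          by (rule tendstoD) (use \<epsilon> in simp)
      qed
      then have "eventually (\<lambda>k. \<forall>u\<in>\<pi> n ` E. dist (S k u) (lim (\<lambda>k. S k u)) < \<epsilon> / 4) sequentially"
        by (rule eventually_ball_finite[OF card(1)])
      then obtain M where M: "\<And>k u. k \<ge> M \<Longrightarrow> u \<in> \<pi> n ` E \<Longrightarrow> \<bar>S k u - lim (\<lambda>k. S k u)\<bar> < \<epsilon> / 4"
        by (auto simp: eventually_sequentially dist_real_def)
      show "\<exists>M. \<forall>x\<in>E. \<forall>j\<ge>M. \<forall>k\<ge>M. dist (S j x) (S k x) < \<epsilon>"
      proof (intro exI ballI allI impI)
        \<comment> \<open>Four errors below \<open>\<epsilon> / 4\<close>: from \<open>x\<close> to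
          its net point in the sums \<open>j\<close> and \<open>k\<close>, and from each of these
          sums to the limit at the net point.\<close>
        fix x j k assume x: "x \<in> E" and jk: "j \<ge> M" "k \<ge> M"
        have u: "\<pi> n x \<in> \<pi> n ` E" using x by simp
        from near[OF x n(2), of j] near[OF x n(2), of k] M[OF jk(1) u] M[OF jk(2) u] n(1)
        show "dist (S j x) (S k x) < \<epsilon>" unfolding dist_real_def by linarith
      qed
    qed
    then show ?case unfolding S_def[abs_def] by (rule Cauchy_uniformly_convergent)
  qed
qed

end

end

text \<open>Points are grouped by the integer parts of their scaled coordinates, and a
  representative of each nonempty class is chosen inside the ball, where corners of the cells need
  not lie. Each coordinate has at most \<open>2 * 2^n + 1 <= 3 * 2^n\<close> integer parts.\<close>

lemma dyadic_net:
  fixes n :: nat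
  shows "\<exists>\<pi> :: real ^ 'n \<Rightarrow> real ^ 'n. (\<forall>x\<in>cball 0 1. \<pi> x \<in> cball 0 1 \<and> norm (x - \<pi> x) \<le> real CARD('n::finite) / 2 ^ n) \<and>
    finite (\<pi> ` cball 0 1) \<and> real (card (\<pi> ` cball 0 1)) \<le> 3 ^ CARD('n) * (2 ^ CARD('n)) ^ n"
proof -
  define \<rho> :: "real ^ 'n \<Rightarrow> 'n \<Rightarrow> int" where "\<rho> x = (\<lambda>i. \<lfloor>2 ^ n * x $ i\<rfloor>)" for x
  define \<pi> where "\<pi> x = inv_into (cball 0 1) \<rho> (\<rho> x)" for x
  have in_ball: "\<pi> x \<in> cball 0 1" and same: "\<rho> (\<pi> x) = \<rho> x" if "x \<in> cball 0 1" for x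
    unfolding \<pi>_def using that by (auto intro!: inv_into_into f_inv_into_f simp del: mem_cball mem_cball_0)
  have close: "norm (x - \<pi> x) \<le> real CARD('n) / 2 ^ n" if x: "x \<in> cball 0 1" for x
  proof -
    have "\<bar>(x - \<pi> x) $ i\<bar> \<le> 1 / 2 ^ n" for i
    proof -
      have "\<lfloor>2 ^ n * \<pi> x $ i\<rfloor> = \<lfloor>2 ^ n * x $ i\<rfloor>" using fun_cong[OF same[OF x], of i] by (simp add: \<rho>_def)
      then have "\<bar>2 ^ n * x $ i - 2 ^ n * \<pi> x $ i\<bar> \<le> 1" by linarith
      then have "2 ^ n * \<bar>(x - \<pi> x) $ i\<bar> \<le> 1" by (simp add: abs_mult flip: right_diff_distrib)
      then show ?thesis by (simp add: field_simps)
    qed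
    then have "(\<Sum>i\<in>UNIV. \<bar>(x - \<pi> x) $ i\<bar>) \<le> (\<Sum>i\<in>(UNIV :: 'n set). 1 / 2 ^ n)" by (intro sum_mono)
    then show ?thesis using norm_le_l1_cart[of "x - \<pi> x"] by simp
  qed
  define Q where "Q = (PiE UNIV (\<lambda>_. {- (2 ^ n)..2 ^ n}) :: ('n \<Rightarrow> int) set)"
  have sub: "\<rho> ` cball 0 1 \<subseteq> Q"
  proof
    fix f assume "f \<in> \<rho> ` cball 0 1"
    then obtain x where x: "norm x \<le> 1" "f = \<rho> x" by auto
    have "- (2 ^ n) \<le> f i \<and> f i \<le> 2 ^ n" for i
    proof -
      have "\<bar>x $ i\<bar> \<le> 1" using component_le_norm_cart[of x i] x(1) by linarith
      then have "2 ^ n * \<bar>x $ i\<bar> \<le> 2 ^ n * 1" by (intro mult_left_mono) auto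
      then have "\<bar>2 ^ n * x $ i\<bar> \<le> 2 ^ n" by (simp add: abs_mult)
      then have "- (2 ^ n) \<le> 2 ^ n * x $ i" "2 ^ n * x $ i < 2 ^ n + 1" by linarith+
      then have "of_int (- (2 ^ n)) \<le> 2 ^ n * x $ i" "2 ^ n * x $ i < of_int (2 ^ n) + 1"
        by (simp_all only: of_int_minus of_int_power of_int_numeral)
      then show ?thesis unfolding x(2) \<rho>_def by (simp add: le_floor_iff floor_le_iff)
    qed
    then show "f \<in> Q" by (auto simp: Q_def PiE_def extensional_def)
  qed
  have Q: "finite Q" "card Q = (2 * 2 ^ n + 1) ^ CARD('n)"
    unfolding Q_def by (auto intro!: finite_PiE simp: card_PiE nat_add_distrib nat_mult_distrib nat_power_eq)
  have "\<pi> ` cball 0 1 = inv_into (cball 0 1) \<rho> ` (\<rho> ` cball 0 1)" by (auto simp: \<pi>_def)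
  then have fin: "finite (\<pi> ` cball 0 1)" and "card (\<pi> ` cball 0 1) \<le> card (\<rho> ` cball 0 1)"
    using finite_subset[OF sub Q(1)] by (auto intro: card_image_le)
  then have "card (\<pi> ` cball 0 1) \<le> card Q" using card_mono[OF Q(1) sub] by simp
  also have "\<dots> \<le> (3 * 2 ^ n) ^ CARD('n)" unfolding Q by (intro power_mono) auto
  finally have "real (card (\<pi> ` cball 0 1)) \<le> real ((3 * 2 ^ n) ^ CARD('n))" by (rule of_nat_mono)
  also have "\<dots> = 3 ^ CARD('n) * (2 ^ CARD('n)) ^ n" by (simp add: power_mult_distrib power_mult[symmetric] mult.commute)
  finally show ?thesis using in_ball close fin by (intro exI[of _ \<pi>]) auto
qed

theorem theorem1:
  fixes H :: real
    and e :: "nat \<Rightarrow> 'n::finite"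
    and P :: "'a measure"
    and \<xi> :: "nat \<Rightarrow> nat \<Rightarrow> nat \<Rightarrow> 'a \<Rightarrow> real"
  assumes H: "0 < H" "H < 1"
    and e: "bij_betw e {1..CARD('n)} UNIV"
    and P: "prob_space P"
    and normal: "\<And>m n l. 1 \<le> n \<Longrightarrow> 1 \<le> l \<Longrightarrow> l \<le> sph_dim m CARD('n) \<Longrightarrow>
        distributed P lborel (\<xi> m n l) std_normal_density"
    and indep: "prob_space.indep_vars P (\<lambda>_. borel) (\<lambda>(m, n, l). \<xi> m n l)
        {(m, n, l). 1 \<le> n \<and> 1 \<le> l \<and> l \<le> sph_dim m CARD('n)}"
  shows "(AE \<omega> in P.
            (\<forall>M. continuous_on (cball 0 1) (\<lambda>x. partial_series e H \<xi> M x \<omega>)) \<and>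
            continuous_on (cball 0 1) (\<lambda>x. series_sum e H \<xi> x \<omega>) \<and>
            uniform_limit (cball 0 1) (\<lambda>M x. partial_series e H \<xi> M x \<omega>)
              (\<lambda>x. series_sum e H \<xi> x \<omega>) sequentially) \<and>
         mfbm_on P H (cball 0 1) (series_sum e H \<xi>)"
proof -
  define N where "N = CARD('n)"
  define A where "A M = (SIGMA m:{0..M}. SIGMA n:{1..M}. {1..sph_dim m N})" for M
  define \<zeta> where "\<zeta> = (\<lambda>(m, n, l). \<xi> m n l)"
  let ?E = "cball 0 1 :: (real ^ 'n) set"
  interpret iid_normal P \<zeta> "series_index N" A
  proof (intro iid_normal.intro iid_normal_axioms.intro P)
    show "distributed P lborel (\<zeta> i) std_normal_density" if "i \<in> series_index N" for i
      using that normal by (auto simp: \<zeta>_def series_index_def N_def)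
    show "prob_space.indep_vars P (\<lambda>_. borel) \<zeta> (series_index N)"
      using indep by (simp add: \<zeta>_def series_index_def N_def)
    show "finite (A M)" for M by (auto simp: A_def)
    show "incseq A" by (auto simp: incseq_def A_def)
    show "(\<Union>M. A M) = series_index N"
    proof
      show "series_index N \<subseteq> (\<Union>M. A M)"
      proof
        fix i assume "i \<in> series_index N"
        then obtain m n l where "i = (m, n, l)" "1 \<le> n" "1 \<le> l" "l \<le> sph_dim m N" by (auto simp: series_index_def)
        then have "i \<in> A (max m n)" by (auto simp: A_def)
        then show "i \<in> (\<Union>M. A M)" by blast
      qed
    qed (auto simp: A_def series_index_def)
  qed
  note cov = feature_covariance[OF N_def H e[folded N_def]]
  note incr = feature_increment[OF N_def H e[folded N_def]]
  have partial: "partial_series e H \<xi> M x \<omega> = gauss_sum (feature e H x) (A M) \<omega>" for M x \<omega>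
    unfolding partial_series_def gauss_sum_def A_def N_def[symmetric]
    by (simp add: sum.Sigma feature_def \<zeta>_def case_prod_unfold)
  have increment: "((\<lambda>i. (feature e H x i - feature e H y i)\<^sup>2) has_sum norm (x - y) powr (2 * H)) (series_index N)"
    if "x \<in> ?E" "y \<in> ?E" for x y
    using incr[of x y] that by simp
  have sq: "(\<lambda>i. (feature e H x i)\<^sup>2) summable_on series_index N" if "x \<in> ?E" for x
    using cov[of x x] that by (auto simp: power2_eq_square summable_on_def)
  have "\<exists>\<pi>. \<forall>n. (\<forall>x\<in>?E. \<pi> n x \<in> ?E \<and> norm (x - \<pi> n x) \<le> real CARD('n) / 2 ^ n) \<and>
    finite (\<pi> n ` ?E) \<and> real (card (\<pi> n ` ?E)) \<le> 3 ^ CARD('n) * (2 ^ CARD('n)) ^ n"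
    by (intro choice allI dyadic_net)
  then obtain \<pi> :: "nat \<Rightarrow> real ^ 'n \<Rightarrow> real ^ 'n" where \<pi>: "\<And>n x. x \<in> ?E \<Longrightarrow> \<pi> n x \<in> ?E"
    "\<And>n x. x \<in> ?E \<Longrightarrow> norm (x - \<pi> n x) \<le> real CARD('n) / 2 ^ n"
    "\<And>n. finite (\<pi> n ` ?E)" "\<And>n. real (card (\<pi> n ` ?E)) \<le> 3 ^ CARD('n) * (2 ^ CARD('n)) ^ n"
    by blast
  have AE_conv: "AE \<omega> in P. uniformly_convergent_on ?E (\<lambda>k x. gauss_sum (feature e H x) (A k) \<omega>)"
    by (rule AE_uniformly_convergent[OF H(1) increment sq \<pi>]) auto
  have sum_eq: "series_sum e H \<xi> x \<omega> = lim (\<lambda>k. gauss_sum (feature e H x) (A k) \<omega>)" for x \<omega>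
    by (simp add: series_sum_def partial)
  have cont: "continuous_on ?E (\<lambda>x. gauss_sum (feature e H x) (A k) \<omega>)" for k \<omega>
    by (rule gauss_sum_continuous[OF H(1) increment])
  have AE_lim: "AE \<omega> in P. uniform_limit ?E (\<lambda>k x. gauss_sum (feature e H x) (A k) \<omega>) (\<lambda>x. series_sum e H \<xi> x \<omega>) sequentially"
    using AE_conv unfolding sum_eq by (simp add: uniformly_convergent_uniform_limit_iff)
  have AE_part: "AE \<omega> in P. (\<forall>M. continuous_on ?E (\<lambda>x. partial_series e H \<xi> M x \<omega>)) \<and>
            continuous_on ?E (\<lambda>x. series_sum e H \<xi> x \<omega>) \<and>
            uniform_limit ?E (\<lambda>M x. partial_series e H \<xi> M x \<omega>) (\<lambda>x. series_sum e H \<xi> x \<omega>) sequentially"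
    using AE_lim
  proof eventually_elim
    case (elim \<omega>)
    then show ?case unfolding partial
      using cont by (auto intro!: uniform_limit_theorem[OF _ elim])
  qed
  define Z where "Z = series_sum e H \<xi>"
  \<comment> \<open>The sum is given by \<open>lim\<close> for every outcome, and this is a
    measurable function on the whole space, including the null set on which the series may
    diverge.\<close>
  have Z_measurable [measurable]: "Z x \<in> borel_measurable P" for x
    unfolding Z_def sum_eq[abs_def] by measurable
  have Z_lim: "AE \<omega> in P. \<forall>x\<in>?E. (\<lambda>k. gauss_sum (feature e H x) (A k) \<omega>) \<longlonglongrightarrow> Z x \<omega>"
    using AE_lim by eventually_elim (auto simp: Z_def dest: tendsto_uniform_limitI)
  \<comment> \<open>The square expands into products of two coefficient sequences, each summable by
    the covariance formula. Finite linear combinations of the field thereby fall under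
    \<open>gaussian_limit\<close>.\<close>
  have comb: "\<exists>V. ((\<lambda>i. (\<Sum>x\<in>F. b x * feature e H x i)\<^sup>2) has_sum V) (series_index N)"
    if F: "finite F" "F \<subseteq> ?E" for F b
  proof -
    have "(\<lambda>i. \<Sum>x\<in>F. \<Sum>y\<in>F. (b x * b y) * (feature e H x i * feature e H y i)) summable_on series_index N"
    proof -
      have s2: "(\<lambda>i. \<Sum>x\<in>G. f x i) summable_on series_index N"
        if "finite G" "\<And>x. x \<in> G \<Longrightarrow> (\<lambda>i. f x i) summable_on series_index N" for f :: "real ^ 'n \<Rightarrow> nat \<times> nat \<times> nat \<Rightarrow> real" and G
        using that by (induction G rule: finite_induct) (auto intro!: summable_on_add)
      show ?thesis
        using F cov by (intro s2 summable_on_cmult_right has_sum_imp_summable[OF cov]) auto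
    qed
    then show ?thesis by (simp add: power2_eq_square sum_product summable_on_def mult_ac)
  qed
  have comb_lim: "AE \<omega> in P. (\<lambda>k. gauss_sum (\<lambda>i. \<Sum>x\<in>F. b x * feature e H x i) (A k) \<omega>) \<longlonglongrightarrow> (\<Sum>x\<in>F. b x * Z x \<omega>)"
    if F: "finite F" "F \<subseteq> ?E" for F b
    using Z_lim
  proof eventually_elim
    case (elim \<omega>)
    have "gauss_sum (\<lambda>i. \<Sum>x\<in>F. b x * feature e H x i) (A k) \<omega> = (\<Sum>x\<in>F. b x * gauss_sum (feature e H x) (A k) \<omega>)" for k
      unfolding gauss_sum_def sum_distrib_left sum_distrib_right by (subst sum.swap) (simp add: mult_ac)
    then show ?case using elim F by (auto intro!: tendsto_intros)
  qed
  have "centred_gaussian_field P ?E Z"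
    unfolding centred_gaussian_field_def
  proof (intro conjI allI impI ballI)
    fix F :: "(real ^ 'n) set" and b assume F: "finite F \<and> F \<subseteq> ?E"
    obtain V where V: "((\<lambda>i. (\<Sum>x\<in>F. b x * feature e H x i)\<^sup>2) has_sum V) (series_index N)" using comb F by blast
    show "gaussian_rv P (\<lambda>\<omega>. \<Sum>x\<in>F. b x * Z x \<omega>)"
      by (rule gaussian_limit(1)[OF V _ comb_lim]) (use F in auto)
  next
    fix x :: "real ^ 'n" assume x: "x \<in> ?E"
    show "integral\<^sup>L P (Z x) = 0"
      by (rule gaussian_limit(3)[of "feature e H x"]) (use has_sum_infsum[OF sq[OF x]] Z_lim x in \<open>auto elim!: eventually_mono\<close>)
  qed
  moreover have "integral\<^sup>L P (\<lambda>\<omega>. Z x \<omega> * Z y \<omega>) = mfbm_cov H x y" if x: "x \<in> ?E" and y: "y \<in> ?E" for x y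
  proof -
    have sq_x: "integrable P (\<lambda>\<omega>. (Z x \<omega>)\<^sup>2) \<and> integral\<^sup>L P (\<lambda>\<omega>. (Z x \<omega>)\<^sup>2) = mfbm_cov H x x" if "x \<in> ?E" for x
    proof -
      have "((\<lambda>i. (feature e H x i)\<^sup>2) has_sum mfbm_cov H x x) (series_index N)" using cov[of x x] that by (simp add: power2_eq_square)
      moreover have "AE \<omega> in P. (\<lambda>k. gauss_sum (feature e H x) (A k) \<omega>) \<longlonglongrightarrow> Z x \<omega>"
        using Z_lim that by (auto elim!: eventually_mono)
      ultimately show ?thesis using gaussian_limit(4,5)[OF _ Z_measurable] by blast
    qed
    \<comment> \<open>The covariance is recovered by polarisation from the variances of both values
      and of their difference, all of which are variances of limits of single Gaussian
      series.\<close>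
    have hd: "((\<lambda>i. (feature e H x i - feature e H y i)\<^sup>2) has_sum norm (x - y) powr (2 * H)) (series_index N)"
      by (rule increment[OF x y])
    have ld: "AE \<omega> in P. (\<lambda>k. gauss_sum (\<lambda>i. feature e H x i - feature e H y i) (A k) \<omega>) \<longlonglongrightarrow> Z x \<omega> - Z y \<omega>"
      using Z_lim by eventually_elim (use x y in \<open>auto simp: gauss_sum_diff intro!: tendsto_diff\<close>)
    have d: "integrable P (\<lambda>\<omega>. (Z x \<omega> - Z y \<omega>)\<^sup>2)" "integral\<^sup>L P (\<lambda>\<omega>. (Z x \<omega> - Z y \<omega>)\<^sup>2) = norm (x - y) powr (2 * H)"
      using gaussian_limit(4,5)[OF hd _ ld] by auto
    have "integral\<^sup>L P (\<lambda>\<omega>. Z x \<omega> * Z y \<omega>) = integral\<^sup>L P (\<lambda>\<omega>. ((Z x \<omega>)\<^sup>2 + (Z y \<omega>)\<^sup>2 - (Z x \<omega> - Z y \<omega>)\<^sup>2) / 2)"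
      by (intro Bochner_Integration.integral_cong refl) (simp add: power2_eq_square algebra_simps)
    also have "\<dots> = (mfbm_cov H x x + mfbm_cov H y y - norm (x - y) powr (2 * H)) / 2"
      using sq_x[OF x] sq_x[OF y] d by simp
    also have "\<dots> = mfbm_cov H x y" by (simp add: mfbm_cov_def)
    finally show ?thesis .
  qed
  ultimately have "mfbm_on P H ?E Z" unfolding mfbm_on_def by blast
  then show ?thesis using AE_part unfolding Z_def by blast
qed

end
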